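(* Let $\Sigma=D/F$ be a compact Riemann surface of genus $g\ge2$ with its hyperbolic metric of curvature $-1$. Suppose $\Sigma$ has $N$ distinct points such that every pair $\{s,s'\}$ of them is of one of the following two types: (a) $s$ and $s'$ are fixed points of one and the same orientation preserving involutive symmetry of $\Sigma$ different from the identity; or (b) $s$ and $s'$ are both fixed by two different orientation reversing involutive symmetries of $\Sigma$. Consider a system of $m$ vortices, $1\le m\le N$, with arbitrarily assigned vortex strengths. Then there are at least $N!/(N-m)!$ different equilibrium configurations.
   Context: $D$ is the unit disk with the Poincaré metric of curvature $-1$, and $F$ is a co-compact Fuchsian group acting freely on $D$. A symmetry of $\Sigma$ is (the map of $\Sigma$ induced by) a Möbius transformation $\sigma$ of $D$, possibly orientation reversing, with $\sigma^{-1}\gamma\sigma\in F$ for all $\gamma\in F$; it is an involution if $\sigma\circ\sigma=\mathrm{id}$ on $\Sigma$. The type (a)/(b) and the symmetries may depend on the pair. Let $\mu$ be the area form, $V$ the total area, $\Delta$ the positive Laplace–Beltrami operator. The Green function $G$ is determined by $\Delta_sG(s,r)=\delta_r(s)-V^{-1}$, $\int_\Sigma G(s,r)\mu(s)=0$, $G(s,r)=G(r,s)$; the Robin function is $R(s_0)=\lim_{s\to s_0}[G(s,s_0)+\frac1{2\pi}\log\ell(s,s_0)]$, $\ell$ the Riemannian distance. For $m$ vortices with nonzero strengths $\Gamma_1,\dots,\Gamma_m\in\mathbb{R}$, an equilibrium configuration is an ordered $m$-tuple $(s_1,\dots,s_m)\in\Sigma^m$ of pairwise distinct points that is a critical point of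 $$H_{\rm vort}(s_1,\dots,s_m)=\sum_{j=1}^m\frac{\Gamma_j^2}{2}R(s_j)+\sum_{j=1}^m\sum_{k\ne j}\frac{\Gamma_j\Gamma_k}{2}G(s_j,s_k)$$ (then the vortices, together with vanishing harmonic component of the flow, are at rest). *)

theory Defs
  imports
    "HOL-Complex_Analysis.Complex_Analysis"
    "HOL-Homology.Homology"
    "HOL-Algebra.Bij"
begin

section \<open>Fuchsian groups and their quotient surfaces\<close>

abbreviation disk :: "complex set" where
  "disk \<equiv> ball 0 1"

text \<open>Transformations of the disk are extensional functions, that is, elements of
  \<^term>\<open>BijGroup disk\<close>, so that a transformation is determined by its values on the disk.\<close>

definition moebius_preserving :: "(complex \<Rightarrow> complex) set" where
  "moebius_preserving = {restrict (Moebius_function t w) disk | t w. w \<in> disk}"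

definition moebius_reversing :: "(complex \<Rightarrow> complex) set" where
  "moebius_reversing = {\<lambda>z\<in>disk. Moebius_function t w (cnj z) | t w. w \<in> disk}"

text \<open>A Fuchsian group is a discrete subgroup of the orientation preserving Moebius group of the
  disk. The map sending the Moebius transformation with parameters \<open>t\<close>, \<open>w\<close> to \<open>(cis t, w)\<close> is a
  homeomorphism of that group onto the product of the unit circle and the disk, so discreteness
  can be read off in these coordinates.\<close>

definition fuchsian_group :: "(complex \<Rightarrow> complex) set \<Rightarrow> bool" where
  "fuchsian_group F \<longleftrightarrow>
     subgroup F (BijGroup disk) \<and> F \<subseteq> moebius_preserving \<and>
     discrete {(cis t, w) | t w. w \<in> disk \<and> restrict (Moebius_function t w) disk \<in> F}"

definition acts_freely :: "(complex \<Rightarrow> complex) set \<Rightarrow> bool" where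
  "acts_freely F \<longleftrightarrow> (\<forall>\<gamma>\<in>F. (\<exists>z\<in>disk. \<gamma> z = z) \<longrightarrow> \<gamma> = \<one>\<^bsub>BijGroup disk\<^esub>)"

text \<open>The points of the surface \<open>disk/F\<close> are the orbits themselves; the lifts to the disk of a
  point \<open>s\<close> of the surface are thus the elements of \<open>s\<close>.\<close>

definition proj :: "(complex \<Rightarrow> complex) set \<Rightarrow> complex \<Rightarrow> complex set" where
  "proj F z = (\<lambda>\<gamma>. \<gamma> z) ` F"

definition surface :: "(complex \<Rightarrow> complex) set \<Rightarrow> complex set set" where
  "surface F = proj F ` disk"

definition surface_topology :: "(complex \<Rightarrow> complex) set \<Rightarrow> complex set topology" where
  "surface_topology F = topology (\<lambda>U. U \<subseteq> surface F \<and> open {z \<in> disk. proj F z \<in> U})"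

lemma openin_surface_topology:
  "openin (surface_topology F) U \<longleftrightarrow> U \<subseteq> surface F \<and> open {z \<in> disk. proj F z \<in> U}"
proof -
  have "istopology (\<lambda>U. U \<subseteq> surface F \<and> open {z \<in> disk. proj F z \<in> U})"
    unfolding istopology_def
  proof (intro conjI allI impI)
    fix S T
    assume "S \<subseteq> surface F \<and> open {z \<in> disk. proj F z \<in> S}"
      and "T \<subseteq> surface F \<and> open {z \<in> disk. proj F z \<in> T}"
    moreover have "{z \<in> disk. proj F z \<in> S \<inter> T}
        = {z \<in> disk. proj F z \<in> S} \<inter> {z \<in> disk. proj F z \<in> T}"
      by blast
    ultimately show "S \<inter> T \<subseteq> surface F" "open {z \<in> disk. proj F z \<in> S \<inter> T}"
      by auto
  next
    fix K
    assume K: "\<forall>S\<in>K. S \<subseteq> surface F \<and> open {z \<in> disk. proj F z \<in> S}"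
    then show "\<Union>K \<subseteq> surface F"
      by blast
    have "{z \<in> disk. proj F z \<in> \<Union>K} = (\<Union>S\<in>K. {z \<in> disk. proj F z \<in> S})"
      by blast
    then show "open {z \<in> disk. proj F z \<in> \<Union>K}"
      using K by auto
  qed
  then show ?thesis
    by (simp add: surface_topology_def)
qed

definition has_genus :: "(complex \<Rightarrow> complex) set \<Rightarrow> nat \<Rightarrow> bool" where
  "has_genus F g \<longleftrightarrow> homology_group 1 (surface_topology F) \<cong> free_Abelian_group {..<2 * g}"


section \<open>Symmetries\<close>

text \<open>Since a symmetry \<open>\<sigma>\<close> normalizes \<open>F\<close>, the map it induces on the surface sends an orbit \<open>s\<close>
  to its image \<open>\<sigma> ` s\<close>.\<close>

definition symmetry :: "(complex \<Rightarrow> complex) set \<Rightarrow> (complex \<Rightarrow> complex) \<Rightarrow> bool" where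
  "symmetry F \<sigma> \<longleftrightarrow>
     \<sigma> \<in> moebius_preserving \<union> moebius_reversing \<and>
     (\<forall>\<gamma>\<in>F. inv\<^bsub>BijGroup disk\<^esub> \<sigma> \<otimes>\<^bsub>BijGroup disk\<^esub> \<gamma> \<otimes>\<^bsub>BijGroup disk\<^esub> \<sigma> \<in> F)"

definition involutive :: "(complex \<Rightarrow> complex) set \<Rightarrow> (complex \<Rightarrow> complex) \<Rightarrow> bool" where
  "involutive F \<sigma> \<longleftrightarrow> (\<forall>s\<in>surface F. \<sigma> ` (\<sigma> ` s) = s)"

definition rotation_pair ::
  "(complex \<Rightarrow> complex) set \<Rightarrow> complex set \<Rightarrow> complex set \<Rightarrow> bool" where
  "rotation_pair F s s' \<longleftrightarrow>
     (\<exists>\<sigma>. symmetry F \<sigma> \<and> \<sigma> \<in> moebius_preserving \<and> involutive F \<sigma> \<and>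
          (\<exists>x\<in>surface F. \<sigma> ` x \<noteq> x) \<and> \<sigma> ` s = s \<and> \<sigma> ` s' = s')"

definition reflection_pair ::
  "(complex \<Rightarrow> complex) set \<Rightarrow> complex set \<Rightarrow> complex set \<Rightarrow> bool" where
  "reflection_pair F s s' \<longleftrightarrow>
     (\<exists>\<sigma> \<tau>. symmetry F \<sigma> \<and> \<sigma> \<in> moebius_reversing \<and> involutive F \<sigma> \<and>
            symmetry F \<tau> \<and> \<tau> \<in> moebius_reversing \<and> involutive F \<tau> \<and>
            (\<exists>x\<in>surface F. \<sigma> ` x \<noteq> \<tau> ` x) \<and>
            \<sigma> ` s = s \<and> \<sigma> ` s' = s' \<and> \<tau> ` s = s \<and> \<tau> ` s' = s')"


section \<open>Smooth functions\<close>

text \<open>For open \<open>S\<close>: \<open>f\<close> is of class \<open>C\<^sup>k\<close> on \<open>S\<close>, respectively smooth on \<open>S\<close>.\<close>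

fun C_diff_on :: "nat \<Rightarrow> 'a::euclidean_space set \<Rightarrow> ('a \<Rightarrow> real) \<Rightarrow> bool" where
  "C_diff_on 0 S f \<longleftrightarrow> continuous_on S f"
| "C_diff_on (Suc k) S f \<longleftrightarrow>
     (\<forall>x\<in>S. f differentiable (at x)) \<and>
     (\<forall>b\<in>Basis. C_diff_on k S (\<lambda>x. frechet_derivative f (at x) b))"

definition smooth_on :: "'a::euclidean_space set \<Rightarrow> ('a \<Rightarrow> real) \<Rightarrow> bool" where
  "smooth_on S f \<longleftrightarrow> (\<forall>k. C_diff_on k S f)"

definition surface_smooth ::
  "(complex \<Rightarrow> complex) set \<Rightarrow> (complex set \<Rightarrow> real) \<Rightarrow> bool" where
  "surface_smooth F \<phi> \<longleftrightarrow> smooth_on disk (\<lambda>z. \<phi> (proj F z))"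


section \<open>Hyperbolic geometry of the surface\<close>

text \<open>The Poincare metric of curvature \<open>-1\<close> is \<open>4 \<bar>dz\<bar>\<^sup>2 / (1 - \<bar>z\<bar>\<^sup>2)\<^sup>2\<close>.\<close>

definition hyp_length :: "(real \<Rightarrow> complex) \<Rightarrow> real" where
  "hyp_length p = integral {0..1} (\<lambda>t. 2 * norm (vector_derivative p (at t)) / (1 - (norm (p t))\<^sup>2))"

text \<open>The \<open>C\<^sup>1\<close> paths in the surface are exactly the projections of \<open>C\<^sup>1\<close> paths in the disk, with
  the same length; hence the Riemannian distance on the surface is the following infimum. The
  condition is not \<^term>\<open>valid_path\<close>, which admits curves of infinite length, for which
  \<^const>\<open>hyp_length\<close> would be \<open>0\<close>.\<close>

definition surface_dist :: "complex set \<Rightarrow> complex set \<Rightarrow> real" where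
  "surface_dist s r =
     Inf {hyp_length p | p. p C1_differentiable_on {0..1} \<and> path_image p \<subseteq> disk \<and>
                             pathstart p \<in> s \<and> pathfinish p \<in> r}"

text \<open>The Dirichlet domain of \<open>F\<close> centred at \<open>0\<close>: the hyperbolic distance of \<open>z\<close> from \<open>0\<close>
  increases with \<open>norm z\<close>, and the distance of \<open>\<gamma> z\<close> from \<open>0\<close> is that of \<open>z\<close> from the inverse
  image of \<open>0\<close> under \<open>\<gamma>\<close>. If \<open>F\<close> is a Fuchsian group acting freely, this is a fundamental domain
  whose boundary is a null set, so the area measure of the surface is the image of the hyperbolic
  area measure on this domain.\<close>

definition dirichlet_domain :: "(complex \<Rightarrow> complex) set \<Rightarrow> complex set" where
  "dirichlet_domain F = {z \<in> disk. \<forall>\<gamma>\<in>F. norm z \<le> norm (\<gamma> z)}"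

definition hyp_area :: "complex measure" where
  "hyp_area = density lborel (\<lambda>z. ennreal (4 / (1 - (norm z)\<^sup>2)\<^sup>2))"

definition area :: "(complex \<Rightarrow> complex) set \<Rightarrow> complex set measure" where
  "area F =
     distr (restrict_space hyp_area (dirichlet_domain F))
       (sigma (surface F) {A. A \<subseteq> surface F \<and> {z \<in> disk. proj F z \<in> A} \<in> sets borel})
       (proj F)"

definition total_area :: "(complex \<Rightarrow> complex) set \<Rightarrow> real" where
  "total_area F = measure (area F) (surface F)"

definition hyp_laplacian :: "(complex \<Rightarrow> real) \<Rightarrow> complex \<Rightarrow> real" where
  "hyp_laplacian f z =
     - ((1 - (norm z)\<^sup>2)\<^sup>2 / 4) *
       (\<Sum>b\<in>Basis. frechet_derivative (\<lambda>w. frechet_derivative f (at w) b) (at z) b)"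

text \<open>The positive Laplace--Beltrami operator of the surface; the value does not depend on the lift
  chosen, as the hyperbolic Laplacian commutes with Moebius transformations.\<close>

definition laplacian ::
  "(complex \<Rightarrow> complex) set \<Rightarrow> (complex set \<Rightarrow> real) \<Rightarrow> complex set \<Rightarrow> real" where
  "laplacian F \<phi> s = hyp_laplacian (\<lambda>z. \<phi> (proj F z)) (SOME z. z \<in> s)"


section \<open>Green function, Robin function and vortex equilibria\<close>

text \<open>The equation \<open>\<Delta> G(\<cdot>,r) = \<delta> - 1/V\<close>, with \<open>\<delta>\<close> the Dirac distribution at \<open>r\<close>, is to be
  understood in the sense of distributions. By itself it determines the function only up to null
  sets, and the Green function is the solution that is smooth off the diagonal. The values on the
  diagonal are irrelevant.\<close>

definition green_function ::
  "(complex \<Rightarrow> complex) set \<Rightarrow> (complex set \<Rightarrow> complex set \<Rightarrow> real) \<Rightarrow> bool" where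
  "green_function F G \<longleftrightarrow>
     smooth_on {(z, w). z \<in> disk \<and> w \<in> disk \<and> proj F z \<noteq> proj F w}
       (\<lambda>(z, w). G (proj F z) (proj F w)) \<and>
     (\<forall>r\<in>surface F. integrable (area F) (\<lambda>s. G s r)) \<and>
     (\<forall>r\<in>surface F. \<forall>\<phi>. surface_smooth F \<phi> \<longrightarrow>
        (\<integral>s. G s r * laplacian F \<phi> s \<partial>area F) = \<phi> r - (\<integral>s. \<phi> s \<partial>area F) / total_area F) \<and>
     (\<forall>r\<in>surface F. (\<integral>s. G s r \<partial>area F) = 0) \<and>
     (\<forall>s\<in>surface F. \<forall>r\<in>surface F. G s r = G r s)"

definition robin_function ::
  "(complex \<Rightarrow> complex) set \<Rightarrow> (complex set \<Rightarrow> complex set \<Rightarrow> real) \<Rightarrow> complex set \<Rightarrow> real" where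
  "robin_function F G s\<^sub>0 =
     Lim (atin (surface_topology F) s\<^sub>0) (\<lambda>s. G s s\<^sub>0 + ln (surface_dist s s\<^sub>0) / (2 * pi))"

definition vortex_hamiltonian ::
  "(complex \<Rightarrow> complex) set \<Rightarrow> (complex set \<Rightarrow> complex set \<Rightarrow> real) \<Rightarrow>
   ('m::finite \<Rightarrow> real) \<Rightarrow> ('m \<Rightarrow> complex set) \<Rightarrow> real" where
  "vortex_hamiltonian F G \<Gamma> s =
     (\<Sum>j\<in>UNIV. (\<Gamma> j)\<^sup>2 / 2 * robin_function F G (s j)) +
     (\<Sum>j\<in>UNIV. \<Sum>k\<in>UNIV - {j}. \<Gamma> j * \<Gamma> k / 2 * G (s j) (s k))"

text \<open>The vortices are indexed by the finite type \<open>'m\<close>. Criticality is expressed by the vanishing of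
  the differential of the Hamiltonian in the local coordinates of the product surface given by the
  lifts of the points to the disk.\<close>

definition equilibrium ::
  "(complex \<Rightarrow> complex) set \<Rightarrow> (complex set \<Rightarrow> complex set \<Rightarrow> real) \<Rightarrow>
   ('m::finite \<Rightarrow> real) \<Rightarrow> ('m \<Rightarrow> complex set) \<Rightarrow> bool" where
  "equilibrium F G \<Gamma> s \<longleftrightarrow>
     range s \<subseteq> surface F \<and> inj s \<and>
     (\<forall>z :: complex ^ 'm. (\<forall>j. z $ j \<in> s j) \<longrightarrow>
        ((\<lambda>w. vortex_hamiltonian F G \<Gamma> (\<lambda>j. proj F (w $ j))) has_derivative (\<lambda>_. 0)) (at z))"

end

theory Submission
  imports Defs
begin

text \<open>A symmetry \<open>\<sigma>\<close> that is an involution of the surface preserves the Green function: for fixed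
  \<open>w\<close>, testing the defining equation with mollified logarithms shows that averages of
  \<open>z \<mapsto> G(\<sigma> z, \<sigma> w) - G(z, w)\<close> over annuli do not depend on the radius, so this difference is
  constant by the maximum principle. By symmetry of \<open>G\<close> the constant does not depend on \<open>w\<close> either,
  and it is zero because replacing \<open>(z, w)\<close> by \<open>(\<sigma> z, \<sigma> w)\<close> changes its sign. The same averages
  show that \<open>G(z, w) + ln \<bar>z - w\<bar> / (2 * pi)\<close> extends across the diagonal, so that the Robin
  function is differentiable, and it is invariant as \<open>\<sigma>\<close> preserves the pseudo-hyperbolic distance.
  At its fixed points, an involution of type (a) acts on tangent vectors as \<open>-1\<close>, and two reflections
  of type (b) act as \<open>h \<mapsto> a * cnj h\<close> and \<open>h \<mapsto> b * cnj h\<close> with \<open>a \<noteq> b\<close>. In both cases a linear form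
  invariant under these actions vanishes. Hence the differentials of the Robin function at every
  given point and of the Green function at every pair are zero, and every injective assignment of the
  vortices to the points is an equilibrium. If there is only one point, take a maximum of the Robin
  function instead.\<close>

section \<open>Moebius transformations of the disk\<close>

text \<open>The Green equation is known only weakly, so all information about \<open>G\<close> has
  to come from test functions that are smooth on the whole surface. They are obtained by summing
  over orbits a function with compact support in the disk: the difference of two regularised
  logarithms of radii \<rho>' \<le> \<rho>, whose Euclidean Laplacian is a difference of two radial
  kernels of equal mass on annuli. Unfolding the sum turns the equation into an identity between
  Euclidean averages of \<open>G\<close> in a Moebius or reflected chart. Its right hand side
  depends on the centre, the radii and the position of the source, but not on the chart, and its
  term with the total area is the same for every source, so it cancels when two instances are
  subtracted. This replaces elliptic regularity: averages that do not depend on the radius give the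
  mean value property, and averages at a fixed radius are continuous and differentiable because on
  the annulus \<open>G\<close> is evaluated away from its singularity.\<close>

definition moeb :: "complex \<Rightarrow> complex \<Rightarrow> complex \<Rightarrow> complex" where
  "moeb c w z = c * (z - w) / (1 - cnj w * z)"

lemma Moebius_function_eq_moeb: "Moebius_function t w = moeb (cis t) w"
  by (simp add: fun_eq_iff Moebius_function_def moeb_def cis_conv_exp)

lemma unit_eq_cis: "norm c = 1 \<Longrightarrow> \<exists>t. c = cis t"
  by (metis complex_norm_eq_1_exp cis_conv_exp)

lemma one_minus_cnj_mult_nonzero:
  assumes "norm w < 1" "norm z < 1"
  shows "1 - cnj w * z \<noteq> 0"
proof
  assume "1 - cnj w * z = 0"
  then have "norm (cnj w * z) = 1" by auto
  then have "norm w * norm z = 1" by (simp add: norm_mult)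
  moreover have "norm w * norm z \<le> norm w"
    using assms by (intro mult_left_le) auto
  ultimately show False using assms by simp
qed

lemma one_minus_mult_cnj_nonzero: "norm w < 1 \<Longrightarrow> norm z < 1 \<Longrightarrow> 1 - w * cnj z \<noteq> 0"
  using one_minus_cnj_mult_nonzero[of z w] by (simp add: mult.commute)

text \<open>The rotation is recorded as a unit number instead of an angle: the parameters of
  products and inverses are then explicit expressions, without any choice of argument.\<close>

lemma moebius_preserving_iff:
  "f \<in> moebius_preserving \<longleftrightarrow> (\<exists>c w. norm c = 1 \<and> norm w < 1 \<and> f = restrict (moeb c w) disk)"
proof
  assume "f \<in> moebius_preserving"
  then obtain t w where "w \<in> disk" "f = restrict (Moebius_function t w) disk"
    unfolding moebius_preserving_def by auto
  then show "\<exists>c w. norm c = 1 \<and> norm w < 1 \<and> f = restrict (moeb c w) disk"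
    by (intro exI[of _ "cis t"] exI[of _ w]) (simp add: Moebius_function_eq_moeb)
next
  assume "\<exists>c w. norm c = 1 \<and> norm w < 1 \<and> f = restrict (moeb c w) disk"
  then obtain c w where "norm c = 1" "norm w < 1" "f = restrict (moeb c w) disk" by auto
  moreover then obtain t where "c = cis t" using unit_eq_cis by blast
  ultimately show "f \<in> moebius_preserving"
    unfolding moebius_preserving_def by (auto simp: Moebius_function_eq_moeb)
qed

lemma moeb_norm_less_1:
  assumes "norm c = 1" "norm w < 1" "norm z < 1"
  shows "norm (moeb c w z) < 1"
  using Moebius_function_norm_lt_1[OF assms(2,3)] unit_eq_cis[OF assms(1)]
  by (metis Moebius_function_eq_moeb)

lemma cnj_unit: "norm c = 1 \<Longrightarrow> c * cnj c = 1"
  by (simp add: complex_norm_square[symmetric])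

text \<open>The equality case of Schwarz-Pick together with its phase: the pseudo-hyperbolic
  quotient is multiplied by a factor of modulus one that depends on \<open>z\<close> but not on
  \<open>x\<close>. Derivatives, distances and the linearization at fixed points are all read off
  from it.\<close>

lemma moeb_diff_quotient:
  assumes "norm c = 1" "norm w < 1" "norm z < 1" "norm x < 1"
  shows "(moeb c w x - moeb c w z) / (1 - cnj (moeb c w z) * moeb c w x) =
         (c * (1 - w * cnj z) / (1 - cnj w * z)) * ((x - z) / (1 - cnj z * x))"
proof -
  note nz = one_minus_cnj_mult_nonzero one_minus_mult_cnj_nonzero
  have n: "1 - cnj w * x \<noteq> 0" "1 - cnj w * z \<noteq> 0" "1 - w * cnj z \<noteq> 0" "1 - cnj z * x \<noteq> 0" "1 - cnj w * w \<noteq> 0"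
    using assms nz by auto
  have cc: "cnj c * c = 1" using cnj_unit[OF assms(1)] by (simp add: mult.commute)
  have a: "moeb c w x - moeb c w z = c * (x - z) * (1 - cnj w * w) / ((1 - cnj w * x) * (1 - cnj w * z))"
    using n unfolding moeb_def by (simp add: divide_simps) (simp add: algebra_simps)
  have "cnj (moeb c w z) * moeb c w x = (cnj c * c) * ((cnj z - cnj w) * (x - w)) / ((1 - w * cnj z) * (1 - cnj w * x))"
    unfolding moeb_def by (simp add: mult_ac)
  then have b: "1 - cnj (moeb c w z) * moeb c w x = (1 - cnj w * w) * (1 - cnj z * x) / ((1 - w * cnj z) * (1 - cnj w * x))"
    using n unfolding cc by (simp add: divide_simps) (simp add: algebra_simps)
  show ?thesis unfolding a b using n by (simp add: divide_simps)
qed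

text \<open>Supplies the parameters of the first map composed with the inverse of the second. The
  new zero is the image of \<open>w1\<close> under the second map. The parameters are continuous and
  tend to \<open>(1, 0)\<close> when both maps approach a common limit, which is the form in which
  discreteness is exploited.\<close>

lemma moeb_compose_inverse:
  assumes "norm c1 = 1" "norm w1 < 1" "norm c2 = 1" "norm w2 < 1" "norm z < 1"
  shows "moeb c1 w1 z =
    moeb (c1 * cnj c2 * (1 - w1 * cnj w2) / (1 - cnj w1 * w2)) (c2 * (w1 - w2) / (1 - w1 * cnj w2)) (moeb c2 w2 z)"
proof -
  note nz = one_minus_cnj_mult_nonzero one_minus_mult_cnj_nonzero
  define A where "A = 1 - w1 * cnj w2"
  define A' where "A' = 1 - cnj w1 * w2"
  define D where "D = 1 - cnj w2 * z"
  have n: "A \<noteq> 0" "A' \<noteq> 0" "D \<noteq> 0" "1 - cnj w1 * z \<noteq> 0" "1 - cnj w2 * w2 \<noteq> 0"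
    using assms nz by (auto simp: A_def A'_def D_def)
  have cc: "cnj c2 * c2 = 1" using cnj_unit[OF assms(3)] by (simp add: mult.commute)
  have c0: "c2 \<noteq> 0" using assms by auto
  have "moeb c2 w2 z - c2 * (w1 - w2) / A = c2 * (1 - cnj w2 * w2) * (z - w1) / (A * D)"
    unfolding moeb_def D_def[symmetric] using n by (simp add: divide_simps) (simp add: A_def D_def algebra_simps)
  moreover have "1 - cnj (c2 * (w1 - w2) / A) * moeb c2 w2 z = (1 - cnj w2 * w2) * (1 - cnj w1 * z) / (A' * D)"
  proof -
    have "cnj A = A'" by (simp add: A_def A'_def)
    then have "cnj (c2 * (w1 - w2) / A) * moeb c2 w2 z = (cnj c2 * c2) * ((cnj w1 - cnj w2) * (z - w2)) / (A' * D)"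
      by (simp add: moeb_def D_def)
    then have "1 - cnj (c2 * (w1 - w2) / A) * moeb c2 w2 z = 1 - ((cnj w1 - cnj w2) * (z - w2)) / (A' * D)"
      unfolding cc by simp
    also have "\<dots> = (1 - cnj w2 * w2) * (1 - cnj w1 * z) / (A' * D)"
      using n by (simp add: divide_simps) (simp add: A'_def D_def algebra_simps)
    finally show ?thesis .
  qed
  ultimately have "moeb (c1 * cnj c2 * A / A') (c2 * (w1 - w2) / A) (moeb c2 w2 z)
     = (c1 * cnj c2 * A / A') * (c2 * (1 - cnj w2 * w2) * (z - w1) / (A * D)) / ((1 - cnj w2 * w2) * (1 - cnj w1 * z) / (A' * D))"
    by (simp add: moeb_def[of "c1 * cnj c2 * A / A'"])
  also have "\<dots> = (cnj c2 * c2) * c1 * (z - w1) / (1 - cnj w1 * z)"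
    using n by (simp add: divide_simps)
  also have "\<dots> = moeb c1 w1 z" using cc by (simp add: moeb_def)
  finally show ?thesis by (simp add: A_def A'_def)
qed

lemma moeb_compose_params:
  assumes "norm c1 = 1" "norm w1 < 1" "norm c2 = 1" "norm w2 < 1"
  shows "norm (c1 * cnj c2 * (1 - w1 * cnj w2) / (1 - cnj w1 * w2)) = 1"
    "norm (c2 * (w1 - w2) / (1 - w1 * cnj w2)) < 1"
proof -
  have "cnj (1 - w1 * cnj w2) = 1 - cnj w1 * w2" by simp
  then have "norm (1 - w1 * cnj w2) = norm (1 - cnj w1 * w2)"
    by (metis complex_mod_cnj)
  then show "norm (c1 * cnj c2 * (1 - w1 * cnj w2) / (1 - cnj w1 * w2)) = 1"
    using assms one_minus_cnj_mult_nonzero[of w1 w2] by (simp add: norm_mult norm_divide)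
  show "norm (c2 * (w1 - w2) / (1 - w1 * cnj w2)) < 1"
    using moeb_norm_less_1[of c2 w2 w1] assms by (simp add: moeb_def mult.commute)
qed

lemma moeb_inverse:
  assumes "norm c = 1" "norm w < 1" "norm z < 1"
  shows "moeb (cnj c) (- (c * w)) (moeb c w z) = z"
  using moeb_compose_inverse[of 1 0 c w z] assms by (simp add: moeb_def)

lemma moeb_inverse':
  assumes "norm c = 1" "norm w < 1" "norm z < 1"
  shows "moeb c w (moeb (cnj c) (- (c * w)) z) = z"
proof -
  have "- (cnj c * (- (c * w))) = w" using cnj_unit[OF assms(1)] by (simp add: mult.commute mult.assoc[symmetric])
  moreover have "moeb (cnj (cnj c)) (- (cnj c * (- (c * w)))) (moeb (cnj c) (- (c * w)) z) = z"
    using assms by (intro moeb_inverse) (auto simp: norm_mult)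
  ultimately show ?thesis by (metis complex_cnj_cnj)
qed

lemma moebius_preserving_in_disk: "f \<in> moebius_preserving \<Longrightarrow> z \<in> disk \<Longrightarrow> f z \<in> disk"
  using moeb_norm_less_1 by (auto simp: moebius_preserving_iff)

lemma moebius_preserving_compose:
  assumes "f \<in> moebius_preserving" "g \<in> moebius_preserving"
  shows "\<exists>h\<in>moebius_preserving. \<forall>z\<in>disk. h z = f (g z)"
proof -
  obtain c1 w1 c2 w2 where f: "norm c1 = 1" "norm w1 < 1" "f = restrict (moeb c1 w1) disk"
    and g: "norm c2 = 1" "norm w2 < 1" "g = restrict (moeb c2 w2) disk"
    using assms unfolding moebius_preserving_iff by blast
  define C where "C = c1 * cnj (cnj c2) * (1 - w1 * cnj (- (c2 * w2))) / (1 - cnj w1 * (- (c2 * w2)))"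
  define W where "W = cnj c2 * (w1 - (- (c2 * w2))) / (1 - w1 * cnj (- (c2 * w2)))"
  have *: "norm (cnj c2) = 1" "norm (- (c2 * w2)) < 1" using g by (auto simp: norm_mult)
  have CW: "norm C = 1" "norm W < 1"
    unfolding C_def W_def using moeb_compose_params[OF f(1,2) *] by auto
  have "moeb C W z = moeb c1 w1 (moeb c2 w2 z)" if "norm z < 1" for z
    using moeb_compose_inverse[OF f(1,2) *, of "moeb c2 w2 z"] moeb_inverse[OF g(1,2) that]
      moeb_norm_less_1[OF g(1,2) that] by (simp add: C_def W_def)
  then have "\<forall>z\<in>disk. restrict (moeb C W) disk z = f (g z)"
    using moeb_norm_less_1[OF g(1,2)] by (simp add: f g)
  moreover have "restrict (moeb C W) disk \<in> moebius_preserving"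
    using CW moebius_preserving_iff by blast
  ultimately show ?thesis by blast
qed

lemma moebius_preserving_inverse:
  assumes "f \<in> moebius_preserving"
  shows "\<exists>g\<in>moebius_preserving. (\<forall>z\<in>disk. g (f z) = z) \<and> (\<forall>z\<in>disk. f (g z) = z)"
proof -
  obtain c w where f: "norm c = 1" "norm w < 1" "f = restrict (moeb c w) disk"
    using assms unfolding moebius_preserving_iff by blast
  have *: "norm (cnj c) = 1" "norm (- (c * w)) < 1" using f by (auto simp: norm_mult)
  show ?thesis
  proof (intro bexI conjI)
    show "restrict (moeb (cnj c) (- (c * w))) disk \<in> moebius_preserving"
      using * moebius_preserving_iff by blast
  qed (use moeb_norm_less_1[OF *] moeb_norm_less_1[OF f(1,2)] moeb_inverse[OF f(1,2)] moeb_inverse'[OF f(1,2)] in \<open>auto simp: f(3)\<close>)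
qed

lemma moebius_preserving_bij:
  assumes "f \<in> moebius_preserving"
  shows "bij_betw f disk disk"
proof -
  obtain g where "g \<in> moebius_preserving" "\<forall>z\<in>disk. g (f z) = z" "\<forall>z\<in>disk. f (g z) = z"
    using moebius_preserving_inverse[OF assms] by blast
  then show ?thesis
    using moebius_preserving_in_disk assms by (intro bij_betw_byWitness[where f' = g]) blast+
qed

lemma moebius_preserving_holomorphic:
  assumes "f \<in> moebius_preserving"
  shows "f holomorphic_on disk"
proof -
  obtain t w where "w \<in> disk" "f = restrict (Moebius_function t w) disk"
    using assms unfolding moebius_preserving_def by auto
  then show ?thesis
    using Moebius_function_holomorphic[of w t] by (auto intro: holomorphic_transform)
qed

lemma moebius_preserving_diff_quotient:
  assumes "f \<in> moebius_preserving" "z \<in> disk"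
  shows "\<exists>c. norm c = 1 \<and> (\<forall>x\<in>disk. (f x - f z) / (1 - cnj (f z) * f x) = c * ((x - z) / (1 - cnj z * x)))"
proof -
  obtain c w where f: "norm c = 1" "norm w < 1" "f = restrict (moeb c w) disk"
    using assms unfolding moebius_preserving_iff by blast
  have "norm (c * (1 - w * cnj z) / (1 - cnj w * z)) = 1"
  proof -
    have "norm (1 - w * cnj z) = norm (1 - cnj w * z)"
      using complex_mod_cnj[of "1 - w * cnj z"] by simp
    then show ?thesis using f assms one_minus_cnj_mult_nonzero[of w z] by (simp add: norm_mult norm_divide)
  qed
  then show ?thesis using moeb_diff_quotient[OF f(1,2)] assms(2) f(3)
    by (intro exI[of _ "c * (1 - w * cnj z) / (1 - cnj w * z)"]) auto
qed

text \<open>Differentiate the identity in the hypothesis at \<open>x = z\<close>: both numerators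
  vanish there, so only the values of the denominators enter.\<close>

lemma moebius_preserving_deriv:
  assumes "f \<in> moebius_preserving" "z \<in> disk"
    and c: "\<forall>x\<in>disk. (f x - f z) / (1 - cnj (f z) * f x) = c * ((x - z) / (1 - cnj z * x))"
  shows "(f has_field_derivative c * of_real ((1 - (norm (f z))\<^sup>2) / (1 - (norm z)\<^sup>2))) (at z)"
proof -
  have fz: "norm (f z) < 1" using moebius_preserving_in_disk assms by auto
  obtain d where d: "(f has_field_derivative d) (at z)"
    using moebius_preserving_holomorphic[OF assms(1)] assms(2) holomorphic_on_imp_differentiable_at
    by (metis field_differentiable_def open_ball)
  have n1: "1 - cnj (f z) * f z \<noteq> 0" "1 - cnj z * z \<noteq> 0"
    using one_minus_cnj_mult_nonzero fz assms(2) by auto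
  have sq: "1 - cnj u * u = of_real (1 - (norm u)\<^sup>2)" for u
    by (simp add: complex_norm_square[symmetric] mult.commute)
  have quot: "((\<lambda>x. (g x - g z) / (1 - k * g x)) has_field_derivative e / (1 - k * g z)) (at z)"
    if "(g has_field_derivative e) (at z)" "1 - k * g z \<noteq> 0" for g k e
  proof -
    have "((\<lambda>x. (g x - g z) / (1 - k * g x)) has_field_derivative
        (e * (1 - k * g z) - (g z - g z) * (0 - k * e)) / ((1 - k * g z) * (1 - k * g z))) (at z)"
      by (rule DERIV_divide) (use that in \<open>auto intro!: derivative_eq_intros\<close>)
    then show ?thesis using that(2) by simp
  qed
  have "((\<lambda>x. (f x - f z) / (1 - cnj (f z) * f x)) has_field_derivative d / (1 - cnj (f z) * f z)) (at z)"
    using quot[OF d n1(1)] .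
  moreover have "((\<lambda>x. c * ((x - z) / (1 - cnj z * x))) has_field_derivative c / (1 - cnj z * z)) (at z)"
    using DERIV_cmult[OF quot[OF DERIV_ident n1(2)], of c] by simp
  then have "((\<lambda>x. (f x - f z) / (1 - cnj (f z) * f x)) has_field_derivative c / (1 - cnj z * z)) (at z)"
    by (rule has_field_derivative_transform_within_open[where S=disk]) (use assms c in auto)
  ultimately have "d / (1 - cnj (f z) * f z) = c / (1 - cnj z * z)"
    by (rule DERIV_unique)
  then have "d = c * ((1 - cnj (f z) * f z) / (1 - cnj z * z))" using n1 by (simp add: field_simps)
  then show ?thesis using d by (simp add: sq)
qed

section \<open>Proper discontinuity\<close>

locale free_fuchsian =
  fixes F :: "(complex \<Rightarrow> complex) set"
  assumes fuchsian: "fuchsian_group F" and free: "acts_freely F"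
begin

lemma subgroup_F: "subgroup F (BijGroup disk)"
  and F_moebius: "\<gamma> \<in> F \<Longrightarrow> \<gamma> \<in> moebius_preserving"
  using fuchsian unfolding fuchsian_group_def by auto

lemma F_in_disk [simp]: "\<gamma> \<in> F \<Longrightarrow> z \<in> disk \<Longrightarrow> \<gamma> z \<in> disk"
  using F_moebius moebius_preserving_in_disk by blast

lemma F_norm [simp]: "\<gamma> \<in> F \<Longrightarrow> norm z < 1 \<Longrightarrow> norm (\<gamma> z) < 1"
  using F_in_disk[of \<gamma> z] by simp

lemma F_continuous: "\<gamma> \<in> F \<Longrightarrow> continuous_on disk \<gamma>"
  using F_moebius moebius_preserving_holomorphic holomorphic_on_imp_continuous_on by blast

lemma F_Bij: "\<gamma> \<in> F \<Longrightarrow> \<gamma> \<in> Bij disk"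
  using subgroup.subset[OF subgroup_F] by (auto simp: BijGroup_def)

lemma F_ext: "\<gamma> \<in> F \<Longrightarrow> \<delta> \<in> F \<Longrightarrow> (\<And>z. z \<in> disk \<Longrightarrow> \<gamma> z = \<delta> z) \<Longrightarrow> \<gamma> = \<delta>"
  using F_Bij Bij_imp_extensional extensionalityI by metis

definition idF :: "complex \<Rightarrow> complex" where "idF = (\<lambda>z\<in>disk. z)"

lemma idF_in: "idF \<in> F" and idF_apply [simp]: "z \<in> disk \<Longrightarrow> idF z = z"
  using subgroup.one_closed[OF subgroup_F] by (auto simp: BijGroup_def idF_def)

lemma idF_eq_one: "\<one>\<^bsub>BijGroup disk\<^esub> = idF"
  by (simp add: BijGroup_def idF_def)

lemma F_comp:
  assumes "\<gamma> \<in> F" "\<delta> \<in> F"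
  obtains \<eta> where "\<eta> \<in> F" "\<And>z. z \<in> disk \<Longrightarrow> \<eta> z = \<gamma> (\<delta> z)"
proof
  show "\<gamma> \<otimes>\<^bsub>BijGroup disk\<^esub> \<delta> \<in> F" using subgroup.m_closed[OF subgroup_F assms] .
  show "(\<gamma> \<otimes>\<^bsub>BijGroup disk\<^esub> \<delta>) z = \<gamma> (\<delta> z)" if "z \<in> disk" for z
    using that F_Bij assms by (auto simp: BijGroup_def compose_def)
qed

lemma F_inv:
  assumes "\<gamma> \<in> F"
  obtains \<eta> where "\<eta> \<in> F" "\<And>z. z \<in> disk \<Longrightarrow> \<eta> (\<gamma> z) = z" "\<And>z. z \<in> disk \<Longrightarrow> \<gamma> (\<eta> z) = z"
proof
  let ?\<eta> = "inv\<^bsub>BijGroup disk\<^esub> \<gamma>"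
  show "?\<eta> \<in> F" using subgroup.m_inv_closed[OF subgroup_F assms] .
  have b: "bij_betw \<gamma> disk disk" using F_Bij[OF assms] by (simp add: Bij_def)
  have e: "?\<eta> = (\<lambda>x\<in>disk. inv_into disk \<gamma> x)" using inv_BijGroup[OF F_Bij[OF assms]] .
  show "?\<eta> (\<gamma> z) = z" if "z \<in> disk" for z
    using that b assms by (auto simp: e bij_betw_inv_into_left)
  show "\<gamma> (?\<eta> z) = z" if "z \<in> disk" for z
    using that b by (auto simp: e bij_betw_inv_into_right)
qed

lemma F_fixed_point: "\<gamma> \<in> F \<Longrightarrow> z \<in> disk \<Longrightarrow> \<gamma> z = z \<Longrightarrow> \<gamma> = idF"
  using free idF_eq_one unfolding acts_freely_def by auto

text \<open>Freeness speaks of fixed points only; applied to the composition with an inverse it says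
  that an element of \<open>F\<close> is determined by a single value.\<close>

lemma F_eq_at:
  assumes "\<gamma> \<in> F" "\<delta> \<in> F" "z \<in> disk" "\<gamma> z = \<delta> z"
  shows "\<gamma> = \<delta>"
proof -
  obtain \<eta> where \<eta>: "\<eta> \<in> F" "\<And>z. z \<in> disk \<Longrightarrow> \<eta> (\<delta> z) = z" "\<And>z. z \<in> disk \<Longrightarrow> \<delta> (\<eta> z) = z"
    using F_inv[OF assms(2)] by blast
  obtain \<theta> where \<theta>: "\<theta> \<in> F" "\<And>z. z \<in> disk \<Longrightarrow> \<theta> z = \<eta> (\<gamma> z)"
    using F_comp[OF \<eta>(1) assms(1)] by blast
  have "\<theta> = idF" using assms \<eta> \<theta> by (intro F_fixed_point[of _ z]) auto
  show ?thesis
  proof (rule F_ext[OF assms(1,2)])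
    fix x :: complex assume x: "x \<in> disk"
    have "\<eta> (\<gamma> x) = x" using \<theta>(2)[OF x] \<open>\<theta> = idF\<close> x by simp
    then show "\<gamma> x = \<delta> x" using \<eta>(3)[of "\<gamma> x"] assms(1) x by simp
  qed
qed

lemma proj_eq_iff:
  assumes "z \<in> disk" and that: "w \<in> disk"
  shows "proj F z = proj F w \<longleftrightarrow> (\<exists>\<gamma>\<in>F. w = \<gamma> z)"
proof
  assume "proj F z = proj F w"
  moreover have "w \<in> proj F w" unfolding proj_def by (metis idF_apply idF_in image_eqI that)
  ultimately show "\<exists>\<gamma>\<in>F. w = \<gamma> z" unfolding proj_def by auto
next
  assume "\<exists>\<gamma>\<in>F. w = \<gamma> z"
  then obtain \<gamma> where \<gamma>: "\<gamma> \<in> F" "w = \<gamma> z" by auto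
  obtain \<eta> where \<eta>: "\<eta> \<in> F" "\<And>z. z \<in> disk \<Longrightarrow> \<eta> (\<gamma> z) = z" using F_inv[OF \<gamma>(1)] by metis
  have 1: "proj F (\<delta> u) \<subseteq> proj F u" if du: "\<delta> \<in> F" "u \<in> disk" for \<delta> u
  proof
    fix v assume "v \<in> proj F (\<delta> u)"
    then obtain \<epsilon> where \<epsilon>: "\<epsilon> \<in> F" "v = \<epsilon> (\<delta> u)" unfolding proj_def by auto
    obtain \<theta> where "\<theta> \<in> F" "\<theta> u = \<epsilon> (\<delta> u)" using F_comp[OF \<epsilon>(1) du(1)] du(2) by metis
    then show "v \<in> proj F u" unfolding proj_def using \<epsilon> by (metis image_eqI)
  qed
  show "proj F z = proj F w"
    using 1[OF \<gamma>(1) assms(1)] 1[OF \<eta>(1), of w] \<eta>(2)[OF assms(1)] \<gamma> assms by auto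
qed

lemma proj_F [simp]: "\<gamma> \<in> F \<Longrightarrow> z \<in> disk \<Longrightarrow> proj F (\<gamma> z) = proj F z"
  using proj_eq_iff[of z "\<gamma> z"] by auto

lemma self_in_proj: "z \<in> disk \<Longrightarrow> z \<in> proj F z"
  unfolding proj_def by (metis idF_apply idF_in image_eqI)

lemma in_proj_iff: "z \<in> disk \<Longrightarrow> w \<in> proj F z \<longleftrightarrow> w \<in> disk \<and> proj F w = proj F z"
proof
  assume z: "z \<in> disk" and "w \<in> proj F z"
  then obtain \<gamma> where "\<gamma> \<in> F" "w = \<gamma> z" unfolding proj_def by auto
  then show "w \<in> disk \<and> proj F w = proj F z" using z by auto
next
  assume "z \<in> disk" "w \<in> disk \<and> proj F w = proj F z"
  then show "w \<in> proj F z" using self_in_proj by auto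
qed

lemma proj_in_surface [simp]: "z \<in> disk \<Longrightarrow> proj F z \<in> surface F"
  by (auto simp: surface_def)

lemma surface_obtain:
  assumes "s \<in> surface F" obtains z where "z \<in> disk" "s = proj F z"
  using assms by (auto simp: surface_def)

section \<open>From discreteness at the identity to finiteness of returns to compact sets\<close>

lemma F_param_discrete:
  "\<exists>e>0. \<forall>c w. norm c = 1 \<and> norm w < 1 \<and> restrict (moeb c w) disk \<in> F \<and> dist (c, w) (1, 0) < e \<longrightarrow> c = 1 \<and> w = 0"
proof -
  define Q where "Q = {(cis t, w) | t w. w \<in> disk \<and> restrict (Moebius_function t w) disk \<in> F}"
  have Q: "(c, w) \<in> Q" if "norm c = 1" "norm w < 1" "restrict (moeb c w) disk \<in> F" for c w
  proof -
    obtain t where "c = cis t" using unit_eq_cis \<open>norm c = 1\<close> by blast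
    then show ?thesis using that unfolding Q_def by (auto simp: Moebius_function_eq_moeb)
  qed
  have "restrict (moeb 1 0) disk = idF" by (auto simp: idF_def moeb_def)
  then have "(1, 0) \<in> Q" using Q idF_in by simp
  moreover have "discrete Q" using fuchsian unfolding fuchsian_group_def Q_def by auto
  ultimately have "(1, 0) isolated_in Q" by (simp add: discreteD)
  then obtain e where "e > 0" "\<forall>y\<in>Q. dist (1, 0) y < e \<longrightarrow> y = (1, 0)"
    unfolding isolated_in_dist_Ex_iff by blast
  then show ?thesis using Q by (metis dist_commute prod.inject)
qed

text \<open>Rests on the identity |1 - cnj w x|^2 - |x - w|^2 = (1 - |w|^2) (1 - |x|^2). If a point
  and its image both stay in the disk of radius \<open>r\<close>, then \<open>w\<close> stays away
  from the unit circle, so the parameters range over a compact set.\<close>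

lemma moeb_center_bound:
  assumes "norm c = 1" "norm w < 1" "norm x \<le> r" "norm (moeb c w x) \<le> r" "r < 1"
  shows "(1 - r\<^sup>2) * (1 - r)\<^sup>2 \<le> 1 - (norm w)\<^sup>2"
proof -
  have x: "norm x < 1" using assms by simp
  have r0: "0 \<le> r" using assms(3) norm_ge_zero order_trans by blast
  have n: "1 - cnj w * x \<noteq> 0" using one_minus_cnj_mult_nonzero assms x by auto
  have id: "(norm (1 - cnj w * x))\<^sup>2 - (norm (x - w))\<^sup>2 = (1 - (norm w)\<^sup>2) * (1 - (norm x)\<^sup>2)"
    by (cases w, cases x) (simp add: cmod_power2 complex_diff complex_mult one_complex.code complex_cnj, simp add: algebra_simps power2_eq_square)
  have "norm (moeb c w x) = norm (x - w) / norm (1 - cnj w * x)"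
    using assms by (simp add: moeb_def norm_mult norm_divide)
  then have "norm (x - w) \<le> r * norm (1 - cnj w * x)"
    using assms(4) n by (simp add: divide_le_eq)
  then have "(norm (x - w))\<^sup>2 \<le> r\<^sup>2 * (norm (1 - cnj w * x))\<^sup>2"
    by (metis power_mono norm_ge_zero power_mult_distrib)
  then have "(1 - r\<^sup>2) * (norm (1 - cnj w * x))\<^sup>2 \<le> (1 - (norm w)\<^sup>2) * (1 - (norm x)\<^sup>2)"
    using id by (simp add: algebra_simps)
  also have "\<dots> \<le> (1 - (norm w)\<^sup>2) * 1"
    using assms(2) by (intro mult_left_mono) (auto simp: power_le_one)
  finally have 1: "(1 - r\<^sup>2) * (norm (1 - cnj w * x))\<^sup>2 \<le> 1 - (norm w)\<^sup>2" by simp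
  have "norm (cnj w * x) \<le> r"
    using assms(2,3) r0 by (simp add: norm_mult) (metis mult_left_le_one_le order_trans less_imp_le norm_ge_zero)
  then have "1 - r \<le> norm (1 - cnj w * x)"
    using norm_triangle_ineq2[of 1 "cnj w * x"] by simp
  then have "(1 - r)\<^sup>2 \<le> (norm (1 - cnj w * x))\<^sup>2"
    using assms(5) by (intro power_mono) auto
  then have "(1 - r\<^sup>2) * (1 - r)\<^sup>2 \<le> (1 - r\<^sup>2) * (norm (1 - cnj w * x))\<^sup>2"
    using r0 assms(5) by (intro mult_left_mono) (auto simp: power_le_one)
  then show ?thesis using 1 by simp
qed

text \<open>Infinitely many returning elements would have parameters accumulating in a compact set.
  Two distinct ones close to the limit have a quotient close to the identity, which discreteness
  forces to be the identity.\<close>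

lemma finite_return_cball:
  assumes "r < 1"
  shows "finite {\<gamma> \<in> F. \<exists>x\<in>cball 0 r. \<gamma> x \<in> cball 0 r}"
proof (rule ccontr)
  define k where "k = (1 - r\<^sup>2) * (1 - r)\<^sup>2"
  define X where "X = sphere (0::complex) 1 \<times> {w::complex. k \<le> 1 - (norm w)\<^sup>2}"
  define Q where "Q = {(c, w). (c, w) \<in> X \<and> restrict (moeb c w) disk \<in> F}"
  assume inf: "infinite {\<gamma> \<in> F. \<exists>x\<in>cball 0 r. \<gamma> x \<in> cball 0 r}"
  have r0: "0 \<le> r"
  proof (rule ccontr)
    assume "\<not> 0 \<le> r" then have "cball (0::complex) r = {}" by simp
    then show False using inf by simp
  qed
  have k: "0 < k" using assms r0 by (auto simp: k_def power_less_one_iff abs_square_less_1)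
  have w1: "norm w < 1" if "k \<le> 1 - (norm w)\<^sup>2" for w :: complex
  proof -
    have "(norm w)\<^sup>2 < 1" using that k by linarith
    then show ?thesis by (simp add: abs_square_less_1)
  qed
  have "{\<gamma> \<in> F. \<exists>x\<in>cball 0 r. \<gamma> x \<in> cball 0 r} \<subseteq> (\<lambda>(c, w). restrict (moeb c w) disk) ` Q"
  proof
    fix \<gamma> assume "\<gamma> \<in> {\<gamma> \<in> F. \<exists>x\<in>cball 0 r. \<gamma> x \<in> cball 0 r}"
    then obtain x where \<gamma>: "\<gamma> \<in> F" and x: "norm x \<le> r" "norm (\<gamma> x) \<le> r" by auto
    obtain c w where cw: "norm c = 1" "norm w < 1" "\<gamma> = restrict (moeb c w) disk"
      using F_moebius[OF \<gamma>] unfolding moebius_preserving_iff by blast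
    have "k \<le> 1 - (norm w)\<^sup>2"
      unfolding k_def using cw x assms by (intro moeb_center_bound[where c = c and x = x]) auto
    then have "(c, w) \<in> Q" using cw \<gamma> by (auto simp: Q_def X_def)
    then show "\<gamma> \<in> (\<lambda>(c, w). restrict (moeb c w) disk) ` Q" using cw by force
  qed
  then have infQ: "infinite Q" using inf by (meson finite_imageI finite_subset)
  have "closed {w::complex. k \<le> 1 - (norm w)\<^sup>2} \<and> bounded {w::complex. k \<le> 1 - (norm w)\<^sup>2}"
  proof
    show "closed {w::complex. k \<le> 1 - (norm w)\<^sup>2}"
      by (intro closed_Collect_le continuous_intros)
    show "bounded {w::complex. k \<le> 1 - (norm w)\<^sup>2}"
      by (rule bounded_subset[of "ball 0 1"]) (use w1 in auto)
  qed
  then have "compact X" unfolding X_def by (intro compact_Times) (auto simp: compact_eq_bounded_closed)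
  moreover have "Q \<subseteq> X" unfolding Q_def by auto
  ultimately obtain l where l: "l \<in> X" "l islimpt Q"
    using infQ Heine_Borel_imp_Bolzano_Weierstrass by blast
  \<comment> \<open>Parameters of the quotient of two Moebius maps as a function of both parameter
    pairs; it is continuous at the diagonal point \<open>(l, l)\<close>, with value
    \<open>(1, 0)\<close>.\<close>
  define \<phi> where "\<phi> = (\<lambda>((c1, w1), (c2, w2)).
     (c1 * cnj c2 * (1 - w1 * cnj w2) / (1 - cnj w1 * w2), c2 * (w1 - w2) / (1 - w1 * cnj w2)))"
  obtain c0 w0 where l0: "l = (c0, w0)" "norm c0 = 1" "norm w0 < 1"
    using l w1 unfolding X_def by (cases l) auto
  have n0: "1 - cnj w0 * w0 \<noteq> 0" "1 - w0 * cnj w0 \<noteq> 0"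
    using one_minus_cnj_mult_nonzero[of w0 w0] l0 by (auto simp: mult.commute)
  have \<phi>0: "\<phi> (l, l) = (1, 0)"
    using n0 cnj_unit[OF l0(2)] by (simp add: \<phi>_def l0 mult.commute)
  have "isCont \<phi> (l, l)"
    unfolding \<phi>_def l0 isCont_def case_prod_unfold using n0 by (intro tendsto_intros) auto
  obtain e where e: "e > 0" "\<And>c w. norm c = 1 \<Longrightarrow> norm w < 1 \<Longrightarrow> restrict (moeb c w) disk \<in> F \<Longrightarrow>
      dist (c, w) (1, 0) < e \<Longrightarrow> c = 1 \<and> w = 0"
    using F_param_discrete by blast
  obtain d where d: "d > 0" "\<And>p. dist p (l, l) < d \<Longrightarrow> dist (\<phi> p) (1, 0) < e"
    using \<open>isCont \<phi> (l, l)\<close> e(1) \<phi>0 unfolding continuous_at_eps_delta by metis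
  obtain p where p: "p \<in> Q" "p \<noteq> l" "dist p l < d / 2"
    using l(2) d(1) unfolding islimpt_approachable by (meson half_gt_zero)
  \<comment> \<open>Taking \<open>q\<close> strictly closer to \<open>l\<close> than
    \<open>p\<close> makes the two parameter pairs distinct.\<close>
  obtain q where q: "q \<in> Q" "q \<noteq> l" "dist q l < min (d / 2) (dist p l)"
    using l(2) d(1) p(2) unfolding islimpt_approachable by (metis half_gt_zero min_less_iff_conj zero_less_dist_iff)
  have "p \<noteq> q" using q by auto
  obtain c1 w1 c2 w2 where pq: "p = (c1, w1)" "q = (c2, w2)" by (cases p, cases q)
  have P: "norm c1 = 1" "norm w1 < 1" "restrict (moeb c1 w1) disk \<in> F"
    and Q: "norm c2 = 1" "norm w2 < 1" "restrict (moeb c2 w2) disk \<in> F"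
    using p q w1 by (auto simp: pq Q_def X_def)
  define C where "C = c1 * cnj c2 * (1 - w1 * cnj w2) / (1 - cnj w1 * w2)"
  define W where "W = c2 * (w1 - w2) / (1 - w1 * cnj w2)"
  have CW: "norm C = 1" "norm W < 1" using moeb_compose_params[OF P(1,2) Q(1,2)] by (auto simp: C_def W_def)
  obtain \<eta> where \<eta>: "\<eta> \<in> F" "\<And>z. z \<in> disk \<Longrightarrow> restrict (moeb c2 w2) disk (\<eta> z) = z"
    using F_inv[OF Q(3)] by metis
  obtain \<theta> where \<theta>: "\<theta> \<in> F" "\<And>z. z \<in> disk \<Longrightarrow> \<theta> z = restrict (moeb c1 w1) disk (\<eta> z)"
    using F_comp[OF P(3) \<eta>(1)] by metis
  have "\<theta> = restrict (moeb C W) disk"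
  proof (rule extensionalityI[of _ disk])
    show "\<theta> \<in> extensional disk" using F_Bij[OF \<theta>(1)] Bij_imp_extensional by blast
    show "\<theta> z = restrict (moeb C W) disk z" if "z \<in> disk" for z
    proof -
      have h: "\<eta> z \<in> disk" using \<eta>(1) that by simp
      have "\<theta> z = moeb c1 w1 (\<eta> z)" using \<theta>(2) that h by simp
      also have "\<dots> = moeb C W (moeb c2 w2 (\<eta> z))"
        unfolding C_def W_def using P Q h by (intro moeb_compose_inverse) auto
      also have "moeb c2 w2 (\<eta> z) = z" using \<eta>(2)[OF that] h by simp
      finally show ?thesis using that by simp
    qed
  qed simp
  moreover have "dist (p, q) (l, l) < d"
  proof -
    have "dist (p, q) (l, l) \<le> dist p l + dist q l"
      by (simp add: dist_Pair_Pair sqrt_sum_squares_le_sum)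
    then show ?thesis using p q by simp
  qed
  then have "dist (\<phi> (p, q)) (1, 0) < e" using d(2) by blast
  then have "dist (C, W) (1, 0) < e" by (simp add: \<phi>_def pq C_def W_def)
  ultimately have "C = 1 \<and> W = 0" using e(2)[OF CW] \<theta>(1) by auto
  then have "w1 = w2" using Q(1) one_minus_mult_cnj_nonzero[OF P(2) Q(2)] by (auto simp: W_def)
  moreover then have "c1 * cnj c2 = 1"
    using \<open>C = 1 \<and> W = 0\<close> one_minus_cnj_mult_nonzero[OF Q(2) Q(2)] by (simp add: C_def mult.commute)
  then have "c1 = c2" using cnj_unit[OF Q(1)] Q(1)
    by (metis mult.commute mult.left_commute mult.right_neutral)
  ultimately show False using \<open>p \<noteq> q\<close> pq by simp
qed

lemma compact_in_cball:
  fixes K :: "complex set"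
  assumes "compact K" "K \<subseteq> disk"
  obtains r where "0 < r" "r < 1" "K \<subseteq> cball 0 r"
proof (cases "K = {}")
  case True then show ?thesis using that[of "1/2"] by auto
next
  case False
  obtain x where x: "x \<in> K" "\<And>y. y \<in> K \<Longrightarrow> norm y \<le> norm x"
    using continuous_attains_sup[OF assms(1) False, of norm] by (auto intro: continuous_intros)
  have "norm x < 1" using x assms by auto
  then show ?thesis using that[of "(1 + norm x) / 2"] x(2) by (force simp: add_pos_nonneg)
qed

lemma finite_return:
  assumes "compact K" "K \<subseteq> disk" "compact L" "L \<subseteq> disk"
  shows "finite {\<gamma> \<in> F. \<exists>x\<in>K. \<gamma> x \<in> L}"
proof -
  obtain r where r: "r < 1" "K \<union> L \<subseteq> cball 0 r"
    using compact_in_cball[of "K \<union> L"] compact_Un[OF assms(1,3)] Un_least[OF assms(2,4)] by metis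
  have "{\<gamma> \<in> F. \<exists>x\<in>K. \<gamma> x \<in> L} \<subseteq> {\<gamma> \<in> F. \<exists>x\<in>cball 0 r. \<gamma> x \<in> cball 0 r}"
  proof
    fix \<gamma> assume "\<gamma> \<in> {\<gamma> \<in> F. \<exists>x\<in>K. \<gamma> x \<in> L}"
    then obtain x where x: "\<gamma> \<in> F" "x \<in> K" "\<gamma> x \<in> L" by blast
    then have "x \<in> cball 0 r" "\<gamma> x \<in> cball 0 r" using r by (meson UnCI subsetD)+
    then show "\<gamma> \<in> {\<gamma> \<in> F. \<exists>x\<in>cball 0 r. \<gamma> x \<in> cball 0 r}" using x(1) by blast
  qed
  then show ?thesis using finite_return_cball[OF r(1)] finite_subset by blast
qed

lemma cball_subset_disk: "x \<in> disk \<Longrightarrow> \<exists>r>0. cball x r \<subseteq> disk"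
  using open_contains_cball[of disk] by auto

text \<open>Only finitely many group elements carry some point of a compact ball at
  \<open>x0\<close> into one at \<open>y0\<close>; those that do not send \<open>x0\<close> to
  \<open>y0\<close> are excluded one by one by shrinking the radius.\<close>

lemma local_separation:
  assumes "x0 \<in> disk" "y0 \<in> disk"
  shows "\<exists>r>0. cball x0 r \<subseteq> disk \<and> cball y0 r \<subseteq> disk \<and>
    (\<forall>\<gamma>\<in>F. \<forall>x\<in>cball x0 r. \<gamma> x \<in> cball y0 r \<longrightarrow> \<gamma> x0 = y0)"
proof -
  obtain r1 r2 where r12: "r1 > 0" "cball x0 r1 \<subseteq> disk" "r2 > 0" "cball y0 r2 \<subseteq> disk"
    using cball_subset_disk assms by meson
  define A where "A = {\<gamma> \<in> F. (\<exists>x\<in>cball x0 r1. \<gamma> x \<in> cball y0 r2) \<and> \<gamma> x0 \<noteq> y0}"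
  have "finite A"
    unfolding A_def by (rule finite_subset[OF _ finite_return[of "cball x0 r1" "cball y0 r2"]]) (use r12 in auto)
  have "\<forall>\<gamma>\<in>A. \<exists>r>0. \<forall>x\<in>cball x0 r. \<gamma> x \<notin> cball y0 r"
  proof
    fix \<gamma> assume "\<gamma> \<in> A"
    then have \<gamma>: "\<gamma> \<in> F" "\<gamma> x0 \<noteq> y0" by (auto simp: A_def)
    define e where "e = dist (\<gamma> x0) y0 / 3"
    have "e > 0" using \<gamma> by (simp add: e_def)
    have "isCont \<gamma> x0" using F_continuous[OF \<gamma>(1)] assms(1)
      by (simp add: continuous_on_eq_continuous_at)
    then obtain d where d: "d > 0" "\<And>x. dist x x0 < d \<Longrightarrow> dist (\<gamma> x) (\<gamma> x0) < e"
      using \<open>e > 0\<close> unfolding continuous_at_eps_delta by metis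
    show "\<exists>r>0. \<forall>x\<in>cball x0 r. \<gamma> x \<notin> cball y0 r"
    proof (intro exI[of _ "min (d/2) e"] conjI ballI notI)
      show "0 < min (d / 2) e" using d \<open>e > 0\<close> by simp
      fix x assume "x \<in> cball x0 (min (d / 2) e)" "\<gamma> x \<in> cball y0 (min (d / 2) e)"
      then have "dist x x0 < d" "dist y0 (\<gamma> x) \<le> e"
        using d(1) by (auto simp: dist_commute)
      then have "dist (\<gamma> x) (\<gamma> x0) < e" "dist y0 (\<gamma> x) \<le> e"
        using d(2) by auto
      then have "dist (\<gamma> x0) y0 < 2 * e"
        using dist_triangle[of "\<gamma> x0" y0 "\<gamma> x"] by (simp add: dist_commute)
      then show False using \<open>e > 0\<close> by (simp add: e_def)
    qed
  qed
  then obtain R where R: "\<And>\<gamma>. \<gamma> \<in> A \<Longrightarrow> R \<gamma> > 0" "\<And>\<gamma> x. \<gamma> \<in> A \<Longrightarrow> x \<in> cball x0 (R \<gamma>) \<Longrightarrow> \<gamma> x \<notin> cball y0 (R \<gamma>)"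
    by metis
  define m where "m = Min (insert 1 (R ` A))"
  have m: "m > 0" "\<And>\<gamma>. \<gamma> \<in> A \<Longrightarrow> m \<le> R \<gamma>"
    using \<open>finite A\<close> R(1) by (auto simp: m_def)
  define r where "r = min (min r1 r2) m"
  have r: "r > 0" "r \<le> r1" "r \<le> r2" "\<And>\<gamma>. \<gamma> \<in> A \<Longrightarrow> r \<le> R \<gamma>"
    using m r12 by (auto simp: r_def intro: min.coboundedI2)
  show ?thesis
  proof (intro exI[of _ r] conjI ballI impI)
    show "cball x0 r \<subseteq> disk" "cball y0 r \<subseteq> disk" using r r12 subset_cball by blast+
    fix \<gamma> x assume h: "\<gamma> \<in> F" "x \<in> cball x0 r" "\<gamma> x \<in> cball y0 r"
    show "\<gamma> x0 = y0"
    proof (rule ccontr)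
      assume "\<gamma> x0 \<noteq> y0"
      moreover have "x \<in> cball x0 r1" "\<gamma> x \<in> cball y0 r2" using h r by auto
      ultimately have "\<gamma> \<in> A" using h(1) unfolding A_def by blast
      then show False using R(2)[of \<gamma> x] h r(4)[of \<gamma>] by auto
    qed
  qed (use r in auto)
qed

lemma nice_ball:
  assumes "x0 \<in> disk"
  obtains r where "r > 0" "cball x0 r \<subseteq> disk" "\<And>\<gamma> x. \<gamma> \<in> F \<Longrightarrow> x \<in> cball x0 r \<Longrightarrow> \<gamma> x \<in> cball x0 r \<Longrightarrow> \<gamma> = idF"
  using local_separation[OF assms assms] F_fixed_point assms by metis

lemma separating_balls:
  assumes "x0 \<in> disk" "y0 \<in> disk" "proj F x0 \<noteq> proj F y0"
  obtains r where "r > 0" "cball x0 r \<subseteq> disk" "cball y0 r \<subseteq> disk"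
    "\<And>x y. x \<in> cball x0 r \<Longrightarrow> y \<in> cball y0 r \<Longrightarrow> proj F x \<noteq> proj F y"
proof -
  obtain r where r: "r > 0" "cball x0 r \<subseteq> disk" "cball y0 r \<subseteq> disk"
    "\<And>\<gamma> x. \<gamma> \<in> F \<Longrightarrow> x \<in> cball x0 r \<Longrightarrow> \<gamma> x \<in> cball y0 r \<Longrightarrow> \<gamma> x0 = y0"
    using local_separation[OF assms(1,2)] by blast
  show ?thesis
  proof (rule that[OF r(1-3)])
    fix x y assume "x \<in> cball x0 r" "y \<in> cball y0 r"
    then show "proj F x \<noteq> proj F y"
      using r proj_eq_iff[of x y] assms proj_F[of _ x0] by (metis subsetD)
  qed
qed

lemma nice_ball_proj:
  assumes "x0 \<in> disk"
  obtains r where "r > 0" "cball x0 r \<subseteq> disk"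
    "\<And>x y. x \<in> cball x0 r \<Longrightarrow> y \<in> cball x0 r \<Longrightarrow> proj F x = proj F y \<Longrightarrow> x = y"
proof -
  obtain r where r: "r > 0" "cball x0 r \<subseteq> disk" "\<And>\<gamma> x. \<gamma> \<in> F \<Longrightarrow> x \<in> cball x0 r \<Longrightarrow> \<gamma> x \<in> cball x0 r \<Longrightarrow> \<gamma> = idF"
    using nice_ball[OF assms] by blast
  show ?thesis
  proof (rule that[OF r(1,2)])
    fix x y assume xy: "x \<in> cball x0 r" "y \<in> cball x0 r" "proj F x = proj F y"
    then have "x \<in> disk" "y \<in> disk" using r(2) by blast+
    then obtain \<gamma> where "\<gamma> \<in> F" "y = \<gamma> x" using xy(3) proj_eq_iff by blast
    then show "x = y" using r(3)[of \<gamma> x] xy \<open>x \<in> disk\<close> by auto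
  qed
qed

lemma open_off_diagonal: "open {(z, w). z \<in> disk \<and> w \<in> disk \<and> proj F z \<noteq> proj F w}"
proof (rule openI)
  fix p assume "p \<in> {(z, w). z \<in> disk \<and> w \<in> disk \<and> proj F z \<noteq> proj F w}"
  then obtain x0 y0 where p: "p = (x0, y0)" "x0 \<in> disk" "y0 \<in> disk" "proj F x0 \<noteq> proj F y0" by auto
  obtain r where r: "r > 0" "cball x0 r \<subseteq> disk" "cball y0 r \<subseteq> disk"
    "\<And>x y. x \<in> cball x0 r \<Longrightarrow> y \<in> cball y0 r \<Longrightarrow> proj F x \<noteq> proj F y"
    using separating_balls[OF p(2-4)] by blast
  show "\<exists>e>0. ball p e \<subseteq> {(z, w). z \<in> disk \<and> w \<in> disk \<and> proj F z \<noteq> proj F w}"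
  proof (intro exI[of _ r] conjI subsetI)
    fix q assume "q \<in> ball p r"
    then obtain x y where q: "q = (x, y)" "dist (x0, y0) (x, y) < r" by (cases q) (auto simp: p)
    then have "x \<in> cball x0 r" "y \<in> cball y0 r"
      using dist_fst_le[of "(x0, y0)" "(x, y)"] dist_snd_le[of "(x0, y0)" "(x, y)"] by auto
    then show "q \<in> {(z, w). z \<in> disk \<and> w \<in> disk \<and> proj F z \<noteq> proj F w}"
      using r q by blast
  qed (rule r)
qed

lemma open_complement_orbit:
  assumes "w \<in> disk"
  shows "open {z \<in> disk. proj F z \<noteq> proj F w}"
proof -
  have "{z \<in> disk. proj F z \<noteq> proj F w} = (\<lambda>z. (z, w)) -` {(z, w). z \<in> disk \<and> w \<in> disk \<and> proj F z \<noteq> proj F w}"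
    using assms by auto
  moreover have "open ((\<lambda>z. (z, w)) -` {(z, w). z \<in> disk \<and> w \<in> disk \<and> proj F z \<noteq> proj F w})"
    by (intro open_vimage open_off_diagonal continuous_intros)
  ultimately show ?thesis by (simp only:)
qed

section \<open>The quotient topology and a compact set meeting every orbit\<close>

lemma topspace_surface: "topspace (surface_topology F) = surface F"
proof -
  have "{z \<in> disk. proj F z \<in> surface F} = disk" by auto
  then have "openin (surface_topology F) (surface F)" by (simp add: openin_surface_topology)
  moreover have "topspace (surface_topology F) \<subseteq> surface F"
    using openin_topspace[of "surface_topology F"] unfolding openin_surface_topology by blast
  ultimately show ?thesis using openin_subset by blast
qed

lemma openin_proj_image:
  assumes "open U" "U \<subseteq> disk"
  shows "openin (surface_topology F) (proj F ` U)"
proof -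
  have "{z \<in> disk. proj F z \<in> proj F ` U} = (\<Union>\<gamma>\<in>F. {z \<in> disk. \<gamma> z \<in> U})"
  proof (intro equalityI subsetI)
    fix z assume "z \<in> {z \<in> disk. proj F z \<in> proj F ` U}"
    then obtain u where u: "z \<in> disk" "u \<in> U" "proj F z = proj F u" by auto
    then obtain \<gamma> where "\<gamma> \<in> F" "u = \<gamma> z" using proj_eq_iff[of z u] assms(2) by blast
    then show "z \<in> (\<Union>\<gamma>\<in>F. {z \<in> disk. \<gamma> z \<in> U})" using u by auto
  next
    fix z assume "z \<in> (\<Union>\<gamma>\<in>F. {z \<in> disk. \<gamma> z \<in> U})"
    then obtain \<gamma> where "\<gamma> \<in> F" "z \<in> disk" "\<gamma> z \<in> U" by auto
    then show "z \<in> {z \<in> disk. proj F z \<in> proj F ` U}" using proj_F[of \<gamma> z] by (metis (mono_tags, lifting) image_eqI mem_Collect_eq)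
  qed
  moreover have "open {z \<in> disk. \<gamma> z \<in> U}" if "\<gamma> \<in> F" for \<gamma>
    using continuous_open_preimage[OF F_continuous[OF that] open_ball assms(1)]
    by (simp add: vimage_def Int_def)
  ultimately show ?thesis using assms(2) by (auto simp: openin_surface_topology)
qed

end

locale compact_fuchsian = free_fuchsian +
  assumes compact: "compact_space (surface_topology F)"
begin

text \<open>The projection is open, so the images of concentric balls form an increasing open cover
  of the compact surface, and a finite subcover has a largest member.\<close>

lemma exhausting_ball:
  obtains r where "0 < r" "r < 1" "\<And>z. z \<in> disk \<Longrightarrow> \<exists>\<gamma>\<in>F. \<gamma> z \<in> cball 0 r"
proof -
  \<comment> \<open>The offset 2 keeps every radius positive, including the one for
    \<open>n = 0\<close>; the radii increase to 1.\<close>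
  define U where "U n = proj F ` ball 0 (1 - 1 / (real n + 2))" for n
  have sub: "ball 0 (1 - 1 / (real n + 2)) \<subseteq> disk" for n by (intro subset_ball) auto
  have op: "openin (surface_topology F) (U n)" for n
    unfolding U_def using sub by (intro openin_proj_image) auto
  have mono: "U m \<subseteq> U n" if "m \<le> n" for m n
    unfolding U_def using that by (intro image_mono subset_ball) (auto simp: field_simps)
  have cover: "\<Union>(range U) = topspace (surface_topology F)"
  proof (intro equalityI subsetI)
    fix s assume "s \<in> \<Union>(range U)" then show "s \<in> topspace (surface_topology F)"
      using sub proj_in_surface unfolding U_def topspace_surface by blast
  next
    fix s assume "s \<in> topspace (surface_topology F)"
    then obtain z where z: "z \<in> disk" "s = proj F z" using surface_obtain topspace_surface by metis
    then obtain n where n: "inverse (real (Suc n)) < 1 - norm z"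
      using reals_Archimedean[of "1 - norm z"] by auto
    have "1 / (real n + 2) \<le> inverse (real (Suc n))" by (simp add: field_simps)
    then have "z \<in> ball 0 (1 - 1 / (real n + 2))" using n by auto
    then show "s \<in> \<Union>(range U)" unfolding U_def z(2) by blast
  qed
  obtain \<F> where \<F>: "finite \<F>" "\<F> \<subseteq> range U" "\<Union>\<F> = topspace (surface_topology F)"
    using compact[unfolded compact_space, rule_format, of "range U"] cover op by auto
  then obtain I where I: "finite I" "\<F> = U ` I" by (meson finite_subset_image)
  define n where "n = Max (insert 0 I)"
  have n: "topspace (surface_topology F) \<subseteq> U n"
  proof
    fix s assume "s \<in> topspace (surface_topology F)"
    then obtain i where "i \<in> I" "s \<in> U i" using \<F>(3) I(2) by blast
    moreover then have "i \<le> n" using I by (simp add: n_def)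
    ultimately show "s \<in> U n" using mono by blast
  qed
  show ?thesis
  proof (rule that[of "1 - 1 / (real n + 2)"])
    fix z :: complex assume z: "z \<in> disk"
    then have "proj F z \<in> U n" using n topspace_surface proj_in_surface by blast
    then obtain u where u: "u \<in> ball 0 (1 - 1 / (real n + 2))" "proj F z = proj F u"
      unfolding U_def by auto
    then obtain \<gamma> where "\<gamma> \<in> F" "u = \<gamma> z" using proj_eq_iff[OF z] sub by (meson subsetD)
    then show "\<exists>\<gamma>\<in>F. \<gamma> z \<in> cball 0 (1 - 1 / (real n + 2))" using u by force
  qed auto
qed

lemma dirichlet_bounded:
  obtains r where "0 < r" "r < 1" "dirichlet_domain F \<subseteq> cball 0 r"
proof -
  obtain r where r: "0 < r" "r < 1" "\<And>z. z \<in> disk \<Longrightarrow> \<exists>\<gamma>\<in>F. \<gamma> z \<in> cball 0 r"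
    using exhausting_ball by blast
  have "dirichlet_domain F \<subseteq> cball 0 r"
  proof
    fix z assume "z \<in> dirichlet_domain F"
    then have z: "z \<in> disk" "\<And>\<gamma>. \<gamma> \<in> F \<Longrightarrow> norm z \<le> norm (\<gamma> z)" by (auto simp: dirichlet_domain_def)
    obtain \<gamma> where "\<gamma> \<in> F" "\<gamma> z \<in> cball 0 r" using r(3)[OF z(1)] by blast
    then show "z \<in> cball 0 r" using z(2)[of \<gamma>] by simp
  qed
  then show ?thesis using that r by blast
qed

text \<open>An orbit has only finitely many points in the closed disk of radius |z|, so its minimal
  norm is attained.\<close>

lemma dirichlet_meets_orbit:
  assumes "z \<in> disk"
  obtains \<gamma> where "\<gamma> \<in> F" "\<gamma> z \<in> dirichlet_domain F"
proof -
  define A where "A = {\<gamma> \<in> F. \<gamma> z \<in> cball 0 (norm z)}"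
  have "finite A"
    unfolding A_def
    by (rule finite_subset[OF _ finite_return[of "{z}" "cball 0 (norm z)"]]) (use assms in auto)
  moreover have "idF \<in> A" using idF_in assms by (simp add: A_def)
  ultimately obtain \<gamma> where \<gamma>: "\<gamma> \<in> A" "\<And>\<delta>. \<delta> \<in> A \<Longrightarrow> norm (\<gamma> z) \<le> norm (\<delta> z)"
    using ex_min_if_finite[of "(\<lambda>\<gamma>. norm (\<gamma> z)) ` A"] by (auto simp: not_less)
  have "norm (\<gamma> z) \<le> norm (\<delta> (\<gamma> z))" if d: "\<delta> \<in> F" for \<delta>
  proof -
    have "\<gamma> \<in> F" using \<gamma>(1) by (simp add: A_def)
    then obtain \<eta> where \<eta>: "\<eta> \<in> F" "\<eta> z = \<delta> (\<gamma> z)" using F_comp[OF d] assms by metis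
    show ?thesis
    proof (cases "norm (\<eta> z) \<le> norm z")
      case True
      then have "\<eta> \<in> A" using \<eta>(1) by (simp add: A_def)
      then show ?thesis using \<gamma>(2)[of \<eta>] \<eta>(2) by simp
    next
      case False
      have "norm (\<gamma> z) \<le> norm z" using \<gamma>(1) by (simp add: A_def)
      then show ?thesis using False \<eta>(2) by simp
    qed
  qed
  then have "\<gamma> z \<in> dirichlet_domain F" using \<gamma>(1) assms by (auto simp: dirichlet_domain_def A_def)
  then show ?thesis using that \<gamma>(1) by (auto simp: A_def)
qed

end

section \<open>Change of variables\<close>

text \<open>The change of variables formula is applied in \<open>real^2\<close>; this map and its
  inverse carry complex integrals there and back.\<close>

definition complex_of_vec :: "real^2 \<Rightarrow> complex" where
  "complex_of_vec v = Complex (v $ 1) (v $ 2)"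

definition vec_of_complex :: "complex \<Rightarrow> real^2" where
  "vec_of_complex z = vector [Re z, Im z]"

lemma complex_of_vec_inverse [simp]: "complex_of_vec (vec_of_complex z) = z"
  by (simp add: complex_of_vec_def vec_of_complex_def)

lemma vec_of_complex_inverse [simp]: "vec_of_complex (complex_of_vec v) = v"
  by (simp add: complex_of_vec_def vec_of_complex_def vec_eq_iff forall_2)

lemma bounded_linear_complex_of_vec: "bounded_linear complex_of_vec"
  unfolding complex_of_vec_def
  by (intro linear_conv_bounded_linear[THEN iffD1] linearI) (simp_all add: complex_eq_iff)

lemma bounded_linear_vec_of_complex: "bounded_linear vec_of_complex"
  unfolding vec_of_complex_def
  by (intro linear_conv_bounded_linear[THEN iffD1] linearI) (simp_all add: vec_eq_iff forall_2)

lemma complex_of_vec_measurable [measurable]: "complex_of_vec \<in> borel_measurable borel"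
  by (intro borel_measurable_continuous_onI linear_continuous_on bounded_linear_complex_of_vec)

lemma lborel_complex_of_vec: "distr lborel borel complex_of_vec = (lborel :: complex measure)"
proof (rule lborel_eqI[symmetric])
  fix l u :: complex
  assume "\<And>b. b \<in> Basis \<Longrightarrow> l \<bullet> b \<le> u \<bullet> b"
  then have le: "Re l \<le> Re u" "Im l \<le> Im u"
    by (metis Basis_complex_def complex_inner_1_right insertI1, metis Basis_complex_def complex_inner_i_right insertI1 insertI2)
  have B2: "(Basis :: (real^2) set) = {axis 1 1, axis 2 1}"
    by (auto simp: Basis_vec_def UNIV_2)
  have ne: "axis 1 1 \<noteq> (axis 2 1 :: real^2)" by (simp add: axis_eq_axis)
  have "complex_of_vec -` box l u = box (vec_of_complex l) (vec_of_complex u)"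
    by (auto simp: mem_box B2 inner_axis Basis_complex_def inner_complex_def complex_of_vec_def vec_of_complex_def)
  then have "emeasure (distr lborel borel complex_of_vec) (box l u) = emeasure lborel (box (vec_of_complex l) (vec_of_complex u))"
    by (subst emeasure_distr) auto
  also have "\<dots> = (\<Prod>b\<in>Basis. (vec_of_complex u - vec_of_complex l) \<bullet> b)"
    using le by (intro emeasure_lborel_box) (auto simp: B2 inner_axis vec_of_complex_def)
  also have "\<dots> = (\<Prod>b\<in>Basis. (u - l) \<bullet> b)"
    using ne by (simp add: B2 inner_axis vec_of_complex_def Basis_complex_def inner_complex_def)
  finally show "emeasure (distr lborel borel complex_of_vec) (box l u) = (\<Prod>b\<in>Basis. (u - l) \<bullet> b)" .
qed simp

lemma complex_vec_integral:
  fixes h :: "complex \<Rightarrow> real"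
  assumes [measurable]: "h \<in> borel_measurable borel" "A \<in> sets borel"
  shows "(\<lambda>v. h (complex_of_vec v)) absolutely_integrable_on (vec_of_complex ` A) \<longleftrightarrow> set_integrable lborel A h"
    and "set_integrable lborel A h \<Longrightarrow>
      integral (vec_of_complex ` A) (\<lambda>v. h (complex_of_vec v)) = set_lebesgue_integral lborel A h"
proof -
  have im: "vec_of_complex ` A = complex_of_vec -` A"
    by force
  have [measurable]: "complex_of_vec -` A \<in> sets borel"
    using measurable_sets_borel[OF complex_of_vec_measurable assms(2)] by simp
  have ind: "indicator (complex_of_vec -` A) v *\<^sub>R h (complex_of_vec v) = indicator A (complex_of_vec v) *\<^sub>R h (complex_of_vec v)" for v
    by (simp add: indicator_def)
  have "(\<lambda>v. h (complex_of_vec v)) absolutely_integrable_on (vec_of_complex ` A)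
      \<longleftrightarrow> integrable lborel (\<lambda>v. indicator (complex_of_vec -` A) v *\<^sub>R h (complex_of_vec v))"
    unfolding im set_integrable_def by (rule integrable_completion) measurable
  also have "\<dots> \<longleftrightarrow> integrable (distr lborel borel complex_of_vec) (\<lambda>x. indicator A x *\<^sub>R h x)"
    unfolding ind by (subst integrable_distr_eq) auto
  finally show 1: "(\<lambda>v. h (complex_of_vec v)) absolutely_integrable_on (vec_of_complex ` A) \<longleftrightarrow> set_integrable lborel A h"
    unfolding lborel_complex_of_vec set_integrable_def .
  assume "set_integrable lborel A h"
  then have "integral (vec_of_complex ` A) (\<lambda>v. h (complex_of_vec v)) =
      set_lebesgue_integral lebesgue (complex_of_vec -` A) (\<lambda>v. h (complex_of_vec v))"
    using 1 unfolding im by (simp add: set_lebesgue_integral_eq_integral)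
  also have "\<dots> = integral\<^sup>L lborel (\<lambda>v. indicator (complex_of_vec -` A) v *\<^sub>R h (complex_of_vec v))"
    unfolding set_lebesgue_integral_def by (rule integral_completion) measurable
  also have "\<dots> = integral\<^sup>L (distr lborel borel complex_of_vec) (\<lambda>x. indicator A x *\<^sub>R h x)"
    unfolding ind by (subst integral_distr) auto
  finally show "integral (vec_of_complex ` A) (\<lambda>v. h (complex_of_vec v)) = set_lebesgue_integral lborel A h"
    unfolding lborel_complex_of_vec set_lebesgue_integral_def .
qed

lemma det_complex_mult:
  "det (matrix (\<lambda>v. vec_of_complex (d * complex_of_vec v))) = (norm d)\<^sup>2"
  using cmod_power2[of d]
  by (simp add: det_2 matrix_def vec_of_complex_def complex_of_vec_def axis_def power2_eq_square)

lemma holomorphic_change_of_variables: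
  fixes u :: "complex \<Rightarrow> real"
  assumes S: "open S" and f: "\<And>x. x \<in> S \<Longrightarrow> (f has_field_derivative f' x) (at x)"
    and inj: "inj_on f S" and fS: "f ` S \<in> sets borel"
    and m: "u \<in> borel_measurable borel" "(\<lambda>x. (norm (f' x))\<^sup>2 * u (f x)) \<in> borel_measurable borel"
  shows "set_integrable lborel (f ` S) u \<longleftrightarrow> set_integrable lborel S (\<lambda>x. (norm (f' x))\<^sup>2 * u (f x))"
    and "set_lebesgue_integral lborel (f ` S) u = set_lebesgue_integral lborel S (\<lambda>x. (norm (f' x))\<^sup>2 * u (f x))"
proof -
  define g where "g = (\<lambda>v. vec_of_complex (f (complex_of_vec v)))"
  define g' where "g' = (\<lambda>v h. vec_of_complex (f' (complex_of_vec v) * complex_of_vec h))"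
  define T where "T = vec_of_complex ` S"
  have Tv: "T = complex_of_vec -` S" unfolding T_def by force
  have Tb: "T \<in> sets borel"
    unfolding Tv using S measurable_sets_borel[OF complex_of_vec_measurable, of S] by simp
  then have Tl: "T \<in> sets lebesgue" using sets_completionI_sets by auto
  have der: "(g has_derivative g' v) (at v within T)" if "v \<in> T" for v
  proof -
    have "complex_of_vec v \<in> S" using that Tv by auto
    from f[OF this] have d: "(f has_derivative (\<lambda>h. f' (complex_of_vec v) * h)) (at (complex_of_vec v) within UNIV)"
      by (simp add: has_field_derivative_def)
    have 1: "(complex_of_vec has_derivative complex_of_vec) (at v within T)"
      using bounded_linear_complex_of_vec by (rule bounded_linear_imp_has_derivative)
    have "((\<lambda>v. f (complex_of_vec v)) has_derivative (\<lambda>h. f' (complex_of_vec v) * complex_of_vec h)) (at v within T)"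
      using has_derivative_in_compose[OF 1, of f "\<lambda>h. f' (complex_of_vec v) * h"] d
      by (meson has_derivative_at_withinI)
    then show ?thesis unfolding g_def g'_def
      by (rule bounded_linear.has_derivative[OF bounded_linear_vec_of_complex])
  qed
  have injg: "inj_on g T"
  proof (rule inj_onI)
    fix v w assume h: "v \<in> T" "w \<in> T" "g v = g w"
    then have "f (complex_of_vec v) = f (complex_of_vec w)"
      unfolding g_def by (metis complex_of_vec_inverse)
    then have "complex_of_vec v = complex_of_vec w" using inj h Tv by (auto dest: inj_onD)
    then show "v = w" by (metis vec_of_complex_inverse)
  qed
  have gT: "g ` T = vec_of_complex ` (f ` S)"
    unfolding T_def g_def by (auto simp: image_image)
  define h where "h = (\<lambda>x. (norm (f' x))\<^sup>2 * u (f x))"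
  have hm: "h \<in> borel_measurable borel" using m by (simp add: h_def)
  \<comment> \<open>The substitution rule concerns vector-valued integrands, hence the
    one-dimensional target \<open>real^1\<close>; the Jacobian determinant is |f'|^2 by
    \<open>det_complex_mult\<close>.\<close>
  define D where "D = (\<lambda>v. \<bar>det (matrix (g' v))\<bar> *\<^sub>R (vec (u (complex_of_vec (g v))) :: real^1))"
  have D1: "(\<lambda>v. D v $ 1) = (\<lambda>v. h (complex_of_vec v))"
    by (simp add: D_def g'_def det_complex_mult h_def g_def)
  have cov: "D absolutely_integrable_on T \<and> integral T D = b \<longleftrightarrow>
      (\<lambda>v. vec (u (complex_of_vec v)) :: real^1) absolutely_integrable_on (g ` T) \<and>
      integral (g ` T) (\<lambda>v. vec (u (complex_of_vec v)) :: real^1) = b" for b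
    unfolding D_def by (rule has_absolute_integral_change_of_variables[OF Tl der injg])
  have A1: "D absolutely_integrable_on T \<longleftrightarrow> set_integrable lborel S h"
    unfolding absolutely_integrable_on_1_iff D1 T_def using complex_vec_integral(1)[OF hm, of S] S by simp
  have A2: "(\<lambda>v. vec (u (complex_of_vec v)) :: real^1) absolutely_integrable_on (g ` T) \<longleftrightarrow> set_integrable lborel (f ` S) u"
    unfolding absolutely_integrable_on_1_iff gT using complex_vec_integral(1)[OF m(1) fS] by simp
  show I: "set_integrable lborel (f ` S) u \<longleftrightarrow> set_integrable lborel S (\<lambda>x. (norm (f' x))\<^sup>2 * u (f x))"
    using cov A1 A2 unfolding h_def by blast
  show "set_lebesgue_integral lborel (f ` S) u = set_lebesgue_integral lborel S (\<lambda>x. (norm (f' x))\<^sup>2 * u (f x))"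
  proof (cases "set_integrable lborel (f ` S) u")
    case True
    then have hS: "set_integrable lborel S h" using I h_def by simp
    have "integral T D = integral (g ` T) (\<lambda>v. vec (u (complex_of_vec v)))"
      using cov A2 True by blast
    then have "integral T (\<lambda>v. D v $ 1) = integral (g ` T) (\<lambda>v. u (complex_of_vec v))"
      unfolding integral_on_1_eq by (simp add: vec_eq_iff)
    then show ?thesis
      unfolding D1 unfolding gT T_def
      using complex_vec_integral(2)[OF hm _ hS] complex_vec_integral(2)[OF m(1) fS True] S
      unfolding gT[unfolded T_def] by (simp add: h_def)
  next
    case False
    then show ?thesis using I
      by (simp add: set_lebesgue_integral_def set_integrable_def not_integrable_integral_eq)
  qed
qed

text \<open>The conformal factor of the metric: the density of \<open>hyp_area\<close> and, up to
  sign, the reciprocal of the coefficient in \<open>hyp_laplacian\<close>.\<close>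

definition lam :: "complex \<Rightarrow> real" where
  "lam z = 4 / (1 - (norm z)\<^sup>2)\<^sup>2"

lemma lam_measurable [measurable]: "lam \<in> borel_measurable borel"
  unfolding lam_def by measurable

lemma lam_pos: "norm z < 1 \<Longrightarrow> lam z > 0"
  using abs_square_less_1[of "norm z"] by (auto simp: lam_def)

lemma lam_continuous: "continuous_on disk lam"
proof -
  have "(norm z)\<^sup>2 \<noteq> 1" if "z \<in> disk" for z :: complex
    using that by (auto simp: abs_square_eq_1)
  then show ?thesis unfolding lam_def by (intro continuous_intros) auto
qed

section \<open>Invariance of the hyperbolic area, and radial integrals\<close>

lemma moeb_measurable [measurable]: "moeb c w \<in> borel_measurable borel"
  unfolding moeb_def by measurable

lemma moeb_image_disk: "norm c = 1 \<Longrightarrow> norm w < 1 \<Longrightarrow> moeb c w ` disk = disk"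
  and moeb_inj: "norm c = 1 \<Longrightarrow> norm w < 1 \<Longrightarrow> inj_on (moeb c w) disk"
proof -
  assume a: "norm c = 1" "norm w < 1"
  then have "restrict (moeb c w) disk \<in> moebius_preserving" using moebius_preserving_iff by blast
  then have "bij_betw (restrict (moeb c w) disk) disk disk" by (rule moebius_preserving_bij)
  then have "bij_betw (moeb c w) disk disk" by (simp add: bij_betw_def inj_on_def)
  then show "moeb c w ` disk = disk" "inj_on (moeb c w) disk" by (auto simp: bij_betw_def)
qed

lemma moebius_deriv_norm:
  assumes "f \<in> moebius_preserving" "z \<in> disk" "(f has_field_derivative d) (at z)"
  shows "norm d * (1 - (norm z)\<^sup>2) = 1 - (norm (f z))\<^sup>2" "(norm d)\<^sup>2 * lam (f z) = lam z" "d \<noteq> 0"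
proof -
  obtain c where c: "norm c = 1" "\<forall>x\<in>disk. (f x - f z) / (1 - cnj (f z) * f x) = c * ((x - z) / (1 - cnj z * x))"
    using moebius_preserving_diff_quotient[OF assms(1,2)] by blast
  have d: "d = c * of_real ((1 - (norm (f z))\<^sup>2) / (1 - (norm z)\<^sup>2))"
    using DERIV_unique[OF assms(3) moebius_preserving_deriv[OF assms(1,2) c(2)]] .
  have fz: "f z \<in> disk" using assms moebius_preserving_in_disk by blast
  have p: "1 - (norm z)\<^sup>2 > 0" "1 - (norm (f z))\<^sup>2 > 0"
    using assms(2) fz by (auto simp: abs_square_less_1)
  have nd: "norm d = (1 - (norm (f z))\<^sup>2) / (1 - (norm z)\<^sup>2)"
    unfolding d using c(1) p by (simp add: norm_mult del: of_real_divide of_real_diff)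
  then show "norm d * (1 - (norm z)\<^sup>2) = 1 - (norm (f z))\<^sup>2" using p by simp
  show "(norm d)\<^sup>2 * lam (f z) = lam z"
    unfolding nd lam_def using p by (simp add: power_divide field_simps)
  show "d \<noteq> 0" using nd p by auto
qed

text \<open>The Jacobian |f'|^2 is compensated by the conformal factor, since |f'(x)|^2
  \<open>lam (f x)\<close> equals \<open>lam x\<close>. Integrability is carried along because it is
  later inferred from one side to the other.\<close>

lemma moebius_integral:
  fixes u :: "complex \<Rightarrow> real"
  assumes f: "f \<in> moebius_preserving" and [measurable]: "u \<in> borel_measurable borel"
  shows "set_integrable lborel disk (\<lambda>x. lam x * u (f x)) \<longleftrightarrow> set_integrable lborel disk (\<lambda>x. lam x * u x)"
    and "(LINT x:disk|lborel. lam x * u (f x)) = (LINT x:disk|lborel. lam x * u x)"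
proof -
  obtain c w where cw: "norm c = 1" "norm w < 1" "f = restrict (moeb c w) disk"
    using f unfolding moebius_preserving_iff by blast
  define d where "d = (\<lambda>x. deriv (moeb c w) x)"
  \<comment> \<open>The derivative is cut off outside the disk so that the transformed integrand,
    computed in \<open>ee\<close>, is visibly Borel measurable on the whole plane.\<close>
  define e where "e = (\<lambda>x. if x \<in> disk then d x else 0)"
  have hol: "moeb c w holomorphic_on disk"
    using moebius_preserving_holomorphic[OF f] by (rule holomorphic_transform) (simp add: cw)
  have der: "(moeb c w has_field_derivative d x) (at x)" if "x \<in> disk" for x
    unfolding d_def using that hol holomorphic_derivI by blast
  have derf: "(f has_field_derivative d x) (at x)" if "x \<in> disk" for x
    by (rule has_field_derivative_transform_within_open[OF der[OF that], of disk]) (use that cw in auto)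
  have ee: "(norm (e x))\<^sup>2 * (lam (moeb c w x) * u (moeb c w x)) = indicator disk x * (lam x * u (moeb c w x))" for x
  proof (cases "x \<in> disk")
    case True
    then have "(norm (d x))\<^sup>2 * lam (moeb c w x) = lam x"
      using moebius_deriv_norm(2)[OF f True derf[OF True]] cw(3) by simp
    then show ?thesis using True by (simp add: e_def flip: mult.assoc)
  qed (simp add: e_def)
  have der': "(moeb c w has_field_derivative e x) (at x)" if "x \<in> disk" for x
    using der[OF that] that by (simp add: e_def)
  have m: "(\<lambda>x. lam x * u x) \<in> borel_measurable borel"
    "(\<lambda>x. (norm (e x))\<^sup>2 * (lam (moeb c w x) * u (moeb c w x))) \<in> borel_measurable borel"
    unfolding ee by (auto intro!: borel_measurable_times borel_measurable_indicator measurable_compose[OF moeb_measurable])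
  have b: "moeb c w ` disk \<in> sets borel" using moeb_image_disk[OF cw(1,2)] by simp
  note cov = holomorphic_change_of_variables[OF open_ball der' moeb_inj[OF cw(1,2)] b m]
  have s: "indicator disk x *\<^sub>R (indicator disk x * (lam x * u (moeb c w x))) = indicator disk x *\<^sub>R (lam x * u (f x))" for x
    by (auto simp: indicator_def cw(3))
  show "set_integrable lborel disk (\<lambda>x. lam x * u (f x)) \<longleftrightarrow> set_integrable lborel disk (\<lambda>x. lam x * u x)"
    using cov(1) unfolding ee moeb_image_disk[OF cw(1,2)] unfolding set_integrable_def s by simp
  show "(LINT x:disk|lborel. lam x * u (f x)) = (LINT x:disk|lborel. lam x * u x)"
    using cov(2) unfolding ee moeb_image_disk[OF cw(1,2)] unfolding set_lebesgue_integral_def s by simp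
qed

text \<open>A disk of radius sqrt x has area pi x, so the squared norm, unlike the norm itself, is
  distributed with constant density.\<close>

lemma distr_norm_square:
  "distr lborel borel (\<lambda>y::complex. (norm y)\<^sup>2) = density lborel (\<lambda>x. ennreal (pi * indicator {0..} x))"
  (is "?L = ?R")
proof (rule measure_eqI_generator_eq)
  let ?E = "range (\<lambda>a::real. {..a})"
  show "Int_stable ?E" by (auto simp: Int_stable_def)
  show "?E \<subseteq> Pow UNIV" "sets ?L = sigma_sets UNIV ?E" "sets ?R = sigma_sets UNIV ?E"
    by (simp_all add: borel_eq_atMost)
  show "range (\<lambda>n::nat. {..real n}) \<subseteq> ?E" by auto
  show "(\<Union>n::nat. {..real n}) = UNIV" by (auto simp: real_arch_simple)
  have L: "emeasure ?L {..x} = ennreal (pi * max 0 x)" for x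
  proof -
    have "emeasure ?L {..x} = emeasure lborel ((\<lambda>y::complex. (norm y)\<^sup>2) -` {..x})"
      by (subst emeasure_distr) auto
    also have "\<dots> = ennreal (pi * max 0 x)"
    proof (cases "x < 0")
      case True
      then have e: "(\<lambda>y::complex. (norm y)\<^sup>2) -` {..x} = {}"
        by (auto simp: not_le) (meson less_le_trans not_less zero_le_power2)
      show ?thesis unfolding e using True by simp
    next
      case False
      then have "(\<lambda>y::complex. (norm y)\<^sup>2) -` {..x} = cball 0 (sqrt x)"
        by (auto simp: real_le_rsqrt real_sqrt_unique) (metis norm_ge_zero power2_le_imp_le real_sqrt_ge_zero real_sqrt_pow2 power_mono linorder_not_less)
      then show ?thesis using False emeasure_cball[of "sqrt x" "0::complex"]
        by (simp add: unit_ball_vol_2)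
    qed
    finally show ?thesis .
  qed
  have R: "emeasure ?R {..x} = ennreal (pi * max 0 x)" for x
  proof -
    have "emeasure ?R {..x} = (\<integral>\<^sup>+ y. ennreal (pi * indicator {0..} y) * indicator {..x} y \<partial>lborel)"
      by (subst emeasure_density) auto
    also have "\<dots> = (\<integral>\<^sup>+ y. ennreal pi * indicator {0..x} y \<partial>lborel)"
      by (intro nn_integral_cong) (auto simp: indicator_def)
    also have "\<dots> = ennreal pi * emeasure lborel {0..x}"
      by (subst nn_integral_cmult_indicator) auto
    also have "\<dots> = ennreal (pi * max 0 x)"
      by (cases "0 \<le> x") (auto simp: ennreal_mult)
    finally show ?thesis .
  qed
  show "emeasure ?L X = emeasure ?R X" if "X \<in> ?E" for X using that L R by auto
  show "emeasure ?L {..real i} \<noteq> \<infinity>" for i :: nat unfolding L by simp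
qed

lemma integral_radial:
  fixes g :: "real \<Rightarrow> real"
  assumes [measurable]: "g \<in> borel_measurable borel"
  shows "(\<integral>y. g ((norm (y::complex))\<^sup>2) \<partial>lborel) = pi * (LINT x:{0..}|lborel. g x)"
    and "integrable lborel (\<lambda>y::complex. g ((norm y)\<^sup>2)) \<longleftrightarrow> set_integrable lborel {0..} g"
proof -
  have "(\<integral>y. g ((norm (y::complex))\<^sup>2) \<partial>lborel) = integral\<^sup>L (distr lborel borel (\<lambda>y::complex. (norm y)\<^sup>2)) g"
    by (subst integral_distr) auto
  also have "\<dots> = (\<integral>x. (pi * indicator {0..} x) *\<^sub>R g x \<partial>lborel)"
    unfolding distr_norm_square by (subst integral_density) (auto simp: indicator_def)
  also have "\<dots> = pi * (LINT x:{0..}|lborel. g x)"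
    unfolding set_lebesgue_integral_def by (simp flip: integral_mult_right_zero add: mult.assoc)
  finally show "(\<integral>y. g ((norm (y::complex))\<^sup>2) \<partial>lborel) = pi * (LINT x:{0..}|lborel. g x)" .
  have "integrable lborel (\<lambda>y::complex. g ((norm y)\<^sup>2)) \<longleftrightarrow> integrable (distr lborel borel (\<lambda>y::complex. (norm y)\<^sup>2)) g"
    by (subst integrable_distr_eq) auto
  also have "\<dots> \<longleftrightarrow> integrable lborel (\<lambda>x. (pi * indicator {0..} x) *\<^sub>R g x)"
    unfolding distr_norm_square by (subst integrable_density) (auto simp: indicator_def)
  also have "\<dots> \<longleftrightarrow> set_integrable lborel {0..} g"
    unfolding set_integrable_def by (simp add: mult.assoc)
  finally show "integrable lborel (\<lambda>y::complex. g ((norm y)\<^sup>2)) \<longleftrightarrow> set_integrable lborel {0..} g" .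
qed

section \<open>Integration over the surface\<close>

context free_fuchsian
begin

abbreviation "D \<equiv> dirichlet_domain F"

lemma F_compose_measurable:
  fixes u :: "complex \<Rightarrow> real"
  assumes "\<gamma> \<in> F" "u \<in> borel_measurable borel"
  shows "(\<lambda>z. indicator disk z * u (\<gamma> z)) \<in> borel_measurable borel"
proof -
  have "\<gamma> \<in> borel_measurable (restrict_space borel disk)"
    using F_continuous[OF assms(1)] by (rule borel_measurable_continuous_on_restrict)
  then have "(\<lambda>z. u (\<gamma> z)) \<in> borel_measurable (restrict_space borel disk)"
    using assms(2) by (rule measurable_compose)
  then show ?thesis by (simp add: borel_measurable_restrict_space_iff mult.commute)
qed

lemma D_borel [measurable]: "D \<in> sets borel"
proof -
  have D: "D = disk - (\<Union>\<gamma>\<in>F. {z \<in> disk. norm (\<gamma> z) - norm z < 0})"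
    by (auto simp: dirichlet_domain_def not_less)
  have "open {z \<in> disk. norm (\<gamma> z) - norm z < 0}" if "\<gamma> \<in> F" for \<gamma>
  proof -
    have "continuous_on disk (\<lambda>z. norm (\<gamma> z) - norm z)"
      using F_continuous[OF that] by (intro continuous_intros)
    from continuous_open_preimage[OF this open_ball, of "{..<0}"] show ?thesis
      by (simp add: vimage_def Int_def)
  qed
  then have "open (\<Union>\<gamma>\<in>F. {z \<in> disk. norm (\<gamma> z) - norm z < 0})" by blast
  then show ?thesis unfolding D by (intro sets.Diff borel_open) auto
qed

lemma D_disk: "D \<subseteq> disk"
  by (auto simp: dirichlet_domain_def)

abbreviation "M_surface \<equiv> sigma (surface F) {A. A \<subseteq> surface F \<and> {z \<in> disk. proj F z \<in> A} \<in> sets borel}"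

text \<open>The generating family is already a sigma-algebra, so measurability of a function on the
  surface can be tested on its lift to the disk.\<close>

lemma sets_M_surface:
  "sets M_surface = {A. A \<subseteq> surface F \<and> {z \<in> disk. proj F z \<in> A} \<in> sets borel}" (is "_ = ?A")
proof -
  have "sigma_algebra (surface F) ?A"
  proof (rule sigma_algebra_iff2[THEN iffD2], intro conjI ballI allI impI)
    fix A assume "A \<in> ?A"
    moreover have "{z \<in> disk. proj F z \<in> surface F - A} = disk - {z \<in> disk. proj F z \<in> A}" by auto
    ultimately show "surface F - A \<in> ?A" by (auto simp del: mem_ball_0)
  next
    fix A :: "nat \<Rightarrow> complex set set" assume A: "range A \<subseteq> ?A"
    have "{z \<in> disk. proj F z \<in> (\<Union>i. A i)} = (\<Union>i. {z \<in> disk. proj F z \<in> A i})" by auto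
    moreover have "\<And>i. {z \<in> disk. proj F z \<in> A i} \<in> sets borel" using A by blast
    ultimately show "(\<Union>i. A i) \<in> ?A" using A by auto
  qed auto
  then show ?thesis by (simp add: sigma_algebra.sets_measure_of_eq)
qed

lemma M_surface_measurable_iff:
  fixes h :: "complex set \<Rightarrow> real"
  shows "h \<in> borel_measurable M_surface \<longleftrightarrow> (\<lambda>z. indicator disk z * h (proj F z)) \<in> borel_measurable borel"
proof -
  have "(\<lambda>z. indicator disk z * h (proj F z)) \<in> borel_measurable borel \<longleftrightarrow>
      (\<lambda>z. h (proj F z)) \<in> borel_measurable (restrict_space borel disk)"
    by (simp add: borel_measurable_restrict_space_iff mult.commute)
  also have "\<dots> \<longleftrightarrow> (\<forall>B\<in>sets borel. {z \<in> disk. h (proj F z) \<in> B} \<in> sets borel)"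
    by (auto simp add: measurable_def space_restrict_space sets_restrict_space_iff vimage_def Int_def conj_commute)
  also have "\<dots> \<longleftrightarrow> h \<in> borel_measurable M_surface"
  proof -
    have "space M_surface = surface F" by (simp add: space_measure_of_conv)
    moreover have "{z \<in> disk. proj F z \<in> h -` B \<inter> surface F} = {z \<in> disk. h (proj F z) \<in> B}" for B
      by auto
    then have "h -` B \<inter> surface F \<in> sets M_surface \<longleftrightarrow> {z \<in> disk. h (proj F z) \<in> B} \<in> sets borel" for B
      unfolding sets_M_surface by (simp del: mem_ball_0)
    ultimately show ?thesis by (simp add: measurable_def del: mem_ball_0)
  qed
  finally show ?thesis by simp
qed

lemma area_integral:
  fixes h :: "complex set \<Rightarrow> real"
  assumes m: "(\<lambda>z. indicator disk z * h (proj F z)) \<in> borel_measurable borel"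
  shows "integrable (area F) h \<longleftrightarrow> set_integrable lborel D (\<lambda>z. lam z * h (proj F z))"
    and "(\<integral>s. h s \<partial>area F) = (LINT z:D|lborel. lam z * h (proj F z))"
proof -
  have hm: "h \<in> borel_measurable M_surface" using m M_surface_measurable_iff by blast
  have sp: "space (restrict_space hyp_area D) = D"
    by (simp add: space_restrict_space hyp_area_def)
  have pm: "proj F \<in> measurable (restrict_space hyp_area D) M_surface"
  proof (rule measurableI)
    fix z assume "z \<in> space (restrict_space hyp_area D)"
    then show "proj F z \<in> space M_surface" using sp D_disk by (auto simp: space_measure_of_conv simp del: mem_ball_0)
  next
    fix A assume A: "A \<in> sets M_surface"
    have "proj F -` A \<inter> D = {z \<in> disk. proj F z \<in> A} \<inter> D" using D_disk by blast
    then show "proj F -` A \<inter> space (restrict_space hyp_area D) \<in> sets (restrict_space hyp_area D)"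
      using A unfolding sp sets_M_surface by (subst sets_restrict_space_iff) (auto simp: hyp_area_def simp del: mem_ball_0)
  qed
  have i: "indicator D z *\<^sub>R h (proj F z) = indicator D z * (indicator disk z * h (proj F z))" for z
    using D_disk by (auto simp: indicator_def simp del: mem_ball_0)
  have i2: "lam z *\<^sub>R (indicator D z *\<^sub>R h (proj F z)) = indicator D z *\<^sub>R (lam z * h (proj F z))" for z
    by simp
  have D': "D \<inter> space hyp_area \<in> sets hyp_area" by (simp add: hyp_area_def)
  have ha: "hyp_area = density lborel (\<lambda>z. ennreal (lam z))" by (simp add: hyp_area_def lam_def)
  have l0: "AE x in lborel. 0 \<le> lam x" by (simp add: lam_def)
  have mm: "(\<lambda>z. indicator D z *\<^sub>R h (proj F z)) \<in> borel_measurable lborel"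
    unfolding i using borel_measurable_times[OF borel_measurable_indicator[OF D_borel] m] by simp
  show "integrable (area F) h \<longleftrightarrow> set_integrable lborel D (\<lambda>z. lam z * h (proj F z))"
    unfolding area_def integrable_distr_eq[OF pm hm] integrable_restrict_space[OF D']
    unfolding ha set_integrable_def
    using integrable_density[OF mm _ l0] unfolding i2 by simp
  show "(\<integral>s. h s \<partial>area F) = (LINT z:D|lborel. lam z * h (proj F z))"
    unfolding area_def integral_distr[OF pm hm] integral_restrict_space[OF D']
    unfolding ha set_lebesgue_integral_def
    using integral_density[OF mm _ l0] unfolding i2 by simp
qed

lemma area_measurable:
  fixes h :: "complex set \<Rightarrow> real"
  assumes "integrable (area F) h"
  shows "(\<lambda>z. indicator disk z * h (proj F z)) \<in> borel_measurable borel"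
proof -
  have "h \<in> borel_measurable (area F)" using assms by (rule borel_measurable_integrable)
  then have "h \<in> borel_measurable M_surface" by (simp add: area_def)
  then show ?thesis using M_surface_measurable_iff by blast
qed

text \<open>For \<gamma> with parameter \<open>w\<close>, the condition |\<gamma> x| = |x| reduces
  to |1 - cnj w x|^2 = 1 - |w|^2, a circle around \<open>1 / cnj w\<close>. Freeness gives w
  \<noteq> 0, since otherwise \<gamma> would fix 0.\<close>

lemma equidistant_negligible:
  assumes "\<gamma> \<in> F" "\<gamma> \<noteq> idF"
  shows "{x \<in> disk. norm (\<gamma> x) = norm x} \<in> null_sets lborel"
proof -
  obtain c w where cw: "norm c = 1" "norm w < 1" "\<gamma> = restrict (moeb c w) disk"
    using F_moebius[OF assms(1)] unfolding moebius_preserving_iff by blast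
  have w0: "w \<noteq> 0"
  proof
    assume "w = 0"
    then have "\<gamma> 0 = 0" by (simp add: cw moeb_def)
    then show False using F_fixed_point[OF assms(1), of 0] assms(2) by simp
  qed
  define q where "q = (1 - (norm w)\<^sup>2) / (norm w)\<^sup>2"
  have "{x \<in> disk. norm (\<gamma> x) = norm x} \<subseteq> sphere (1 / cnj w) (sqrt q)"
  proof
    fix x assume "x \<in> {x \<in> disk. norm (\<gamma> x) = norm x}"
    then have x: "norm x < 1" "norm (moeb c w x) = norm x" by (auto simp: cw)
    have n: "1 - cnj w * x \<noteq> 0" using one_minus_cnj_mult_nonzero cw x by auto
    have id: "(norm (1 - cnj w * x))\<^sup>2 - (norm (x - w))\<^sup>2 = (1 - (norm w)\<^sup>2) * (1 - (norm x)\<^sup>2)"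
      by (cases w, cases x) (simp add: cmod_power2 complex_diff complex_mult one_complex.code complex_cnj, simp add: algebra_simps power2_eq_square)
    have "norm (moeb c w x) = norm (x - w) / norm (1 - cnj w * x)"
      using cw(1) by (simp add: moeb_def norm_mult norm_divide)
    then have "norm (x - w) = norm x * norm (1 - cnj w * x)"
      using x(2) n by (simp add: nonzero_divide_eq_eq)
    then have "(norm (1 - cnj w * x))\<^sup>2 * (1 - (norm x)\<^sup>2) = (1 - (norm w)\<^sup>2) * (1 - (norm x)\<^sup>2)"
      using id by (simp add: power_mult_distrib algebra_simps)
    moreover have "1 - (norm x)\<^sup>2 \<noteq> 0" using x(1) abs_square_less_1[of "norm x"] by auto
    ultimately have e: "(norm (1 - cnj w * x))\<^sup>2 = 1 - (norm w)\<^sup>2" by simp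
    have "1 / cnj w - x = (1 - cnj w * x) / cnj w" using w0 by (simp add: field_simps)
    then have "(dist (1 / cnj w) x)\<^sup>2 = q"
      using e by (simp add: dist_norm norm_divide power_divide q_def)
    then show "x \<in> sphere (1 / cnj w) (sqrt q)" using real_sqrt_unique[of "dist (1 / cnj w) x" q] by simp
  qed
  moreover have "sphere (1 / cnj w) (sqrt q) \<in> null_sets lborel"
    using negligible_sphere[of "1 / cnj w" "sqrt q"]
    by (simp add: negligible_iff_null_sets null_sets_completion_iff)
  moreover have "{x \<in> disk. norm (\<gamma> x) = norm x} \<in> sets lborel"
  proof -
    have "continuous_on disk (\<lambda>z. norm (\<gamma> z) - norm z)"
      using F_continuous[OF assms(1)] by (intro continuous_intros)
    then have "(\<lambda>z. norm (\<gamma> z) - norm z) \<in> borel_measurable (restrict_space borel disk)"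
      by (rule borel_measurable_continuous_on_restrict)
    from measurable_sets[OF this, of "{0}"] show ?thesis
      by (simp add: sets_restrict_space_iff space_restrict_space vimage_def Int_def conj_commute)
  qed
  ultimately show ?thesis using null_sets_subset by blast
qed

text \<open>If \<gamma> x and \<delta> x both lie in the Dirichlet domain, minimality gives them
  equal norm, so \<gamma> x lies on the equidistant circle of \<delta> composed with the inverse of
  \<gamma>. Moebius invariance of area pulls this null set back to \<open>x\<close>.\<close>

lemma translate_overlap_null:
  assumes "\<gamma> \<in> F" "\<delta> \<in> F" "\<gamma> \<noteq> \<delta>"
  shows "AE x in lborel. x \<in> disk \<longrightarrow> \<not> (\<gamma> x \<in> D \<and> \<delta> x \<in> D)"
proof -
  obtain \<eta> where \<eta>: "\<eta> \<in> F" "\<And>z. z \<in> disk \<Longrightarrow> \<eta> (\<gamma> z) = z" "\<And>z. z \<in> disk \<Longrightarrow> \<gamma> (\<eta> z) = z"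
    using F_inv[OF assms(1)] by blast
  obtain \<theta> where \<theta>: "\<theta> \<in> F" "\<And>z. z \<in> disk \<Longrightarrow> \<theta> z = \<delta> (\<eta> z)" using F_comp[OF assms(2) \<eta>(1)] by metis
  have "\<theta> \<noteq> idF"
  proof
    assume "\<theta> = idF"
    have "\<gamma> 0 = \<delta> 0" using \<theta>(2)[of "\<gamma> 0"] \<eta>(2)[of 0] assms(1) \<open>\<theta> = idF\<close> by simp
    then show False using F_eq_at[OF assms(1,2), of 0] assms(3) by simp
  qed
  define N where "N = {x \<in> disk. norm (\<theta> x) = norm x}"
  have N0: "N \<in> null_sets lborel" unfolding N_def using equidistant_negligible[OF \<theta>(1) \<open>\<theta> \<noteq> idF\<close>] .
  then have Nb: "N \<in> sets borel" by auto
  have sub: "x \<in> disk \<Longrightarrow> \<gamma> x \<in> D \<Longrightarrow> \<delta> x \<in> D \<Longrightarrow> \<gamma> x \<in> N" for x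
  proof -
    assume x: "x \<in> disk" "\<gamma> x \<in> D" "\<delta> x \<in> D"
    have t: "\<theta> (\<gamma> x) = \<delta> x" using \<theta>(2)[of "\<gamma> x"] \<eta>(2)[OF x(1)] assms(1) x(1) by simp
    obtain \<theta>' where \<theta>': "\<theta>' \<in> F" "\<And>z. z \<in> disk \<Longrightarrow> \<theta>' (\<theta> z) = z" using F_inv[OF \<theta>(1)] by metis
    have "norm (\<gamma> x) \<le> norm (\<delta> x)" using x(2) \<theta>(1) t by (auto simp: dirichlet_domain_def)
    moreover have "norm (\<delta> x) \<le> norm (\<gamma> x)"
      using x(3) \<theta>'(1) \<theta>'(2)[of "\<gamma> x"] t assms(1) x(1) by (force simp: dirichlet_domain_def)
    ultimately have "norm (\<theta> (\<gamma> x)) = norm (\<gamma> x)" using t by simp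
    then show "\<gamma> x \<in> N" using F_in_disk[OF assms(1) x(1)] by (simp add: N_def)
  qed
  \<comment> \<open>The null set is transported by \<gamma> through the integral of a nonnegative
    function: the integral over the preimage of \<open>N\<close> equals the one over
    \<open>N\<close>, which is zero.\<close>
  have "(LINT x:disk|lborel. lam x * indicator N (\<gamma> x)) = (LINT x:disk|lborel. lam x * indicator N x)"
    and "set_integrable lborel disk (\<lambda>x. lam x * indicator N (\<gamma> x)) \<longleftrightarrow> set_integrable lborel disk (\<lambda>x. lam x * indicator N x)"
    using moebius_integral[OF F_moebius[OF assms(1)], of "indicator N"] Nb by auto
  moreover have zm: "(\<lambda>x. indicator disk x *\<^sub>R (lam x * indicator N x)) \<in> borel_measurable lborel"
    using borel_measurable_times[OF borel_measurable_indicator[of disk borel] borel_measurable_times[OF lam_measurable borel_measurable_indicator[OF Nb]]]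
    by simp
  moreover have zero: "AE x in lborel. indicator disk x *\<^sub>R (lam x * indicator N x) = 0"
    using AE_not_in[OF N0] by eventually_elim auto
  moreover have "set_integrable lborel disk (\<lambda>x. lam x * indicator N x)"
    unfolding set_integrable_def using integrable_cong_AE[OF zm _ zero] by simp
  moreover have "(LINT x:disk|lborel. lam x * indicator N x) = 0"
    unfolding set_lebesgue_integral_def using integral_cong_AE[OF zm _ zero] by simp
  ultimately have "set_integrable lborel disk (\<lambda>x. lam x * indicator N (\<gamma> x))"
    "(LINT x:disk|lborel. lam x * indicator N (\<gamma> x)) = 0" by auto
  then have "AE x in lborel. indicator disk x *\<^sub>R (lam x * indicator N (\<gamma> x)) = 0"
    unfolding set_integrable_def set_lebesgue_integral_def
    by (subst (asm) integral_nonneg_eq_0_iff_AE) (auto simp: lam_def)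
  then show ?thesis
  proof eventually_elim
    case (elim x)
    show ?case
    proof (intro impI notI)
      assume h: "x \<in> disk" "\<gamma> x \<in> D \<and> \<delta> x \<in> D"
      then have "\<gamma> x \<in> N" using sub by blast
      then show False using elim h(1) lam_pos[of x] by (simp add: indicator_def)
    qed
  qed
qed

text \<open>Intersecting with a compact \<open>K\<close> keeps the sum finite. When \<open>u\<close>
  vanishes off \<open>K\<close>, this is the Poincare series of \<open>u\<close> over the group,
  regarded as a function on the surface.\<close>

definition orbit_sum :: "complex set \<Rightarrow> (complex \<Rightarrow> real) \<Rightarrow> complex set \<Rightarrow> real" where
  "orbit_sum K u s = sum u (s \<inter> K)"

text \<open>A group element is determined by its value at \<open>x\<close>, so summing over the
  orbit and over the group agree. The index set may be too large, because the extra terms vanish;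
  this permits one set for all nearby \<open>x\<close>.\<close>

lemma orbit_sum_eq:
  assumes "x \<in> disk" "finite \<Gamma>" "\<Gamma> \<subseteq> F" "\<And>\<gamma>. \<gamma> \<in> F \<Longrightarrow> \<gamma> x \<in> K \<Longrightarrow> \<gamma> \<in> \<Gamma>"
    and "\<And>y. y \<in> disk \<Longrightarrow> y \<notin> K \<Longrightarrow> u y = 0"
  shows "orbit_sum K u (proj F x) = (\<Sum>\<gamma>\<in>\<Gamma>. u (\<gamma> x))"
proof -
  have "(\<Sum>\<gamma>\<in>\<Gamma>. u (\<gamma> x)) = (\<Sum>\<gamma>\<in>{\<gamma>\<in>\<Gamma>. \<gamma> x \<in> K}. u (\<gamma> x))"
  proof (rule sum.mono_neutral_right)
    show "\<forall>\<gamma>\<in>\<Gamma> - {\<gamma> \<in> \<Gamma>. \<gamma> x \<in> K}. u (\<gamma> x) = 0"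
      using assms(1,3,5) by (metis (mono_tags, lifting) DiffD1 DiffD2 F_in_disk mem_Collect_eq subsetD)
  qed (use assms(2) in auto)
  also have "\<dots> = sum u ((\<lambda>\<gamma>. \<gamma> x) ` {\<gamma>\<in>\<Gamma>. \<gamma> x \<in> K})"
  proof -
    have "inj_on (\<lambda>\<gamma>. \<gamma> x) {\<gamma>\<in>\<Gamma>. \<gamma> x \<in> K}"
      using F_eq_at[OF _ _ assms(1)] assms(3) by (intro inj_onI) blast
    then show ?thesis by (simp add: sum.reindex)
  qed
  also have "(\<lambda>\<gamma>. \<gamma> x) ` {\<gamma>\<in>\<Gamma>. \<gamma> x \<in> K} = proj F x \<inter> K"
    using assms(3,4) by (auto simp: proj_def)
  finally show ?thesis by (simp add: orbit_sum_def)
qed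

end

context compact_fuchsian
begin

text \<open>The sum of indicators counts the translates of the Dirichlet domain that contain
  \<open>x\<close>: at least one by \<open>dirichlet_meets_orbit\<close>, and at most one almost
  everywhere by \<open>translate_overlap_null\<close>.\<close>

lemma D_translates_cover:
  assumes K: "compact K" "K \<subseteq> disk"
  obtains \<Gamma> where "finite \<Gamma>" "\<Gamma> \<subseteq> F" "\<And>\<gamma> x. \<gamma> \<in> F \<Longrightarrow> x \<in> K \<Longrightarrow> \<gamma> x \<in> D \<Longrightarrow> \<gamma> \<in> \<Gamma>"
    "AE x in lborel. x \<in> K \<longrightarrow> (\<Sum>\<gamma>\<in>\<Gamma>. indicator D (\<gamma> x)) = (1::real)"
proof -
  obtain r where r: "0 < r" "r < 1" "D \<subseteq> cball 0 r" using dirichlet_bounded by metis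
  define \<Gamma> where "\<Gamma> = {\<gamma> \<in> F. \<exists>x\<in>K. \<gamma> x \<in> cball 0 r}"
  have fin: "finite \<Gamma>" unfolding \<Gamma>_def using K r by (intro finite_return) auto
  have sub: "\<Gamma> \<subseteq> F" by (auto simp: \<Gamma>_def)
  have mem: "\<gamma> \<in> F \<Longrightarrow> x \<in> K \<Longrightarrow> \<gamma> x \<in> D \<Longrightarrow> \<gamma> \<in> \<Gamma>" for \<gamma> x
    using r(3) unfolding \<Gamma>_def by blast
  have "AE x in lborel. \<forall>p\<in>{p \<in> \<Gamma> \<times> \<Gamma>. fst p \<noteq> snd p}. x \<in> disk \<longrightarrow> \<not> (fst p x \<in> D \<and> snd p x \<in> D)"
  proof (rule AE_finite_allI)
    show "finite {p \<in> \<Gamma> \<times> \<Gamma>. fst p \<noteq> snd p}" using fin by auto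
    fix p assume "p \<in> {p \<in> \<Gamma> \<times> \<Gamma>. fst p \<noteq> snd p}"
    then show "AE x in lborel. x \<in> disk \<longrightarrow> \<not> (fst p x \<in> D \<and> snd p x \<in> D)"
      using sub by (intro translate_overlap_null) auto
  qed
  then have "AE x in lborel. x \<in> K \<longrightarrow> (\<Sum>\<gamma>\<in>\<Gamma>. indicator D (\<gamma> x)) = (1::real)"
  proof eventually_elim
    case (elim x)
    show ?case
    proof
      assume x: "x \<in> K"
      then have xd: "x \<in> disk" using K by blast
      obtain \<gamma> where \<gamma>: "\<gamma> \<in> F" "\<gamma> x \<in> D" using dirichlet_meets_orbit[OF xd] by metis
      then have g: "\<gamma> \<in> \<Gamma>" using mem x by blast
      have "indicator D (\<delta> x) = (if \<delta> = \<gamma> then 1 else 0 :: real)" if "\<delta> \<in> \<Gamma>" for \<delta>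
        using elim xd \<gamma> g that by (auto simp: indicator_def)
      then have "(\<Sum>\<delta>\<in>\<Gamma>. indicator D (\<delta> x)) = (\<Sum>\<delta>\<in>\<Gamma>. if \<delta> = \<gamma> then 1 else 0 :: real)"
        by (intro sum.cong) auto
      also have "\<dots> = 1" using fin g by simp
      finally show "(\<Sum>\<gamma>\<in>\<Gamma>. indicator D (\<gamma> x)) = (1::real)" .
    qed
  qed
  then show ?thesis using that fin sub mem by blast
qed

end

context compact_fuchsian
begin

text \<open>The unfolding trick: almost every point of \<open>K\<close> lies in exactly one
  translate of the Dirichlet domain, so integrating an invariant function against a Poincare series
  over this domain amounts to integrating it against \<open>u\<close> over the disk.\<close>

lemma unfolding_integral:
  fixes u v :: "complex \<Rightarrow> real"
  assumes K: "compact K" "K \<subseteq> disk"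
    and v: "\<And>\<gamma> z. \<gamma> \<in> F \<Longrightarrow> z \<in> disk \<Longrightarrow> v (\<gamma> z) = v z"
    and vm: "(\<lambda>z. indicator disk z * v z) \<in> borel_measurable borel"
    and vi: "set_integrable lborel D (\<lambda>z. lam z * v z)"
    and um [measurable]: "u \<in> borel_measurable borel" and ub: "\<And>z. \<bar>u z\<bar> \<le> B"
    and uK: "\<And>z. z \<in> disk \<Longrightarrow> z \<notin> K \<Longrightarrow> u z = 0"
  shows "set_integrable lborel disk (\<lambda>z. lam z * (v z * u z))"
    and "(LINT z:D|lborel. lam z * (v z * orbit_sum K u (proj F z))) = (LINT z:disk|lborel. lam z * (v z * u z))"
proof -
  obtain \<Gamma> where \<Gamma>: "finite \<Gamma>" "\<Gamma> \<subseteq> F" "\<And>\<gamma> x. \<gamma> \<in> F \<Longrightarrow> x \<in> K \<Longrightarrow> \<gamma> x \<in> D \<Longrightarrow> \<gamma> \<in> \<Gamma>"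
    "AE x in lborel. x \<in> K \<longrightarrow> (\<Sum>\<gamma>\<in>\<Gamma>. indicator D (\<gamma> x)) = (1::real)"
    by (rule D_translates_cover[OF K], rule that)
  have "\<forall>\<gamma>\<in>F. \<exists>\<eta>. \<eta> \<in> F \<and> (\<forall>z\<in>disk. \<eta> (\<gamma> z) = z) \<and> (\<forall>z\<in>disk. \<gamma> (\<eta> z) = z)"
    using F_inv by metis
  \<comment> \<open>The cover of \<open>K\<close> is indexed by elements that move points of
    \<open>K\<close> into the Dirichlet domain, whereas the orbit sum at a point of the domain uses
    elements that move it into \<open>K\<close>, that is, their inverses.\<close>
  then obtain \<iota> where \<iota>: "\<And>\<gamma>. \<gamma> \<in> F \<Longrightarrow> \<iota> \<gamma> \<in> F" "\<And>\<gamma> z. \<gamma> \<in> F \<Longrightarrow> z \<in> disk \<Longrightarrow> \<iota> \<gamma> (\<gamma> z) = z"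
    "\<And>\<gamma> z. \<gamma> \<in> F \<Longrightarrow> z \<in> disk \<Longrightarrow> \<gamma> (\<iota> \<gamma> z) = z"
    by metis
  have inj: "inj_on \<iota> \<Gamma>"
  proof (rule inj_onI)
    fix \<gamma> \<delta> assume h: "\<gamma> \<in> \<Gamma>" "\<delta> \<in> \<Gamma>" "\<iota> \<gamma> = \<iota> \<delta>"
    then have gd: "\<gamma> \<in> F" "\<delta> \<in> F" using \<Gamma> by auto
    show "\<gamma> = \<delta>"
    proof (rule F_eq_at[OF gd])
      show "\<iota> \<gamma> 0 \<in> disk" using \<iota>(1) gd by simp
      show "\<gamma> (\<iota> \<gamma> 0) = \<delta> (\<iota> \<gamma> 0)" using \<iota>(3)[OF gd(1), of 0] \<iota>(3)[OF gd(2), of 0] h(3) by simp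
    qed
  qed
  have os: "orbit_sum K u (proj F z) = (\<Sum>\<gamma>\<in>\<Gamma>. u (\<iota> \<gamma> z))" if z: "z \<in> D" for z
  proof -
    have zd: "z \<in> disk" using z D_disk by blast
    have "orbit_sum K u (proj F z) = (\<Sum>\<delta>\<in>\<iota> ` \<Gamma>. u (\<delta> z))"
    proof (rule orbit_sum_eq[OF zd _ _ _ uK])
      fix \<delta> assume d: "\<delta> \<in> F" "\<delta> z \<in> K"
      have "\<iota> \<delta> (\<delta> z) \<in> D" using \<iota>(2)[OF d(1) zd] z by simp
      then have "\<iota> \<delta> \<in> \<Gamma>" using \<Gamma>(3) \<iota>(1) d by blast
      moreover have "\<iota> (\<iota> \<delta>) = \<delta>"
        by (rule F_eq_at[of _ _ "\<iota> \<delta> 0"]) (use \<iota> d in auto)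
      ultimately show "\<delta> \<in> \<iota> ` \<Gamma>" by force
    qed (use \<Gamma> \<iota>(1) in auto)
    then show ?thesis using inj by (simp add: sum.reindex)
  qed
  \<comment> \<open>The piece of \<open>v * u\<close> on the translate that \<gamma> moves into the
    Dirichlet domain. The indicators of the disk make each factor a Borel function on the
    plane.\<close>
  define w where "w \<gamma> y = (indicator disk y * indicator D (\<gamma> y)) * (indicator disk y * v y) * u y" for \<gamma> y
  have wm: "w \<gamma> \<in> borel_measurable borel" if "\<gamma> \<in> \<Gamma>" for \<gamma>
    unfolding w_def
    by (intro borel_measurable_times F_compose_measurable vm um borel_measurable_indicator[OF D_borel])
      (use that \<Gamma> in auto)
  have ws: "indicator disk z *\<^sub>R (lam z * w \<gamma> (\<iota> \<gamma> z)) = indicator D z *\<^sub>R (lam z * (v z * u (\<iota> \<gamma> z)))" if "\<gamma> \<in> \<Gamma>" for \<gamma> z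
  proof (cases "z \<in> disk")
    case True
    have "\<gamma> \<in> F" using that \<Gamma> by blast
    then have "\<gamma> (\<iota> \<gamma> z) = z" "\<iota> \<gamma> z \<in> disk" "v (\<iota> \<gamma> z) = v z" using True \<iota> v by auto
    then show ?thesis using True by (simp add: w_def)
  next
    case False
    then have "z \<notin> D" using D_disk by blast
    then show ?thesis using False by simp
  qed
  have int1: "set_integrable lborel D (\<lambda>z. lam z * (v z * u (\<iota> \<gamma> z)))" if "\<gamma> \<in> \<Gamma>" for \<gamma>
    unfolding set_integrable_def
  proof (rule Bochner_Integration.integrable_bound[where f = "\<lambda>z. B *\<^sub>R (indicator D z *\<^sub>R (lam z * v z))"])
    have "\<iota> \<gamma> \<in> F" using \<iota> \<Gamma> that by blast
    have "(\<lambda>z. indicator D z * (lam z * ((indicator disk z * v z) * (indicator disk z * u (\<iota> \<gamma> z))))) \<in> borel_measurable borel"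
      by (intro borel_measurable_times F_compose_measurable vm um borel_measurable_indicator[OF D_borel] lam_measurable) fact
    moreover have "(\<lambda>z. indicator D z *\<^sub>R (lam z * (v z * u (\<iota> \<gamma> z)))) =
        (\<lambda>z. indicator D z * (lam z * ((indicator disk z * v z) * (indicator disk z * u (\<iota> \<gamma> z)))))"
      using D_disk by (auto simp: fun_eq_iff indicator_def simp del: mem_ball_0)
    ultimately show "(\<lambda>z. indicator D z *\<^sub>R (lam z * (v z * u (\<iota> \<gamma> z)))) \<in> borel_measurable lborel" by simp
    show "integrable lborel (\<lambda>z. B *\<^sub>R indicator D z *\<^sub>R (lam z * v z))"
      using vi unfolding set_integrable_def by (rule integrable_scaleR_right)
    have "\<bar>u y\<bar> \<le> \<bar>B\<bar>" for y using ub[of y] by linarith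
    then have "\<bar>lam z * v z\<bar> * \<bar>u (\<iota> \<gamma> z)\<bar> \<le> \<bar>lam z * v z\<bar> * \<bar>B\<bar>" for z
      by (intro mult_left_mono) auto
    then show "AE z in lborel. norm (indicator D z *\<^sub>R (lam z * (v z * u (\<iota> \<gamma> z))))
        \<le> norm (B *\<^sub>R indicator D z *\<^sub>R (lam z * v z))"
      by (intro AE_I2) (auto simp: abs_mult indicator_def mult_ac)
  qed
  have int2: "set_integrable lborel disk (\<lambda>z. lam z * w \<gamma> z)"
    and eq2: "(LINT z:disk|lborel. lam z * w \<gamma> z) = (LINT z:D|lborel. lam z * (v z * u (\<iota> \<gamma> z)))"
    if "\<gamma> \<in> \<Gamma>" for \<gamma>
  proof -
    have "\<iota> \<gamma> \<in> moebius_preserving" using \<iota> \<Gamma> that F_moebius by blast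
    note mi = moebius_integral[OF this wm[OF that]]
    show "set_integrable lborel disk (\<lambda>z. lam z * w \<gamma> z)"
      using mi(1) int1[OF that] unfolding set_integrable_def ws[OF that] by blast
    show "(LINT z:disk|lborel. lam z * w \<gamma> z) = (LINT z:D|lborel. lam z * (v z * u (\<iota> \<gamma> z)))"
      using mi(2) unfolding set_lebesgue_integral_def ws[OF that] by simp
  qed
  have ae: "AE z in lborel. indicator disk z *\<^sub>R (\<Sum>\<gamma>\<in>\<Gamma>. lam z * w \<gamma> z) = indicator disk z *\<^sub>R (lam z * (v z * u z))"
    using \<Gamma>(4)
  proof eventually_elim
    case (elim z)
    show ?case
    proof (cases "z \<in> disk")
      case True
      have "(\<Sum>\<gamma>\<in>\<Gamma>. lam z * w \<gamma> z) = lam z * (v z * u z) * (\<Sum>\<gamma>\<in>\<Gamma>. indicator D (\<gamma> z))"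
        using True by (simp add: w_def sum_distrib_left mult_ac)
      also have "\<dots> = lam z * (v z * u z)" using elim uK[OF True] by (cases "z \<in> K") auto
      finally show ?thesis by simp
    qed simp
  qed
  have m1: "(\<lambda>z. indicator disk z *\<^sub>R (\<Sum>\<gamma>\<in>\<Gamma>. lam z * w \<gamma> z)) \<in> borel_measurable lborel"
    using wm by (auto intro!: borel_measurable_times borel_measurable_sum borel_measurable_indicator)
  have m2: "(\<lambda>z. indicator disk z *\<^sub>R (lam z * (v z * u z))) \<in> borel_measurable lborel"
  proof -
    have "(\<lambda>z. lam z * ((indicator disk z * v z) * u z)) \<in> borel_measurable borel"
      by (intro borel_measurable_times vm um lam_measurable)
    moreover have "(\<lambda>z. indicator disk z *\<^sub>R (lam z * (v z * u z))) = (\<lambda>z. lam z * ((indicator disk z * v z) * u z))"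
      by (auto simp: fun_eq_iff)
    ultimately show ?thesis by simp
  qed
  have int3: "integrable lborel (\<lambda>z. indicator disk z *\<^sub>R (\<Sum>\<gamma>\<in>\<Gamma>. lam z * w \<gamma> z))"
    unfolding scaleR_sum_right using int2 unfolding set_integrable_def by (intro Bochner_Integration.integrable_sum)
  then show "set_integrable lborel disk (\<lambda>z. lam z * (v z * u z))"
    unfolding set_integrable_def using integrable_cong_AE[OF m1 m2 ae] by blast
  have "(LINT z:disk|lborel. lam z * (v z * u z)) = (\<integral>z. indicator disk z *\<^sub>R (\<Sum>\<gamma>\<in>\<Gamma>. lam z * w \<gamma> z) \<partial>lborel)"
    unfolding set_lebesgue_integral_def using integral_cong_AE[OF m1 m2 ae] by simp
  also have "\<dots> = (\<Sum>\<gamma>\<in>\<Gamma>. LINT z:disk|lborel. lam z * w \<gamma> z)"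
    unfolding scaleR_sum_right set_lebesgue_integral_def
    using int2 unfolding set_integrable_def by (intro Bochner_Integration.integral_sum)
  also have "\<dots> = (\<Sum>\<gamma>\<in>\<Gamma>. LINT z:D|lborel. lam z * (v z * u (\<iota> \<gamma> z)))"
    using eq2 by (intro sum.cong) auto
  also have "\<dots> = (\<integral>z. (\<Sum>\<gamma>\<in>\<Gamma>. indicator D z *\<^sub>R (lam z * (v z * u (\<iota> \<gamma> z)))) \<partial>lborel)"
    unfolding set_lebesgue_integral_def
    using int1 unfolding set_integrable_def by (intro Bochner_Integration.integral_sum[symmetric])
  also have "\<dots> = (LINT z:D|lborel. lam z * (v z * orbit_sum K u (proj F z)))"
    unfolding set_lebesgue_integral_def
  proof (intro Bochner_Integration.integral_cong refl)
    fix z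
    show "(\<Sum>\<gamma>\<in>\<Gamma>. indicator D z *\<^sub>R (lam z * (v z * u (\<iota> \<gamma> z)))) = indicator D z *\<^sub>R (lam z * (v z * orbit_sum K u (proj F z)))"
      by (cases "z \<in> D") (simp_all add: os sum_distrib_left)
  qed
  finally show "(LINT z:D|lborel. lam z * (v z * orbit_sum K u (proj F z))) = (LINT z:disk|lborel. lam z * (v z * u z))" by simp
qed

end

section \<open>Smooth cutoffs\<close>

text \<open>With u = 1/x, the derivative of p(u) exp (-u) with respect to x is u^2 (p(u) - p'(u))
  exp (-u); the recursion records this.\<close>

fun flat_poly :: "nat \<Rightarrow> real poly" where
  "flat_poly 0 = 1"
| "flat_poly (Suc n) = [:0, 0, 1:] * (flat_poly n - pderiv (flat_poly n))"

text \<open>The \<open>n\<close>-th derivative of the function \<open>exp (-1/x)\<close>, extended by \<open>0\<close> to \<open>x \<le> 0\<close>.\<close>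

definition flat :: "nat \<Rightarrow> real \<Rightarrow> real" where
  "flat n x = (if x > 0 then poly (flat_poly n) (1 / x) * exp (- (1 / x)) else 0)"

lemma poly_times_exp_tendsto_0:
  "((\<lambda>u. u ^ k * poly q u * exp (- u)) \<longlongrightarrow> (0::real)) at_top"
proof (induction q arbitrary: k)
  case 0 then show ?case by simp
next
  case (pCons a q)
  have "((\<lambda>u. a * (u ^ k / exp u) + u ^ Suc k * poly q u * exp (- u)) \<longlongrightarrow> a * 0 + (0::real)) at_top"
    by (intro tendsto_intros tendsto_power_div_exp_0 pCons.IH)
  then show ?case by (simp add: algebra_simps exp_minus divide_inverse)
qed

text \<open>Only the point 0 needs an argument: from the right, the difference quotient becomes with
  u = 1/h a polynomial in u times exp (-u), which tends to 0; from the left it is identically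
  0.\<close>

lemma flat_deriv: "(flat n has_real_derivative flat (Suc n) x) (at x)"
proof -
  consider "x > 0" | "x < 0" | "x = 0" by linarith
  then show ?thesis
  proof cases
    case 1
    have "((\<lambda>x. poly (flat_poly n) (1 / x) * exp (- (1 / x))) has_real_derivative flat (Suc n) x) (at x)"
      using 1 by (auto intro!: derivative_eq_intros poly_DERIV[THEN DERIV_chain2] simp: flat_def power2_eq_square field_simps)
    then show ?thesis
      by (rule has_field_derivative_transform_within_open[of _ _ _ "{0<..}"]) (use 1 in \<open>auto simp: flat_def\<close>)
  next
    case 2
    have "((\<lambda>x. 0) has_real_derivative flat (Suc n) x) (at x)"
      using 2 by (simp add: flat_def)
    then show ?thesis
      by (rule has_field_derivative_transform_within_open[of _ _ _ "{..<0}"]) (use 2 in \<open>auto simp: flat_def\<close>)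
  next
    case 3
    have "((\<lambda>h. (flat n h - flat n 0) / (h - 0)) \<longlongrightarrow> 0) (at_right 0)"
    proof -
      have "((\<lambda>h::real. (1 / h) ^ 1 * poly (flat_poly n) (1 / h) * exp (- (1 / h))) \<longlongrightarrow> 0) (at_right 0)"
        using filterlim_compose[OF poly_times_exp_tendsto_0[of 1 "flat_poly n"] filterlim_inverse_at_top_right]
        by (simp add: inverse_eq_divide)
      moreover have "\<forall>\<^sub>F h in at_right 0. (1 / h) ^ 1 * poly (flat_poly n) (1 / h) * exp (- (1 / h)) = (flat n h - flat n 0) / (h - 0)"
        by (auto simp: eventually_at_right_field flat_def intro!: exI[of _ 1])
      ultimately show ?thesis by (rule Lim_transform_eventually)
    qed
    moreover have "((\<lambda>h. (flat n h - flat n 0) / (h - 0)) \<longlongrightarrow> 0) (at_left 0)"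
    proof (rule tendsto_eventually)
      show "\<forall>\<^sub>F h in at_left 0. (flat n h - flat n 0) / (h - 0) = 0"
        by (auto simp: eventually_at_left_field flat_def intro!: exI[of _ "-1"])
    qed
    ultimately have "((\<lambda>h. (flat n h - flat n 0) / (h - 0)) \<longlongrightarrow> 0) (at 0)"
      using filterlim_split_at by blast
    then show ?thesis using 3 by (simp add: has_field_derivative_iff flat_def)
  qed
qed

lemma flat_nonpos [simp]: "x \<le> 0 \<Longrightarrow> flat n x = 0"
  by (simp add: flat_def)

lemma flat_0_pos: "x > 0 \<Longrightarrow> flat 0 x > 0"
  by (simp add: flat_def)

lemma continuous_flat_product: "continuous_on UNIV (\<lambda>x. flat 0 x * flat 0 (1 - x))"
proof -
  have cf: "continuous_on UNIV (flat 0)"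
    by (intro continuous_at_imp_continuous_on ballI DERIV_isCont[OF flat_deriv])
  have "continuous_on UNIV (\<lambda>x::real. 1 - x)" by (intro continuous_intros)
  then show ?thesis by (rule continuous_on_mult[OF cf continuous_on_compose2[OF cf _ subset_UNIV]])
qed

text \<open>A smoothed positive part: \<open>T\<close> vanishes up to 0 and has slope 1 from 1 on.
  Prescribing the second derivative as a multiple of a product of \<open>flat\<close> functions
  keeps all higher derivatives inside one explicit class.\<close>

definition is_ramp :: "(real \<Rightarrow> real) \<Rightarrow> (real \<Rightarrow> real) \<Rightarrow> real \<Rightarrow> bool" where
  "is_ramp T T' k \<longleftrightarrow> (\<forall>x. (T has_real_derivative T' x) (at x)) \<and>
     (\<forall>x. (T' has_real_derivative k * (flat 0 x * flat 0 (1 - x))) (at x)) \<and>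
     (\<forall>x\<le>0. T x = 0 \<and> T' x = (0::real)) \<and> (\<forall>x\<ge>1. T' x = 1 \<and> T x = x - 1 + T 1) \<and> k > 0"

text \<open>Integrate the product of the two flat functions twice. The first integral is normalised
  by its increment over the unit interval, which the mean value theorem shows to be
  positive.\<close>

lemma ramp_exists: "\<exists>T T' k. is_ramp T T' k"
proof -
  define b where "b x = flat 0 x * flat 0 (1 - x)" for x
  have antider: "\<exists>g. \<forall>x. (g has_real_derivative f x) (at x)" if "continuous_on UNIV f" for f :: "real \<Rightarrow> real"
  proof -
    have "\<exists>g. \<forall>x::real. -\<infinity> < ereal x \<longrightarrow> ereal x < \<infinity> \<longrightarrow> (g has_vector_derivative f x) (at x)"
      by (rule einterval_antiderivative) (use that in \<open>auto simp: continuous_on_eq_continuous_at\<close>)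
    then show ?thesis by (auto simp: has_real_derivative_iff_has_vector_derivative)
  qed
  have "continuous_on UNIV b"
    unfolding b_def by (rule continuous_flat_product)
  then obtain B where B: "\<And>x. (B has_real_derivative b x) (at x)" using antider by blast
  have b0: "b x = 0" if "x \<le> 0 \<or> x \<ge> 1" for x using that by (auto simp: b_def)
  have const: "g x = g y" if "\<And>z. z \<in> S \<Longrightarrow> (g has_real_derivative 0) (at z)" "x \<in> S" "y \<in> S" "convex S" for g :: "real \<Rightarrow> real" and x y S
    using has_field_derivative_zero_constant[OF that(4), of g] that(1-3) by (metis has_field_derivative_at_within)
  obtain z where z: "0 < z" "z < 1" "B 1 - B 0 = b z" using MVT2[of 0 1 B b] B by auto
  have "b z > 0" unfolding b_def using z by (intro mult_pos_pos flat_0_pos) auto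
  then have c: "B 1 - B 0 > 0" using z(3) by simp
  define T' where "T' x = (B x - B 0) / (B 1 - B 0)" for x
  have T': "(T' has_real_derivative 1 / (B 1 - B 0) * b x) (at x)" for x
    unfolding T'_def using c by (auto intro!: derivative_eq_intros B)
  have T'z: "(T' has_real_derivative 0) (at x)" if "x \<le> 0 \<or> x \<ge> 1" for x
    using T'[of x] b0[OF that] by simp
  have "continuous_on UNIV T'"
    by (intro continuous_at_imp_continuous_on ballI DERIV_isCont[OF T'])
  then obtain C where C: "\<And>x. (C has_real_derivative T' x) (at x)" using antider by blast
  define T where "T x = C x - C 0" for x
  have T: "(T has_real_derivative T' x) (at x)" for x
    unfolding T_def by (auto intro!: derivative_eq_intros C)
  have T'0: "T' x = 0" if "x \<le> 0" for x
  proof -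
    have "T' x = T' 0" by (rule const[where g = T' and S = "{..0}"]) (use that T'z in auto)
    then show ?thesis by (simp add: T'_def)
  qed
  have T'1: "T' x = 1" if "x \<ge> 1" for x
  proof -
    have "T' x = T' 1" by (rule const[where g = T' and S = "{1..}"]) (use that T'z in auto)
    then show ?thesis using c by (simp add: T'_def)
  qed
  have T0: "T x = 0" if "x \<le> 0" for x
  proof -
    have "T x = T 0"
    proof (rule const[where g = T and S = "{..0}"])
      fix z :: real assume "z \<in> {..0}"
      then show "(T has_real_derivative 0) (at z)" using T[of z] T'0[of z] by simp
    qed (use that in auto)
    then show ?thesis by (simp add: T_def)
  qed
  have T1: "T x = x - 1 + T 1" if "x \<ge> 1" for x
  proof -
    have "T x - x = T 1 - 1"
    proof (rule const[where S = "{1..}" and g = "\<lambda>x. T x - x"])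
      fix z :: real assume "z \<in> {1..}"
      then show "((\<lambda>x. T x - x) has_real_derivative 0) (at z)"
        using T[of z] T'1[of z] by (auto intro!: derivative_eq_intros)
    qed (use that in auto)
    then show ?thesis by simp
  qed
  have "is_ramp T T' (1 / (B 1 - B 0))"
    unfolding is_ramp_def
  proof (intro conjI allI impI)
    show "(T' has_real_derivative 1 / (B 1 - B 0) * (flat 0 x * flat 0 (1 - x))) (at x)" for x
      using T'[of x] unfolding b_def .
  qed (use T T'0 T'1 T0 c in \<open>simp_all\<close>, rule T1)
  then show ?thesis by blast
qed

text \<open>One choice for all three components, so that \<open>ramp\<close>, \<open>ramp'\<close>
  and \<open>bump_scale\<close> belong to each other.\<close>

definition ramp_triple :: "(real \<Rightarrow> real) \<times> (real \<Rightarrow> real) \<times> real" where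
  "ramp_triple = (SOME p. is_ramp (fst p) (fst (snd p)) (snd (snd p)))"

definition ramp :: "real \<Rightarrow> real" where "ramp = fst ramp_triple"
definition ramp' :: "real \<Rightarrow> real" where "ramp' = fst (snd ramp_triple)"
definition bump_scale :: real where "bump_scale = snd (snd ramp_triple)"
definition bump :: "real \<Rightarrow> real" where "bump x = bump_scale * (flat 0 x * flat 0 (1 - x))"

lemma ramp_deriv: "(ramp has_real_derivative ramp' x) (at x)"
  and ramp'_deriv: "(ramp' has_real_derivative bump x) (at x)"
  and ramp_0: "x \<le> 0 \<Longrightarrow> ramp x = 0" and ramp'_0: "x \<le> 0 \<Longrightarrow> ramp' x = 0"
  and ramp'_1: "x \<ge> 1 \<Longrightarrow> ramp' x = 1" and ramp_1: "x \<ge> 1 \<Longrightarrow> ramp x = x - 1 + ramp 1"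
  and bump_scale_pos: "bump_scale > 0"
proof -
  have "\<exists>p. is_ramp (fst p) (fst (snd p)) (snd (snd p))" using ramp_exists by force
  then have "is_ramp ramp ramp' bump_scale"
    unfolding ramp_def ramp'_def bump_scale_def ramp_triple_def by (rule someI_ex)
  then show "(ramp has_real_derivative ramp' x) (at x)" "(ramp' has_real_derivative bump x) (at x)"
    "x \<le> 0 \<Longrightarrow> ramp x = 0" "x \<le> 0 \<Longrightarrow> ramp' x = 0"
    "x \<ge> 1 \<Longrightarrow> ramp' x = 1" "x \<ge> 1 \<Longrightarrow> ramp x = x - 1 + ramp 1" "bump_scale > 0"
    unfolding is_ramp_def bump_def by blast+
qed

lemma bump_nonneg: "bump x \<ge> 0"
  using bump_scale_pos flat_0_pos by (force simp: bump_def flat_def)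

lemma bump_pos: "0 < x \<Longrightarrow> x < 1 \<Longrightarrow> bump x > 0"
  using bump_scale_pos flat_0_pos by (simp add: bump_def)

lemma bump_zero: "x \<le> 0 \<or> x \<ge> 1 \<Longrightarrow> bump x = 0"
  by (auto simp: bump_def)

lemma continuous_bump: "continuous_on UNIV bump"
  unfolding bump_def by (intro continuous_on_mult continuous_on_const continuous_flat_product)

lemma continuous_ramp: "continuous_on UNIV ramp"
  by (intro continuous_at_imp_continuous_on ballI DERIV_isCont[OF ramp_deriv])

section \<open>The class of smooth functions\<close>

lemma C_diff_on_cong:
  assumes "open S" "\<And>x. x \<in> S \<Longrightarrow> f x = g x" "C_diff_on k S f"
  shows "C_diff_on k S g"
  using assms(2,3)
proof (induction k arbitrary: f g)
  case 0
  then show ?case using continuous_on_cong[of S S f g] by simp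
next
  case (Suc k)
  have d: "(g has_derivative frechet_derivative f (at x)) (at x)" if "x \<in> S" for x
  proof -
    have "(f has_derivative frechet_derivative f (at x)) (at x)"
      using Suc.prems(2) that frechet_derivative_works by auto
    then show ?thesis by (rule has_derivative_transform_within_open[OF _ assms(1) that]) (use Suc.prems in auto)
  qed
  have e: "frechet_derivative f (at x) = frechet_derivative g (at x)" if "x \<in> S" for x
    using frechet_derivative_at[OF d[OF that]] .
  show ?case
    unfolding C_diff_on.simps
  proof (intro conjI ballI)
    fix x assume "x \<in> S" then show "g differentiable at x" unfolding differentiable_def using d by blast
  next
    fix b :: 'a assume b: "b \<in> Basis"
    show "C_diff_on k S (\<lambda>x. frechet_derivative g (at x) b)"
      by (rule Suc.IH[of "\<lambda>x. frechet_derivative f (at x) b"]) (use Suc.prems(2) b in \<open>simp_all add: e\<close>)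
  qed
qed

lemma C_diff_on_local:
  assumes "\<And>x. x \<in> S \<Longrightarrow> \<exists>U. open U \<and> x \<in> U \<and> C_diff_on k U f"
  shows "C_diff_on k S f"
  using assms
proof (induction k arbitrary: f)
  case 0
  show ?case
    unfolding C_diff_on.simps
  proof (rule continuous_at_imp_continuous_on, rule ballI)
    fix x assume "x \<in> S"
    then obtain U where U: "open U" "x \<in> U" "C_diff_on 0 U f" using 0 by blast
    then show "isCont f x" using continuous_on_eq_continuous_at[OF U(1), of f] by simp
  qed
next
  case (Suc k)
  show ?case
    unfolding C_diff_on.simps
  proof (intro conjI ballI)
    fix x assume "x \<in> S"
    then obtain U where U: "open U" "x \<in> U" "C_diff_on (Suc k) U f" using Suc.prems by blast
    then show "f differentiable at x" by simp
  next
    fix b :: 'a assume b: "b \<in> Basis"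
    show "C_diff_on k S (\<lambda>x. frechet_derivative f (at x) b)"
    proof (rule Suc.IH)
      fix x assume "x \<in> S"
      then obtain U where U: "open U" "x \<in> U" "C_diff_on (Suc k) U f" using Suc.prems by blast
      then show "\<exists>U. open U \<and> x \<in> U \<and> C_diff_on k U (\<lambda>x. frechet_derivative f (at x) b)"
        using b by (intro exI[of _ U]) simp
    qed
  qed
qed

lemma C_diff_on_subset: "C_diff_on k S f \<Longrightarrow> T \<subseteq> S \<Longrightarrow> C_diff_on k T f"
  by (induction k arbitrary: f) (auto intro: continuous_on_subset)

lemma C_diff_on_add:
  assumes "open S" "C_diff_on k S f" "C_diff_on k S g"
  shows "C_diff_on k S (\<lambda>x. f x + g x)"
  using assms(2,3)
proof (induction k arbitrary: f g)
  case 0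
  then show ?case by (simp add: continuous_on_add)
next
  case (Suc k)
  have d: "((\<lambda>x. f x + g x) has_derivative (\<lambda>h. frechet_derivative f (at x) h + frechet_derivative g (at x) h)) (at x)"
    if "x \<in> S" for x
    using Suc.prems that by (intro has_derivative_add) (auto simp: frechet_derivative_works[symmetric])
  show ?case
    unfolding C_diff_on.simps
  proof (intro conjI ballI)
    fix x assume "x \<in> S" then show "(\<lambda>x. f x + g x) differentiable at x" unfolding differentiable_def using d by blast
  next
    fix b :: 'a assume b: "b \<in> Basis"
    have "C_diff_on k S (\<lambda>x. frechet_derivative f (at x) b + frechet_derivative g (at x) b)"
      using Suc b by auto
    moreover have "frechet_derivative f (at x) b + frechet_derivative g (at x) b = frechet_derivative (\<lambda>x. f x + g x) (at x) b"
      if "x \<in> S" for x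
      using frechet_derivative_at[OF d[OF that], symmetric] by simp
    ultimately show "C_diff_on k S (\<lambda>x. frechet_derivative (\<lambda>x. f x + g x) (at x) b)"
      by (rule C_diff_on_cong[OF assms(1), rotated])
  qed
qed

lemma C_diff_on_const: "C_diff_on k S (\<lambda>x. c)"
  by (induction k arbitrary: c) auto

lemma C_diff_on_sum:
  assumes "open S" "\<And>i. i \<in> I \<Longrightarrow> C_diff_on k S (f i)"
  shows "C_diff_on k S (\<lambda>x. \<Sum>i\<in>I. f i x)"
  using assms(2)
proof (induction I rule: infinite_finite_induct)
  case (insert i I)
  have "C_diff_on k S (\<lambda>x. f i x + (\<Sum>i\<in>I. f i x))"
    using insert by (intro C_diff_on_add[OF assms(1)]) auto
  then show ?case using insert.hyps by simp
qed (simp_all add: C_diff_on_const)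

text \<open>A class of functions closed under partial derivatives that contains the test functions.\<close>

inductive smooth_expr :: "complex set \<Rightarrow> (complex \<Rightarrow> real) \<Rightarrow> bool" for U where
  Re: "f holomorphic_on U \<Longrightarrow> smooth_expr U (\<lambda>z. Re (f z))"
| add: "smooth_expr U f \<Longrightarrow> smooth_expr U g \<Longrightarrow> smooth_expr U (\<lambda>z. f z + g z)"
| mult: "smooth_expr U f \<Longrightarrow> smooth_expr U g \<Longrightarrow> smooth_expr U (\<lambda>z. f z * g z)"
| flat: "smooth_expr U f \<Longrightarrow> smooth_expr U (\<lambda>z. flat n (f z))"
| ramp: "smooth_expr U f \<Longrightarrow> smooth_expr U (\<lambda>z. ramp (f z))"
| ramp': "smooth_expr U f \<Longrightarrow> smooth_expr U (\<lambda>z. ramp' (f z))"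

lemma smooth_expr_const: "smooth_expr U (\<lambda>z. c)"
  using smooth_expr.Re[of "\<lambda>z. of_real c" U] by (simp add: holomorphic_on_const)

lemma has_derivative_real_compose:
  fixes f :: "'a::real_normed_vector \<Rightarrow> real"
  assumes "(h has_real_derivative d) (at (f x))" "(f has_derivative f') (at x)"
  shows "((\<lambda>z. h (f z)) has_derivative (\<lambda>b. d * f' b)) (at x)"
  using has_derivative_compose[OF assms(2), of h "\<lambda>y. d * y"] assms(1)
  by (simp add: has_field_derivative_def)

lemma smooth_expr_derivative:
  assumes U: "open U" and "smooth_expr U f"
  shows "\<exists>f'. (\<forall>x\<in>U. (f has_derivative f' x) (at x)) \<and> (\<forall>b. smooth_expr U (\<lambda>x. f' x b))"
  using assms(2)
proof induction
  case (Re f)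
  show ?case
  proof (intro exI[of _ "\<lambda>x b. Re (deriv f x * b)"] conjI ballI allI)
    fix x assume "x \<in> U"
    then have "(f has_field_derivative deriv f x) (at x)" using Re U holomorphic_derivI by blast
    then have "(f has_derivative (\<lambda>b. deriv f x * b)) (at x)" by (simp add: has_field_derivative_def)
    then show "((\<lambda>z. Re (f z)) has_derivative (\<lambda>b. Re (deriv f x * b))) (at x)"
      by (rule has_derivative_Re)
  next
    fix b show "smooth_expr U (\<lambda>x. Re (deriv f x * b))"
      using Re U by (intro smooth_expr.Re holomorphic_intros) auto
  qed
next
  case (add f g)
  then obtain f' g' where "\<forall>x\<in>U. (f has_derivative f' x) (at x)" "\<forall>b. smooth_expr U (\<lambda>x. f' x b)"
    "\<forall>x\<in>U. (g has_derivative g' x) (at x)" "\<forall>b. smooth_expr U (\<lambda>x. g' x b)" by blast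
  then show ?case
    by (intro exI[of _ "\<lambda>x b. f' x b + g' x b"]) (auto intro!: has_derivative_add smooth_expr.add)
next
  case (mult f g)
  then obtain f' g' where "\<forall>x\<in>U. (f has_derivative f' x) (at x)" "\<forall>b. smooth_expr U (\<lambda>x. f' x b)"
    "\<forall>x\<in>U. (g has_derivative g' x) (at x)" "\<forall>b. smooth_expr U (\<lambda>x. g' x b)" by blast
  then show ?case using mult
    by (intro exI[of _ "\<lambda>x b. f x * g' x b + f' x b * g x"])
      (auto intro!: has_derivative_mult smooth_expr.add smooth_expr.mult)
next
  case (flat f n)
  then obtain f' where "\<forall>x\<in>U. (f has_derivative f' x) (at x)" "\<forall>b. smooth_expr U (\<lambda>x. f' x b)" by blast
  then show ?case using flat
    by (intro exI[of _ "\<lambda>x b. flat (Suc n) (f x) * f' x b"])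
      (auto intro!: has_derivative_real_compose[OF flat_deriv] smooth_expr.mult smooth_expr.flat)
next
  case (ramp f)
  then obtain f' where "\<forall>x\<in>U. (f has_derivative f' x) (at x)" "\<forall>b. smooth_expr U (\<lambda>x. f' x b)" by blast
  then show ?case using ramp
    by (intro exI[of _ "\<lambda>x b. ramp' (f x) * f' x b"])
      (auto intro!: has_derivative_real_compose[OF ramp_deriv] smooth_expr.mult smooth_expr.ramp')
next
  case (ramp' f)
  then obtain f' where f': "\<forall>x\<in>U. (f has_derivative f' x) (at x)" "\<forall>b. smooth_expr U (\<lambda>x. f' x b)" by blast
  \<comment> \<open>Here the chain of derivatives closes: \<open>ramp\<close> leads to
    \<open>ramp'\<close>, \<open>ramp'\<close> leads to \<open>bump\<close>, and \<open>bump\<close>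
    is a constant times a product of \<open>flat\<close> functions.\<close>
  have "smooth_expr U (\<lambda>x. bump (f x))"
  proof -
    have "smooth_expr U (\<lambda>x. 1 + (-1) * f x)"
      by (intro smooth_expr.add smooth_expr.mult smooth_expr_const ramp')
    then show ?thesis unfolding bump_def
      by (intro smooth_expr.mult smooth_expr.flat smooth_expr_const ramp') simp
  qed
  then show ?case using f'
    by (intro exI[of _ "\<lambda>x b. bump (f x) * f' x b"])
      (auto intro!: has_derivative_real_compose[OF ramp'_deriv] smooth_expr.mult)
qed

lemma smooth_expr_C_diff_on:
  assumes U: "open U" and "smooth_expr U f"
  shows "C_diff_on k U f"
  using assms(2)
proof (induction k arbitrary: f)
  case 0
  then obtain f' where "\<forall>x\<in>U. (f has_derivative f' x) (at x)" using smooth_expr_derivative[OF U] by blast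
  then show ?case by (auto intro!: continuous_at_imp_continuous_on dest: has_derivative_continuous)
next
  case (Suc k)
  obtain f' where f': "\<forall>x\<in>U. (f has_derivative f' x) (at x)" "\<forall>b. smooth_expr U (\<lambda>x. f' x b)"
    using smooth_expr_derivative[OF U Suc.prems] by blast
  show ?case
    unfolding C_diff_on.simps
  proof (intro conjI ballI)
    fix x assume "x \<in> U" then show "f differentiable at x" unfolding differentiable_def using f' by blast
  next
    fix b
    have "C_diff_on k U (\<lambda>x. f' x b)" using Suc.IH f' by blast
    moreover have "f' x b = frechet_derivative f (at x) b" if "x \<in> U" for x
      using frechet_derivative_at[of f "f' x"] f'(1) that by simp
    ultimately show "C_diff_on k U (\<lambda>x. frechet_derivative f (at x) b)"
      by (rule C_diff_on_cong[OF U, rotated])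
  qed
qed

text \<open>A relational Laplacian with witnesses for the first derivatives near \<open>x\<close>
  and for the second ones at \<open>x\<close>. Sums and local replacements are handled on the
  witnesses, and nested \<open>frechet_derivative\<close> terms occur only in
  \<open>has_lapl_hyp_laplacian\<close>.\<close>

definition has_lapl :: "(complex \<Rightarrow> real) \<Rightarrow> complex \<Rightarrow> real \<Rightarrow> bool" where
  "has_lapl f x v \<longleftrightarrow> (\<exists>U g d. open U \<and> x \<in> U \<and> (\<forall>w\<in>U. (f has_derivative g w) (at w)) \<and>
     (\<forall>b\<in>Basis. ((\<lambda>w. g w b) has_derivative d b) (at x)) \<and> v = (\<Sum>b\<in>Basis. d b b))"

lemma has_lapl_hyp_laplacian:
  assumes "has_lapl f x v" "norm x < 1"
  shows "hyp_laplacian f x = - (1 / lam x) * v"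
proof -
  obtain U g d where U: "open U" "x \<in> U" and g: "\<And>w. w \<in> U \<Longrightarrow> (f has_derivative g w) (at w)"
    and d: "\<And>b. b \<in> Basis \<Longrightarrow> ((\<lambda>w. g w b) has_derivative d b) (at x)" "v = (\<Sum>b\<in>Basis. d b b)"
    using assms(1) unfolding has_lapl_def by blast
  have "frechet_derivative (\<lambda>w. frechet_derivative f (at w) b) (at x) = d b" if "b \<in> Basis" for b
  proof -
    have "((\<lambda>w. frechet_derivative f (at w) b) has_derivative d b) (at x)"
      using d(1)[OF that]
      by (rule has_derivative_transform_within_open[OF _ U]) (simp add: frechet_derivative_at[OF g, symmetric])
    then show ?thesis using frechet_derivative_at[of _ "d b"] by simp
  qed
  then show ?thesis unfolding hyp_laplacian_def d(2) lam_def by simp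
qed

lemma has_lapl_add:
  assumes "has_lapl f x v" "has_lapl h x w"
  shows "has_lapl (\<lambda>z. f z + h z) x (v + w)"
proof -
  obtain U g d where U: "open U" "x \<in> U" and g: "\<And>w. w \<in> U \<Longrightarrow> (f has_derivative g w) (at w)"
    and d: "\<And>b. b \<in> Basis \<Longrightarrow> ((\<lambda>w. g w b) has_derivative d b) (at x)" "v = (\<Sum>b\<in>Basis. d b b)"
    using assms(1) unfolding has_lapl_def by blast
  obtain U' g' d' where U': "open U'" "x \<in> U'" and g': "\<And>w. w \<in> U' \<Longrightarrow> (h has_derivative g' w) (at w)"
    and d': "\<And>b. b \<in> Basis \<Longrightarrow> ((\<lambda>w. g' w b) has_derivative d' b) (at x)" "w = (\<Sum>b\<in>Basis. d' b b)"
    using assms(2) unfolding has_lapl_def by blast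
  show ?thesis unfolding has_lapl_def
    using U U' g g' d d'
    by (intro exI[of _ "U \<inter> U'"] exI[of _ "\<lambda>w b. g w b + g' w b"] exI[of _ "\<lambda>b c. d b c + d' b c"])
      (auto intro!: has_derivative_add simp: sum.distrib)
qed

lemma has_lapl_cmult:
  assumes "has_lapl f x v"
  shows "has_lapl (\<lambda>z. c * f z) x (c * v)"
proof -
  obtain U g d where U: "open U" "x \<in> U" and g: "\<And>w. w \<in> U \<Longrightarrow> (f has_derivative g w) (at w)"
    and d: "\<And>b. b \<in> Basis \<Longrightarrow> ((\<lambda>w. g w b) has_derivative d b) (at x)" "v = (\<Sum>b\<in>Basis. d b b)"
    using assms(1) unfolding has_lapl_def by blast
  show ?thesis unfolding has_lapl_def
    using U g d
    by (intro exI[of _ U] exI[of _ "\<lambda>w b. c * g w b"] exI[of _ "\<lambda>b e. c * d b e"])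
      (auto intro!: has_derivative_mult_right simp: sum_distrib_left)
qed

lemma has_lapl_const: "has_lapl (\<lambda>z. c) x 0"
  unfolding has_lapl_def by (intro exI[of _ UNIV] exI[of _ "\<lambda>w b. 0"] exI[of _ "\<lambda>b e. 0"]) auto

lemma has_lapl_sum:
  assumes "\<And>i. i \<in> I \<Longrightarrow> has_lapl (f i) x (v i)"
  shows "has_lapl (\<lambda>z. \<Sum>i\<in>I. f i z) x (\<Sum>i\<in>I. v i)"
  using assms
proof (induction I rule: infinite_finite_induct)
  case (insert i I)
  then have "has_lapl (\<lambda>z. f i z + (\<Sum>i\<in>I. f i z)) x (v i + (\<Sum>i\<in>I. v i))"
    by (intro has_lapl_add) auto
  then show ?case using insert.hyps by simp
qed (simp_all add: has_lapl_const)

lemma has_lapl_cong: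
  assumes "has_lapl f x v" "open S" "x \<in> S" "\<And>z. z \<in> S \<Longrightarrow> f z = h z"
  shows "has_lapl h x v"
proof -
  obtain U g d where U: "open U" "x \<in> U" and g: "\<And>w. w \<in> U \<Longrightarrow> (f has_derivative g w) (at w)"
    and d: "\<And>b. b \<in> Basis \<Longrightarrow> ((\<lambda>w. g w b) has_derivative d b) (at x)" "v = (\<Sum>b\<in>Basis. d b b)"
    using assms(1) unfolding has_lapl_def by blast
  have "(h has_derivative g w) (at w)" if "w \<in> U \<inter> S" for w
    using g by (rule has_derivative_transform_within_open[OF _ assms(2)]) (use that assms in auto)
  then show ?thesis unfolding has_lapl_def using U d assms(2,3)
    by (intro exI[of _ "U \<inter> S"] exI[of _ g] exI[of _ d]) auto
qed

text \<open>The real part of a holomorphic function is harmonic, so only the second derivative of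
  \<open>ramp\<close> contributes, multiplied by the squared gradient |h'|^2.\<close>

lemma has_lapl_ramp_Re:
  assumes U: "open U" "x \<in> U" and h: "h holomorphic_on U"
  shows "has_lapl (\<lambda>z. ramp (Re (h z))) x (bump (Re (h x)) * (norm (deriv h x))\<^sup>2)"
proof -
  have h1: "(h has_field_derivative deriv h w) (at w)" if "w \<in> U" for w
    using h U that holomorphic_derivI by blast
  have h2: "(deriv h has_field_derivative deriv (deriv h) x) (at x)"
    using h U holomorphic_deriv holomorphic_derivI by blast
  have r1: "((\<lambda>z. Re (h z)) has_derivative (\<lambda>b. Re (deriv h w * b))) (at w)" if "w \<in> U" for w
    using h1[OF that] unfolding has_field_derivative_def by (rule has_derivative_Re)
  have d1: "((\<lambda>z. ramp (Re (h z))) has_derivative (\<lambda>b. ramp' (Re (h w)) * Re (deriv h w * b))) (at w)" if "w \<in> U" for w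
    using has_derivative_real_compose[OF ramp_deriv r1[OF that]] .
  have r2: "((\<lambda>w. Re (deriv h w * b)) has_derivative (\<lambda>e. Re (deriv (deriv h) x * e * b))) (at x)" for b
    using h2 unfolding has_field_derivative_def
    by (intro has_derivative_Re has_derivative_mult_left)
  have d2: "((\<lambda>w. ramp' (Re (h w)) * Re (deriv h w * b)) has_derivative
      (\<lambda>e. ramp' (Re (h x)) * Re (deriv (deriv h) x * e * b) + (bump (Re (h x)) * Re (deriv h x * e)) * Re (deriv h x * b))) (at x)" for b
    using has_derivative_mult[OF has_derivative_real_compose[OF ramp'_deriv r1[OF U(2)]] r2] .
  have "bump (Re (h x)) * (norm (deriv h x))\<^sup>2 = (\<Sum>b\<in>Basis. ramp' (Re (h x)) * Re (deriv (deriv h) x * b * b) + (bump (Re (h x)) * Re (deriv h x * b)) * Re (deriv h x * b))"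
    by (simp add: Basis_complex_def cmod_power2) (simp add: power2_eq_square algebra_simps)
  then show ?thesis unfolding has_lapl_def
    using U d1 d2 by (intro exI[of _ U] exI[of _ "\<lambda>w b. ramp' (Re (h w)) * Re (deriv h w * b)"]
       exI[of _ "\<lambda>b e. ramp' (Re (h x)) * Re (deriv (deriv h) x * e * b) + (bump (Re (h x)) * Re (deriv h x * e)) * Re (deriv h x * b)"]) auto
qed

text \<open>A regularisation of \<open>ln (norm y ^ 2 / \<rho>\<^sup>2)\<close>. Its value at \<open>0\<close> is correct because \<open>ln 0 = 0\<close>.\<close>

definition reg_log :: "real \<Rightarrow> complex \<Rightarrow> real" where
  "reg_log \<rho> y = ramp (ln ((norm y)\<^sup>2 / \<rho>\<^sup>2))"

text \<open>The Euclidean Laplacian of \<open>reg_log \<rho>\<close>: the argument of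
  \<open>ramp\<close> is the real part of h = 2 log y - 2 ln \<rho>, and |h'|^2 = 4 / |y|^2.\<close>

definition lap_kernel :: "real \<Rightarrow> complex \<Rightarrow> real" where
  "lap_kernel \<rho> y = bump (ln ((norm y)\<^sup>2 / \<rho>\<^sup>2)) * (4 / (norm y)\<^sup>2)"

text \<open>Where \<open>f - a\<close> has no zero, \<open>h\<close> is twice a logarithm of it,
  shifted by a constant. Near a zero the argument of \<open>ramp\<close> is nonpositive, the
  regularisation is constant, and the zero function serves as \<open>h\<close>. Both cases thus
  reduce to \<open>has_lapl_ramp_Re\<close>.\<close>

lemma reg_log_local:
  assumes f: "f holomorphic_on disk" and x0: "x0 \<in> disk" and \<rho>: "\<rho> > 0"
  obtains U h where "open U" "x0 \<in> U" "U \<subseteq> disk" "h holomorphic_on U"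
    "\<And>x. x \<in> U \<Longrightarrow> reg_log \<rho> (f x - a) = ramp (Re (h x))"
    "bump (Re (h x0)) * (norm (deriv h x0))\<^sup>2 = (norm (deriv f x0))\<^sup>2 * lap_kernel \<rho> (f x0 - a)"
proof (cases "f x0 = a")
  case True
  have "continuous_on disk f" using f holomorphic_on_imp_continuous_on by blast
  from continuous_open_preimage[OF this open_ball, of "ball a \<rho>"]
  have op: "open {x \<in> disk. f x \<in> ball a \<rho>}" by (simp add: vimage_def Int_def)
  show ?thesis
  proof (rule that[OF op, of "\<lambda>_. 0"])
    show "x0 \<in> {x \<in> disk. f x \<in> ball a \<rho>}" using x0 True \<rho> by simp
    fix x assume "x \<in> {x \<in> disk. f x \<in> ball a \<rho>}"
    then have n: "norm (f x - a) < \<rho>" by (simp add: dist_norm norm_minus_commute)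
    have "ln ((norm (f x - a))\<^sup>2 / \<rho>\<^sup>2) \<le> 0"
    proof (cases "f x = a")
      case False
      then show ?thesis using n \<rho> by (simp add: divide_le_eq_1 power_mono)
    qed simp
    then show "reg_log \<rho> (f x - a) = ramp (Re 0)" using ramp_0 by (simp add: reg_log_def)
  qed (use True in \<open>auto simp: lap_kernel_def bump_zero\<close>)
next
  case False
  have "continuous_on disk f" using f holomorphic_on_imp_continuous_on by blast
  moreover have "open (- {a})" by (simp add: open_Compl)
  ultimately have "open (disk \<inter> f -` (- {a}))" using continuous_open_preimage[OF _ open_ball] by blast
  then have "open {x \<in> disk. f x \<noteq> a}" by (simp add: vimage_def Int_def)
  moreover have "x0 \<in> {x \<in> disk. f x \<noteq> a}" using x0 False by simp
  ultimately obtain r where r: "r > 0" "ball x0 r \<subseteq> {x \<in> disk. f x \<noteq> a}"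
    using open_contains_ball by blast
  have fh: "f holomorphic_on ball x0 r" by (rule holomorphic_on_subset[OF f]) (use r(2) in auto)
  then have "(\<lambda>x. f x - a) holomorphic_on ball x0 r" by (intro holomorphic_intros)
  moreover have "f x - a \<noteq> 0" if "x \<in> ball x0 r" for x using r that by auto
  moreover have "x0 \<in> ball x0 r" using r by simp
  ultimately obtain g where g: "g holomorphic_on ball x0 r" "\<And>x. x \<in> ball x0 r \<Longrightarrow> exp (g x) = f x - a"
    using holomorphic_logarithm_exists[of "ball x0 r" "\<lambda>x. f x - a" x0] by auto
  define h where "h x = 2 * g x - of_real (2 * ln \<rho>)" for x
  have hh: "h holomorphic_on ball x0 r" unfolding h_def by (intro holomorphic_intros g)
  have Reh: "Re (h x) = ln ((norm (f x - a))\<^sup>2 / \<rho>\<^sup>2)" if "x \<in> ball x0 r" for x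
  proof -
    have "norm (f x - a) = exp (Re (g x))" using g(2)[OF that] by (metis norm_exp_eq_Re)
    then show ?thesis using \<rho> by (simp add: h_def ln_div ln_realpow)
  qed
  have xr: "x0 \<in> ball x0 r" using r by simp
  have gd: "(g has_field_derivative deriv g x0) (at x0)" using g(1) xr holomorphic_derivI open_ball by blast
  have fd: "(f has_field_derivative deriv f x0) (at x0)" using fh xr holomorphic_derivI open_ball by blast
  have "((\<lambda>x. exp (g x)) has_field_derivative exp (g x0) * deriv g x0) (at x0)"
    using gd by (auto intro!: derivative_eq_intros)
  then have "((\<lambda>x. f x - a) has_field_derivative exp (g x0) * deriv g x0) (at x0)"
    by (rule has_field_derivative_transform_within_open[of _ _ _ "ball x0 r"]) (use xr g in auto)
  moreover have "((\<lambda>x. f x - a) has_field_derivative deriv f x0) (at x0)"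
    using fd by (auto intro!: derivative_eq_intros)
  ultimately have "(f x0 - a) * deriv g x0 = deriv f x0" using DERIV_unique g(2)[OF xr] by metis
  moreover have "deriv h x0 = 2 * deriv g x0"
    using gd unfolding h_def by (intro DERIV_imp_deriv) (auto intro!: derivative_eq_intros)
  ultimately have dh: "deriv h x0 = 2 * deriv f x0 / (f x0 - a)"
    using False by (metis nonzero_mult_div_cancel_left right_minus_eq times_divide_eq_right)
  show ?thesis
  proof (rule that[OF open_ball xr _ hh])
    show "ball x0 r \<subseteq> disk" using r by auto
    show "reg_log \<rho> (f x - a) = ramp (Re (h x))" if "x \<in> ball x0 r" for x
      using Reh[OF that] by (simp add: reg_log_def)
    show "bump (Re (h x0)) * (norm (deriv h x0))\<^sup>2 = (norm (deriv f x0))\<^sup>2 * lap_kernel \<rho> (f x0 - a)"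
      unfolding Reh[OF xr] dh lap_kernel_def by (simp add: norm_divide norm_mult power_divide power_mult_distrib)
  qed
qed

lemma reg_log_C_diff_on:
  assumes "f holomorphic_on disk" "\<rho> > 0"
  shows "C_diff_on k disk (\<lambda>x. reg_log \<rho> (f x - a))"
proof (rule C_diff_on_local)
  fix x0 assume x0: "x0 \<in> disk"
  obtain U h where U: "open U" "x0 \<in> U" "h holomorphic_on U" "\<And>x. x \<in> U \<Longrightarrow> reg_log \<rho> (f x - a) = ramp (Re (h x))"
    by (rule reg_log_local[OF assms(1) x0 assms(2), of a], rule that)
  have "C_diff_on k U (\<lambda>x. ramp (Re (h x)))"
    using U by (intro smooth_expr_C_diff_on smooth_expr.intros)
  then have "C_diff_on k U (\<lambda>x. reg_log \<rho> (f x - a))"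
    by (rule C_diff_on_cong[OF U(1), rotated]) (simp add: U(4))
  then show "\<exists>U. open U \<and> x0 \<in> U \<and> C_diff_on k U (\<lambda>x. reg_log \<rho> (f x - a))" using U by blast
qed

lemma reg_log_has_lapl:
  assumes "f holomorphic_on disk" "\<rho> > 0" "x0 \<in> disk"
  shows "has_lapl (\<lambda>x. reg_log \<rho> (f x - a)) x0 ((norm (deriv f x0))\<^sup>2 * lap_kernel \<rho> (f x0 - a))"
proof -
  obtain U h where U: "open U" "x0 \<in> U" "h holomorphic_on U" "\<And>x. x \<in> U \<Longrightarrow> reg_log \<rho> (f x - a) = ramp (Re (h x))"
    "bump (Re (h x0)) * (norm (deriv h x0))\<^sup>2 = (norm (deriv f x0))\<^sup>2 * lap_kernel \<rho> (f x0 - a)"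
    by (rule reg_log_local[OF assms(1,3,2), of a], rule that)
  show ?thesis
    using has_lapl_cong[OF has_lapl_ramp_Re[OF U(1-3)] U(1,2), of "\<lambda>x. reg_log \<rho> (f x - a)"] U(4,5) by simp
qed

section \<open>The annular averaging kernel\<close>

text \<open>The bump is nonzero only if |y|^2 / \<rho>^2 lies strictly between 1 and e; the factor 2
  comes from e < 4.\<close>

lemma lap_kernel_support:
  assumes "\<rho> > 0" "lap_kernel \<rho> y \<noteq> 0"
  shows "\<rho> < norm y" "norm y < 2 * \<rho>"
proof -
  have b: "\<not> (ln ((norm y)\<^sup>2 / \<rho>\<^sup>2) \<le> 0 \<or> ln ((norm y)\<^sup>2 / \<rho>\<^sup>2) \<ge> 1)"
    using assms(2) bump_zero unfolding lap_kernel_def by auto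
  have y: "y \<noteq> 0" using assms(2) by (auto simp: lap_kernel_def)
  then have p: "(norm y)\<^sup>2 / \<rho>\<^sup>2 > 0" using assms(1) by simp
  have "1 < (norm y)\<^sup>2 / \<rho>\<^sup>2" using b p ln_le_zero_iff by force
  then have "\<rho>\<^sup>2 < (norm y)\<^sup>2" using assms(1) by (simp add: less_divide_eq)
  then show "\<rho> < norm y" by (simp add: power2_less_imp_less)
  have "(norm y)\<^sup>2 / \<rho>\<^sup>2 < exp 1" using b p by (metis exp_less_cancel_iff exp_ln linorder_not_less)
  also have "exp 1 < (4::real)" using exp_le by simp
  finally have "(norm y)\<^sup>2 < (2 * \<rho>)\<^sup>2" using assms(1) by (simp add: divide_less_eq power_mult_distrib)
  then show "norm y < 2 * \<rho>" by (rule power2_less_imp_less) (use assms(1) in simp)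
qed

lemma lap_kernel_nonneg: "lap_kernel \<rho> y \<ge> 0"
  by (simp add: lap_kernel_def bump_nonneg)

text \<open>The factor 6/5 keeps the logarithm at most 36/25 - 1 < 1, inside the interval where the
  bump is positive. This strict positivity drives the maximum principle.\<close>

lemma lap_kernel_pos:
  assumes "\<rho> > 0" "\<rho> < norm y" "norm y \<le> 6/5 * \<rho>"
  shows "lap_kernel \<rho> y > 0"
proof -
  have "norm y > 0" using assms by linarith
  have 1: "(norm y)\<^sup>2 / \<rho>\<^sup>2 > 1" using assms by (simp add: less_divide_eq power_strict_mono)
  have "(norm y)\<^sup>2 \<le> (6/5 * \<rho>)\<^sup>2" using assms by (intro power_mono) auto
  then have "(norm y)\<^sup>2 / \<rho>\<^sup>2 \<le> 36/25" using assms by (simp add: divide_le_eq power_mult_distrib power2_eq_square)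
  moreover have "ln ((norm y)\<^sup>2 / \<rho>\<^sup>2) \<le> (norm y)\<^sup>2 / \<rho>\<^sup>2 - 1" using 1 by (intro ln_le_minus_one) auto
  ultimately have "ln ((norm y)\<^sup>2 / \<rho>\<^sup>2) < 1" by linarith
  moreover have "ln ((norm y)\<^sup>2 / \<rho>\<^sup>2) > 0" using 1 by simp
  ultimately show ?thesis unfolding lap_kernel_def using bump_pos \<open>norm y > 0\<close> by simp
qed

lemma lap_kernel_continuous:
  assumes "\<rho> > 0" shows "continuous_on UNIV (lap_kernel \<rho>)"
proof (rule continuous_at_imp_continuous_on, rule ballI)
  fix y :: complex
  show "isCont (lap_kernel \<rho>) y"
  proof (cases "y = 0")
    case True
    have "\<forall>\<^sub>F x in nhds y. lap_kernel \<rho> x = 0"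
    proof (rule eventually_nhds[THEN iffD2], intro exI conjI ballI)
      show "open (ball (0::complex) \<rho>)" "y \<in> ball 0 \<rho>" using True assms by auto
      show "lap_kernel \<rho> x = 0" if "x \<in> ball 0 \<rho>" for x
        using lap_kernel_support(1)[OF assms, of x] that by force
    qed
    then show ?thesis using isCont_cong[of "lap_kernel \<rho>" "\<lambda>_. 0" y] by simp
  next
    case False
    have b: "isCont bump x" for x using continuous_bump by (simp add: continuous_on_eq_continuous_at)
    have "isCont (\<lambda>y. ln ((norm y)\<^sup>2 / \<rho>\<^sup>2)) y"
      using False assms by (intro continuous_intros) auto
    then have "isCont (\<lambda>y. bump (ln ((norm y)\<^sup>2 / \<rho>\<^sup>2))) y"
      by (rule isCont_o2) (rule b)
    then show ?thesis unfolding lap_kernel_def using False by (intro continuous_intros) auto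
  qed
qed

lemma lap_kernel_measurable: "\<rho> > 0 \<Longrightarrow> lap_kernel \<rho> \<in> borel_measurable borel"
  using lap_kernel_continuous by (rule borel_measurable_continuous_onI)

lemma lap_kernel_bounded:
  assumes "\<rho> > 0" obtains B where "B > 0" "\<And>y. \<bar>lap_kernel \<rho> y\<bar> \<le> B"
proof -
  have "compact (lap_kernel \<rho> ` cball 0 (2 * \<rho>))"
    using lap_kernel_continuous[OF assms] by (intro compact_continuous_image) (auto intro: continuous_on_subset)
  then obtain B where B: "B > 0" "\<And>z. z \<in> lap_kernel \<rho> ` cball 0 (2 * \<rho>) \<Longrightarrow> norm z \<le> B"
    using compact_imp_bounded bounded_pos by metis
  show ?thesis
  proof (rule that[OF B(1)])
    fix y
    show "\<bar>lap_kernel \<rho> y\<bar> \<le> B"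
    proof (cases "lap_kernel \<rho> y = 0")
      case False
      then have "y \<in> cball 0 (2 * \<rho>)" using lap_kernel_support[OF assms, of y] by simp
      then show ?thesis using B(2) by force
    qed (use B in simp)
  qed
qed

text \<open>In the variable q = |y|^2 the density is the constant pi, and the integrand is the
  derivative of 4 ramp' (ln (q / \<rho>^2)), which increases by 4. The mass does not depend on
  \<rho>, so averages at different radii are comparable.\<close>

lemma lap_kernel_integral:
  assumes "\<rho> > 0"
  shows "integrable lborel (lap_kernel \<rho>)" "(\<integral>y. lap_kernel \<rho> y \<partial>lborel) = 4 * pi"
proof -
  define g where "g q = bump (ln (q / \<rho>\<^sup>2)) * (4 / q)" for q
  define c where "c = exp 1 * \<rho>\<^sup>2"
  have r2: "\<rho>\<^sup>2 > 0" using assms by simp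
  have "1 * \<rho>\<^sup>2 \<le> exp 1 * \<rho>\<^sup>2" by (intro mult_right_mono) auto
  then have cr: "\<rho>\<^sup>2 \<le> c" by (simp add: c_def)
  have cont: "isCont g q" if "q > 0" for q
  proof -
    have b: "isCont bump x" for x using continuous_bump by (simp add: continuous_on_eq_continuous_at)
    have "isCont (\<lambda>q. ln (q / \<rho>\<^sup>2)) q" using that assms by (intro continuous_intros) auto
    then have "isCont (\<lambda>q. bump (ln (q / \<rho>\<^sup>2))) q" by (rule isCont_o2) (rule b)
    then show ?thesis unfolding g_def using that by (intro continuous_intros) auto
  qed
  have der: "((\<lambda>q. 4 * ramp' (ln (q / \<rho>\<^sup>2))) has_real_derivative g q) (at q)" if "q > 0" for q
  proof -
    have "((\<lambda>q. ln (q / \<rho>\<^sup>2)) has_real_derivative 1 / q) (at q)"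
      using that assms by (auto intro!: derivative_eq_intros simp: field_simps)
    from DERIV_cmult[OF DERIV_chain2[OF ramp'_deriv this], of 4] show ?thesis by (simp add: g_def mult_ac)
  qed
  have gz: "g q = 0" if "q \<notin> {\<rho>\<^sup>2..c}" "q \<ge> 0" for q
  proof (cases "q = 0")
    case False
    then have "q > 0" using that by simp
    have "ln (q / \<rho>\<^sup>2) \<le> 0 \<or> ln (q / \<rho>\<^sup>2) \<ge> 1"
    proof (cases "q < \<rho>\<^sup>2")
      case True then show ?thesis using \<open>q > 0\<close> assms by simp
    next
      case False
      then have "exp 1 < q / \<rho>\<^sup>2" using that r2 by (simp add: c_def less_divide_eq)
      then have "1 < ln (q / \<rho>\<^sup>2)" by (metis exp_gt_zero less_trans ln_exp ln_less_cancel_iff)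
      then show ?thesis by simp
    qed
    then show ?thesis using bump_zero by (simp add: g_def)
  qed (simp add: g_def)
  have gi: "indicator {0..} q *\<^sub>R g q = g q * indicator {\<rho>\<^sup>2..c} q" for q
  proof (cases "q \<in> {\<rho>\<^sup>2..c}")
    case True
    then have "0 \<le> q" using r2 by (meson atLeastAtMost_iff less_imp_le order_trans)
    then show ?thesis using True by simp
  next
    case False
    then show ?thesis using gz[of q] by (cases "0 \<le> q") auto
  qed
  have FTC: "has_bochner_integral lborel (\<lambda>q. g q * indicator {\<rho>\<^sup>2..c} q) (4 * ramp' (ln (c / \<rho>\<^sup>2)) - 4 * ramp' (ln (\<rho>\<^sup>2 / \<rho>\<^sup>2)))"
  proof (rule has_bochner_integral_FTC_Icc_real[OF cr])
    fix q assume "\<rho>\<^sup>2 \<le> q" "q \<le> c"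
    then have "q > 0" using r2 by linarith
    then show "((\<lambda>q. 4 * ramp' (ln (q / \<rho>\<^sup>2))) has_real_derivative g q) (at q)" "isCont g q"
      using der cont by auto
  qed
  have "(\<lambda>q. bump (ln (q / \<rho>\<^sup>2)) * (4 / q)) \<in> borel_measurable borel"
    using borel_measurable_continuous_onI[OF continuous_bump] by measurable
  then have gm: "g \<in> borel_measurable borel" by (simp add: g_def[abs_def])
  have k: "lap_kernel \<rho> y = g ((norm y)\<^sup>2)" for y by (simp add: lap_kernel_def g_def)
  have "set_integrable lborel {0..} g" unfolding set_integrable_def gi
    using FTC by (rule integrable.intros)
  then show "integrable lborel (lap_kernel \<rho>)" using integral_radial(2)[OF gm] unfolding k[abs_def] by blast
  have "(LINT x:{0..}|lborel. g x) = 4"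
    unfolding set_lebesgue_integral_def gi using has_bochner_integral_integral_eq[OF FTC] r2 ramp'_0[of 0] ramp'_1[of 1]
    by (simp add: c_def)
  then show "(\<integral>y. lap_kernel \<rho> y \<partial>lborel) = 4 * pi"
    using integral_radial(1)[OF gm] unfolding k by simp
qed

lemma reg_log_small: "norm y \<le> \<rho> \<Longrightarrow> \<rho> > 0 \<Longrightarrow> reg_log \<rho> y = 0"
proof -
  assume a: "norm y \<le> \<rho>" "\<rho> > 0"
  have "ln ((norm y)\<^sup>2 / \<rho>\<^sup>2) \<le> 0"
  proof (cases "y = 0")
    case False
    then show ?thesis using a by (simp add: divide_le_eq_1 power_mono)
  qed simp
  then show ?thesis using ramp_0 by (simp add: reg_log_def)
qed

lemma reg_log_large:
  assumes "2 * \<rho> \<le> norm y" "\<rho> > 0"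
  shows "reg_log \<rho> y = ln ((norm y)\<^sup>2 / \<rho>\<^sup>2) - 1 + ramp 1"
proof -
  have "(2 * \<rho>)\<^sup>2 \<le> (norm y)\<^sup>2" using assms by (intro power_mono) auto
  then have "4 \<le> (norm y)\<^sup>2 / \<rho>\<^sup>2" using assms by (simp add: le_divide_eq power_mult_distrib)
  moreover have "exp 1 \<le> (4::real)" using exp_le by simp
  ultimately have "exp 1 \<le> (norm y)\<^sup>2 / \<rho>\<^sup>2" by simp
  then have "1 \<le> ln ((norm y)\<^sup>2 / \<rho>\<^sup>2)" by (metis exp_gt_zero ln_exp ln_le_cancel_iff order_less_le_trans)
  then show ?thesis unfolding reg_log_def by (rule ramp_1)
qed

text \<open>For \<rho>' \<le> \<rho> the added constant makes the two logarithms cancel beyond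
  radius 2 \<rho>, so the function has compact support; its Laplacian is a difference of two
  kernels.\<close>

definition test_fun :: "real \<Rightarrow> real \<Rightarrow> complex \<Rightarrow> real" where
  "test_fun \<rho> \<rho>' y = reg_log \<rho> y + (-1) * reg_log \<rho>' y + ln (\<rho>\<^sup>2 / \<rho>'\<^sup>2)"

lemma test_fun_zero:
  assumes "0 < \<rho>'" "\<rho>' \<le> \<rho>" "2 * \<rho> \<le> norm y"
  shows "test_fun \<rho> \<rho>' y = 0"
proof -
  have y: "norm y > 0" using assms by linarith
  show ?thesis unfolding test_fun_def
    using reg_log_large[of \<rho> y] reg_log_large[of \<rho>' y] assms y by (simp add: ln_div)
qed

text \<open>Beyond \<open>2 * \<rho>'\<close> the value no longer depends on \<rho>'. This allows
  the inner radius to tend to 0 while the outer one stays fixed.\<close>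

lemma test_fun_middle:
  assumes "0 < \<rho>'" "\<rho>' \<le> \<rho>" "2 * \<rho>' \<le> norm y"
  shows "test_fun \<rho> \<rho>' y = reg_log \<rho> y - ln ((norm y)\<^sup>2 / \<rho>\<^sup>2) + 1 - ramp 1"
proof -
  have y: "norm y > 0" using assms by linarith
  show ?thesis unfolding test_fun_def
    using reg_log_large[of \<rho>' y] assms y by (simp add: ln_div)
qed

lemma reg_log_measurable: "reg_log \<rho> \<in> borel_measurable borel"
proof -
  have "(\<lambda>y::complex. ramp (ln ((norm y)\<^sup>2 / \<rho>\<^sup>2))) \<in> borel_measurable borel"
    using borel_measurable_continuous_onI[OF continuous_ramp] by measurable
  then show ?thesis by (simp add: reg_log_def[abs_def])
qed

lemma test_fun_measurable: "test_fun \<rho> \<rho>' \<in> borel_measurable borel"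
  unfolding test_fun_def using reg_log_measurable by measurable

lemma reg_log_continuous:
  assumes "\<rho> > 0" shows "continuous_on UNIV (reg_log \<rho>)"
proof (rule continuous_at_imp_continuous_on, rule ballI)
  fix y :: complex
  show "isCont (reg_log \<rho>) y"
  proof (cases "y = 0")
    case True
    have "\<forall>\<^sub>F x in nhds y. reg_log \<rho> x = 0"
    proof (rule eventually_nhds[THEN iffD2], intro exI conjI ballI)
      show "open (ball (0::complex) \<rho>)" "y \<in> ball 0 \<rho>" using True assms by auto
      show "reg_log \<rho> x = 0" if "x \<in> ball 0 \<rho>" for x
        using reg_log_small[of x \<rho>] that assms by simp
    qed
    then show ?thesis using isCont_cong[of "reg_log \<rho>" "\<lambda>_. 0" y] by simp
  next
    case False
    have b: "isCont ramp x" for x using continuous_ramp by (simp add: continuous_on_eq_continuous_at)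
    have "isCont (\<lambda>y. ln ((norm y)\<^sup>2 / \<rho>\<^sup>2)) y"
      using False assms by (intro continuous_intros) auto
    then show ?thesis unfolding reg_log_def by (rule isCont_o2) (rule b)
  qed
qed

lemma test_fun_bounded:
  assumes "0 < \<rho>'" "\<rho>' \<le> \<rho>" obtains B where "B > 0" "\<And>y. \<bar>test_fun \<rho> \<rho>' y\<bar> \<le> B"
proof -
  have c: "continuous_on UNIV (test_fun \<rho> \<rho>')"
    unfolding test_fun_def using reg_log_continuous assms by (intro continuous_intros) auto
  have "compact (test_fun \<rho> \<rho>' ` cball 0 (2 * \<rho>))"
    using c by (intro compact_continuous_image) (auto intro: continuous_on_subset)
  then obtain B where B: "B > 0" "\<And>z. z \<in> test_fun \<rho> \<rho>' ` cball 0 (2 * \<rho>) \<Longrightarrow> norm z \<le> B"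
    using compact_imp_bounded bounded_pos by metis
  show ?thesis
  proof (rule that[OF B(1)])
    fix y
    show "\<bar>test_fun \<rho> \<rho>' y\<bar> \<le> B"
    proof (cases "norm y \<le> 2 * \<rho>")
      case True
      then have "y \<in> cball 0 (2 * \<rho>)" by simp
      then show ?thesis using B(2) by force
    qed (use B test_fun_zero[OF assms, of y] in simp)
  qed
qed

section \<open>Averages of the Green function\<close>

lemma test_fun_C_diff_on:
  assumes "h holomorphic_on disk" "\<rho> > 0" "\<rho>' > 0"
  shows "C_diff_on k disk (\<lambda>x. test_fun \<rho> \<rho>' (h x - a))"
proof -
  have neg: "C_diff_on k S (\<lambda>x. (-1) * f x)" if "open S" "C_diff_on k S f" for S :: "complex set" and f k
    using that(2)
  proof (induction k arbitrary: f)
    case 0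
    then show ?case by (auto intro: continuous_intros)
  next
    case (Suc k)
    have d: "((\<lambda>x. (-1) * f x) has_derivative (\<lambda>h. (-1) * frechet_derivative f (at x) h)) (at x)" if "x \<in> S" for x
      using Suc.prems that by (intro has_derivative_mult_right) (auto simp: frechet_derivative_works[symmetric])
    show ?case
      unfolding C_diff_on.simps
    proof (intro conjI ballI)
      fix x assume "x \<in> S" then show "(\<lambda>x. (-1) * f x) differentiable at x"
        unfolding differentiable_def using d by blast
    next
      fix b :: complex assume b: "b \<in> Basis"
      have "C_diff_on k S (\<lambda>x. (-1) * frechet_derivative f (at x) b)"
        using Suc b by auto
      moreover have "(-1) * frechet_derivative f (at x) b = frechet_derivative (\<lambda>x. (-1) * f x) (at x) b"
        if "x \<in> S" for x
        using frechet_derivative_at[OF d[OF that], symmetric] by simp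
      ultimately show "C_diff_on k S (\<lambda>x. frechet_derivative (\<lambda>x. (-1) * f x) (at x) b)"
        by (rule C_diff_on_cong[OF \<open>open S\<close>, rotated])
    qed
  qed
  show ?thesis unfolding test_fun_def
    by (intro C_diff_on_add C_diff_on_const neg reg_log_C_diff_on assms open_ball)
qed

lemma test_fun_has_lapl:
  assumes "h holomorphic_on disk" "\<rho> > 0" "\<rho>' > 0" "x \<in> disk"
  shows "has_lapl (\<lambda>x. test_fun \<rho> \<rho>' (h x - a)) x
    ((norm (deriv h x))\<^sup>2 * (lap_kernel \<rho> (h x - a) - lap_kernel \<rho>' (h x - a)))"
proof -
  have "has_lapl (\<lambda>x. test_fun \<rho> \<rho>' (h x - a)) x
     ((norm (deriv h x))\<^sup>2 * lap_kernel \<rho> (h x - a) + (-1) * ((norm (deriv h x))\<^sup>2 * lap_kernel \<rho>' (h x - a)) + 0)"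
    unfolding test_fun_def
    by (intro has_lapl_add has_lapl_cmult has_lapl_const reg_log_has_lapl assms)
  then show ?thesis by (simp add: algebra_simps)
qed

text \<open>The finite set of group elements is chosen before \<open>u\<close>, so the same finite
  sums represent a test function and its Laplacian on a common neighbourhood.\<close>

lemma (in free_fuchsian) orbit_sum_local:
  assumes "compact K" "K \<subseteq> disk" "x0 \<in> disk"
  shows "\<exists>U \<Gamma>. open U \<and> x0 \<in> U \<and> U \<subseteq> disk \<and> finite \<Gamma> \<and> \<Gamma> \<subseteq> F \<and>
    (\<forall>u. (\<forall>y\<in>disk. y \<notin> K \<longrightarrow> u y = 0) \<longrightarrow> (\<forall>x\<in>U. orbit_sum K u (proj F x) = (\<Sum>\<gamma>\<in>\<Gamma>. u (\<gamma> x))))"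
proof -
  obtain r where r: "r > 0" "cball x0 r \<subseteq> disk" using cball_subset_disk[OF assms(3)] by blast
  define \<Gamma> where "\<Gamma> = {\<gamma> \<in> F. \<exists>x\<in>cball x0 r. \<gamma> x \<in> K}"
  have "finite \<Gamma>" unfolding \<Gamma>_def using r assms by (intro finite_return) auto
  have "orbit_sum K u (proj F x) = (\<Sum>\<gamma>\<in>\<Gamma>. u (\<gamma> x))"
    if u: "\<forall>y\<in>disk. y \<notin> K \<longrightarrow> u y = 0" and x: "x \<in> ball x0 r" for u x
  proof (rule orbit_sum_eq[OF _ \<open>finite \<Gamma>\<close>])
    have xr: "x \<in> cball x0 r" using x by simp
    show "x \<in> disk" using r xr by blast
    show "\<gamma> \<in> \<Gamma>" if "\<gamma> \<in> F" "\<gamma> x \<in> K" for \<gamma> using that xr by (auto simp: \<Gamma>_def simp del: mem_cball)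
  qed (use u in \<open>auto simp: \<Gamma>_def\<close>)
  moreover have "ball x0 r \<subseteq> disk" using r(2) ball_subset_cball by blast
  moreover have "\<Gamma> \<subseteq> F" by (auto simp: \<Gamma>_def)
  ultimately show ?thesis using r(1) \<open>finite \<Gamma>\<close>
    by (intro exI[of _ "ball x0 r"] exI[of _ \<Gamma>]) auto
qed

locale vortex_surface = compact_fuchsian +
  fixes G :: "complex set \<Rightarrow> complex set \<Rightarrow> real"
  assumes green: "green_function F G"
begin

lemma G_smooth: "smooth_on {(z, w). z \<in> disk \<and> w \<in> disk \<and> proj F z \<noteq> proj F w} (\<lambda>(z, w). G (proj F z) (proj F w))"
  and G_integrable: "r \<in> surface F \<Longrightarrow> integrable (area F) (\<lambda>s. G s r)"
  and G_weak: "r \<in> surface F \<Longrightarrow> surface_smooth F \<phi> \<Longrightarrow>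
        (\<integral>s. G s r * laplacian F \<phi> s \<partial>area F) = \<phi> r - (\<integral>s. \<phi> s \<partial>area F) / total_area F"
  and G_sym: "s \<in> surface F \<Longrightarrow> r \<in> surface F \<Longrightarrow> G s r = G r s"
  using green unfolding green_function_def by blast+

lemma moebius_compose_F:
  assumes "f \<in> moebius_preserving" "\<gamma> \<in> F"
  obtains h where "h \<in> moebius_preserving" "\<And>z. z \<in> disk \<Longrightarrow> h z = f (\<gamma> z)"
  using moebius_preserving_compose[OF assms(1) F_moebius[OF assms(2)]] by blast

text \<open>The weak equation is tested with the Poincare series of \<open>test_fun\<close> in the
  chart \<open>f\<close>. Its Laplacian is the series of the kernel difference divided by
  \<open>lam\<close>; unfolding brings the integral to the disk, and substituting \<open>g\<close>
  cancels the factor \<open>lam\<close> and leaves a Euclidean average.\<close>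

lemma averaging_identity:
  assumes f: "f \<in> moebius_preserving" and g: "g \<in> moebius_preserving"
    and fg: "\<And>z. z \<in> disk \<Longrightarrow> f (g z) = z" and gf: "\<And>z. z \<in> disk \<Longrightarrow> g (f z) = z"
    and \<rho>: "0 < \<rho>'" "\<rho>' \<le> \<rho>" and a: "cball a (2 * \<rho>) \<subseteq> disk"
    and r: "r \<in> surface F"
  shows "set_integrable lborel disk (\<lambda>y. G (proj F (g y)) r * (lap_kernel \<rho>' (y - a) - lap_kernel \<rho> (y - a)))" (is ?A)
    and "(LINT y:disk|lborel. G (proj F (g y)) r * (lap_kernel \<rho>' (y - a) - lap_kernel \<rho> (y - a))) =
      orbit_sum (g ` cball a (2 * \<rho>)) (\<lambda>x. test_fun \<rho> \<rho>' (f x - a)) r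
        - (LINT y:disk|lborel. lam y * test_fun \<rho> \<rho>' (y - a)) / total_area F" (is ?B)
proof -
  have \<rho>0: "\<rho> > 0" using \<rho> by linarith
  define K where "K = g ` cball a (2 * \<rho>)"
  have fd: "f z \<in> disk" if "z \<in> disk" for z using moebius_preserving_in_disk[OF f that] .
  have gd: "g z \<in> disk" if "z \<in> disk" for z using moebius_preserving_in_disk[OF g that] .
  have fh: "f holomorphic_on disk" using moebius_preserving_holomorphic[OF f] .
  have "continuous_on disk g" using moebius_preserving_holomorphic[OF g] holomorphic_on_imp_continuous_on by blast
  then have K: "compact K" "K \<subseteq> disk"
    unfolding K_def using a gd by (auto intro!: compact_continuous_image intro: continuous_on_subset)
  have inK: "x \<in> K \<longleftrightarrow> f x \<in> cball a (2 * \<rho>)" if "x \<in> disk" for x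
  proof
    assume "x \<in> K"
    then obtain y where "y \<in> cball a (2 * \<rho>)" "x = g y" by (auto simp: K_def)
    then show "f x \<in> cball a (2 * \<rho>)" using fg[of y] a by auto
  next
    assume "f x \<in> cball a (2 * \<rho>)"
    then have "g (f x) \<in> K" by (auto simp: K_def)
    then show "x \<in> K" using gf[OF that] by simp
  qed
  obtain c0 w0 where cw: "norm c0 = 1" "norm w0 < 1" "f = restrict (moeb c0 w0) disk"
    using f unfolding moebius_preserving_iff by blast
  \<comment> \<open>Agrees with \<open>f\<close> on the disk but is given by a formula on the whole
    plane, where measurability is immediate.\<close>
  define f1 where "f1 = moeb c0 w0"
  have f1: "f1 x = f x" if "x \<in> disk" for x using that by (simp add: f1_def cw(3))
  define u where "u x = indicator disk x * test_fun \<rho> \<rho>' (f1 x - a)" for x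
  define k where "k y = lap_kernel \<rho>' (y - a) - lap_kernel \<rho> (y - a)" for y
  \<comment> \<open>The positive hyperbolic Laplacian of the test function in the chart: |f'(x)|^2
    divided by \<open>lam x\<close> is the reciprocal of \<open>lam (f x)\<close>, and the sign in
    \<open>hyp_laplacian\<close> exchanges the two kernels.\<close>
  define q where "q x = (if x \<in> disk then k (f1 x) / lam (f1 x) else 0)" for x
  have out: "2 * \<rho> \<le> norm (f x - a)" if "x \<in> disk" "x \<notin> K" for x
    using inK[OF that(1)] that(2) by (auto simp: dist_norm norm_minus_commute)
  have uK: "u x = 0" if "x \<in> disk" "x \<notin> K" for x
    using test_fun_zero[OF \<rho> out[OF that]] f1[OF that(1)] by (simp add: u_def)
  have kz: "k y = 0" if "2 * \<rho> \<le> norm (y - a)" for y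
  proof -
    have "lap_kernel \<rho> (y - a) = 0"
      using lap_kernel_support(2)[OF \<rho>0, of "y - a"] that by linarith
    moreover have "lap_kernel \<rho>' (y - a) = 0"
      using lap_kernel_support(2)[OF \<rho>(1), of "y - a"] that \<rho> by linarith
    ultimately show ?thesis by (simp add: k_def)
  qed
  have qK: "q x = 0" if "x \<in> disk" "x \<notin> K" for x
    using kz[OF out[OF that]] f1[OF that(1)] by (simp add: q_def)
  define \<phi> where "\<phi> = orbit_sum K u"
  have phi_eq: "orbit_sum K (\<lambda>x. test_fun \<rho> \<rho>' (f x - a)) s = \<phi> s" for s
    unfolding \<phi>_def orbit_sum_def using K(2) f1 by (intro sum.cong) (auto simp: u_def)
  have loc: "\<exists>U \<Gamma>. open U \<and> x0 \<in> U \<and> U \<subseteq> disk \<and> finite \<Gamma> \<and> \<Gamma> \<subseteq> F \<and>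
      (\<forall>x\<in>U. \<phi> (proj F x) = (\<Sum>\<gamma>\<in>\<Gamma>. test_fun \<rho> \<rho>' (f (\<gamma> x) - a))) \<and>
      (\<forall>x\<in>U. orbit_sum K q (proj F x) = (\<Sum>\<gamma>\<in>\<Gamma>. q (\<gamma> x)))" if x0: "x0 \<in> disk" for x0
  proof -
    obtain U \<Gamma> where U: "open U" "x0 \<in> U" "U \<subseteq> disk" "finite \<Gamma>" "\<Gamma> \<subseteq> F"
      "\<forall>u. (\<forall>y\<in>disk. y \<notin> K \<longrightarrow> u y = 0) \<longrightarrow> (\<forall>x\<in>U. orbit_sum K u (proj F x) = (\<Sum>\<gamma>\<in>\<Gamma>. u (\<gamma> x)))"
      using orbit_sum_local[OF K x0] by blast
    have "\<phi> (proj F x) = (\<Sum>\<gamma>\<in>\<Gamma>. test_fun \<rho> \<rho>' (f (\<gamma> x) - a))" if x: "x \<in> U" for x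
    proof -
      have "\<phi> (proj F x) = (\<Sum>\<gamma>\<in>\<Gamma>. u (\<gamma> x))" unfolding \<phi>_def using U(6) uK x by blast
      also have "\<dots> = (\<Sum>\<gamma>\<in>\<Gamma>. test_fun \<rho> \<rho>' (f (\<gamma> x) - a))"
      proof (rule sum.cong[OF refl])
        fix \<gamma> assume "\<gamma> \<in> \<Gamma>"
        then have "\<gamma> x \<in> disk" using U(3,5) x by (meson F_in_disk subsetD)
        then show "u (\<gamma> x) = test_fun \<rho> \<rho>' (f (\<gamma> x) - a)" using f1 by (simp add: u_def)
      qed
      finally show ?thesis .
    qed
    moreover have "orbit_sum K q (proj F x) = (\<Sum>\<gamma>\<in>\<Gamma>. q (\<gamma> x))" if x: "x \<in> U" for x
      using U(6) qK x by blast
    ultimately show ?thesis using U(1-5) by blast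
  qed
  have smooth: "surface_smooth F \<phi>"
    unfolding surface_smooth_def smooth_on_def
  proof (rule allI, rule C_diff_on_local)
    fix n x0 assume x0: "x0 \<in> disk"
    obtain U \<Gamma> where U: "open U" "x0 \<in> U" "U \<subseteq> disk" "finite \<Gamma>" "\<Gamma> \<subseteq> F"
      "\<forall>x\<in>U. \<phi> (proj F x) = (\<Sum>\<gamma>\<in>\<Gamma>. test_fun \<rho> \<rho>' (f (\<gamma> x) - a))"
      using loc[OF x0] by blast
    have "C_diff_on n U (\<lambda>x. \<Sum>\<gamma>\<in>\<Gamma>. test_fun \<rho> \<rho>' (f (\<gamma> x) - a))"
    proof (rule C_diff_on_sum[OF U(1)])
      fix \<gamma> assume "\<gamma> \<in> \<Gamma>"
      then have "\<gamma> \<in> F" using U by blast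
      then obtain h where h: "h \<in> moebius_preserving" "\<And>z. z \<in> disk \<Longrightarrow> h z = f (\<gamma> z)"
        using moebius_compose_F[OF f] by blast
      have "C_diff_on n disk (\<lambda>x. test_fun \<rho> \<rho>' (h x - a))"
        using \<rho>0 \<rho> moebius_preserving_holomorphic[OF h(1)] by (intro test_fun_C_diff_on) auto
      then have "C_diff_on n disk (\<lambda>x. test_fun \<rho> \<rho>' (f (\<gamma> x) - a))"
        by (rule C_diff_on_cong[OF open_ball, rotated]) (simp add: h)
      then show "C_diff_on n U (\<lambda>x. test_fun \<rho> \<rho>' (f (\<gamma> x) - a))" using U(3) by (rule C_diff_on_subset)
    qed
    then have "C_diff_on n U (\<lambda>z. \<phi> (proj F z))"
      by (rule C_diff_on_cong[OF U(1), rotated]) (use U(6) in auto)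
    then show "\<exists>U. open U \<and> x0 \<in> U \<and> C_diff_on n U (\<lambda>z. \<phi> (proj F z))" using U by blast
  qed
  have lap: "laplacian F \<phi> (proj F x) = orbit_sum K q (proj F x)" if x: "x \<in> disk" for x
  proof -
    \<comment> \<open>\<open>laplacian\<close> evaluates at some chosen lift. The local
      representation around that lift expresses the result as an orbit sum, which depends on the
      orbit only.\<close>
    define z where "z = (SOME z. z \<in> proj F x)"
    have "z \<in> proj F x" unfolding z_def using self_in_proj[OF x] by (rule someI)
    then have z: "z \<in> disk" "proj F z = proj F x" using in_proj_iff[OF x] by auto
    obtain U \<Gamma> where U: "open U" "z \<in> U" "U \<subseteq> disk" "finite \<Gamma>" "\<Gamma> \<subseteq> F"
      "\<forall>x\<in>U. \<phi> (proj F x) = (\<Sum>\<gamma>\<in>\<Gamma>. test_fun \<rho> \<rho>' (f (\<gamma> x) - a))"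
      "\<forall>x\<in>U. orbit_sum K q (proj F x) = (\<Sum>\<gamma>\<in>\<Gamma>. q (\<gamma> x))"
      using loc[OF z(1)] by blast
    have "has_lapl (\<lambda>x. \<Sum>\<gamma>\<in>\<Gamma>. test_fun \<rho> \<rho>' (f (\<gamma> x) - a)) z (\<Sum>\<gamma>\<in>\<Gamma>. - lam z * q (\<gamma> z))"
    proof (rule has_lapl_sum)
      fix \<gamma> assume "\<gamma> \<in> \<Gamma>"
      then have \<gamma>: "\<gamma> \<in> F" using U by blast
      then obtain h where h: "h \<in> moebius_preserving" "\<And>z. z \<in> disk \<Longrightarrow> h z = f (\<gamma> z)"
        using moebius_compose_F[OF f] by blast
      have hh: "h holomorphic_on disk" by (rule moebius_preserving_holomorphic[OF h(1)])
      have hz: "h z \<in> disk" using h moebius_preserving_in_disk z by blast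
      have 1: "has_lapl (\<lambda>x. test_fun \<rho> \<rho>' (h x - a)) z ((norm (deriv h z))\<^sup>2 * (lap_kernel \<rho> (h z - a) - lap_kernel \<rho>' (h z - a)))"
        by (rule test_fun_has_lapl[OF hh \<rho>0 \<rho>(1) z(1)])
      have "(norm (deriv h z))\<^sup>2 * lam (h z) = lam z"
        using moebius_deriv_norm(2)[OF h(1) z(1)] holomorphic_derivI[OF hh open_ball z(1)] by blast
      then have e1: "(norm (deriv h z))\<^sup>2 = lam z / lam (h z)" using lam_pos[of "h z"] hz by (simp add: field_simps)
      have e2: "q (\<gamma> z) = k (h z) / lam (h z)" using \<gamma> z h f1 by (simp add: q_def)
      have "(norm (deriv h z))\<^sup>2 * (lap_kernel \<rho> (h z - a) - lap_kernel \<rho>' (h z - a)) = - lam z * q (\<gamma> z)"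
        unfolding e1 e2 k_def by (simp add: algebra_simps diff_divide_distrib)
      then have "has_lapl (\<lambda>x. test_fun \<rho> \<rho>' (h x - a)) z (- lam z * q (\<gamma> z))" using 1 by simp
      then show "has_lapl (\<lambda>x. test_fun \<rho> \<rho>' (f (\<gamma> x) - a)) z (- lam z * q (\<gamma> z))"
        by (rule has_lapl_cong[OF _ open_ball z(1)]) (simp add: h)
    qed
    then have "has_lapl (\<lambda>x. \<phi> (proj F x)) z (\<Sum>\<gamma>\<in>\<Gamma>. - lam z * q (\<gamma> z))"
      by (rule has_lapl_cong[OF _ U(1,2)]) (use U(6) in auto)
    then have "hyp_laplacian (\<lambda>x. \<phi> (proj F x)) z = - (1 / lam z) * (\<Sum>\<gamma>\<in>\<Gamma>. - lam z * q (\<gamma> z))"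
      by (rule has_lapl_hyp_laplacian) (use z in auto)
    also have "\<dots> = (\<Sum>\<gamma>\<in>\<Gamma>. q (\<gamma> z))" using lam_pos[of z] z by (simp add: sum_distrib_left)
    also have "\<dots> = orbit_sum K q (proj F x)" using U(2,7) z(2) by metis
    finally show ?thesis by (simp add: laplacian_def z_def)
  qed
  have f1m: "f1 \<in> borel_measurable borel" unfolding f1_def by measurable
  have shift: "(\<lambda>x. f1 x - a) \<in> borel_measurable borel" "(\<lambda>y. y - a) \<in> borel_measurable borel"
    using f1m by measurable
  have km: "k \<in> borel_measurable borel"
    unfolding k_def
    by (intro borel_measurable_diff measurable_compose[OF shift(2) lap_kernel_measurable] \<rho>0 \<rho>(1))
  have um: "u \<in> borel_measurable borel"
    unfolding u_def
    by (intro borel_measurable_times borel_measurable_indicator measurable_compose[OF shift(1) test_fun_measurable]) simp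
  have qe: "q = (\<lambda>x. indicator disk x * (k (f1 x) / lam (f1 x)))" by (auto simp: q_def)
  have qm: "q \<in> borel_measurable borel"
    unfolding qe
    by (intro borel_measurable_times borel_measurable_divide borel_measurable_indicator
        measurable_compose[OF f1m km] measurable_compose[OF f1m lam_measurable]) simp
  have ub: "\<exists>B. \<forall>x. \<bar>u x\<bar> \<le> B"
  proof -
    obtain B where "B > 0" "\<And>y. \<bar>test_fun \<rho> \<rho>' y\<bar> \<le> B" using test_fun_bounded[OF \<rho>] by metis
    then have "\<bar>u x\<bar> \<le> B" for x by (simp add: u_def indicator_def)
    then show ?thesis by blast
  qed
  have qb: "\<exists>B. \<forall>x. \<bar>q x\<bar> \<le> B"
  proof -
    obtain B where B: "B > 0" "\<And>y. \<bar>lap_kernel \<rho> y\<bar> \<le> B" using lap_kernel_bounded[OF \<rho>0] by metis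
    obtain B' where B': "B' > 0" "\<And>y. \<bar>lap_kernel \<rho>' y\<bar> \<le> B'" using lap_kernel_bounded[OF \<rho>(1)] by metis
    have kb: "\<bar>k y\<bar> \<le> B' + B" for y
      unfolding k_def using B(2)[of "y - a"] B'(2)[of "y - a"] by linarith
    have "lam z \<ge> 4" if "z \<in> disk" for z
    proof -
      have "(norm z)\<^sup>2 < 1" using that by (simp add: abs_square_less_1)
      then have "(1 - (norm z)\<^sup>2)\<^sup>2 \<le> 1" "(1 - (norm z)\<^sup>2)\<^sup>2 > 0" by (auto simp: power_le_one)
      then show ?thesis unfolding lam_def by (simp add: le_divide_eq)
    qed
    then have "\<bar>q x\<bar> \<le> B' + B" for x
    proof (cases "x \<in> disk")
      case True
      then have l: "lam (f1 x) \<ge> 4" using \<open>\<And>z. z \<in> disk \<Longrightarrow> lam z \<ge> 4\<close>[of "f1 x"] fd f1 by simp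
      have "\<bar>q x\<bar> = \<bar>k (f1 x)\<bar> / lam (f1 x)" using True l by (simp add: q_def)
      also have "\<dots> \<le> \<bar>k (f1 x)\<bar> / 1" using l by (intro divide_left_mono) auto
      finally show ?thesis using kb[of "f1 x"] by simp
    qed (use B B' in \<open>simp add: q_def\<close>)
    then show ?thesis by blast
  qed
  have one: "(\<lambda>z. indicator disk z * G (proj F z) r) \<in> borel_measurable borel"
    by (rule area_measurable[OF G_integrable[OF r]])
  have Gi: "set_integrable lborel D (\<lambda>z. lam z * G (proj F z) r)"
    using area_integral(1)[OF one] G_integrable[OF r] by blast
  obtain Bq where Bq: "\<And>x. \<bar>q x\<bar> \<le> Bq" using qb by blast
  obtain Bu where Bu: "\<And>x. \<bar>u x\<bar> \<le> Bu" using ub by blast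
  have inv: "G (proj F (\<gamma> z)) r = G (proj F z) r" if "\<gamma> \<in> F" "z \<in> disk" for \<gamma> z using that by simp
  have unf: "set_integrable lborel disk (\<lambda>z. lam z * (G (proj F z) r * q z))"
    "(LINT z:D|lborel. lam z * (G (proj F z) r * orbit_sum K q (proj F z))) = (LINT z:disk|lborel. lam z * (G (proj F z) r * q z))"
    by (rule unfolding_integral[where v = "\<lambda>z. G (proj F z) r" and u = q and K = K and B = Bq];
        (fact K one Gi qm Bq | (rule inv; assumption) | (rule qK; assumption)))+
  have "continuous_on disk (\<lambda>z. \<phi> (proj F z))"
    using smooth unfolding surface_smooth_def smooth_on_def by (metis C_diff_on.simps(1))
  then have phim: "(\<lambda>z. indicator disk z * \<phi> (proj F z)) \<in> borel_measurable borel"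
    using borel_measurable_continuous_on_indicator[of disk "\<lambda>z. \<phi> (proj F z)"] by simp
  have oqm: "(\<lambda>z. indicator disk z * orbit_sum K q (proj F z)) \<in> borel_measurable borel"
  proof -
    have "continuous_on disk (\<lambda>z. orbit_sum K q (proj F z))"
    proof (rule continuous_at_imp_continuous_on, rule ballI)
      fix x0 assume x0: "x0 \<in> disk"
      obtain U \<Gamma> where U: "open U" "x0 \<in> U" "U \<subseteq> disk" "finite \<Gamma>" "\<Gamma> \<subseteq> F"
        "\<forall>x\<in>U. orbit_sum K q (proj F x) = (\<Sum>\<gamma>\<in>\<Gamma>. q (\<gamma> x))"
        using loc[OF x0] by blast
      have kc: "continuous_on UNIV k"
      proof -
        have "continuous_on UNIV (\<lambda>y. lap_kernel \<rho> (y - a))" "continuous_on UNIV (\<lambda>y. lap_kernel \<rho>' (y - a))"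
          by (rule continuous_on_compose2[OF lap_kernel_continuous[OF \<rho>0] _ subset_UNIV], intro continuous_intros,
              rule continuous_on_compose2[OF lap_kernel_continuous[OF \<rho>(1)] _ subset_UNIV], intro continuous_intros)
        then show ?thesis unfolding k_def by (intro continuous_on_diff)
      qed
      have "continuous_on disk (\<lambda>y. k y / lam y)"
        using lam_pos by (intro continuous_on_divide continuous_on_subset[OF kc] lam_continuous) force+
      moreover have "continuous_on disk f" using fh holomorphic_on_imp_continuous_on by blast
      ultimately have "continuous_on disk (\<lambda>x. k (f x) / lam (f x))"
        by (rule continuous_on_compose2) (use fd in blast)
      then have qc: "continuous_on disk q"
        by (rule continuous_on_eq) (simp add: q_def f1)
      have "continuous_on U (\<lambda>x. \<Sum>\<gamma>\<in>\<Gamma>. q (\<gamma> x))"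
      proof (rule continuous_on_sum)
        fix \<gamma> assume "\<gamma> \<in> \<Gamma>"
        then have \<gamma>: "\<gamma> \<in> F" using U by blast
        show "continuous_on U (\<lambda>x. q (\<gamma> x))"
          by (rule continuous_on_compose2[OF qc continuous_on_subset[OF F_continuous[OF \<gamma>] U(3)]])
            (use F_in_disk[OF \<gamma>] U(3) in blast)
      qed
      then have "continuous_on U (\<lambda>z. orbit_sum K q (proj F z))"
        by (rule continuous_on_eq) (use U(6) in auto)
      then show "isCont (\<lambda>z. orbit_sum K q (proj F z)) x0"
        using U continuous_on_eq_continuous_at by blast
    qed
    then show ?thesis
      using borel_measurable_continuous_on_indicator[of disk "\<lambda>z. orbit_sum K q (proj F z)"] by simp
  qed
  have "(\<integral>s. G s r * laplacian F \<phi> s \<partial>area F) = (LINT z:D|lborel. lam z * (G (proj F z) r * laplacian F \<phi> (proj F z)))"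
  proof (rule area_integral(2))
    have "(\<lambda>z. (indicator disk z * G (proj F z) r) * (indicator disk z * orbit_sum K q (proj F z))) \<in> borel_measurable borel"
      using one oqm by (rule borel_measurable_times)
    moreover have "(\<lambda>z. (indicator disk z * G (proj F z) r) * (indicator disk z * orbit_sum K q (proj F z))) =
        (\<lambda>z. indicator disk z * (G (proj F z) r * laplacian F \<phi> (proj F z)))"
      using lap by (auto simp: fun_eq_iff indicator_def)
    ultimately show "(\<lambda>z. indicator disk z * (G (proj F z) r * laplacian F \<phi> (proj F z))) \<in> borel_measurable borel" by simp
  qed
  also have "\<dots> = (LINT z:D|lborel. lam z * (G (proj F z) r * orbit_sum K q (proj F z)))"
    using lap D_disk by (intro set_lebesgue_integral_cong) auto
  also have "\<dots> = (LINT z:disk|lborel. lam z * (G (proj F z) r * q z))" by (rule unf(2))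
  finally have E1: "(\<integral>s. G s r * laplacian F \<phi> s \<partial>area F) = (LINT z:disk|lborel. lam z * (G (proj F z) r * q z))" .
  \<comment> \<open>The factor with \<open>G\<close> is multiplied by the indicator of the disk to
    obtain a Borel function on the plane, as \<open>moebius_integral\<close> requires.\<close>
  define v where "v z = (indicator disk z * G (proj F z) r) * q z" for z
  have vm: "v \<in> borel_measurable borel" unfolding v_def using one qm by (rule borel_measurable_times)
  have v1: "lam z * v z = lam z * (G (proj F z) r * q z)" if "z \<in> disk" for z using that by (simp add: v_def)
  have v2: "lam y * v (g y) = G (proj F (g y)) r * (lap_kernel \<rho>' (y - a) - lap_kernel \<rho> (y - a))" if "y \<in> disk" for y
  proof -
    have "f1 (g y) = y" using f1[OF gd[OF that]] fg[OF that] by simp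
    then show ?thesis using that gd[OF that] lam_pos[of y] by (simp add: v_def q_def k_def)
  qed
  note mi = moebius_integral[OF g vm]
  have "set_integrable lborel disk (\<lambda>z. lam z * v z)"
  proof -
    have "indicator disk z *\<^sub>R (lam z * (G (proj F z) r * q z)) = indicator disk z *\<^sub>R (lam z * v z)" for z
      using v1[of z] by (cases "z \<in> disk") auto
    then show ?thesis using unf(1) unfolding set_integrable_def by (simp only:)
  qed
  then have "set_integrable lborel disk (\<lambda>y. lam y * v (g y))" using mi(1) by blast
  moreover have "indicator disk y *\<^sub>R (lam y * v (g y)) =
      indicator disk y *\<^sub>R (G (proj F (g y)) r * (lap_kernel \<rho>' (y - a) - lap_kernel \<rho> (y - a)))" for y
    using v2[of y] by (cases "y \<in> disk") auto
  ultimately show ?A unfolding set_integrable_def by (simp only:)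
  have "(LINT z:disk|lborel. lam z * (G (proj F z) r * q z)) = (LINT z:disk|lborel. lam z * v z)"
    by (rule set_lebesgue_integral_cong) (simp, blast intro: v1[symmetric])
  also have "\<dots> = (LINT y:disk|lborel. lam y * v (g y))" using mi(2) by simp
  also have "\<dots> = (LINT y:disk|lborel. G (proj F (g y)) r * (lap_kernel \<rho>' (y - a) - lap_kernel \<rho> (y - a)))"
    by (rule set_lebesgue_integral_cong) (simp, blast intro: v2)
  finally have E2: "(LINT z:disk|lborel. lam z * (G (proj F z) r * q z)) =
    (LINT y:disk|lborel. G (proj F (g y)) r * (lap_kernel \<rho>' (y - a) - lap_kernel \<rho> (y - a)))" .
  \<comment> \<open>The same unfolding, with the constant 1 in place of the Green function, computes
    the integral of the test function; constants are integrable because the Dirichlet domain lies in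
    a compact subdisk.\<close>
  have "(\<integral>s. \<phi> s \<partial>area F) = (LINT z:D|lborel. lam z * (1 * orbit_sum K u (proj F z)))"
    using area_integral(2)[OF phim] by (simp add: \<phi>_def)
  also have "\<dots> = (LINT z:disk|lborel. lam z * (1 * u z))"
  proof (rule unfolding_integral(2)[where v = "\<lambda>z. 1" and u = u and K = K and B = Bu, OF K _ _ _ um Bu])
    show "(\<lambda>z. indicator disk z * (1::real)) \<in> borel_measurable borel"
      by (intro borel_measurable_times borel_measurable_indicator borel_measurable_const) simp
    obtain R where R: "0 < R" "R < 1" "D \<subseteq> cball 0 R" using dirichlet_bounded by metis
    have "set_integrable lborel (cball 0 R) (\<lambda>z. lam z * 1)"
    proof -
      have "continuous_on (cball 0 R) lam" using R by (intro continuous_on_subset[OF lam_continuous]) auto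
      then have "set_integrable lborel (cball 0 R) lam" unfolding set_integrable_def by (intro borel_integrable_compact) auto
      then show ?thesis by simp
    qed
    then show "set_integrable lborel D (\<lambda>z. lam z * 1)" by (rule set_integrable_subset) (use R in auto)
  qed (use uK in auto)
  also have "\<dots> = (LINT z:disk|lborel. lam z * u z)" by simp
  also have "\<dots> = (LINT y:disk|lborel. lam y * u (g y))" using moebius_integral(2)[OF g um] by simp
  also have "\<dots> = (LINT y:disk|lborel. lam y * test_fun \<rho> \<rho>' (y - a))"
  proof (rule set_lebesgue_integral_cong)
    show "\<forall>y. y \<in> disk \<longrightarrow> lam y * u (g y) = lam y * test_fun \<rho> \<rho>' (y - a)"
    proof (intro allI impI)
      fix y :: complex assume y: "y \<in> disk"
      have "f1 (g y) = y" using f1[OF gd[OF y]] fg[OF y] by simp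
      then show "lam y * u (g y) = lam y * test_fun \<rho> \<rho>' (y - a)" using gd[OF y] by (simp add: u_def)
    qed
  qed simp
  finally have E3: "(\<integral>s. \<phi> s \<partial>area F) = (LINT y:disk|lborel. lam y * test_fun \<rho> \<rho>' (y - a))" .
  show ?B unfolding K_def[symmetric] phi_eq using G_weak[OF r smooth] unfolding E1 E2 E3 .
qed

end

text \<open>Not normalised: the kernel has total mass 4 pi, so the mean value property reads
  \<open>avg \<rho> H a = 4 * pi * H a\<close>.\<close>

definition avg :: "real \<Rightarrow> (complex \<Rightarrow> real) \<Rightarrow> complex \<Rightarrow> real" where
  "avg \<rho> H a = (\<integral>x. H (a + x) * lap_kernel \<rho> x \<partial>lborel)"

lemma lborel_distr_cnj: "distr lborel borel cnj = lborel"
proof (rule lborel_eqI[symmetric])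
  fix l u :: complex
  assume "\<And>b. b \<in> Basis \<Longrightarrow> l \<bullet> b \<le> u \<bullet> b"
  then have le: "Re l \<le> Re u" "Im l \<le> Im u"
    by (metis Basis_complex_def complex_inner_1_right insertI1, metis Basis_complex_def \<open>\<And>b. b \<in> Basis \<Longrightarrow> l \<bullet> b \<le> u \<bullet> b\<close> complex_inner_i_right insertI1 insertI2)
  have "cnj -` box l u = box (Complex (Re l) (- Im u)) (Complex (Re u) (- Im l))"
    by (auto simp: mem_box Basis_complex_def inner_complex_def)
  then have "emeasure (distr lborel borel cnj) (box l u) = emeasure lborel (box (Complex (Re l) (- Im u)) (Complex (Re u) (- Im l)))"
    by (subst emeasure_distr) (auto intro!: borel_measurable_continuous_onI continuous_intros)
  also have "\<dots> = (\<Prod>b\<in>Basis. (Complex (Re u) (- Im l) - Complex (Re l) (- Im u)) \<bullet> b)"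
    using le by (intro emeasure_lborel_box) (auto simp: Basis_complex_def inner_complex_def)
  also have "\<dots> = (\<Prod>b\<in>Basis. (u - l) \<bullet> b)"
    by (simp add: Basis_complex_def inner_complex_def)
  finally show "emeasure (distr lborel borel cnj) (box l u) = (\<Prod>b\<in>Basis. (u - l) \<bullet> b)" .
qed simp

lemma lap_kernel_radial: "norm x = norm y \<Longrightarrow> lap_kernel \<rho> x = lap_kernel \<rho> y"
  by (simp add: lap_kernel_def)

lemma test_fun_radial: "norm x = norm y \<Longrightarrow> test_fun \<rho> \<rho>' x = test_fun \<rho> \<rho>' y"
  by (simp add: test_fun_def reg_log_def)

text \<open>The translated kernel is supported in the closed ball, hence in the disk; values of
  \<open>H\<close> outside the disk, where \<open>proj\<close> has no meaning, do not enter.\<close>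

lemma avg_eq_set_integral:
  assumes \<rho>: "\<rho> > 0" "cball a (2 * \<rho>) \<subseteq> disk"
    and i: "set_integrable lborel disk (\<lambda>y. H y * lap_kernel \<rho> (y - a))"
  shows "integrable lborel (\<lambda>x. H (a + x) * lap_kernel \<rho> x)"
    and "avg \<rho> H a = (LINT y:disk|lborel. H y * lap_kernel \<rho> (y - a))"
proof -
  define \<phi> where "\<phi> y = indicator disk y *\<^sub>R (H y * lap_kernel \<rho> (y - a))" for y
  have \<phi>i: "integrable lborel \<phi>" using i unfolding set_integrable_def \<phi>_def .
  then have \<phi>m: "\<phi> \<in> borel_measurable borel" by auto
  have e: "\<phi> (a + x) = H (a + x) * lap_kernel \<rho> x" for x
  proof (cases "lap_kernel \<rho> x = 0")
    case False
    then have "a + x \<in> cball a (2 * \<rho>)" using lap_kernel_support(2)[OF \<rho>(1) False] by (simp add: dist_norm)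
    then have "a + x \<in> disk" using \<rho>(2) by blast
    then show ?thesis by (simp add: \<phi>_def)
  qed (simp add: \<phi>_def)
  have d: "distr lborel borel ((+) a) = (lborel :: complex measure)" by (rule lborel_distr_plus)
  have pm: "(+) a \<in> measurable lborel borel" by simp
  have "integrable (distr lborel borel ((+) a)) \<phi>" unfolding d by (rule \<phi>i)
  then show "integrable lborel (\<lambda>x. H (a + x) * lap_kernel \<rho> x)"
    unfolding integrable_distr_eq[OF pm \<phi>m] e .
  have "integral\<^sup>L (distr lborel borel ((+) a)) \<phi> = avg \<rho> H a"
    unfolding integral_distr[OF pm \<phi>m] e avg_def ..
  then show "avg \<rho> H a = (LINT y:disk|lborel. H y * lap_kernel \<rho> (y - a))"
    unfolding d \<phi>_def set_lebesgue_integral_def by simp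
qed

text \<open>The kernels have constant mass and shrinking supports, so they form an approximate
  identity up to the factor 4 pi.\<close>

lemma avg_limit:
  assumes cont: "isCont H a" and "\<rho>0 > 0" and int: "\<And>\<rho>. 0 < \<rho> \<Longrightarrow> \<rho> < \<rho>0 \<Longrightarrow> integrable lborel (\<lambda>x. H (a + x) * lap_kernel \<rho> x)"
  shows "((\<lambda>\<rho>. avg \<rho> H a) \<longlongrightarrow> 4 * pi * H a) (at_right 0)"
proof (rule tendstoI)
  fix e :: real assume e: "e > 0"
  define \<eta> where "\<eta> = e / (8 * pi)"
  have \<eta>: "\<eta> > 0" using e by (simp add: \<eta>_def)
  obtain d where d: "d > 0" "\<And>y. dist y a < d \<Longrightarrow> dist (H y) (H a) < \<eta>"
    using cont \<eta> unfolding continuous_at_eps_delta by metis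
  have "dist (avg \<rho> H a) (4 * pi * H a) < e" if \<rho>: "0 < \<rho>" "\<rho> < min \<rho>0 (d / 2)" for \<rho>
  proof -
    have i1: "integrable lborel (\<lambda>x. H (a + x) * lap_kernel \<rho> x)" using int \<rho> by simp
    have i2: "integrable lborel (\<lambda>x. H a * lap_kernel \<rho> x)" using lap_kernel_integral(1)[OF \<rho>(1)] by simp
    have "avg \<rho> H a - 4 * pi * H a = (\<integral>x. H (a + x) * lap_kernel \<rho> x - H a * lap_kernel \<rho> x \<partial>lborel)"
      using i1 i2 lap_kernel_integral(2)[OF \<rho>(1)] by (simp add: avg_def)
    also have "norm \<dots> \<le> (\<integral>x. norm (H (a + x) * lap_kernel \<rho> x - H a * lap_kernel \<rho> x) \<partial>lborel)"
      by (rule integral_norm_bound)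
    also have "\<dots> \<le> (\<integral>x. \<eta> * lap_kernel \<rho> x \<partial>lborel)"
    proof (rule integral_mono)
      show "integrable lborel (\<lambda>x. norm (H (a + x) * lap_kernel \<rho> x - H a * lap_kernel \<rho> x))"
        using i1 i2 by (intro integrable_norm Bochner_Integration.integrable_diff)
      show "integrable lborel (\<lambda>x. \<eta> * lap_kernel \<rho> x)" using lap_kernel_integral(1)[OF \<rho>(1)] by simp
      fix x
      show "norm (H (a + x) * lap_kernel \<rho> x - H a * lap_kernel \<rho> x) \<le> \<eta> * lap_kernel \<rho> x"
      proof (cases "lap_kernel \<rho> x = 0")
        case False
        then have "norm x < d" using lap_kernel_support(2)[OF \<rho>(1) False] \<rho>(2) by simp
        then have "\<bar>H (a + x) - H a\<bar> \<le> \<eta>" using d(2)[of "a + x"] by (simp add: dist_norm dist_real_def)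
        then have "\<bar>H (a + x) - H a\<bar> * lap_kernel \<rho> x \<le> \<eta> * lap_kernel \<rho> x"
          by (intro mult_right_mono lap_kernel_nonneg)
        moreover have "norm (H (a + x) * lap_kernel \<rho> x - H a * lap_kernel \<rho> x) = \<bar>H (a + x) - H a\<bar> * lap_kernel \<rho> x"
          using lap_kernel_nonneg[of \<rho> x] by (simp add: abs_mult flip: left_diff_distrib)
        ultimately show ?thesis by simp
      qed simp
    qed
    also have "\<dots> = \<eta> * (4 * pi)" using lap_kernel_integral(2)[OF \<rho>(1)] by simp
    also have "\<dots> < e" using e by (simp add: \<eta>_def)
    finally show ?thesis by (simp add: dist_real_def)
  qed
  then show "\<forall>\<^sub>F \<rho> in at_right 0. dist (avg \<rho> H a) (4 * pi * H a) < e"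
    unfolding eventually_at_right_field using \<open>\<rho>0 > 0\<close> d(1) by (intro exI[of _ "min \<rho>0 (d / 2)"]) auto
qed

lemma moebius_reversing_iff:
  "\<sigma> \<in> moebius_reversing \<longleftrightarrow> (\<exists>g\<in>moebius_preserving. \<sigma> = (\<lambda>z\<in>disk. g (cnj z)))"
proof
  assume "\<sigma> \<in> moebius_reversing"
  then obtain t w where tw: "w \<in> disk" "\<sigma> = (\<lambda>z\<in>disk. Moebius_function t w (cnj z))"
    unfolding moebius_reversing_def by auto
  then have "\<sigma> = (\<lambda>z\<in>disk. restrict (Moebius_function t w) disk (cnj z))" by (auto simp: restrict_def)
  then show "\<exists>g\<in>moebius_preserving. \<sigma> = (\<lambda>z\<in>disk. g (cnj z))"
    using tw(1) unfolding moebius_preserving_def by blast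
next
  assume "\<exists>g\<in>moebius_preserving. \<sigma> = (\<lambda>z\<in>disk. g (cnj z))"
  then obtain t w where tw: "w \<in> disk" "\<sigma> = (\<lambda>z\<in>disk. restrict (Moebius_function t w) disk (cnj z))"
    unfolding moebius_preserving_def by auto
  have e: "\<sigma> = (\<lambda>z\<in>disk. Moebius_function t w (cnj z))" unfolding tw(2) by (auto simp: restrict_def)
  show "\<sigma> \<in> moebius_reversing" unfolding moebius_reversing_def e using tw(1) by blast
qed

section \<open>Averages of the Green function in the chart of a symmetry\<close>

context vortex_surface
begin

text \<open>The part of being a symmetry that the averages use: orbits go onto orbits. The identity
  of the disk qualifies too, so the averages of \<open>G\<close> itself and of its transform obey
  one and the same formula.\<close>

definition orbit_map :: "(complex \<Rightarrow> complex) \<Rightarrow> bool" where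
  "orbit_map \<sigma> \<longleftrightarrow> \<sigma> \<in> moebius_preserving \<union> moebius_reversing \<and> (\<forall>w\<in>disk. \<sigma> ` proj F w = proj F (\<sigma> w))"

text \<open>Separates the two radii of \<open>averaging_identity\<close>. The point is that the
  integral against a single kernel exists, while the weak equation speaks of differences of
  kernels.\<close>

lemma avg_identity_preserving:
  assumes f: "f \<in> moebius_preserving" and g: "g \<in> moebius_preserving"
    and fg: "\<And>z. z \<in> disk \<Longrightarrow> f (g z) = z" and gf: "\<And>z. z \<in> disk \<Longrightarrow> g (f z) = z"
    and \<rho>: "0 < \<rho>" and a: "cball a (2 * \<rho>) \<subseteq> disk" and r: "r \<in> surface F"
  shows "integrable lborel (\<lambda>x. G (proj F (g (a + x))) r * lap_kernel \<rho> x)"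
    and "0 < \<rho>' \<Longrightarrow> \<rho>' \<le> \<rho> \<Longrightarrow> avg \<rho>' (\<lambda>y. G (proj F (g y)) r) a - avg \<rho> (\<lambda>y. G (proj F (g y)) r) a =
      orbit_sum (g ` cball a (2 * \<rho>)) (\<lambda>x. test_fun \<rho> \<rho>' (f x - a)) r
        - (LINT y:disk|lborel. lam y * test_fun \<rho> \<rho>' (y - a)) / total_area F"
proof -
  let ?H = "\<lambda>y. G (proj F (g y)) r"
  have i: "set_integrable lborel disk (\<lambda>y. ?H y * lap_kernel \<rho> (y - a))"
    if \<rho>: "0 < \<rho>" and a: "cball a (2 * \<rho>) \<subseteq> disk" for \<rho>
  proof -
    have "set_integrable lborel disk (\<lambda>y. ?H y * (lap_kernel (\<rho> / 2) (y - a) - lap_kernel \<rho> (y - a)))"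
      by (rule averaging_identity(1)[OF f g fg gf _ _ a r]) (use \<rho> in auto)
    then have 1: "integrable lborel (\<lambda>y. indicator disk y *\<^sub>R (?H y * (lap_kernel (\<rho> / 2) (y - a) - lap_kernel \<rho> (y - a))))"
      unfolding set_integrable_def .
    \<comment> \<open>The kernels of radii \<open>\<rho> / 2\<close> and \<open>\<rho>\<close> live
      on opposite sides of the circle of radius \<rho>; cutting the integrable difference along this
      circle isolates the second kernel.\<close>
    have "closed {y. \<rho> \<le> norm (y - a)}" by (intro closed_Collect_le continuous_intros)
    then have "{y. \<rho> \<le> norm (y - a)} \<in> sets lborel" by simp
    from integrable_mult_right[OF integrable_mult_indicator[OF this 1], of "-1"]
    have "integrable lborel (\<lambda>y. (- 1) * (indicator {y. \<rho> \<le> norm (y - a)} y *\<^sub>R (indicator disk y *\<^sub>R (?H y * (lap_kernel (\<rho> / 2) (y - a) - lap_kernel \<rho> (y - a))))))"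
      by blast
    moreover have "(- 1) * (indicator {y. \<rho> \<le> norm (y - a)} y *\<^sub>R (indicator disk y *\<^sub>R (?H y * (lap_kernel (\<rho> / 2) (y - a) - lap_kernel \<rho> (y - a)))))
        = indicator disk y *\<^sub>R (?H y * lap_kernel \<rho> (y - a))" for y
    proof (cases "\<rho> \<le> norm (y - a)")
      case True
      then have "lap_kernel (\<rho> / 2) (y - a) = 0" using lap_kernel_support(2)[of "\<rho> / 2" "y - a"] \<rho> by force
      then show ?thesis using True by simp
    next
      case False
      then have "lap_kernel \<rho> (y - a) = 0" using lap_kernel_support(1)[of \<rho> "y - a"] \<rho> by force
      then show ?thesis using False by simp
    qed
    ultimately show ?thesis unfolding set_integrable_def by (simp only:)
  qed
  show "integrable lborel (\<lambda>x. ?H (a + x) * lap_kernel \<rho> x)"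
    by (rule avg_eq_set_integral(1)[OF \<rho> a i[OF \<rho> a]])
  assume \<rho>': "0 < \<rho>'" "\<rho>' \<le> \<rho>"
  have a': "cball a (2 * \<rho>') \<subseteq> disk"
  proof -
    have "cball a (2 * \<rho>') \<subseteq> cball a (2 * \<rho>)" using \<rho>' by (intro subset_cball) simp
    then show ?thesis using a by blast
  qed
  have "avg \<rho>' ?H a - avg \<rho> ?H a =
      (LINT y:disk|lborel. ?H y * lap_kernel \<rho>' (y - a)) - (LINT y:disk|lborel. ?H y * lap_kernel \<rho> (y - a))"
    using avg_eq_set_integral(2)[OF \<rho> a i[OF \<rho> a]] avg_eq_set_integral(2)[OF \<rho>'(1) a' i[OF \<rho>'(1) a']] by simp
  also have "\<dots> = (LINT y:disk|lborel. ?H y * (lap_kernel \<rho>' (y - a) - lap_kernel \<rho> (y - a)))"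
    using set_integral_diff(2)[OF i[OF \<rho>'(1) a'] i[OF \<rho> a]] by (simp add: right_diff_distrib)
  also have "\<dots> = orbit_sum (g ` cball a (2 * \<rho>)) (\<lambda>x. test_fun \<rho> \<rho>' (f x - a)) r
        - (LINT y:disk|lborel. lam y * test_fun \<rho> \<rho>' (y - a)) / total_area F"
    by (rule averaging_identity(2)[OF f g fg gf \<rho>' a r])
  finally show "avg \<rho>' ?H a - avg \<rho> ?H a =
      orbit_sum (g ` cball a (2 * \<rho>)) (\<lambda>x. test_fun \<rho> \<rho>' (f x - a)) r
        - (LINT y:disk|lborel. lam y * test_fun \<rho> \<rho>' (y - a)) / total_area F" .
qed

text \<open>The right hand side does not contain \<sigma>: the orbit of \<sigma> w is the image of
  the orbit of \<open>w\<close>, so in the chart inverse to \<sigma> the test function sees the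
  original positions. A reflection is treated as conjugation followed by an orientation preserving
  map, with the centre moved to \<open>cnj a\<close>.\<close>

lemma avg_identity:
  assumes \<sigma>: "orbit_map \<sigma>" and \<rho>: "0 < \<rho>" and a: "cball a (2 * \<rho>) \<subseteq> disk" and w: "w \<in> disk"
  shows "integrable lborel (\<lambda>x. G (proj F (\<sigma> (a + x))) (proj F (\<sigma> w)) * lap_kernel \<rho> x)"
    and "0 < \<rho>' \<Longrightarrow> \<rho>' \<le> \<rho> \<Longrightarrow>
      avg \<rho>' (\<lambda>y. G (proj F (\<sigma> y)) (proj F (\<sigma> w))) a - avg \<rho> (\<lambda>y. G (proj F (\<sigma> y)) (proj F (\<sigma> w))) a =
      orbit_sum (cball a (2 * \<rho>)) (\<lambda>x. test_fun \<rho> \<rho>' (x - a)) (proj F w)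
        - (LINT y:disk|lborel. lam y * test_fun \<rho> \<rho>' (y - a)) / total_area F"
proof -
  have img: "\<sigma> ` proj F w = proj F (\<sigma> w)" using \<sigma> w by (simp add: orbit_map_def)
  have Fw: "x \<in> disk" if "x \<in> proj F w" for x using in_proj_iff[OF w] that by simp
  have "integrable lborel (\<lambda>x. G (proj F (\<sigma> (a + x))) (proj F (\<sigma> w)) * lap_kernel \<rho> x) \<and>
    (0 < \<rho>' \<longrightarrow> \<rho>' \<le> \<rho> \<longrightarrow>
      avg \<rho>' (\<lambda>y. G (proj F (\<sigma> y)) (proj F (\<sigma> w))) a - avg \<rho> (\<lambda>y. G (proj F (\<sigma> y)) (proj F (\<sigma> w))) a =
      orbit_sum (cball a (2 * \<rho>)) (\<lambda>x. test_fun \<rho> \<rho>' (x - a)) (proj F w)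
        - (LINT y:disk|lborel. lam y * test_fun \<rho> \<rho>' (y - a)) / total_area F)"
  proof (cases "\<sigma> \<in> moebius_preserving")
    case True
    obtain f where f: "f \<in> moebius_preserving" "\<forall>z\<in>disk. f (\<sigma> z) = z" "\<forall>z\<in>disk. \<sigma> (f z) = z"
      using moebius_preserving_inverse[OF True] by blast
    have r: "proj F (\<sigma> w) \<in> surface F" using moebius_preserving_in_disk[OF True w] by simp
    have inj: "inj_on \<sigma> disk" using moebius_preserving_bij[OF True] by (simp add: bij_betw_def)
    have e: "proj F (\<sigma> w) \<inter> \<sigma> ` cball a (2 * \<rho>) = \<sigma> ` (proj F w \<inter> cball a (2 * \<rho>))"
      unfolding img[symmetric] by (rule inj_on_image_Int[OF inj _ a, symmetric]) (use Fw in blast)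
    have os: "orbit_sum (\<sigma> ` cball a (2 * \<rho>)) (\<lambda>x. test_fun \<rho> \<rho>' (f x - a)) (proj F (\<sigma> w)) =
        orbit_sum (cball a (2 * \<rho>)) (\<lambda>x. test_fun \<rho> \<rho>' (x - a)) (proj F w)"
      unfolding orbit_sum_def e
    proof (subst sum.reindex)
      show "inj_on \<sigma> (proj F w \<inter> cball a (2 * \<rho>))" using inj by (rule inj_on_subset) (use Fw in auto)
    qed (use Fw f in \<open>auto intro!: sum.cong\<close>)
    show ?thesis
      using avg_identity_preserving[OF f(1) True f(2)[rule_format] f(3)[rule_format] \<rho> a r]
      unfolding os[symmetric] by simp
  next
    case False
    then obtain g where g: "g \<in> moebius_preserving" "\<sigma> = (\<lambda>z\<in>disk. g (cnj z))"
      using \<sigma> moebius_reversing_iff unfolding orbit_map_def by blast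
    obtain f where f: "f \<in> moebius_preserving" "\<forall>z\<in>disk. f (g z) = z" "\<forall>z\<in>disk. g (f z) = z"
      using moebius_preserving_inverse[OF g(1)] by blast
    define r where "r = proj F (\<sigma> w)"
    have cd: "cnj z \<in> disk \<longleftrightarrow> z \<in> disk" for z by simp
    have r: "r \<in> surface F" unfolding r_def g(2) using w moebius_preserving_in_disk[OF g(1), of "cnj w"] by simp
    have cnjball: "cnj x \<in> cball (cnj a) s \<longleftrightarrow> x \<in> cball a s" for x s
      using complex_mod_cnj[of "a - x"] by (simp add: dist_norm)
    have ca: "cball (cnj a) (2 * \<rho>) \<subseteq> disk"
    proof
      fix x assume "x \<in> cball (cnj a) (2 * \<rho>)"
      then have "cnj x \<in> cball a (2 * \<rho>)" using cnjball[of "cnj x"] by simp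
      then have "cnj x \<in> disk" using a by blast
      then show "x \<in> disk" by simp
    qed
    have gi: "inj_on g disk" using moebius_preserving_bij[OF g(1)] by (simp add: bij_betw_def)
    have si: "inj_on \<sigma> disk"
    proof (rule inj_onI)
      fix x y assume h: "x \<in> disk" "y \<in> disk" "\<sigma> x = \<sigma> y"
      then have "g (cnj x) = g (cnj y)" by (simp add: g(2))
      from inj_onD[OF gi this] h(1,2) show "x = y" by simp
    qed
    have e: "r \<inter> g ` cball (cnj a) (2 * \<rho>) = \<sigma> ` (proj F w \<inter> cball a (2 * \<rho>))"
    proof (intro equalityI subsetI)
      fix x assume "x \<in> r \<inter> g ` cball (cnj a) (2 * \<rho>)"
      then have "x \<in> \<sigma> ` proj F w" "x \<in> g ` cball (cnj a) (2 * \<rho>)"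
        unfolding r_def img by (rule IntD1, rule IntD2)
      then obtain u v where uv: "u \<in> proj F w" "x = \<sigma> u" "v \<in> cball (cnj a) (2 * \<rho>)" "x = g v"
        by blast
      have eq: "g (cnj u) = g v" using uv Fw[OF uv(1)] by (simp add: g(2))
      have "cnj u = v"
        by (rule inj_onD[OF gi eq]) (use Fw[OF uv(1)] in simp, rule subsetD[OF ca uv(3)])
      then have "u \<in> cball a (2 * \<rho>)" using uv(3) cnjball by blast
      then show "x \<in> \<sigma> ` (proj F w \<inter> cball a (2 * \<rho>))" using uv by blast
    next
      fix x assume "x \<in> \<sigma> ` (proj F w \<inter> cball a (2 * \<rho>))"
      then obtain u where u: "u \<in> proj F w" "u \<in> cball a (2 * \<rho>)" "x = \<sigma> u" by blast
      have "x = g (cnj u)" using u(3) Fw[OF u(1)] by (simp add: g(2))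
      moreover have "cnj u \<in> cball (cnj a) (2 * \<rho>)" using u(2) cnjball by blast
      moreover have "x \<in> r" unfolding r_def img[symmetric] using u by blast
      ultimately show "x \<in> r \<inter> g ` cball (cnj a) (2 * \<rho>)" by blast
    qed
    have os: "orbit_sum (g ` cball (cnj a) (2 * \<rho>)) (\<lambda>x. test_fun \<rho> \<rho>' (f x - cnj a)) r =
        orbit_sum (cball a (2 * \<rho>)) (\<lambda>x. test_fun \<rho> \<rho>' (x - a)) (proj F w)"
      unfolding orbit_sum_def e
    proof (subst sum.reindex)
      show "inj_on \<sigma> (proj F w \<inter> cball a (2 * \<rho>))" using si by (rule inj_on_subset) (use Fw in auto)
      show "sum ((\<lambda>x. test_fun \<rho> \<rho>' (f x - cnj a)) \<circ> \<sigma>) (proj F w \<inter> cball a (2 * \<rho>)) =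
         (\<Sum>x\<in>proj F w \<inter> cball a (2 * \<rho>). test_fun \<rho> \<rho>' (x - a))"
      proof (rule sum.cong[OF refl])
        fix x assume "x \<in> proj F w \<inter> cball a (2 * \<rho>)"
        then have x: "x \<in> disk" using Fw by blast
        then have "f (\<sigma> x) = cnj x" using f(2) by (simp add: g(2))
        then show "((\<lambda>x. test_fun \<rho> \<rho>' (f x - cnj a)) \<circ> \<sigma>) x = test_fun \<rho> \<rho>' (x - a)"
          by (simp add: test_fun_radial[of "cnj (x - a)" "x - a"] flip: complex_cnj_diff)
      qed
    qed
    have cm: "cnj \<in> measurable lborel borel" by (auto intro!: borel_measurable_continuous_onI continuous_intros)
    \<comment> \<open>Lebesgue measure, \<open>lam\<close> and the radial test function are all
      compatible with conjugation.\<close>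
    have J: "(LINT y:disk|lborel. lam y * test_fun \<rho> \<rho>' (y - cnj a)) = (LINT y:disk|lborel. lam y * test_fun \<rho> \<rho>' (y - a))"
    proof -
      define \<phi> where "\<phi> y = indicator disk y * (lam y * test_fun \<rho> \<rho>' (y - cnj a))" for y
      have "(\<lambda>y. y - cnj a) \<in> borel_measurable borel" by measurable
      then have m: "\<phi> \<in> borel_measurable borel"
        unfolding \<phi>_def by (intro borel_measurable_times borel_measurable_indicator lam_measurable measurable_compose[OF _ test_fun_measurable]) auto
      have "integral\<^sup>L lborel \<phi> = integral\<^sup>L (distr lborel borel cnj) \<phi>" by (simp add: lborel_distr_cnj)
      also have "\<dots> = integral\<^sup>L lborel (\<lambda>y. \<phi> (cnj y))" by (rule integral_distr[OF cm m])
      also have "(\<lambda>y. \<phi> (cnj y)) = (\<lambda>y. indicator disk y * (lam y * test_fun \<rho> \<rho>' (y - a)))"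
      proof
        fix y
        have "test_fun \<rho> \<rho>' (cnj y - cnj a) = test_fun \<rho> \<rho>' (y - a)"
          by (rule test_fun_radial) (simp add: complex_mod_cnj flip: complex_cnj_diff)
        then show "\<phi> (cnj y) = indicator disk y * (lam y * test_fun \<rho> \<rho>' (y - a))"
          by (simp add: \<phi>_def indicator_def lam_def)
      qed
      finally show ?thesis by (simp add: set_lebesgue_integral_def \<phi>_def)
    qed
    \<comment> \<open>\<sigma> is conjugation followed by \<open>g\<close> on the disk only; where
      \<open>a + x\<close> leaves the disk, the kernel vanishes and both sides are 0.\<close>
    have swap: "G (proj F (\<sigma> (a + x))) r * lap_kernel s x = G (proj F (g (cnj a + cnj x))) r * lap_kernel s (cnj x)"
      if "s > 0" "cball a (2 * s) \<subseteq> disk" for x s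
    proof (cases "lap_kernel s x = 0")
      case True
      then show ?thesis using lap_kernel_radial[of "cnj x" x s] by simp
    next
      case False
      then have "a + x \<in> cball a (2 * s)" using lap_kernel_support(2)[OF that(1) False] by (simp add: dist_norm)
      then have "a + x \<in> disk" using that(2) by blast
      then show ?thesis using lap_kernel_radial[of "cnj x" x s] by (simp add: g(2))
    qed
    have avg_swap: "integrable lborel (\<lambda>x. G (proj F (\<sigma> (a + x))) r * lap_kernel s x) \<and>
       avg s (\<lambda>y. G (proj F (\<sigma> y)) r) a = avg s (\<lambda>y. G (proj F (g y)) r) (cnj a)" if s: "0 < s" "s \<le> \<rho>" for s
    proof -
      have as: "cball a (2 * s) \<subseteq> disk" "cball (cnj a) (2 * s) \<subseteq> disk"
        using subset_cball[of "2 * s" "2 * \<rho>" a] subset_cball[of "2 * s" "2 * \<rho>" "cnj a"] s a ca by auto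
      define \<phi> where "\<phi> x = G (proj F (g (cnj a + x))) r * lap_kernel s x" for x
      have i: "integrable lborel \<phi>"
        unfolding \<phi>_def
        by (rule avg_identity_preserving(1)[OF f(1) g(1) f(2)[rule_format] f(3)[rule_format] s(1) as(2) r])
      then have m: "\<phi> \<in> borel_measurable borel" by auto
      have e: "(\<lambda>x. \<phi> (cnj x)) = (\<lambda>x. G (proj F (\<sigma> (a + x))) r * lap_kernel s x)"
        using swap[OF s(1) as(1)] by (simp add: \<phi>_def)
      have "integrable (distr lborel borel cnj) \<phi>" using i by (simp add: lborel_distr_cnj)
      then have 1: "integrable lborel (\<lambda>x. \<phi> (cnj x))" unfolding integrable_distr_eq[OF cm m] .
      have "avg s (\<lambda>y. G (proj F (g y)) r) (cnj a) = integral\<^sup>L (distr lborel borel cnj) \<phi>"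
        by (simp add: lborel_distr_cnj avg_def \<phi>_def[abs_def])
      also have "\<dots> = avg s (\<lambda>y. G (proj F (\<sigma> y)) r) a"
        unfolding integral_distr[OF cm m] e avg_def ..
      finally show ?thesis using 1 unfolding e by simp
    qed
    show ?thesis unfolding r_def[symmetric]
    proof (intro conjI impI)
      show "integrable lborel (\<lambda>x. G (proj F (\<sigma> (a + x))) r * lap_kernel \<rho> x)" using avg_swap[of \<rho>] \<rho> by simp
      assume r': "0 < \<rho>'" "\<rho>' \<le> \<rho>"
      have "avg \<rho>' (\<lambda>y. G (proj F (g y)) r) (cnj a) - avg \<rho> (\<lambda>y. G (proj F (g y)) r) (cnj a) =
        orbit_sum (g ` cball (cnj a) (2 * \<rho>)) (\<lambda>x. test_fun \<rho> \<rho>' (f x - cnj a)) r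
          - (LINT y:disk|lborel. lam y * test_fun \<rho> \<rho>' (y - cnj a)) / total_area F"
        by (rule avg_identity_preserving(2)[OF f(1) g(1) f(2)[rule_format] f(3)[rule_format] \<rho> ca r r'])
      then show "avg \<rho>' (\<lambda>y. G (proj F (\<sigma> y)) r) a - avg \<rho> (\<lambda>y. G (proj F (\<sigma> y)) r) a =
      orbit_sum (cball a (2 * \<rho>)) (\<lambda>x. test_fun \<rho> \<rho>' (x - a)) (proj F w)
        - (LINT y:disk|lborel. lam y * test_fun \<rho> \<rho>' (y - a)) / total_area F"
        unfolding os J using avg_swap[OF r'] avg_swap[of \<rho>] \<rho> by simp
    qed
  qed
  then show "integrable lborel (\<lambda>x. G (proj F (\<sigma> (a + x))) (proj F (\<sigma> w)) * lap_kernel \<rho> x)"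
    "0 < \<rho>' \<Longrightarrow> \<rho>' \<le> \<rho> \<Longrightarrow>
      avg \<rho>' (\<lambda>y. G (proj F (\<sigma> y)) (proj F (\<sigma> w))) a - avg \<rho> (\<lambda>y. G (proj F (\<sigma> y)) (proj F (\<sigma> w))) a =
      orbit_sum (cball a (2 * \<rho>)) (\<lambda>x. test_fun \<rho> \<rho>' (x - a)) (proj F w)
        - (LINT y:disk|lborel. lam y * test_fun \<rho> \<rho>' (y - a)) / total_area F"
    by blast+
qed

end

section \<open>Averages depending on parameters\<close>

text \<open>The parameter function is controlled on an open set containing the closed annulus for
  each parameter. At the remaining points the kernel vanishes in a whole neighbourhood, so the
  product is continuous there as well.\<close>

lemma kernel_param:
  fixes \<Phi> :: "'a::euclidean_space \<Rightarrow> complex \<Rightarrow> 'b::real_normed_vector"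
  assumes \<rho>: "\<rho> > 0" and \<Omega>: "open \<Omega>" and sub: "\<And>p x. p \<in> U \<Longrightarrow> \<rho> \<le> norm x \<Longrightarrow> norm x \<le> 2 * \<rho> \<Longrightarrow> (p, x) \<in> \<Omega>"
    and cont: "continuous_on \<Omega> (\<lambda>(p, x). \<Phi> p x)"
  shows "continuous_on (U \<times> A) (\<lambda>(p, x). lap_kernel \<rho> x *\<^sub>R \<Phi> p x)"
proof (rule continuous_at_imp_continuous_on, rule ballI)
  fix q assume q: "q \<in> U \<times> A"
  obtain p0 x0 where q0: "q = (p0, x0)" "p0 \<in> U" using q by auto
  show "isCont (\<lambda>(p, x). lap_kernel \<rho> x *\<^sub>R \<Phi> p x) q"
  proof (cases "\<rho> \<le> norm x0 \<and> norm x0 \<le> 2 * \<rho>")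
    case True
    then have "q \<in> \<Omega>" using sub q0 by simp
    then have "isCont (\<lambda>(p, x). \<Phi> p x) q" using cont \<Omega> continuous_on_eq_continuous_at by blast
    moreover have "isCont (\<lambda>q::'a \<times> complex. lap_kernel \<rho> (snd q)) q"
    proof (rule isCont_o2[where g = "lap_kernel \<rho>"])
      show "isCont snd q" by (intro continuous_intros)
      show "isCont (lap_kernel \<rho>) (snd q)" using lap_kernel_continuous[OF \<rho>] by (simp add: continuous_on_eq_continuous_at)
    qed
    ultimately have "isCont (\<lambda>q. lap_kernel \<rho> (snd q) *\<^sub>R (case q of (p, x) \<Rightarrow> \<Phi> p x)) q"
      by (intro continuous_scaleR)
    then show ?thesis by (simp add: case_prod_unfold)
  next
    case False
    have "open ({x. norm x < \<rho>} \<union> {x::complex. 2 * \<rho> < norm x})"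
      by (intro open_Un open_Collect_less continuous_intros)
    then have o: "open ((UNIV :: 'a set) \<times> ({x. norm x < \<rho>} \<union> {x::complex. 2 * \<rho> < norm x}))"
      by (intro open_Times) auto
    have "lap_kernel \<rho> x = 0" if "norm x < \<rho> \<or> 2 * \<rho> < norm x" for x
      using lap_kernel_support[OF \<rho>, of x] that by force
    then have "\<forall>\<^sub>F q in nhds q. (case q of (p, x) \<Rightarrow> lap_kernel \<rho> x *\<^sub>R \<Phi> p x) = 0"
      unfolding eventually_nhds using o False q0
      by (intro exI[of _ "(UNIV :: 'a set) \<times> ({x. norm x < \<rho>} \<union> {x::complex. 2 * \<rho> < norm x})"]) auto
    then show ?thesis using isCont_cong[of _ "\<lambda>_. 0" q] by simp
  qed
qed

text \<open>A box containing the support of the kernel: continuity in a parameter and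
  differentiation under the integral sign are applied to integrals over a
  \<open>cbox\<close>.\<close>

definition kbox :: "real \<Rightarrow> complex set" where
  "kbox \<rho> = cbox (Complex (- 2 * \<rho>) (- 2 * \<rho>)) (Complex (2 * \<rho>) (2 * \<rho>))"

lemma kbox_contains: "norm x \<le> 2 * \<rho> \<Longrightarrow> x \<in> kbox \<rho>"
  using abs_Re_le_cmod[of x] abs_Im_le_cmod[of x]
  by (auto simp: kbox_def mem_box Basis_complex_def inner_complex_def)

lemma kernel_integral_box:
  fixes h :: "complex \<Rightarrow> real"
  assumes \<rho>: "\<rho> > 0" and c: "continuous_on (kbox \<rho>) (\<lambda>x. lap_kernel \<rho> x * h x)"
  shows "(\<integral>x. h x * lap_kernel \<rho> x \<partial>lborel) = integral (kbox \<rho>) (\<lambda>x. lap_kernel \<rho> x * h x)"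
    and "integrable lborel (\<lambda>x. h x * lap_kernel \<rho> x)"
proof -
  have z: "indicator (kbox \<rho>) x *\<^sub>R (lap_kernel \<rho> x * h x) = h x * lap_kernel \<rho> x" for x
  proof (cases "lap_kernel \<rho> x = 0")
    case False
    then have "x \<in> kbox \<rho>" using lap_kernel_support(2)[OF \<rho> False] by (intro kbox_contains) simp
    then show ?thesis by simp
  qed simp
  have i: "set_integrable lborel (kbox \<rho>) (\<lambda>x. lap_kernel \<rho> x * h x)"
    using c unfolding set_integrable_def kbox_def by (intro borel_integrable_compact compact_cbox)
  then show "integrable lborel (\<lambda>x. h x * lap_kernel \<rho> x)" unfolding set_integrable_def z .
  show "(\<integral>x. h x * lap_kernel \<rho> x \<partial>lborel) = integral (kbox \<rho>) (\<lambda>x. lap_kernel \<rho> x * h x)"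
    using set_borel_integral_eq_integral(2)[OF i] unfolding set_lebesgue_integral_def z .
qed

lemma kernel_integral_continuous:
  fixes \<Phi> :: "'a::euclidean_space \<Rightarrow> complex \<Rightarrow> real"
  assumes \<rho>: "\<rho> > 0" and \<Omega>: "open \<Omega>" and sub: "\<And>p x. p \<in> U \<Longrightarrow> \<rho> \<le> norm x \<Longrightarrow> norm x \<le> 2 * \<rho> \<Longrightarrow> (p, x) \<in> \<Omega>"
    and cont: "continuous_on \<Omega> (\<lambda>(p, x). \<Phi> p x)"
  shows "continuous_on U (\<lambda>p. \<integral>x. \<Phi> p x * lap_kernel \<rho> x \<partial>lborel)"
proof -
  have c: "continuous_on (U \<times> kbox \<rho>) (\<lambda>(p, x). lap_kernel \<rho> x *\<^sub>R \<Phi> p x)"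
    by (rule kernel_param[OF \<rho> \<Omega> sub cont])
  have cs: "continuous_on (kbox \<rho>) (\<lambda>x. lap_kernel \<rho> x * \<Phi> p x)" if "p \<in> U" for p
  proof -
    have "continuous_on (kbox \<rho>) (\<lambda>x. (p, x))" by (intro continuous_intros)
    from continuous_on_compose2[OF c this] that show ?thesis by auto
  qed
  have "continuous_on U (\<lambda>p. integral (kbox \<rho>) (\<lambda>x. lap_kernel \<rho> x * \<Phi> p x))"
    using integral_continuous_on_param[of U _ _ "\<lambda>p x. lap_kernel \<rho> x * \<Phi> p x"] c unfolding kbox_def by simp
  then show ?thesis
    by (rule continuous_on_eq) (use kernel_integral_box(1)[OF \<rho> cs] in auto)
qed

text \<open>Differentiation under the integral sign. The derivative is given as a
  \<open>blinfun\<close> so that its joint continuity in parameter and integration variable can be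
  expressed.\<close>

lemma kernel_integral_has_derivative:
  fixes \<Phi> :: "'a::euclidean_space \<Rightarrow> complex \<Rightarrow> real" and d :: "'a \<Rightarrow> complex \<Rightarrow> 'a \<Rightarrow>\<^sub>L real"
  assumes \<rho>: "\<rho> > 0" and \<Omega>: "open \<Omega>" and sub: "\<And>p x. p \<in> U \<Longrightarrow> \<rho> \<le> norm x \<Longrightarrow> norm x \<le> 2 * \<rho> \<Longrightarrow> (p, x) \<in> \<Omega>"
    and cont: "continuous_on \<Omega> (\<lambda>(p, x). \<Phi> p x)" and dcont: "continuous_on \<Omega> (\<lambda>(p, x). d p x)"
    and der: "\<And>p x. (p, x) \<in> \<Omega> \<Longrightarrow> ((\<lambda>p. \<Phi> p x) has_derivative blinfun_apply (d p x)) (at p)"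
    and U: "open U" "convex U" "p0 \<in> U"
  shows "(\<lambda>p. \<integral>x. \<Phi> p x * lap_kernel \<rho> x \<partial>lborel) differentiable (at p0)"
proof -
  have c: "continuous_on (U \<times> kbox \<rho>) (\<lambda>(p, x). lap_kernel \<rho> x *\<^sub>R \<Phi> p x)"
    by (rule kernel_param[OF \<rho> \<Omega> sub cont])
  have dc: "continuous_on (U \<times> kbox \<rho>) (\<lambda>(p, x). lap_kernel \<rho> x *\<^sub>R d p x)"
    by (rule kernel_param[OF \<rho> \<Omega> sub dcont])
  have cs: "continuous_on (kbox \<rho>) (\<lambda>x. lap_kernel \<rho> x * \<Phi> p x)" if "p \<in> U" for p
  proof -
    have "continuous_on (kbox \<rho>) (\<lambda>x. (p, x))" by (intro continuous_intros)
    from continuous_on_compose2[OF c this] that show ?thesis by auto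
  qed
  have "((\<lambda>p. integral (kbox \<rho>) (\<lambda>x. lap_kernel \<rho> x * \<Phi> p x)) has_derivative
      blinfun_apply (integral (kbox \<rho>) (\<lambda>x. lap_kernel \<rho> x *\<^sub>R d p0 x))) (at p0 within U)"
    unfolding kbox_def
  proof (rule leibniz_rule[where U = U])
    show "continuous_on (U \<times> cbox (Complex (- 2 * \<rho>) (- 2 * \<rho>)) (Complex (2 * \<rho>) (2 * \<rho>))) (\<lambda>(p, x). lap_kernel \<rho> x *\<^sub>R d p x)"
      using dc unfolding kbox_def .
    fix p x assume p: "p \<in> U"
    show "((\<lambda>p. lap_kernel \<rho> x * \<Phi> p x) has_derivative blinfun_apply (lap_kernel \<rho> x *\<^sub>R d p x)) (at p within U)"
    proof (cases "lap_kernel \<rho> x = 0")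
      case False
      then have "(p, x) \<in> \<Omega>" using lap_kernel_support[OF \<rho> False] p by (intro sub) auto
      then show ?thesis using has_derivative_at_withinI[OF has_derivative_mult_right[OF der]]
        by (simp add: scaleR_blinfun.rep_eq)
    qed (simp add: zero_blinfun.rep_eq)
  next
    fix p assume p: "p \<in> U"
    show "(\<lambda>x. lap_kernel \<rho> x * \<Phi> p x) integrable_on cbox (Complex (- 2 * \<rho>) (- 2 * \<rho>)) (Complex (2 * \<rho>) (2 * \<rho>))"
      by (rule integrable_continuous[OF cs[OF p, unfolded kbox_def]])
  qed (use U in auto)
  then have "((\<lambda>p. integral (kbox \<rho>) (\<lambda>x. lap_kernel \<rho> x * \<Phi> p x)) has_derivative
      blinfun_apply (integral (kbox \<rho>) (\<lambda>x. lap_kernel \<rho> x *\<^sub>R d p0 x))) (at p0)"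
    using at_within_open[OF U(3,1)] by simp
  then have "((\<lambda>p. \<integral>x. \<Phi> p x * lap_kernel \<rho> x \<partial>lborel) has_derivative
      blinfun_apply (integral (kbox \<rho>) (\<lambda>x. lap_kernel \<rho> x *\<^sub>R d p0 x))) (at p0)"
    by (rule has_derivative_transform_within_open[OF _ U(1,3)]) (use kernel_integral_box(1)[OF \<rho> cs] in auto)
  then show ?thesis unfolding differentiable_def by blast
qed

section \<open>The maximum principle\<close>

lemma AE_lborel_ball:
  fixes c :: complex
  assumes "AE x in lborel. P x" "e > 0"
  obtains x where "x \<in> ball c e" "P x"
proof -
  have "\<exists>x\<in>ball c e. P x"
  proof (rule ccontr)
    assume n: "\<not> (\<exists>x\<in>ball c e. P x)"
    have "AE x in lborel. x \<notin> ball c e" using assms(1) by eventually_elim (use n in blast)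
    then have "ball c e \<in> null_sets lborel" using AE_iff_null_sets[of "ball c e" lborel] by simp
    then have "emeasure lborel (ball c e) = 0" by auto
    then have "measure lborel (ball c e) = 0" by (simp add: measure_def)
    then show False using content_ball_gt_0_iff[of c e] assms(2) by simp
  qed
  then show ?thesis using that by blast
qed

text \<open>Cocompactness and invariance give a global maximum \<open>M\<close>. Around a maximum
  point the average of \<open>M - H\<close> over an annulus is zero with a nonnegative integrand, so
  \<open>M - H\<close> vanishes wherever the kernel is positive; varying the radius shows that the
  set of maximum points is open. It is also closed, hence all of the disk.\<close>

lemma (in compact_fuchsian) max_principle:
  fixes H :: "complex \<Rightarrow> real"
  assumes cont: "continuous_on disk H" and inv: "\<And>\<gamma> z. \<gamma> \<in> F \<Longrightarrow> z \<in> disk \<Longrightarrow> H (\<gamma> z) = H z"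
    and mean: "\<And>a \<rho>. 0 < \<rho> \<Longrightarrow> cball a (2 * \<rho>) \<subseteq> disk \<Longrightarrow> avg \<rho> H a = 4 * pi * H a"
    and int: "\<And>a \<rho>. 0 < \<rho> \<Longrightarrow> cball a (2 * \<rho>) \<subseteq> disk \<Longrightarrow> integrable lborel (\<lambda>x. H (a + x) * lap_kernel \<rho> x)"
  shows "\<exists>c. \<forall>z\<in>disk. H z = c"
proof -
  obtain r where r: "0 < r" "r < 1" "\<And>z. z \<in> disk \<Longrightarrow> \<exists>\<gamma>\<in>F. \<gamma> z \<in> cball 0 r"
    using exhausting_ball by metis
  have rd: "cball 0 r \<subseteq> disk" using r by auto
  have "continuous_on (cball 0 r) H" using cont rd by (rule continuous_on_subset)
  then obtain m where m: "m \<in> cball 0 r" "\<And>z. z \<in> cball 0 r \<Longrightarrow> H z \<le> H m"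
    using continuous_attains_sup[of "cball (0::complex) r" H] r(1) by auto
  define M where "M = H m"
  have le: "H z \<le> M" if z: "z \<in> disk" for z
  proof -
    obtain \<gamma> where "\<gamma> \<in> F" "\<gamma> z \<in> cball 0 r" using r(3)[OF z] by blast
    then show ?thesis using m(2)[of "\<gamma> z"] inv[of \<gamma> z] z by (simp add: M_def)
  qed
  define S where "S = {z \<in> disk. H z = M}"
  have "closedin (top_of_set disk) S"
    unfolding S_def using continuous_closedin_preimage_constant[OF cont] .
  moreover have "openin (top_of_set disk) S"
  proof -
    have "\<exists>e>0. ball z e \<subseteq> S" if zS: "z \<in> S" for z
    proof -
      have z: "z \<in> disk" "H z = M" using zS by (auto simp: S_def)
      obtain e where e: "e > 0" "cball z e \<subseteq> disk" using cball_subset_disk[OF z(1)] by blast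
      have "H y = M" if y: "y \<in> ball z (e / 2)" for y
      proof (rule ccontr)
        assume ne: "H y \<noteq> M"
        have "y \<in> cball z e" using y e(1) by simp
        then have yd: "y \<in> disk" using e(2) by blast
        then have lt: "H y < M" using ne le by force
        define t where "t = norm (y - z)"
        have "y \<noteq> z" using ne z by auto
        then have t: "t > 0" "t < e / 2" using y by (auto simp: t_def dist_norm norm_minus_commute)
        \<comment> \<open>With this radius t / \<rho> = 11/10 lies between 1 and 6/5, so
          \<open>lap_kernel_pos\<close> applies at \<open>y - z\<close>, while t < e/2 keeps the
          annulus inside the disk.\<close>
        define \<rho> where "\<rho> = 10 / 11 * t"
        have \<rho>: "\<rho> > 0" "\<rho> < t" "t \<le> 6/5 * \<rho>" using t by (auto simp: \<rho>_def)
        have "cball z (2 * \<rho>) \<subseteq> cball z e" using t \<rho> by (intro subset_cball) simp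
        then have cd: "cball z (2 * \<rho>) \<subseteq> disk" using e by blast
        have i: "integrable lborel (\<lambda>x. M * lap_kernel \<rho> x - H (z + x) * lap_kernel \<rho> x)"
          using int[OF \<rho>(1) cd] lap_kernel_integral(1)[OF \<rho>(1)] by simp
        have "(\<integral>x. M * lap_kernel \<rho> x - H (z + x) * lap_kernel \<rho> x \<partial>lborel) = M * (4 * pi) - avg \<rho> H z"
          using int[OF \<rho>(1) cd] lap_kernel_integral[OF \<rho>(1)] by (simp add: avg_def)
        also have "\<dots> = 0" using mean[OF \<rho>(1) cd] z by simp
        finally have 0: "(\<integral>x. M * lap_kernel \<rho> x - H (z + x) * lap_kernel \<rho> x \<partial>lborel) = 0" .
        have nn: "0 \<le> M * lap_kernel \<rho> x - H (z + x) * lap_kernel \<rho> x" for x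
        proof (cases "lap_kernel \<rho> x = 0")
          case False
          then have "z + x \<in> cball z (2 * \<rho>)" using lap_kernel_support(2)[OF \<rho>(1) False] by (simp add: dist_norm)
          then have "H (z + x) \<le> M" using le cd by blast
          then show ?thesis using lap_kernel_nonneg[of \<rho> x] by (simp add: mult_right_mono flip: left_diff_distrib)
        qed simp
        have AE: "AE x in lborel. M * lap_kernel \<rho> x - H (z + x) * lap_kernel \<rho> x = 0"
          using integral_nonneg_eq_0_iff_AE[OF i] 0 nn by auto
        have "isCont (\<lambda>x. (M - H (z + x)) * lap_kernel \<rho> x) (y - z)"
        proof -
          have "isCont H (z + (y - z))" using cont yd by (simp add: continuous_on_eq_continuous_at)
          moreover have "isCont ((+) z) (y - z)" by (intro continuous_intros)
          ultimately have "isCont (\<lambda>x. H (z + x)) (y - z)" by (rule isCont_o2[rotated])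
          moreover have "isCont (lap_kernel \<rho>) (y - z)" using lap_kernel_continuous[OF \<rho>(1)] by (simp add: continuous_on_eq_continuous_at)
          ultimately show ?thesis by (intro continuous_intros)
        qed
        moreover have "(M - H (z + (y - z))) * lap_kernel \<rho> (y - z) > 0"
          using lt lap_kernel_pos[OF \<rho>(1), of "y - z"] \<rho> by (simp add: t_def)
        ultimately have "\<forall>\<^sub>F x in at (y - z). (M - H (z + x)) * lap_kernel \<rho> x > 0"
          unfolding isCont_def by (rule order_tendstoD(1))
        then obtain d where d: "d > 0" "\<And>x. x \<noteq> y - z \<Longrightarrow> dist x (y - z) < d \<Longrightarrow> (M - H (z + x)) * lap_kernel \<rho> x > 0"
          unfolding eventually_at by auto
        have d': "(M - H (z + x)) * lap_kernel \<rho> x > 0" if "x \<in> ball (y - z) d" for x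
          using d(2)[of x] that \<open>(M - H (z + (y - z))) * lap_kernel \<rho> (y - z) > 0\<close>
          by (cases "x = y - z") (auto simp: dist_commute)
        obtain x where x: "x \<in> ball (y - z) d" "M * lap_kernel \<rho> x - H (z + x) * lap_kernel \<rho> x = 0"
          using AE_lborel_ball[OF AE d(1)] by metis
        have "(M - H (z + x)) * lap_kernel \<rho> x = 0" using x(2) by (simp only: left_diff_distrib)
        then show False using d'[OF x(1)] by (metis less_irrefl)
      qed
      moreover have "ball z (e / 2) \<subseteq> disk"
      proof -
        have "ball z (e / 2) \<subseteq> cball z e" using e(1) by (auto simp: subset_eq)
        then show ?thesis using e(2) by blast
      qed
      ultimately have "ball z (e / 2) \<subseteq> S" unfolding S_def by blast
      then show ?thesis using e(1) by (intro exI[of _ "e / 2"]) simp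
    qed
    then have "open S" using open_contains_ball by blast
    then show ?thesis by (intro open_subset) (auto simp: S_def)
  qed
  moreover have "m \<in> S" using m(1) rd by (auto simp: S_def M_def)
  ultimately have "S = disk" using connected_clopen[of disk] convex_connected[OF convex_ball] by blast
  then show ?thesis by (auto simp: S_def)
qed

section \<open>Symmetries preserve the Green function\<close>

lemma avg_cong:
  assumes "\<rho> > 0" "\<And>y. y \<in> cball a (2 * \<rho>) \<Longrightarrow> H y = H' y"
  shows "(\<lambda>x. H (a + x) * lap_kernel \<rho> x) = (\<lambda>x. H' (a + x) * lap_kernel \<rho> x)" "avg \<rho> H a = avg \<rho> H' a"
proof -
  show e: "(\<lambda>x. H (a + x) * lap_kernel \<rho> x) = (\<lambda>x. H' (a + x) * lap_kernel \<rho> x)"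
  proof
    fix x
    show "H (a + x) * lap_kernel \<rho> x = H' (a + x) * lap_kernel \<rho> x"
    proof (cases "lap_kernel \<rho> x = 0")
      case False
      then have "a + x \<in> cball a (2 * \<rho>)" using lap_kernel_support(2)[OF assms(1) False] by (simp add: dist_norm)
      then show ?thesis using assms(2) by simp
    qed simp
  qed
  show "avg \<rho> H a = avg \<rho> H' a" unfolding avg_def e ..
qed

lemma moebius_union_props:
  assumes "\<sigma> \<in> moebius_preserving \<union> moebius_reversing"
  shows "z \<in> disk \<Longrightarrow> \<sigma> z \<in> disk" "inj_on \<sigma> disk" "continuous_on disk \<sigma>" "\<sigma> ` disk = disk"
proof -
  have "(\<forall>z\<in>disk. \<sigma> z \<in> disk) \<and> inj_on \<sigma> disk \<and> continuous_on disk \<sigma> \<and> \<sigma> ` disk = disk"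
  proof (cases "\<sigma> \<in> moebius_preserving")
    case True
    have "continuous_on disk \<sigma>"
      using moebius_preserving_holomorphic[OF True] holomorphic_on_imp_continuous_on by blast
    then show ?thesis
      using moebius_preserving_in_disk[OF True] moebius_preserving_bij[OF True] by (simp add: bij_betw_def)
  next
    case False
    then obtain g where g: "g \<in> moebius_preserving" "\<sigma> = (\<lambda>z\<in>disk. g (cnj z))"
      using assms moebius_reversing_iff by blast
    have gb: "inj_on g disk" "g ` disk = disk" using moebius_preserving_bij[OF g(1)] by (auto simp: bij_betw_def)
    have cd: "cnj ` disk = disk"
    proof (intro equalityI subsetI)
      fix x :: complex assume "x \<in> disk"
      then have "cnj x \<in> disk" "x = cnj (cnj x)" by auto
      then show "x \<in> cnj ` disk" by blast
    qed auto
    have "inj_on \<sigma> disk"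
    proof (rule inj_onI)
      fix x y assume h: "x \<in> disk" "y \<in> disk" "\<sigma> x = \<sigma> y"
      then have "g (cnj x) = g (cnj y)" by (simp add: g(2))
      from inj_onD[OF gb(1) this] h(1,2) show "x = y" by simp
    qed
    moreover have im: "\<sigma> ` disk = disk"
    proof -
      have "\<sigma> ` disk = g ` cnj ` disk" unfolding g(2) by (auto simp: image_image)
      then show ?thesis using cd gb by simp
    qed
    moreover have "continuous_on disk (\<lambda>z. g (cnj z))"
    proof (rule continuous_on_compose2[of disk g])
      show "continuous_on disk g"
        using moebius_preserving_holomorphic[OF g(1)] holomorphic_on_imp_continuous_on by blast
    qed (auto intro: continuous_intros)
    then have "continuous_on disk \<sigma>" by (rule continuous_on_eq) (simp add: g(2))
    ultimately show ?thesis by blast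
  qed
  then show "z \<in> disk \<Longrightarrow> \<sigma> z \<in> disk" "inj_on \<sigma> disk" "continuous_on disk \<sigma>" "\<sigma> ` disk = disk" by blast+
qed

context vortex_surface
begin

lemma orbit_map_idF: "orbit_map idF"
proof -
  have "idF ` proj F w = proj F (idF w)" if w: "w \<in> disk" for w
  proof -
    have "idF x = x" if "x \<in> proj F w" for x using in_proj_iff[OF w] that by simp
    then show ?thesis using w by simp
  qed
  then show ?thesis using F_moebius[OF idF_in] by (simp add: orbit_map_def)
qed

lemma orbit_map_proj_iff:
  assumes \<sigma>: "orbit_map \<sigma>" and zw: "z \<in> disk" "w \<in> disk"
  shows "proj F (\<sigma> z) = proj F (\<sigma> w) \<longleftrightarrow> proj F z = proj F w"
proof
  assume "proj F (\<sigma> z) = proj F (\<sigma> w)"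
  then have "\<sigma> ` proj F z = \<sigma> ` proj F w" using \<sigma> zw by (simp add: orbit_map_def)
  moreover have "proj F z \<subseteq> disk" "proj F w \<subseteq> disk" using in_proj_iff zw by blast+
  moreover have "inj_on \<sigma> disk" using \<sigma> moebius_union_props(2) by (simp add: orbit_map_def)
  ultimately show "proj F z = proj F w" using inj_on_image_eq_iff by metis
next
  assume "proj F z = proj F w"
  then have "\<sigma> ` proj F z = \<sigma> ` proj F w" by simp
  then show "proj F (\<sigma> z) = proj F (\<sigma> w)" using \<sigma> zw by (simp add: orbit_map_def)
qed

lemma G_pair_continuous:
  "continuous_on {(z, w). z \<in> disk \<and> w \<in> disk \<and> proj F z \<noteq> proj F w} (\<lambda>(z, w). G (proj F z) (proj F w))"
  using spec[OF G_smooth[unfolded smooth_on_def], of 0] by (simp only: C_diff_on.simps)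

lemma G_continuous:
  assumes "w \<in> disk"
  shows "continuous_on {z \<in> disk. proj F z \<noteq> proj F w} (\<lambda>z. G (proj F z) (proj F w))"
proof -
  have "continuous_on {z \<in> disk. proj F z \<noteq> proj F w} (\<lambda>z. (z, w))" by (intro continuous_intros)
  from continuous_on_compose2[OF G_pair_continuous this] assms show ?thesis by auto
qed

lemma G_orbit_map_continuous:
  assumes \<sigma>: "orbit_map \<sigma>" and w: "w \<in> disk"
  shows "continuous_on {z \<in> disk. proj F z \<noteq> proj F w} (\<lambda>z. G (proj F (\<sigma> z)) (proj F (\<sigma> w)))"
proof -
  have u: "\<sigma> \<in> moebius_preserving \<union> moebius_reversing" using \<sigma> by (simp add: orbit_map_def)
  have "continuous_on {z \<in> disk. proj F z \<noteq> proj F w} \<sigma>"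
    using moebius_union_props(3)[OF u] by (rule continuous_on_subset) auto
  moreover have "\<sigma> ` {z \<in> disk. proj F z \<noteq> proj F w} \<subseteq> {z \<in> disk. proj F z \<noteq> proj F (\<sigma> w)}"
    using moebius_union_props(1)[OF u] orbit_map_proj_iff[OF \<sigma> _ w] by auto
  ultimately show ?thesis
    using continuous_on_compose2[OF G_continuous[OF moebius_union_props(1)[OF u w]]] by blast
qed

lemma orbit_locally_isolated:
  assumes "z \<in> disk"
  obtains e where "e > 0" "cball z e \<subseteq> disk" "\<And>y. y \<in> cball z e \<Longrightarrow> y \<noteq> z \<Longrightarrow> proj F y \<noteq> proj F w"
proof (cases "proj F z = proj F w")
  case True
  obtain r where r: "r > 0" "cball z r \<subseteq> disk" "\<And>x y. x \<in> cball z r \<Longrightarrow> y \<in> cball z r \<Longrightarrow> proj F x = proj F y \<Longrightarrow> x = y"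
    using nice_ball_proj[OF assms] by metis
  show ?thesis
  proof (rule that[OF r(1,2)])
    fix y assume "y \<in> cball z r" "y \<noteq> z"
    then show "proj F y \<noteq> proj F w" using r(3)[of y z] r(1) True by auto
  qed
next
  case False
  show ?thesis
  proof (cases "proj F w \<in> surface F")
    case True
    then obtain v where v: "v \<in> disk" "proj F w = proj F v" by (rule surface_obtain)
    have "open {x \<in> disk. proj F x \<noteq> proj F v}" by (rule open_complement_orbit[OF v(1)])
    moreover have "z \<in> {x \<in> disk. proj F x \<noteq> proj F v}" using assms False v by simp
    ultimately obtain e where e: "e > 0" "cball z e \<subseteq> {x \<in> disk. proj F x \<noteq> proj F v}"
      using open_contains_cball by blast
    show ?thesis
    proof (rule that[OF e(1)])
      show "cball z e \<subseteq> disk" using e(2) by blast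
      show "proj F y \<noteq> proj F w" if "y \<in> cball z e" for y using e(2) that v(2) by auto
    qed
  next
    \<comment> \<open>Nothing is assumed about \<open>w\<close>; if \<open>proj F w\<close> is not a
      point of the surface, no point of the disk projects to it.\<close>
    case False
    obtain e where "e > 0" "cball z e \<subseteq> disk" using cball_subset_disk[OF assms] by blast
    then show ?thesis using that[of e] False proj_in_surface by (metis subsetD)
  qed
qed

text \<open>In the difference of the instances of \<open>avg_identity\<close> for \<sigma> and for
  the identity the right hand sides cancel, so averages of the difference are independent of the
  radius. Averages at a locally fixed radius are continuous even on the orbit of \<open>w\<close>,
  and so extend the difference to a function to which the maximum principle applies.\<close>

lemma green_difference_constant:
  assumes \<sigma>: "orbit_map \<sigma>" and w: "w \<in> disk"
  shows "\<exists>c. \<forall>z\<in>disk. proj F z \<noteq> proj F w \<longrightarrow> G (proj F (\<sigma> z)) (proj F (\<sigma> w)) - G (proj F z) (proj F w) = c"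
proof -
  define H where "H y = G (proj F (\<sigma> y)) (proj F (\<sigma> w)) - G (proj F y) (proj F w)" for y
  define X where "X = {z \<in> disk. proj F z \<noteq> proj F w}"
  have X: "open X" unfolding X_def by (rule open_complement_orbit[OF w])
  have Hc: "continuous_on X H"
    unfolding H_def X_def by (intro continuous_on_diff G_continuous G_orbit_map_continuous \<sigma> w)
  have Hi: "integrable lborel (\<lambda>x. H (a + x) * lap_kernel \<rho> x)"
    and avgH: "avg \<rho> H a = avg \<rho> (\<lambda>y. G (proj F (\<sigma> y)) (proj F (\<sigma> w))) a - avg \<rho> (\<lambda>y. G (proj F (idF y)) (proj F (idF w))) a"
    if \<rho>: "0 < \<rho>" and a: "cball a (2 * \<rho>) \<subseteq> disk" for a \<rho>
  proof -
    note i1 = avg_identity(1)[OF \<sigma> \<rho> a w] and i2 = avg_identity(1)[OF orbit_map_idF \<rho> a w]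
    have e: "G (proj F (idF y)) (proj F (idF w)) = G (proj F y) (proj F w)" if "y \<in> cball a (2 * \<rho>)" for y
    proof -
      have "y \<in> disk" using that a by blast
      then show ?thesis using w by simp
    qed
    have e1: "(\<lambda>x. G (proj F (idF (a + x))) (proj F (idF w)) * lap_kernel \<rho> x) = (\<lambda>x. G (proj F (a + x)) (proj F w) * lap_kernel \<rho> x)"
      by (rule avg_cong(1)[OF \<rho> e])
    have e2: "avg \<rho> (\<lambda>y. G (proj F (idF y)) (proj F (idF w))) a = avg \<rho> (\<lambda>y. G (proj F y) (proj F w)) a"
      by (rule avg_cong(2)[OF \<rho> e])
    have d: "(\<lambda>x. H (a + x) * lap_kernel \<rho> x) = (\<lambda>x. G (proj F (\<sigma> (a + x))) (proj F (\<sigma> w)) * lap_kernel \<rho> x -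
        G (proj F (a + x)) (proj F w) * lap_kernel \<rho> x)"
      by (simp add: H_def left_diff_distrib)
    show "integrable lborel (\<lambda>x. H (a + x) * lap_kernel \<rho> x)"
      unfolding d by (rule Bochner_Integration.integrable_diff[OF i1 i2[unfolded e1]])
    show "avg \<rho> H a = avg \<rho> (\<lambda>y. G (proj F (\<sigma> y)) (proj F (\<sigma> w))) a - avg \<rho> (\<lambda>y. G (proj F (idF y)) (proj F (idF w))) a"
      unfolding e2 unfolding avg_def d by (rule Bochner_Integration.integral_diff[OF i1 i2[unfolded e1]])
  qed
  have sub: "cball a (2 * \<rho>') \<subseteq> disk" if "cball a (2 * \<rho>) \<subseteq> disk" "\<rho>' \<le> \<rho>" for a \<rho> \<rho>'
  proof -
    have "cball a (2 * \<rho>') \<subseteq> cball a (2 * \<rho>)" using that(2) by (intro subset_cball) simp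
    then show ?thesis using that(1) by blast
  qed
  have indep: "avg \<rho>' H a = avg \<rho> H a" if \<rho>: "0 < \<rho>'" "\<rho>' \<le> \<rho>" and a: "cball a (2 * \<rho>) \<subseteq> disk" for a \<rho> \<rho>'
  proof -
    have "0 < \<rho>" using \<rho> by simp
    then show ?thesis
      using avg_identity(2)[OF \<sigma> _ a w \<rho>] avg_identity(2)[OF orbit_map_idF _ a w \<rho>] avgH[OF _ a] avgH[OF \<rho>(1) sub[OF a \<rho>(2)]] w
      by simp
  qed
  have indep': "avg \<rho>' H a = avg \<rho> H a" if "0 < \<rho>'" "0 < \<rho>" "cball a (2 * \<rho>') \<subseteq> disk" "cball a (2 * \<rho>) \<subseteq> disk" for a \<rho> \<rho>'
  proof (cases "\<rho>' \<le> \<rho>")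
    case True then show ?thesis by (rule indep[OF that(1) _ that(4)])
  next
    case False
    then have "\<rho> \<le> \<rho>'" by simp
    from indep[OF that(2) this that(3)] show ?thesis by simp
  qed
  \<comment> \<open>Independence of the radius turns the limit of small averages into an exact mean
    value property.\<close>
  have mean: "avg \<rho> H a = 4 * pi * H a" if \<rho>: "0 < \<rho>" and a: "cball a (2 * \<rho>) \<subseteq> disk" and aX: "a \<in> X" for a \<rho>
  proof -
    have "isCont H a" using Hc X aX continuous_on_eq_continuous_at by blast
    then have l: "((\<lambda>\<rho>. avg \<rho> H a) \<longlongrightarrow> 4 * pi * H a) (at_right 0)"
      by (rule avg_limit[OF _ \<rho>]) (use Hi sub[OF a] in simp_all)
    have "\<forall>\<^sub>F s in at_right 0. avg s H a = avg \<rho> H a"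
      unfolding eventually_at_right_field
    proof (intro exI[of _ \<rho>] conjI allI impI)
      show "avg s H a = avg \<rho> H a" if "0 < s" "s < \<rho>" for s using that by (intro indep[OF _ _ a]) simp_all
    qed (rule \<rho>)
    then have "((\<lambda>\<rho>. avg \<rho> H a) \<longlongrightarrow> avg \<rho> H a) (at_right 0)" by (rule tendsto_eventually)
    from tendsto_unique[OF _ this l] show ?thesis by simp
  qed
  \<comment> \<open>Any admissible radius gives the same value; (1 - |a|) / 4 is one for which the
    annulus stays in the disk, also for \<open>a\<close> on the orbit of \<open>w\<close>, where
    \<open>H\<close> itself is not meaningful.\<close>
  define H' where "H' a = avg ((1 - norm a) / 4) H a / (4 * pi)" for a
  have own: "cball a (2 * ((1 - norm a) / 4)) \<subseteq> disk" "(1 - norm a) / 4 > 0" if "a \<in> disk" for a :: complex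
  proof -
    show "(1 - norm a) / 4 > 0" using that by simp
    show "cball a (2 * ((1 - norm a) / 4)) \<subseteq> disk"
    proof
      fix x assume "x \<in> cball a (2 * ((1 - norm a) / 4))"
      then have "norm (x - a) \<le> (1 - norm a) / 2" by (simp add: dist_norm norm_minus_commute)
      then show "x \<in> disk" using norm_triangle_ineq[of a "x - a"] that by (simp add: field_simps)
    qed
  qed
  have H'avg: "avg \<rho> H a = 4 * pi * H' a" if \<rho>: "0 < \<rho>" and a: "cball a (2 * \<rho>) \<subseteq> disk" for a \<rho>
  proof -
    have "a \<in> cball a (2 * \<rho>)" using \<rho> by simp
    then have ad: "a \<in> disk" using a by blast
    show ?thesis unfolding H'_def using indep'[OF own(2)[OF ad] \<rho> own(1)[OF ad] a] by simp
  qed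
  have H'X: "H' a = H a" if "a \<in> X" for a
  proof -
    have ad: "a \<in> disk" using that by (auto simp: X_def)
    then obtain e where e: "e > 0" "cball a e \<subseteq> disk" using cball_subset_disk by blast
    show ?thesis using mean[of "e / 2" a] H'avg[of "e / 2" a] e that by simp
  qed
  have H'c: "isCont H' a" if a: "a \<in> disk" for a
  proof -
    obtain e where e: "e > 0" "cball a e \<subseteq> disk" "\<And>y. y \<in> cball a e \<Longrightarrow> y \<noteq> a \<Longrightarrow> proj F y \<noteq> proj F w"
      using orbit_locally_isolated[OF a] by metis
    \<comment> \<open>For \<open>p\<close> within \<open>\<rho> / 2\<close> of \<open>a\<close>, the
      closed annulus around \<open>p\<close> with radii \<open>\<rho>\<close> and
      \<open>2 * \<rho>\<close> misses \<open>a\<close> and stays within distance \<open>e\<close>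
      of it, so it avoids the orbit of \<open>w\<close>.\<close>
    define \<rho> where "\<rho> = e / 4"
    have \<rho>: "\<rho> > 0" using e by (simp add: \<rho>_def)
    define U where "U = ball a (\<rho> / 2)"
    define \<Omega> where "\<Omega> = (\<lambda>(p, x). p + x) -` X"
    have op: "open \<Omega>" unfolding \<Omega>_def case_prod_unfold by (intro open_vimage X continuous_intros)
    have c: "continuous_on \<Omega> (\<lambda>(p, x). H (p + x))"
      unfolding case_prod_unfold
      by (rule continuous_on_compose2[OF Hc]) (auto intro!: continuous_intros simp: \<Omega>_def)
    have inU: "(p, x) \<in> \<Omega>" if "p \<in> U" "\<rho> \<le> norm x" "norm x \<le> 2 * \<rho>" for p x
    proof -
      have p: "norm (p - a) < \<rho> / 2" using that(1) by (simp add: U_def dist_norm norm_minus_commute)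
      have "norm (p + x - a) \<le> norm (p - a) + norm x" using norm_triangle_ineq[of "p - a" x] by (simp add: algebra_simps)
      then have in1: "p + x \<in> cball a e" using p that(3) \<rho> by (simp add: dist_norm norm_minus_commute \<rho>_def)
      have "p + x \<noteq> a"
      proof
        assume "p + x = a"
        then have "p - a = - x" by (simp add: algebra_simps eq_neg_iff_add_eq_0)
        then show False using p that(2) \<rho> by simp
      qed
      then show ?thesis using in1 e(2) e(3)[OF in1] by (auto simp: \<Omega>_def X_def)
    qed
    have "continuous_on U (\<lambda>p. \<integral>x. H (p + x) * lap_kernel \<rho> x \<partial>lborel)"
      by (rule kernel_integral_continuous[OF \<rho> op inU c])
    then have "continuous_on U (\<lambda>p. avg \<rho> H p / (4 * pi))"
      unfolding avg_def by (intro continuous_intros) auto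
    moreover have "avg \<rho> H p / (4 * pi) = H' p" if "p \<in> U" for p
    proof -
      have "cball p (2 * \<rho>) \<subseteq> cball a e"
      proof
        fix x assume "x \<in> cball p (2 * \<rho>)"
        then have "dist p x \<le> 2 * \<rho>" "dist a p < \<rho> / 2" using that by (auto simp: U_def)
        then show "x \<in> cball a e" using dist_triangle[of a x p] \<rho> by (simp add: \<rho>_def)
      qed
      then show ?thesis using H'avg[OF \<rho>, of p] e(2) by auto
    qed
    ultimately have "continuous_on U H'" by (rule continuous_on_eq)
    moreover have "a \<in> U" "open U" using \<rho> by (auto simp: U_def)
    ultimately show ?thesis using continuous_on_eq_continuous_at by blast
  qed
  have punct: "\<forall>\<^sub>F y in at a. y \<in> X" if a: "a \<in> disk" for a
  proof -
    obtain e where e: "e > 0" "cball a e \<subseteq> disk" "\<And>y. y \<in> cball a e \<Longrightarrow> y \<noteq> a \<Longrightarrow> proj F y \<noteq> proj F w"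
      using orbit_locally_isolated[OF a] by metis
    show ?thesis unfolding eventually_at
    proof (intro exI[of _ e] conjI ballI impI)
      fix y assume "y \<noteq> a \<and> dist y a < e"
      then have "y \<in> cball a e" "y \<noteq> a" by (auto simp: dist_commute)
      then show "y \<in> X" using e(2,3) by (auto simp: X_def)
    qed (use e in auto)
  qed
  have lim: "(H \<longlongrightarrow> H' a) (at a)" if a: "a \<in> disk" for a
  proof -
    have "(H' \<longlongrightarrow> H' a) (at a)" using H'c[OF a] by (simp add: isCont_def)
    moreover have "\<forall>\<^sub>F y in at a. H' y = H y" using punct[OF a] by eventually_elim (rule H'X)
    ultimately show ?thesis by (rule Lim_transform_eventually)
  qed
  \<comment> \<open>On the orbit of \<open>w\<close> the value of \<open>H'\<close> is accessible
    only as a limit of \<open>H\<close>, so its invariance is obtained by letting \<open>y\<close>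
    tend to \<open>z\<close> in the invariance of \<open>H\<close>.\<close>
  have inv: "H' (\<gamma> z) = H' z" if \<gamma>: "\<gamma> \<in> F" and z: "z \<in> disk" for \<gamma> z
  proof -
    have u: "\<gamma> \<in> moebius_preserving \<union> moebius_reversing" using F_moebius[OF \<gamma>] by simp
    have "isCont \<gamma> z" using F_continuous[OF \<gamma>] z by (simp add: continuous_on_eq_continuous_at)
    then have g: "(\<gamma> \<longlongrightarrow> \<gamma> z) (at z)" by (simp add: isCont_def)
    have "\<forall>\<^sub>F y in at z. y \<in> disk" using z by (intro eventually_at_in_open') auto
    then have ne: "\<forall>\<^sub>F y in at z. \<gamma> y \<noteq> \<gamma> z"
      using eventually_neq_at_within[of z z UNIV]
    proof eventually_elim
      case (elim y)
      then show ?case using moebius_union_props(2)[OF u] z by (auto dest: inj_onD)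
    qed
    have 1: "((\<lambda>y. H (\<gamma> y)) \<longlongrightarrow> H' (\<gamma> z)) (at z)"
      by (rule filterlim_compose[OF lim[OF F_in_disk[OF \<gamma> z]]]) (use g ne in \<open>simp add: filterlim_at\<close>)
    have "H (\<gamma> y) = H y" if y: "y \<in> disk" for y
    proof -
      have "proj F (\<sigma> (\<gamma> y)) = proj F (\<sigma> y)"
        using orbit_map_proj_iff[OF \<sigma>, of "\<gamma> y" y] y \<gamma> by simp
      then show ?thesis using y \<gamma> by (simp add: H_def)
    qed
    then have "\<forall>\<^sub>F y in at z. H (\<gamma> y) = H y"
      using \<open>\<forall>\<^sub>F y in at z. y \<in> disk\<close> by (auto elim: eventually_mono)
    then have "(H \<longlongrightarrow> H' (\<gamma> z)) (at z)" using 1 by (rule Lim_transform_eventually[rotated])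
    from tendsto_unique[OF _ this lim[OF z]] show ?thesis by simp
  qed
  have "\<exists>c. \<forall>z\<in>disk. H' z = c"
  proof (rule max_principle)
    show "continuous_on disk H'" using H'c by (simp add: continuous_at_imp_continuous_on)
    fix a and \<rho> :: real assume \<rho>: "0 < \<rho>" and a: "cball a (2 * \<rho>) \<subseteq> disk"
    have fin: "finite {x \<in> cball a (2 * \<rho>). proj F x = proj F w}"
    proof -
      have "{x \<in> cball a (2 * \<rho>). proj F x = proj F w} \<subseteq> (\<lambda>\<gamma>. \<gamma> w) ` {\<gamma> \<in> F. \<exists>x\<in>{w}. \<gamma> x \<in> cball a (2 * \<rho>)}"
      proof
        fix x assume x: "x \<in> {x \<in> cball a (2 * \<rho>). proj F x = proj F w}"
        then have "x \<in> disk" using a by blast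
        then obtain \<gamma> where "\<gamma> \<in> F" "x = \<gamma> w" using x proj_eq_iff[of w x] w by auto
        then show "x \<in> (\<lambda>\<gamma>. \<gamma> w) ` {\<gamma> \<in> F. \<exists>x\<in>{w}. \<gamma> x \<in> cball a (2 * \<rho>)}" using x by blast
      qed
      moreover have "finite {\<gamma> \<in> F. \<exists>x\<in>{w}. \<gamma> x \<in> cball a (2 * \<rho>)}"
        by (rule finite_return) (use w a in auto)
      ultimately show ?thesis by (meson finite_imageI finite_subset)
    qed
    \<comment> \<open>\<open>H\<close> and its extension can differ in the ball only at the finitely
      many points of the orbit of \<open>w\<close>, which do not affect the integrals.\<close>
    define N where "N = (\<lambda>x. x - a) ` {x \<in> cball a (2 * \<rho>). proj F x = proj F w}"
    have N: "N \<in> null_sets lborel" unfolding N_def using fin by (intro finite_imp_null_set_lborel) simp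
    have ae: "AE x in lborel. H (a + x) * lap_kernel \<rho> x = H' (a + x) * lap_kernel \<rho> x"
      using AE_not_in[OF N]
    proof eventually_elim
      case (elim x)
      show ?case
      proof (cases "lap_kernel \<rho> x = 0")
        case False
        then have ax: "a + x \<in> cball a (2 * \<rho>)" using lap_kernel_support(2)[OF \<rho> False] by (simp add: dist_norm)
        have "proj F (a + x) \<noteq> proj F w"
        proof
          assume "proj F (a + x) = proj F w"
          then have "(a + x) - a \<in> N" unfolding N_def using ax by blast
          then show False using elim by simp
        qed
        then have "a + x \<in> X" using ax a by (auto simp: X_def)
        then show ?thesis using H'X by simp
      qed simp
    qed
    have H'c2: "continuous_on disk H'" using H'c by (simp add: continuous_at_imp_continuous_on)
    have m: "(\<lambda>x. H' (a + x) * lap_kernel \<rho> x) \<in> borel_measurable lborel"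
    proof -
      have "(\<lambda>y. indicator disk y *\<^sub>R H' y) \<in> borel_measurable borel"
        by (rule borel_measurable_continuous_on_indicator[OF _ H'c2]) simp
      moreover have shift: "(\<lambda>x. a + x) \<in> borel_measurable borel" by simp
      ultimately have "(\<lambda>x. indicator disk (a + x) *\<^sub>R H' (a + x)) \<in> borel_measurable borel"
        by (rule measurable_compose[rotated])
      from borel_measurable_times[OF this lap_kernel_measurable[OF \<rho>]]
      have "(\<lambda>x. (indicator disk (a + x) *\<^sub>R H' (a + x)) * lap_kernel \<rho> x) \<in> borel_measurable borel" .
      moreover have "(\<lambda>x. (indicator disk (a + x) *\<^sub>R H' (a + x)) * lap_kernel \<rho> x) = (\<lambda>x. H' (a + x) * lap_kernel \<rho> x)"
      proof
        fix x
        show "(indicator disk (a + x) *\<^sub>R H' (a + x)) * lap_kernel \<rho> x = H' (a + x) * lap_kernel \<rho> x"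
        proof (cases "lap_kernel \<rho> x = 0")
          case False
          then have "a + x \<in> cball a (2 * \<rho>)" using lap_kernel_support(2)[OF \<rho> False] by (simp add: dist_norm)
          then have "a + x \<in> disk" using a by blast
          then show ?thesis by simp
        qed simp
      qed
      ultimately show ?thesis by simp
    qed
    have mH: "(\<lambda>x. H (a + x) * lap_kernel \<rho> x) \<in> borel_measurable lborel" using Hi[OF \<rho> a] by auto
    show "integrable lborel (\<lambda>x. H' (a + x) * lap_kernel \<rho> x)"
      using integrable_cong_AE[OF mH m ae] Hi[OF \<rho> a] by blast
    have "avg \<rho> H' a = avg \<rho> H a"
      unfolding avg_def using integral_cong_AE[OF mH m ae] by simp
    then show "avg \<rho> H' a = 4 * pi * H' a" using H'avg[OF \<rho> a] by simp
  qed (rule inv)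
  then obtain c where "\<forall>z\<in>disk. H' z = c" by blast
  then have "\<forall>z\<in>disk. proj F z \<noteq> proj F w \<longrightarrow> H z = c" using H'X by (auto simp: X_def)
  then show ?thesis unfolding H_def by blast
qed

theorem G_invariant:
  assumes \<sigma>: "orbit_map \<sigma>" and invol: "involutive F \<sigma>"
    and zw: "z \<in> disk" "w \<in> disk" "proj F z \<noteq> proj F w"
  shows "G (proj F (\<sigma> z)) (proj F (\<sigma> w)) = G (proj F z) (proj F w)"
proof -
  have u: "\<sigma> \<in> moebius_preserving \<union> moebius_reversing" using \<sigma> by (simp add: orbit_map_def)
  note sd = moebius_union_props(1)[OF u]
  define h where "h z w = G (proj F (\<sigma> z)) (proj F (\<sigma> w)) - G (proj F z) (proj F w)" for z w
  have "\<forall>w\<in>disk. \<exists>c. \<forall>z\<in>disk. proj F z \<noteq> proj F w \<longrightarrow> h z w = c"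
    unfolding h_def using green_difference_constant[OF \<sigma>] by blast
  then obtain c where c: "\<And>z w. z \<in> disk \<Longrightarrow> w \<in> disk \<Longrightarrow> proj F z \<noteq> proj F w \<Longrightarrow> h z w = c w" by metis
  have sym: "h z w = h w z" if "z \<in> disk" "w \<in> disk" for z w
    unfolding h_def using G_sym[of "proj F z" "proj F w"] G_sym[of "proj F (\<sigma> z)" "proj F (\<sigma> w)"] that sd by simp
  have cc: "c w = c z" using c[OF zw] c[OF zw(2,1)] sym[OF zw(1,2)] zw(3) by simp
  have im: "\<sigma> ` proj F x = proj F (\<sigma> x)" if "x \<in> disk" for x using \<sigma> that by (simp add: orbit_map_def)
  have ss: "proj F (\<sigma> (\<sigma> x)) = proj F x" if "x \<in> disk" for x
  proof -
    have "\<sigma> ` (\<sigma> ` proj F x) = proj F x" using invol that by (simp add: involutive_def)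
    then show ?thesis using im[OF that] im[OF sd[OF that]] by simp
  qed
  have neg: "h (\<sigma> z) (\<sigma> w) = - h z w" using ss zw by (simp add: h_def)
  have ne: "proj F (\<sigma> z) \<noteq> proj F (\<sigma> w)" using orbit_map_proj_iff[OF \<sigma> zw(1,2)] zw(3) by simp
  have "h (\<sigma> z) (\<sigma> w) = c (\<sigma> w)" using c[OF sd[OF zw(1)] sd[OF zw(2)] ne] .
  \<comment> \<open>If \<sigma> w and \<open>w\<close> lie in different orbits, the symmetry of
    \<open>h\<close> equates the two constants; if they lie in the same orbit, \<open>h\<close>
    cannot distinguish them.\<close>
  moreover have "c (\<sigma> w) = c w"
  proof (cases "proj F (\<sigma> w) = proj F w")
    case False
    then show ?thesis
      using c[OF sd[OF zw(2)] zw(2)] c[OF zw(2) sd[OF zw(2)]] sym[OF zw(2) sd[OF zw(2)]] by simp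
  next
    case True
    have "h z (\<sigma> w) = h z w"
    proof -
      have "proj F (\<sigma> (\<sigma> w)) = proj F (\<sigma> w)" using ss[OF zw(2)] True by simp
      then show ?thesis using True by (simp add: h_def)
    qed
    moreover have "h z (\<sigma> w) = c (\<sigma> w)" using c[OF zw(1) sd[OF zw(2)]] zw(3) True by simp
    ultimately show ?thesis using c[OF zw] by simp
  qed
  ultimately have "h z w = 0" using neg c[OF zw] by simp
  then show ?thesis by (simp add: h_def)
qed

end

section \<open>Distances\<close>

text \<open>Since |f'(p)| (1 - |p|^2) = 1 - |f(p)|^2 \<le> 1, hyperbolic length dominates twice the
  Euclidean length of the image curve. This is weaker than the exact hyperbolic distance, but sharp
  to first order at the zero of \<open>f\<close>.\<close>

lemma hyp_length_lower_bound:
  assumes f: "f \<in> moebius_preserving" and p: "p C1_differentiable_on {0..1}" "path_image p \<subseteq> disk"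
  shows "2 * norm (f (pathfinish p) - f (pathstart p)) \<le> hyp_length p"
proof -
  have pd: "p t \<in> disk" if "t \<in> {0..1}" for t using p(2) that unfolding path_image_def by blast
  obtain p' where p': "\<And>t. t \<in> {0..1} \<Longrightarrow> (p has_vector_derivative p' t) (at t)" "continuous_on {0..1} p'"
    using p(1) unfolding C1_differentiable_on_def by blast
  have vd: "vector_derivative p (at t) = p' t" if "t \<in> {0..1}" for t
    using vector_derivative_at[OF p'(1)[OF that]] .
  have pc: "continuous_on {0..1} p"
    using p'(1) by (meson continuous_at_imp_continuous_on has_vector_derivative_continuous)
  have fh: "f holomorphic_on disk" by (rule moebius_preserving_holomorphic[OF f])
  have fd: "(f has_field_derivative deriv f (p t)) (at (p t))" if "t \<in> {0..1}" for t
    using holomorphic_derivI[OF fh open_ball pd[OF that]] .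
  have der: "((\<lambda>t. f (p t)) has_vector_derivative p' t * deriv f (p t)) (at t within {0..1})" if "t \<in> {0..1}" for t
    using has_vector_derivative_at_within[OF field_vector_diff_chain_at[OF p'(1)[OF that] fd[OF that]]]
    by (simp add: o_def)
  have I: "((\<lambda>t. p' t * deriv f (p t)) has_integral (f (p 1) - f (p 0))) {0..1}"
    by (rule fundamental_theorem_of_calculus[OF _ der]) simp_all
  have I2: "((\<lambda>t. 2 *\<^sub>R (p' t * deriv f (p t))) has_integral 2 *\<^sub>R (f (p 1) - f (p 0))) {0..1}"
    using has_integral_cmul[OF I, of 2] .
  let ?g = "\<lambda>t. 2 * norm (vector_derivative p (at t)) / (1 - (norm (p t))\<^sup>2)"
  have ne: "1 - (norm (p t))\<^sup>2 > 0" if "t \<in> {0..1}" for t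
    using pd[OF that] by (simp add: abs_square_less_1)
  have "continuous_on {0..1} (\<lambda>t. 2 * norm (p' t) / (1 - (norm (p t))\<^sup>2))"
    using ne by (intro continuous_intros p'(2) pc) force
  then have "continuous_on {0..1} ?g" by (rule continuous_on_eq) (simp add: vd)
  then have gi: "?g integrable_on {0..1}" by (rule integrable_continuous_interval)
  have "norm (integral {0..1} (\<lambda>t. 2 *\<^sub>R (p' t * deriv f (p t)))) \<le> integral {0..1} ?g"
  proof (rule integral_norm_bound_integral)
    show "(\<lambda>t. 2 *\<^sub>R (p' t * deriv f (p t))) integrable_on {0..1}" using I2 by blast
    fix t :: real assume t: "t \<in> {0..1}"
    have "norm (deriv f (p t)) * (1 - (norm (p t))\<^sup>2) \<le> 1"
      using moebius_deriv_norm(1)[OF f pd[OF t] fd[OF t]] by simp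
    then have "norm (deriv f (p t)) \<le> 1 / (1 - (norm (p t))\<^sup>2)" using ne[OF t] by (simp add: le_divide_eq)
    then have "2 * norm (p' t) * norm (deriv f (p t)) \<le> 2 * norm (p' t) * (1 / (1 - (norm (p t))\<^sup>2))"
      by (intro mult_left_mono) auto
    then show "norm (2 *\<^sub>R (p' t * deriv f (p t))) \<le> ?g t" using vd[OF t] by (simp add: norm_mult)
  qed (rule gi)
  then show ?thesis
    unfolding integral_unique[OF I2] by (simp add: hyp_length_def pathfinish_def pathstart_def)
qed

text \<open>The straight segment is the comparison curve for the upper bound on the distance; along
  it the conformal factor is at most its value at radius \<open>m\<close>.\<close>

lemma hyp_length_linepath:
  assumes "norm y \<le> m" "norm z \<le> m" "m < 1"
  shows "hyp_length (linepath y z) \<le> 2 * norm (y - z) / (1 - m\<^sup>2)"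
    "linepath y z C1_differentiable_on {0..1}" "path_image (linepath y z) \<subseteq> disk"
proof -
  have seg: "norm (linepath y z t) \<le> m" if "t \<in> {0..1}" for t
  proof -
    have "linepath y z t \<in> closed_segment y z" using that by (metis imageI path_image_def path_image_linepath)
    moreover have "closed_segment y z \<subseteq> cball 0 m" using assms by (intro closed_segment_subset) auto
    ultimately show ?thesis by auto
  qed
  show C1: "linepath y z C1_differentiable_on {0..1}"
    unfolding C1_differentiable_on_def
    by (intro exI[of _ "\<lambda>_. z - y"]) (auto intro: has_vector_derivative_linepath_within)
  show "path_image (linepath y z) \<subseteq> disk" unfolding path_image_def using seg assms(3) by force
  have m0: "0 \<le> m" using assms(1) norm_ge_zero order_trans by blast
  have m1: "1 - m\<^sup>2 > 0" using m0 assms(3) by (simp add: abs_square_less_1)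
  let ?g = "\<lambda>t. 2 * norm (vector_derivative (linepath y z) (at t)) / (1 - (norm (linepath y z t))\<^sup>2)"
  have b: "0 \<le> ?g t \<and> ?g t \<le> 2 * norm (y - z) / (1 - m\<^sup>2)" if "t \<in> {0..1}" for t
  proof -
    have "(norm (linepath y z t))\<^sup>2 \<le> m\<^sup>2" using seg[OF that] by (intro power_mono) auto
    then show ?thesis using m1 by (auto simp: norm_minus_commute intro!: divide_left_mono mult_pos_pos divide_nonneg_nonneg)
  qed
  have "continuous_on {0..1} ?g"
  proof -
    have "1 - (norm (linepath y z t))\<^sup>2 \<noteq> 0" if "t \<in> {0..1}" for t
    proof -
      have "(norm (linepath y z t))\<^sup>2 \<le> m\<^sup>2" using seg[OF that] by (intro power_mono) auto
      then show ?thesis using m1 by linarith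
    qed
    then show ?thesis by (simp del: of_real_diff) (intro continuous_intros continuous_on_linepath, auto)
  qed
  then have "?g integrable_on {0..1}" by (rule integrable_continuous_interval)
  then have "integral {0..1} ?g \<le> integral {0..1} (\<lambda>t::real. 2 * norm (y - z) / (1 - m\<^sup>2))"
    by (rule integral_le) (use b in auto)
  then show "hyp_length (linepath y z) \<le> 2 * norm (y - z) / (1 - m\<^sup>2)" by (simp add: hyp_length_def)
qed

lemma moebius_center: "norm a < 1 \<Longrightarrow> restrict (moeb 1 a) disk \<in> moebius_preserving"
  unfolding moebius_preserving_iff by (intro exI[of _ 1] exI[of _ a]) simp

section \<open>First order asymptotics of the Riemannian distance\<close>

context free_fuchsian
begin

text \<open>For the lower bound, a path between the two orbits is moved by the group so that it ends
  at \<open>z\<close>. It then starts at \<open>y\<close> or at another orbit point \<open>v\<close>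
  with |v - z| \<ge> r; as |1 - cnj z v| \<le> 2, the quotient of such a \<open>v\<close> is at
  least \<open>r / 2\<close>, which is where the assumption on the quotient of \<open>y\<close>
  enters.\<close>

lemma surface_dist_bounds:
  assumes z: "z \<in> disk" and y: "y \<in> disk" and r: "r > 0"
    and nice: "\<And>v. v \<in> disk \<Longrightarrow> proj F v = proj F y \<Longrightarrow> v \<noteq> y \<Longrightarrow> r \<le> norm (v - z)"
    and small: "norm (y - z) / norm (1 - cnj z * y) \<le> r / 2"
  shows "2 * (norm (y - z) / norm (1 - cnj z * y)) \<le> surface_dist (proj F y) (proj F z)"
    and "surface_dist (proj F y) (proj F z) \<le> 2 * norm (y - z) / (1 - (max (norm y) (norm z))\<^sup>2)"
proof -
  define S where "S = {hyp_length p | p. p C1_differentiable_on {0..1} \<and> path_image p \<subseteq> disk \<and>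
                             pathstart p \<in> proj F y \<and> pathfinish p \<in> proj F z}"
  have lower: "2 * (norm (y - z) / norm (1 - cnj z * y)) \<le> l" if lS: "l \<in> S" for l
  proof -
    obtain p where p: "l = hyp_length p" "p C1_differentiable_on {0..1}" "path_image p \<subseteq> disk"
      "pathstart p \<in> proj F y" "pathfinish p \<in> proj F z" using lS unfolding S_def by blast
    obtain \<gamma> where \<gamma>: "\<gamma> \<in> F" "pathfinish p = \<gamma> z" using p(5) by (auto simp: proj_def)
    obtain \<eta> where \<eta>: "\<eta> \<in> F" "\<And>z. z \<in> disk \<Longrightarrow> \<eta> (\<gamma> z) = z" "\<And>z. z \<in> disk \<Longrightarrow> \<gamma> (\<eta> z) = z"
      using F_inv[OF \<gamma>(1)] by blast
    have zc: "restrict (moeb 1 z) disk \<in> moebius_preserving" using z by (intro moebius_center) simp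
    obtain f where f: "f \<in> moebius_preserving" "\<forall>x\<in>disk. f x = restrict (moeb 1 z) disk (\<eta> x)"
      using moebius_preserving_compose[OF zc F_moebius[OF \<eta>(1)]] by blast
    define v where "v = \<eta> (pathstart p)"
    have ps: "pathstart p \<in> disk" "proj F (pathstart p) = proj F y" using p(4) in_proj_iff[OF y] by auto
    have v: "v \<in> disk" "proj F v = proj F y" using ps \<eta>(1) by (auto simp: v_def)
    have f0: "f (pathfinish p) = 0" using f(2) \<eta> \<gamma> z by (simp add: moeb_def)
    have f1: "norm (f (pathstart p)) = norm (v - z) / norm (1 - cnj z * v)"
      using f(2) ps(1) \<eta>(1) by (simp add: v_def moeb_def norm_divide)
    have "2 * (norm (v - z) / norm (1 - cnj z * v)) \<le> l"
      using hyp_length_lower_bound[OF f(1) p(2,3)] f0 f1 p(1) by simp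
    moreover have "norm (y - z) / norm (1 - cnj z * y) \<le> norm (v - z) / norm (1 - cnj z * v)"
    proof (cases "v = y")
      case False
      have "norm (cnj z * v) \<le> 1" using z v(1) by (simp add: norm_mult mult_le_one)
      then have "norm (1 - cnj z * v) \<le> 2" using norm_triangle_ineq4[of 1 "cnj z * v"] by simp
      moreover have "norm (1 - cnj z * v) > 0" using one_minus_cnj_mult_nonzero[of z v] z v(1) by simp
      ultimately have "r / 2 \<le> norm (v - z) / norm (1 - cnj z * v)"
        using nice[OF v False] r by (intro frac_le) auto
      then show ?thesis using small by linarith
    qed simp
    ultimately show ?thesis by linarith
  qed
  define m where "m = max (norm y) (norm z)"
  have m: "norm y \<le> m" "norm z \<le> m" "m < 1" using y z by (auto simp: m_def)
  have inS: "hyp_length (linepath y z) \<in> S"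
    unfolding S_def using hyp_length_linepath(2,3)[OF m] self_in_proj[OF y] self_in_proj[OF z] by force
  have sd: "surface_dist (proj F y) (proj F z) = Inf S" by (simp add: surface_dist_def S_def)
  show "2 * (norm (y - z) / norm (1 - cnj z * y)) \<le> surface_dist (proj F y) (proj F z)"
    unfolding sd by (rule cInf_greatest) (use inS lower in blast)+
  have "Inf S \<le> hyp_length (linepath y z)"
    by (rule cInf_lower[OF inS]) (use lower in \<open>auto simp: bdd_below_def\<close>)
  then show "surface_dist (proj F y) (proj F z) \<le> 2 * norm (y - z) / (1 - (max (norm y) (norm z))\<^sup>2)"
    unfolding sd using hyp_length_linepath(1)[OF m] by (simp add: m_def)
qed

text \<open>The two bounds of \<open>surface_dist_bounds\<close>, divided by |y - z|, have the same
  limit, so the Robin function needs no exact formula for the distance.\<close>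

lemma surface_dist_limit:
  assumes z: "z \<in> disk"
  shows "((\<lambda>y. surface_dist (proj F y) (proj F z) / norm (y - z)) \<longlongrightarrow> 2 / (1 - (norm z)\<^sup>2)) (at z)"
proof -
  obtain r where r: "r > 0" "cball z r \<subseteq> disk" "\<And>x y. x \<in> cball z r \<Longrightarrow> y \<in> cball z r \<Longrightarrow> proj F x = proj F y \<Longrightarrow> x = y"
    using nice_ball_proj[OF z] by metis
  have z1: "1 - (norm z)\<^sup>2 > 0" using z by (simp add: abs_square_less_1)
  have zz: "1 - cnj z * z = of_real (1 - (norm z)\<^sup>2)"
    by (simp add: complex_norm_square[symmetric] mult.commute)
  have nz: "norm (1 - cnj z * z) = 1 - (norm z)\<^sup>2" unfolding zz using z1 by (simp del: of_real_diff)
  have l1: "((\<lambda>y. 2 / norm (1 - cnj z * y)) \<longlongrightarrow> 2 / (1 - (norm z)\<^sup>2)) (at z)"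
    unfolding nz[symmetric] using z1 nz by (intro tendsto_intros) auto
  have "((\<lambda>y. 2 / (1 - (max (norm y) (norm z))\<^sup>2)) \<longlongrightarrow> 2 / (1 - (max (norm z) (norm z))\<^sup>2)) (at z)"
    using z1 by (intro tendsto_intros) auto
  then have l2: "((\<lambda>y. 2 / (1 - (max (norm y) (norm z))\<^sup>2)) \<longlongrightarrow> 2 / (1 - (norm z)\<^sup>2)) (at z)" by simp
  have "((\<lambda>y. norm (y - z) / norm (1 - cnj z * y)) \<longlongrightarrow> norm (z - z) / norm (1 - cnj z * z)) (at z)"
    using z1 nz by (intro tendsto_intros) auto
  then have "\<forall>\<^sub>F y in at z. norm (y - z) / norm (1 - cnj z * y) < r / 2"
    using r(1) by (intro order_tendstoD(2)) auto
  moreover have "\<forall>\<^sub>F y in at z. y \<in> ball z r \<and> y \<noteq> z"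
    using r(1) by (auto simp: eventually_at dist_commute intro!: exI[of _ r])
  ultimately have ev: "\<forall>\<^sub>F y in at z. 2 / norm (1 - cnj z * y) \<le> surface_dist (proj F y) (proj F z) / norm (y - z) \<and>
      surface_dist (proj F y) (proj F z) / norm (y - z) \<le> 2 / (1 - (max (norm y) (norm z))\<^sup>2)"
  proof eventually_elim
    case (elim y)
    have yb: "y \<in> cball z r" using elim by auto
    then have yd: "y \<in> disk" using r(2) by blast
    have "r \<le> norm (v - z)" if "v \<in> disk" "proj F v = proj F y" "v \<noteq> y" for v
    proof (rule ccontr)
      assume "\<not> r \<le> norm (v - z)"
      then have "v \<in> cball z r" by (simp add: dist_norm norm_minus_commute)
      then show False using r(3)[of v y] yb that by blast
    qed
    moreover have "norm (y - z) / norm (1 - cnj z * y) \<le> r / 2" using elim by simp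
    ultimately have b: "2 * (norm (y - z) / norm (1 - cnj z * y)) \<le> surface_dist (proj F y) (proj F z)"
      "surface_dist (proj F y) (proj F z) \<le> 2 * norm (y - z) / (1 - (max (norm y) (norm z))\<^sup>2)"
      using surface_dist_bounds[OF z yd r(1)] by blast+
    have n: "norm (y - z) > 0" using elim by simp
    have "2 / norm (1 - cnj z * y) * norm (y - z) \<le> surface_dist (proj F y) (proj F z)" using b(1) by simp
    moreover have "surface_dist (proj F y) (proj F z) \<le> 2 / (1 - (max (norm y) (norm z))\<^sup>2) * norm (y - z)"
      using b(2) by simp
    ultimately show ?case unfolding pos_le_divide_eq[OF n] pos_divide_le_eq[OF n] by blast
  qed
  show ?thesis
    by (rule tendsto_sandwich[OF _ _ l1 l2]) (use ev in \<open>auto elim: eventually_mono\<close>)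
qed

text \<open>The projection is open, so a limit along lifts gives a limit in the quotient topology.
  To read off the value of \<open>Lim\<close>, it is also shown that no point of the surface is
  isolated.\<close>

lemma tendsto_atin_proj:
  assumes z: "z \<in> disk" and l: "((\<lambda>y. h (proj F y)) \<longlongrightarrow> l) (at z)"
  shows "(h \<longlongrightarrow> l) (atin (surface_topology F) (proj F z))" "Lim (atin (surface_topology F) (proj F z)) h = (l :: real)"
proof -
  show t: "(h \<longlongrightarrow> l) (atin (surface_topology F) (proj F z))"
    unfolding tendsto_def
  proof (intro allI impI)
    fix S :: "real set" assume S: "open S" "l \<in> S"
    then have "\<forall>\<^sub>F y in at z. h (proj F y) \<in> S" using l unfolding tendsto_def by blast
    then obtain d where d: "d > 0" "\<And>y. y \<noteq> z \<Longrightarrow> dist y z < d \<Longrightarrow> h (proj F y) \<in> S"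
      unfolding eventually_at by auto
    obtain r where r: "r > 0" "cball z r \<subseteq> disk" using cball_subset_disk[OF z] by blast
    define U where "U = ball z (min d r)"
    have Ud: "U \<subseteq> disk" unfolding U_def using r(2) by (force simp: subset_eq)
    have "openin (surface_topology F) (proj F ` U)" by (rule openin_proj_image[OF _ Ud]) (simp add: U_def)
    moreover have "proj F z \<in> proj F ` U" using d r by (simp add: U_def)
    moreover have "\<forall>x\<in>proj F ` U - {proj F z}. h x \<in> S"
    proof
      fix x assume "x \<in> proj F ` U - {proj F z}"
      then obtain y where "x = proj F y" "y \<in> U" "y \<noteq> z" by auto
      then show "h x \<in> S" using d(2)[of y] by (simp add: U_def dist_commute)
    qed
    ultimately show "\<forall>\<^sub>F x in atin (surface_topology F) (proj F z). h x \<in> S"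
      unfolding eventually_atin by blast
  qed
  have "\<not> trivial_limit (atin (surface_topology F) (proj F z))"
  proof
    assume "trivial_limit (atin (surface_topology F) (proj F z))"
    then have "\<forall>\<^sub>F x in atin (surface_topology F) (proj F z). False" by (simp add: trivial_limit_def)
    moreover have "proj F z \<in> topspace (surface_topology F)" using z by (simp add: topspace_surface)
    ultimately obtain U where U: "openin (surface_topology F) U" "proj F z \<in> U" "\<forall>x\<in>U - {proj F z}. False"
      unfolding eventually_atin by blast
    have "open {y \<in> disk. proj F y \<in> U}" using U(1) by (simp add: openin_surface_topology)
    moreover have "z \<in> {y \<in> disk. proj F y \<in> U}" using z U(2) by simp
    ultimately obtain e where e: "e > 0" "ball z e \<subseteq> {y \<in> disk. proj F y \<in> U}" using open_contains_ball by blast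
    obtain r where r: "r > 0" "cball z r \<subseteq> disk" "\<And>x y. x \<in> cball z r \<Longrightarrow> y \<in> cball z r \<Longrightarrow> proj F x = proj F y \<Longrightarrow> x = y"
      using nice_ball_proj[OF z] by metis
    define y where "y = z + of_real (min e r / 2)"
    have yz: "dist z y = min e r / 2" using e r by (simp add: y_def dist_norm)
    have "proj F y \<in> U" using e yz r by (auto dest!: subsetD[of _ _ y])
    then have "proj F y = proj F z" using U(3) by blast
    then have "y = z" using r(3)[of y z] yz r(1) e(1) by auto
    then show False using yz e r by simp
  qed
  then show "Lim (atin (surface_topology F) (proj F z)) h = l" using t by (rule tendsto_Lim)
qed

end

section \<open>The Robin function\<close>

context vortex_surface
begin

abbreviation "off_diag \<equiv> {(z, w). z \<in> disk \<and> w \<in> disk \<and> proj F z \<noteq> proj F w}"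

definition Gp :: "complex \<times> complex \<Rightarrow> real" where
  "Gp q = G (proj F (fst q)) (proj F (snd q))"

lemma Gp_C1:
  "q \<in> off_diag \<Longrightarrow> Gp differentiable (at q)"
  "b \<in> Basis \<Longrightarrow> continuous_on off_diag (\<lambda>q. frechet_derivative Gp (at q) b)"
proof -
  have "C_diff_on (Suc 0) off_diag Gp"
    using spec[OF G_smooth[unfolded smooth_on_def], of "Suc 0"]
    by (simp only: Gp_def[abs_def] case_prod_unfold)
  then show "q \<in> off_diag \<Longrightarrow> Gp differentiable (at q)"
    "b \<in> Basis \<Longrightarrow> continuous_on off_diag (\<lambda>q. frechet_derivative Gp (at q) b)"
    unfolding C_diff_on.simps by blast+
qed

text \<open>The derivative of \<open>Gp\<close> assembled from its partial derivatives as a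
  \<open>blinfun\<close>, so that continuity of the partials yields continuity of the derivative in
  operator norm.\<close>

definition dG :: "complex \<times> complex \<Rightarrow> (complex \<times> complex) \<Rightarrow>\<^sub>L real" where
  "dG q = (\<Sum>b\<in>Basis. frechet_derivative Gp (at q) b *\<^sub>R blinfun_inner_left b)"

lemma dG_derivative:
  assumes "q \<in> off_diag" shows "(Gp has_derivative blinfun_apply (dG q)) (at q)"
proof -
  have d: "(Gp has_derivative frechet_derivative Gp (at q)) (at q)"
    using Gp_C1(1)[OF assms] frechet_derivative_works by blast
  then have l: "linear (frechet_derivative Gp (at q))" by (rule has_derivative_linear)
  have "frechet_derivative Gp (at q) h = blinfun_apply (dG q) h" for h
  proof -
    have "frechet_derivative Gp (at q) h = frechet_derivative Gp (at q) (\<Sum>b\<in>Basis. (h \<bullet> b) *\<^sub>R b)"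
      by (simp add: euclidean_representation)
    also have "\<dots> = (\<Sum>b\<in>Basis. (h \<bullet> b) *\<^sub>R frechet_derivative Gp (at q) b)"
      using l by (simp add: linear_sum linear_scale)
    also have "\<dots> = blinfun_apply (dG q) h"
      by (simp add: dG_def blinfun.sum_left blinfun.scaleR_left mult.commute)
    finally show ?thesis .
  qed
  then have "frechet_derivative Gp (at q) = blinfun_apply (dG q)" by blast
  then show ?thesis using d by simp
qed

lemma dG_continuous: "continuous_on off_diag dG"
  unfolding dG_def by (intro continuous_on_sum continuous_on_scaleR continuous_on_const Gp_C1(2))

lemma Gp_continuous: "continuous_on off_diag Gp"
  using G_pair_continuous by (simp only: Gp_def[abs_def] case_prod_unfold)

text \<open>The average of the Green function over an annulus around \<open>p\<close>, the second argument
  \<open>\<l> p\<close> being the centre \<open>p\<close> itself or a constant.\<close>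

lemma avg_green_differentiable:
  fixes \<l> :: "complex \<Rightarrow> complex" and L :: "complex \<Rightarrow>\<^sub>L complex"
  assumes \<rho>: "\<rho> > 0" and U: "open U" "convex U" "p0 \<in> U"
    and l: "\<And>p. (\<l> has_derivative blinfun_apply L) (at p)"
    and off: "\<And>p x. p \<in> U \<Longrightarrow> \<rho> \<le> norm x \<Longrightarrow> norm x \<le> 2 * \<rho> \<Longrightarrow> (p + x, \<l> p) \<in> off_diag"
  shows "(\<lambda>p. avg \<rho> (\<lambda>y. G (proj F y) (proj F (\<l> p))) p) differentiable (at p0)"
proof -
  define \<Omega> where "\<Omega> = (\<lambda>(p, x). (p + x, \<l> p)) -` off_diag"
  have lc: "continuous_on UNIV \<l>" using l has_derivative_continuous by (blast intro: continuous_at_imp_continuous_on)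
  have mc: "continuous_on S (\<lambda>(p, x). (p + x, \<l> p))" for S
  proof -
    have "continuous_on S (\<lambda>q. \<l> (fst q))"
      by (rule continuous_on_compose2[OF lc continuous_on_fst[OF continuous_on_id]]) simp
    moreover have "continuous_on S (\<lambda>q. fst q + snd q :: complex)"
      by (rule continuous_on_add[OF continuous_on_fst[OF continuous_on_id] continuous_on_snd[OF continuous_on_id]])
    ultimately show ?thesis unfolding case_prod_unfold by (rule continuous_on_Pair[rotated])
  qed
  have op: "open \<Omega>" unfolding \<Omega>_def by (rule open_vimage[OF open_off_diagonal mc])
  define M where "M = Blinfun (\<lambda>h. (h, blinfun_apply L h))"
  have bl: "bounded_linear (\<lambda>h. (h, blinfun_apply L h))"
    by (intro bounded_linear_Pair bounded_linear_ident blinfun.bounded_linear_right)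
  have Mh: "blinfun_apply M h = (h, blinfun_apply L h)" for h
    unfolding M_def by (simp add: bounded_linear_Blinfun_apply[OF bl])
  define d where "d p x = dG (p + x, \<l> p) o\<^sub>L M" for p x
  have "(\<lambda>p. \<integral>x. Gp (p + x, \<l> p) * lap_kernel \<rho> x \<partial>lborel) differentiable (at p0)"
  proof (rule kernel_integral_has_derivative[OF \<rho> op _ _ _ _ U, where d = d])
    show "(p, x) \<in> \<Omega>" if "p \<in> U" "\<rho> \<le> norm x" "norm x \<le> 2 * \<rho>" for p x
      unfolding \<Omega>_def using off[OF that] by simp
    have "continuous_on \<Omega> (\<lambda>q. Gp ((\<lambda>(p, x). (p + x, \<l> p)) q))"
      by (rule continuous_on_compose2[OF Gp_continuous mc]) (auto simp: \<Omega>_def)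
    then show "continuous_on \<Omega> (\<lambda>(p, x). Gp (p + x, \<l> p))" by (simp add: case_prod_unfold)
    have "continuous_on \<Omega> (\<lambda>q. dG ((\<lambda>(p, x). (p + x, \<l> p)) q))"
      by (rule continuous_on_compose2[OF dG_continuous mc]) (auto simp: \<Omega>_def)
    then have "continuous_on \<Omega> (\<lambda>q. dG ((\<lambda>(p, x). (p + x, \<l> p)) q) o\<^sub>L M)" by (intro continuous_intros)
    then show "continuous_on \<Omega> (\<lambda>(p, x). d p x)" by (simp add: d_def case_prod_unfold)
    fix p x assume "(p, x) \<in> \<Omega>"
    then have q: "(p + x, \<l> p) \<in> off_diag" by (simp add: \<Omega>_def)
    have "((\<lambda>p. (p + x, \<l> p)) has_derivative (\<lambda>h. (h + 0, blinfun_apply L h))) (at p)"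
      by (intro has_derivative_Pair has_derivative_add has_derivative_ident has_derivative_const l)
    from has_derivative_compose[OF this dG_derivative[OF q]]
    have "((\<lambda>p. Gp (p + x, \<l> p)) has_derivative (\<lambda>h. blinfun_apply (dG (p + x, \<l> p)) (h + 0, blinfun_apply L h))) (at p)" .
    moreover have "(\<lambda>h. blinfun_apply (dG (p + x, \<l> p)) (h + 0, blinfun_apply L h)) = blinfun_apply (d p x)"
      by (simp add: fun_eq_iff d_def Mh)
    ultimately show "((\<lambda>p. Gp (p + x, \<l> p)) has_derivative blinfun_apply (d p x)) (at p)" by simp
  qed
  then show ?thesis by (simp add: avg_def Gp_def)
qed

lemma avg_green_continuous:
  assumes \<rho>: "\<rho> > 0" and off: "\<And>p x. p \<in> U \<Longrightarrow> \<rho> \<le> norm x \<Longrightarrow> norm x \<le> 2 * \<rho> \<Longrightarrow> (p + x, w) \<in> off_diag"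
  shows "continuous_on U (\<lambda>p. avg \<rho> (\<lambda>y. G (proj F y) (proj F w)) p)"
proof -
  define \<Omega> where "\<Omega> = (\<lambda>(p, x). (p + x, w)) -` off_diag"
  have mc: "continuous_on S (\<lambda>(p, x). (p + x :: complex, w))" for S
    unfolding case_prod_unfold
    by (rule continuous_on_Pair[OF continuous_on_add[OF continuous_on_fst[OF continuous_on_id]
      continuous_on_snd[OF continuous_on_id]] continuous_on_const])
  have op: "open \<Omega>" unfolding \<Omega>_def by (rule open_vimage[OF open_off_diagonal mc])
  have "continuous_on U (\<lambda>p. \<integral>x. Gp (p + x, w) * lap_kernel \<rho> x \<partial>lborel)"
  proof (rule kernel_integral_continuous[OF \<rho> op])
    show "(p, x) \<in> \<Omega>" if "p \<in> U" "\<rho> \<le> norm x" "norm x \<le> 2 * \<rho>" for p x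
      unfolding \<Omega>_def using off[OF that] by simp
    have "continuous_on \<Omega> (\<lambda>q. Gp ((\<lambda>(p, x). (p + x, w)) q))"
      by (rule continuous_on_compose2[OF Gp_continuous mc]) (auto simp: \<Omega>_def)
    then show "continuous_on \<Omega> (\<lambda>(p, x). Gp (p + x, w))" by (simp add: case_prod_unfold)
  qed
  then show ?thesis by (simp add: avg_def Gp_def)
qed

text \<open>The case of the identity symmetry, freed from \<open>idF\<close>, which acts as the
  identity only on the disk.\<close>

lemma avg_identity_id:
  assumes \<rho>: "0 < \<rho>" and a: "cball a (2 * \<rho>) \<subseteq> disk" and w: "w \<in> disk"
  shows "integrable lborel (\<lambda>x. G (proj F (a + x)) (proj F w) * lap_kernel \<rho> x)"
    and "0 < \<rho>' \<Longrightarrow> \<rho>' \<le> \<rho> \<Longrightarrow>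
      avg \<rho>' (\<lambda>y. G (proj F y) (proj F w)) a - avg \<rho> (\<lambda>y. G (proj F y) (proj F w)) a =
      orbit_sum (cball a (2 * \<rho>)) (\<lambda>x. test_fun \<rho> \<rho>' (x - a)) (proj F w)
        - (LINT y:disk|lborel. lam y * test_fun \<rho> \<rho>' (y - a)) / total_area F"
proof -
  have e: "G (proj F (idF y)) (proj F (idF w)) = G (proj F y) (proj F w)" if "y \<in> cball a (2 * \<rho>)" for y
  proof -
    have "y \<in> disk" using that a by blast
    then show ?thesis using w by simp
  qed
  have e1: "(\<lambda>x. G (proj F (idF (a + x))) (proj F (idF w)) * lap_kernel \<rho> x) = (\<lambda>x. G (proj F (a + x)) (proj F w) * lap_kernel \<rho> x)"
    by (rule avg_cong(1)[OF \<rho> e])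
  show "integrable lborel (\<lambda>x. G (proj F (a + x)) (proj F w) * lap_kernel \<rho> x)"
    using avg_identity(1)[OF orbit_map_idF \<rho> a w] unfolding e1 .
  assume \<rho>': "0 < \<rho>'" "\<rho>' \<le> \<rho>"
  have "cball a (2 * \<rho>') \<subseteq> cball a (2 * \<rho>)" using \<rho>'(2) by (intro subset_cball) simp
  then have e': "G (proj F (idF y)) (proj F (idF w)) = G (proj F y) (proj F w)" if "y \<in> cball a (2 * \<rho>')" for y
    using e that by blast
  have e2: "avg \<rho> (\<lambda>y. G (proj F (idF y)) (proj F (idF w))) a = avg \<rho> (\<lambda>y. G (proj F y) (proj F w)) a"
    by (rule avg_cong(2)[OF \<rho> e])
  have e3: "avg \<rho>' (\<lambda>y. G (proj F (idF y)) (proj F (idF w))) a = avg \<rho>' (\<lambda>y. G (proj F y) (proj F w)) a"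
    by (rule avg_cong(2)[OF \<rho>'(1) e'])
  show "avg \<rho>' (\<lambda>y. G (proj F y) (proj F w)) a - avg \<rho> (\<lambda>y. G (proj F y) (proj F w)) a =
      orbit_sum (cball a (2 * \<rho>)) (\<lambda>x. test_fun \<rho> \<rho>' (x - a)) (proj F w)
        - (LINT y:disk|lborel. lam y * test_fun \<rho> \<rho>' (y - a)) / total_area F"
    using avg_identity(2)[OF orbit_map_idF \<rho> a w \<rho>'] unfolding e2 e3 .
qed

lemma avg_green_limit:
  assumes "z \<in> disk" "w \<in> disk" "proj F z \<noteq> proj F w"
  shows "((\<lambda>s. avg s (\<lambda>y. G (proj F y) (proj F w)) z) \<longlongrightarrow> 4 * pi * G (proj F z) (proj F w)) (at_right 0)"
proof -
  obtain e where e: "e > 0" "cball z e \<subseteq> disk" using cball_subset_disk[OF assms(1)] by blast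
  have "isCont (\<lambda>y. G (proj F y) (proj F w)) z"
  proof (rule bspec[OF iffD1[OF continuous_on_eq_continuous_at[OF open_complement_orbit[OF assms(2)]] G_continuous[OF assms(2)]]])
    show "z \<in> {z \<in> disk. proj F z \<noteq> proj F w}" using assms(1,3) by simp
  qed
  then show ?thesis
  proof (rule avg_limit[of _ _ "e / 2"])
    fix s assume s: "0 < s" "s < e / 2"
    have "cball z (2 * s) \<subseteq> cball z e" using s by (intro subset_cball) simp
    then show "integrable lborel (\<lambda>x. G (proj F (z + x)) (proj F w) * lap_kernel s x)"
      using avg_identity_id(1)[OF s(1) _ assms(2)] e(2) by blast
  qed (use e in simp)
qed

text \<open>Subtract the averaging identities for the sources \<open>w\<close> and \<open>w1\<close>
  with common centre \<open>z\<close>, and let the inner radius tend to 0. The area term cancels; of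
  the two orbits only the point \<open>w\<close> lies in the ball, and the test function there
  produces the logarithm. The factors 4 pi and 2 come from the mass of the kernel and from the
  squared norm inside the logarithm.\<close>

lemma green_local:
  assumes z0: "z0 \<in> disk"
  obtains \<rho> w1 where "\<rho> > 0" "w1 \<in> disk" "cball z0 (4 * \<rho>) \<subseteq> disk"
    "\<And>x y. x \<in> cball z0 (4 * \<rho>) \<Longrightarrow> y \<in> cball z0 (4 * \<rho>) \<Longrightarrow> proj F x = proj F y \<Longrightarrow> x = y"
    "\<And>x. x \<in> cball z0 (4 * \<rho>) \<Longrightarrow> proj F x \<noteq> proj F w1"
    "\<And>z w. z \<in> ball z0 (\<rho> / 2) \<Longrightarrow> w \<in> ball z0 (\<rho> / 2) \<Longrightarrow> z \<noteq> w \<Longrightarrow>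
      4 * pi * G (proj F z) (proj F w) + 2 * ln (norm (z - w)) = 4 * pi * G (proj F z) (proj F w1) +
        (avg \<rho> (\<lambda>y. G (proj F y) (proj F w)) z - avg \<rho> (\<lambda>y. G (proj F y) (proj F w1)) z) + (2 * ln \<rho> + 1 - ramp 1)"
proof -
  obtain r where r: "r > 0" "cball z0 r \<subseteq> disk" "\<And>x y. x \<in> cball z0 r \<Longrightarrow> y \<in> cball z0 r \<Longrightarrow> proj F x = proj F y \<Longrightarrow> x = y"
    using nice_ball_proj[OF z0] by metis
  define \<rho> where "\<rho> = r / 8"
  \<comment> \<open>On the rim of a ball on which the projection is injective, hence in a different
    orbit from every point of the ball of radius \<open>4 * \<rho>\<close>, which is half as
    large.\<close>
  define w1 where "w1 = z0 + of_real r"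
  have \<rho>: "\<rho> > 0" using r(1) by (simp add: \<rho>_def)
  have w1r: "w1 \<in> cball z0 r" using r(1) by (simp add: w1_def dist_norm)
  then have w1: "w1 \<in> disk" using r(2) by blast
  have sub: "cball z0 (4 * \<rho>) \<subseteq> cball z0 r" using r(1) by (intro subset_cball) (simp add: \<rho>_def)
  have nice: "x = y" if "x \<in> cball z0 (4 * \<rho>)" "y \<in> cball z0 (4 * \<rho>)" "proj F x = proj F y" for x y
    using r(3)[of x y] that sub by blast
  have far: "proj F x \<noteq> proj F w1" if x: "x \<in> cball z0 (4 * \<rho>)" for x
  proof
    assume "proj F x = proj F w1"
    then have "x = w1" using r(3)[of x w1] x sub w1r by blast
    then show False using x r(1) by (simp add: w1_def dist_norm \<rho>_def)
  qed
  have rep: "4 * pi * G (proj F z) (proj F w) + 2 * ln (norm (z - w)) = 4 * pi * G (proj F z) (proj F w1) +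
        (avg \<rho> (\<lambda>y. G (proj F y) (proj F w)) z - avg \<rho> (\<lambda>y. G (proj F y) (proj F w1)) z) + (2 * ln \<rho> + 1 - ramp 1)"
    if zw: "z \<in> ball z0 (\<rho> / 2)" "w \<in> ball z0 (\<rho> / 2)" "z \<noteq> w" for z w
  proof -
    let ?A = "\<lambda>s. avg s (\<lambda>y. G (proj F y) (proj F w)) z"
    let ?B = "\<lambda>s. avg s (\<lambda>y. G (proj F y) (proj F w1)) z"
    have zs: "cball z (2 * \<rho>) \<subseteq> cball z0 (4 * \<rho>)"
    proof
      fix x assume "x \<in> cball z (2 * \<rho>)"
      then show "x \<in> cball z0 (4 * \<rho>)" using zw(1) dist_triangle[of z0 x z] \<rho> by simp
    qed
    have zd: "cball z (2 * \<rho>) \<subseteq> disk" using zs sub r(2) by blast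
    have in4: "z \<in> cball z0 (4 * \<rho>)" "w \<in> cball z0 (4 * \<rho>)" using zw \<rho> by auto
    have zwd: "z \<in> disk" "w \<in> disk" using in4 sub r(2) by blast+
    have dzw: "norm (w - z) < \<rho>"
      using zw(1,2) dist_triangle[of w z z0] by (simp add: dist_norm norm_minus_commute)
    have wz: "norm (w - z) > 0" using zw(3) by simp
    have iw: "proj F w \<inter> cball z (2 * \<rho>) = {w}"
    proof (intro equalityI subsetI)
      fix x assume "x \<in> proj F w \<inter> cball z (2 * \<rho>)"
      then have "proj F x = proj F w" "x \<in> cball z0 (4 * \<rho>)" using in_proj_iff[OF zwd(2)] zs by blast+
      then show "x \<in> {w}" using nice in4 by blast
    next
      fix x assume "x \<in> {w}"
      then show "x \<in> proj F w \<inter> cball z (2 * \<rho>)"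
        using self_in_proj[OF zwd(2)] dzw \<rho> by (simp add: dist_norm norm_minus_commute)
    qed
    have iw1: "proj F w1 \<inter> cball z (2 * \<rho>) = {}"
    proof (rule ccontr)
      assume "proj F w1 \<inter> cball z (2 * \<rho>) \<noteq> {}"
      then obtain x where "proj F x = proj F w1" "x \<in> cball z0 (4 * \<rho>)" using in_proj_iff[OF w1] zs by blast
      then show False using far by blast
    qed
    \<comment> \<open>For such \<open>s\<close> the source lies outside the inner annulus and within
      distance \<rho> of \<open>z\<close>, so the value of \<open>test_fun\<close> there does not
      depend on \<open>s\<close>.\<close>
    have diff: "?A s - ?B s = ?A \<rho> - ?B \<rho> + (1 - ramp 1 - ln ((norm (w - z))\<^sup>2 / \<rho>\<^sup>2))"
      if s: "0 < s" "s < norm (w - z) / 2" for s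
    proof -
      have s\<rho>: "s \<le> \<rho>" using s dzw by linarith
      have "?A s - ?A \<rho> = test_fun \<rho> s (w - z) - (LINT y:disk|lborel. lam y * test_fun \<rho> s (y - z)) / total_area F"
        using avg_identity_id(2)[OF \<rho> zd zwd(2) s(1) s\<rho>] by (simp add: orbit_sum_def iw)
      moreover have "?B s - ?B \<rho> = - (LINT y:disk|lborel. lam y * test_fun \<rho> s (y - z)) / total_area F"
        using avg_identity_id(2)[OF \<rho> zd w1 s(1) s\<rho>] by (simp add: orbit_sum_def iw1)
      moreover have "test_fun \<rho> s (w - z) = 1 - ramp 1 - ln ((norm (w - z))\<^sup>2 / \<rho>\<^sup>2)"
        using test_fun_middle[OF s(1) s\<rho>, of "w - z"] reg_log_small[of "w - z" \<rho>] s(2) dzw \<rho> by simp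
      ultimately show ?thesis by simp
    qed
    have "\<forall>\<^sub>F s in at_right 0. ?A s - ?B s = ?A \<rho> - ?B \<rho> + (1 - ramp 1 - ln ((norm (w - z))\<^sup>2 / \<rho>\<^sup>2))"
      unfolding eventually_at_right_field using wz diff by (intro exI[of _ "norm (w - z) / 2"]) simp
    then have l1: "((\<lambda>s. ?A s - ?B s) \<longlongrightarrow> ?A \<rho> - ?B \<rho> + (1 - ramp 1 - ln ((norm (w - z))\<^sup>2 / \<rho>\<^sup>2))) (at_right 0)"
      by (rule tendsto_eventually)
    have "proj F z \<noteq> proj F w" using nice in4 zw(3) by blast
    then have l2: "((\<lambda>s. ?A s - ?B s) \<longlongrightarrow> 4 * pi * G (proj F z) (proj F w) - 4 * pi * G (proj F z) (proj F w1)) (at_right 0)"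
      using far[OF in4(1)] by (intro tendsto_diff avg_green_limit zwd w1)
    have "4 * pi * G (proj F z) (proj F w) - 4 * pi * G (proj F z) (proj F w1) =
        ?A \<rho> - ?B \<rho> + (1 - ramp 1 - ln ((norm (w - z))\<^sup>2 / \<rho>\<^sup>2))"
      using tendsto_unique[OF _ l2 l1] by simp
    moreover have "ln ((norm (w - z))\<^sup>2 / \<rho>\<^sup>2) = 2 * ln (norm (z - w)) - 2 * ln \<rho>"
      using wz \<rho> by (simp add: ln_div ln_realpow norm_minus_commute)
    ultimately show ?thesis by simp
  qed
  have sub': "cball z0 (4 * \<rho>) \<subseteq> disk" using sub r(2) by blast
  show ?thesis by (rule that[OF \<rho> w1 sub' nice far rep])
qed

text \<open>Letting the source tend to the same point in \<open>green_local\<close> leaves the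
  regular part \<open>R0\<close>, an expression in averages at a fixed radius. Passing from |y - z|
  to the Riemannian distance adds the logarithm of 2 / (1 - |z|^2), divided by 2 pi, which is
  differentiable.\<close>

lemma robin_local:
  assumes z0: "z0 \<in> disk"
  shows "(\<lambda>z. robin_function F G (proj F z)) differentiable (at z0)"
    and "((\<lambda>y. G (proj F y) (proj F z0) + ln (norm (y - z0)) / (2 * pi)) \<longlongrightarrow>
      robin_function F G (proj F z0) - ln (2 / (1 - (norm z0)\<^sup>2)) / (2 * pi)) (at z0)"
proof -
  obtain \<rho> w1 where \<rho>: "\<rho> > 0" and w1: "w1 \<in> disk" and sub: "cball z0 (4 * \<rho>) \<subseteq> disk"
    and nice: "\<And>x y. x \<in> cball z0 (4 * \<rho>) \<Longrightarrow> y \<in> cball z0 (4 * \<rho>) \<Longrightarrow> proj F x = proj F y \<Longrightarrow> x = y"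
    and far: "\<And>x. x \<in> cball z0 (4 * \<rho>) \<Longrightarrow> proj F x \<noteq> proj F w1"
    and rep: "\<And>z w. z \<in> ball z0 (\<rho> / 2) \<Longrightarrow> w \<in> ball z0 (\<rho> / 2) \<Longrightarrow> z \<noteq> w \<Longrightarrow>
      4 * pi * G (proj F z) (proj F w) + 2 * ln (norm (z - w)) = 4 * pi * G (proj F z) (proj F w1) +
        (avg \<rho> (\<lambda>y. G (proj F y) (proj F w)) z - avg \<rho> (\<lambda>y. G (proj F y) (proj F w1)) z) + (2 * ln \<rho> + 1 - ramp 1)"
    by (rule green_local[OF z0], rule that)
  define U where "U = ball z0 (\<rho> / 2)"
  have U: "open U" "convex U" "z0 \<in> U" using \<rho> by (auto simp: U_def)
  have U4: "p + x \<in> cball z0 (4 * \<rho>)" if "p \<in> U" "norm x \<le> 2 * \<rho>" for p x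
  proof -
    have "dist z0 (p + x) \<le> dist z0 p + dist p (p + x)" by (rule dist_triangle)
    then show ?thesis using that \<rho> by (simp add: U_def dist_norm)
  qed
  have U4': "p \<in> cball z0 (4 * \<rho>)" if "p \<in> U" for p using U4[OF that, of 0] \<rho> by simp
  have Ud: "p \<in> disk" if "p \<in> U" for p using U4'[OF that] sub by blast
  have off1: "(p + x, w1) \<in> off_diag" if "p \<in> U" "norm x \<le> 2 * \<rho>" for p x
    using U4[OF that] sub far[OF U4[OF that]] w1 by auto
  have off2: "(p + x, w) \<in> off_diag" if "p \<in> U" "w \<in> U" "norm (p - w) < norm x" "norm x \<le> 2 * \<rho>" for p w x
  proof -
    have "p + x \<noteq> w"
    proof
      assume "p + x = w"
      then have "p - w = - x" by (simp add: algebra_simps eq_neg_iff_add_eq_0)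
      then show False using that(3) by simp
    qed
    then have "proj F (p + x) \<noteq> proj F w" using nice[OF U4[OF that(1,4)] U4'[OF that(2)]] by blast
    moreover have "p + x \<in> disk" using U4[OF that(1,4)] sub by blast
    ultimately show ?thesis using Ud[OF that(2)] by simp
  qed
  define R0 where "R0 z = (4 * pi * G (proj F z) (proj F w1) +
     (avg \<rho> (\<lambda>y. G (proj F y) (proj F z)) z - avg \<rho> (\<lambda>y. G (proj F y) (proj F w1)) z) + (2 * ln \<rho> + 1 - ramp 1)) / (4 * pi)" for z
  have lim: "((\<lambda>y. G (proj F y) (proj F z) + ln (norm (y - z)) / (2 * pi)) \<longlongrightarrow> R0 z) (at z)" if z: "z \<in> U" for z
  proof -
    \<comment> \<open>For \<open>p\<close> within \<rho> of \<open>z\<close>, the open annulus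
      around \<open>p\<close> avoids \<open>z\<close>; the average with source \<open>z\<close> is
      then continuous in its centre.\<close>
    define V where "V = U \<inter> ball z \<rho>"
    have V: "open V" "z \<in> V" using U z \<rho> by (auto simp: V_def)
    have c1: "continuous_on V (\<lambda>p. avg \<rho> (\<lambda>y. G (proj F y) (proj F z)) p)"
      by (rule avg_green_continuous[OF \<rho>], rule off2[OF _ z]) (auto simp: V_def dist_norm norm_minus_commute)
    have c2: "continuous_on V (\<lambda>p. avg \<rho> (\<lambda>y. G (proj F y) (proj F w1)) p)"
      by (rule avg_green_continuous[OF \<rho>], rule off1) (auto simp: V_def)
    have "continuous_on V (\<lambda>p. G (proj F p) (proj F w1))"
    proof (rule continuous_on_subset[OF G_continuous[OF w1]])
      show "V \<subseteq> {z \<in> disk. proj F z \<noteq> proj F w1}" using Ud far U4' by (auto simp: V_def)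
    qed
    then have "continuous_on V (\<lambda>p. (4 * pi * G (proj F p) (proj F w1) +
     (avg \<rho> (\<lambda>y. G (proj F y) (proj F z)) p - avg \<rho> (\<lambda>y. G (proj F y) (proj F w1)) p) + (2 * ln \<rho> + 1 - ramp 1)) / (4 * pi))"
      by (intro continuous_intros c1 c2) auto
    then have "isCont (\<lambda>p. (4 * pi * G (proj F p) (proj F w1) +
     (avg \<rho> (\<lambda>y. G (proj F y) (proj F z)) p - avg \<rho> (\<lambda>y. G (proj F y) (proj F w1)) p) + (2 * ln \<rho> + 1 - ramp 1)) / (4 * pi)) z"
      using V continuous_on_eq_continuous_at by blast
    then have "((\<lambda>p. (4 * pi * G (proj F p) (proj F w1) +
     (avg \<rho> (\<lambda>y. G (proj F y) (proj F z)) p - avg \<rho> (\<lambda>y. G (proj F y) (proj F w1)) p) + (2 * ln \<rho> + 1 - ramp 1)) / (4 * pi)) \<longlongrightarrow> R0 z) (at z)"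
      unfolding isCont_def R0_def .
    moreover have "\<forall>\<^sub>F p in at z. (4 * pi * G (proj F p) (proj F w1) +
     (avg \<rho> (\<lambda>y. G (proj F y) (proj F z)) p - avg \<rho> (\<lambda>y. G (proj F y) (proj F w1)) p) + (2 * ln \<rho> + 1 - ramp 1)) / (4 * pi)
       = G (proj F p) (proj F z) + ln (norm (p - z)) / (2 * pi)"
    proof -
      have "\<forall>\<^sub>F p in at z. p \<in> U - {z}" using U(1) z by (rule eventually_at_in_open)
      then show ?thesis
      proof eventually_elim
        case (elim p)
        then have "p \<in> ball z0 (\<rho> / 2)" "z \<in> ball z0 (\<rho> / 2)" "p \<noteq> z" using z by (auto simp: U_def)
        from rep[OF this, symmetric] show ?case by (simp add: add_divide_distrib)
      qed
    qed
    ultimately show ?thesis by (rule Lim_transform_eventually)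
  qed
  have robin: "robin_function F G (proj F z) = R0 z + ln (2 / (1 - (norm z)\<^sup>2)) / (2 * pi)" if z: "z \<in> U" for z
  proof -
    have zd: "z \<in> disk" by (rule Ud[OF z])
    have z1: "1 - (norm z)\<^sup>2 > 0" using zd by (simp add: abs_square_less_1)
    have pos: "2 / (1 - (norm z)\<^sup>2) > 0" using z1 by simp
    have sd: "((\<lambda>y. surface_dist (proj F y) (proj F z) / norm (y - z)) \<longlongrightarrow> 2 / (1 - (norm z)\<^sup>2)) (at z)"
      by (rule surface_dist_limit[OF zd])
    have "((\<lambda>y. ln (surface_dist (proj F y) (proj F z) / norm (y - z))) \<longlongrightarrow> ln (2 / (1 - (norm z)\<^sup>2))) (at z)"
      using sd pos by (intro tendsto_ln) auto
    then have "((\<lambda>y. (G (proj F y) (proj F z) + ln (norm (y - z)) / (2 * pi)) +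
        ln (surface_dist (proj F y) (proj F z) / norm (y - z)) / (2 * pi)) \<longlongrightarrow> R0 z + ln (2 / (1 - (norm z)\<^sup>2)) / (2 * pi)) (at z)"
      by (intro tendsto_add lim[OF z] tendsto_divide tendsto_const) auto
    moreover have "\<forall>\<^sub>F y in at z. (G (proj F y) (proj F z) + ln (norm (y - z)) / (2 * pi)) +
        ln (surface_dist (proj F y) (proj F z) / norm (y - z)) / (2 * pi) =
        G (proj F y) (proj F z) + ln (surface_dist (proj F y) (proj F z)) / (2 * pi)"
      using order_tendstoD(1)[OF sd pos] eventually_neq_at_within[of z z UNIV]
    proof eventually_elim
      case (elim y)
      then have "surface_dist (proj F y) (proj F z) > 0" "norm (y - z) > 0" by (auto simp: zero_less_divide_iff)
      then show ?case by (simp add: ln_div diff_divide_distrib)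
    qed
    ultimately have "((\<lambda>y. G (proj F y) (proj F z) + ln (surface_dist (proj F y) (proj F z)) / (2 * pi)) \<longlongrightarrow>
        R0 z + ln (2 / (1 - (norm z)\<^sup>2)) / (2 * pi)) (at z)"
      by (rule Lim_transform_eventually)
    from tendsto_atin_proj(2)[OF zd, of "\<lambda>s. G s (proj F z) + ln (surface_dist s (proj F z)) / (2 * pi)", OF this]
    show ?thesis by (simp add: robin_function_def)
  qed
  show "((\<lambda>y. G (proj F y) (proj F z0) + ln (norm (y - z0)) / (2 * pi)) \<longlongrightarrow>
      robin_function F G (proj F z0) - ln (2 / (1 - (norm z0)\<^sup>2)) / (2 * pi)) (at z0)"
    using lim[OF U(3)] robin[OF U(3)] by simp
  \<comment> \<open>Centre and source move together: on the annulus \<open>p + x\<close> stays away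
    from \<open>p\<close>, so the singularity is never met.\<close>
  have d1: "(\<lambda>p. avg \<rho> (\<lambda>y. G (proj F y) (proj F p)) p) differentiable (at z0)"
  proof (rule avg_green_differentiable[OF \<rho> U, where L = id_blinfun])
    show "((\<lambda>p. p) has_derivative blinfun_apply id_blinfun) (at p)" for p :: complex by simp
    show "(p + x, p) \<in> off_diag" if "p \<in> U" "\<rho> \<le> norm x" "norm x \<le> 2 * \<rho>" for p x
      using that \<rho> by (intro off2) auto
  qed
  have d2: "(\<lambda>p. avg \<rho> (\<lambda>y. G (proj F y) (proj F w1)) p) differentiable (at z0)"
  proof (rule avg_green_differentiable[OF \<rho> U, where L = 0 and \<l> = "\<lambda>_. w1"])
    show "((\<lambda>p. w1) has_derivative blinfun_apply 0) (at p)" for p :: complex by (simp add: zero_blinfun.rep_eq)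
    show "(p + x, w1) \<in> off_diag" if "p \<in> U" "\<rho> \<le> norm x" "norm x \<le> 2 * \<rho>" for p x
      by (rule off1[OF that(1,3)])
  qed
  have d3: "(\<lambda>p. G (proj F p) (proj F w1)) differentiable (at z0)"
  proof -
    have "(z0, w1) \<in> off_diag" using off1[OF U(3), of 0] \<rho> by simp
    note d = dG_derivative[OF this]
    have "((\<lambda>p. (p, w1)) has_derivative (\<lambda>h. (h, 0))) (at z0)" by (intro has_derivative_Pair has_derivative_ident has_derivative_const)
    from has_derivative_compose[OF this d] show ?thesis by (auto simp: differentiable_def Gp_def)
  qed
  have z1: "1 - (norm z0)\<^sup>2 > 0" using z0 by (simp add: abs_square_less_1)
  have d4: "(\<lambda>p. ln (2 / (1 - (norm p)\<^sup>2))) differentiable (at z0)"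
  proof -
    have "((\<lambda>p. 1 - p \<bullet> p) has_derivative (\<lambda>h. 0 - (z0 \<bullet> h + h \<bullet> z0))) (at z0)"
      by (intro derivative_intros)
    then have "((\<lambda>p. 2 / (1 - (norm p)\<^sup>2)) differentiable (at z0))"
      using z1 unfolding power2_norm_eq_inner[symmetric]
      by (intro differentiable_divide differentiable_const) (auto simp: differentiable_def)
    then obtain D where "((\<lambda>p. 2 / (1 - (norm p)\<^sup>2)) has_derivative D) (at z0)" unfolding differentiable_def by blast
    from has_derivative_ln[OF _ this] z1 show ?thesis unfolding differentiable_def by auto
  qed
  have "(\<lambda>z. R0 z + ln (2 / (1 - (norm z)\<^sup>2)) / (2 * pi)) differentiable (at z0)"
    unfolding R0_def using d1 d2 d3 d4
    by (intro differentiable_add differentiable_diff differentiable_mult differentiable_divide differentiable_const) auto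
  then obtain D where "((\<lambda>z. R0 z + ln (2 / (1 - (norm z)\<^sup>2)) / (2 * pi)) has_derivative D) (at z0)"
    unfolding differentiable_def by blast
  then have "((\<lambda>z. robin_function F G (proj F z)) has_derivative D) (at z0)"
    by (rule has_derivative_transform_within_open[OF _ U(1,3)]) (simp add: robin)
  then show "(\<lambda>z. robin_function F G (proj F z)) differentiable (at z0)"
    unfolding differentiable_def by blast
qed

end

section \<open>Critical points of the Hamiltonian\<close>

text \<open>Invariance of the pseudo-hyperbolic distance, cleared of denominators so that logarithms
  split it into a sum.\<close>

lemma moebius_preserving_dist:
  assumes f: "f \<in> moebius_preserving" and yz: "y \<in> disk" "z \<in> disk"
  shows "norm (f y - f z) * norm (1 - cnj z * y) = norm (y - z) * norm (1 - cnj (f z) * f y)"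
proof -
  obtain c where c: "norm c = 1" "\<And>x. x \<in> disk \<Longrightarrow> (f x - f z) / (1 - cnj (f z) * f x) = c * ((x - z) / (1 - cnj z * x))"
    using moebius_preserving_diff_quotient[OF f yz(2)] by blast
  have "norm ((f y - f z) / (1 - cnj (f z) * f y)) = norm (c * ((y - z) / (1 - cnj z * y)))" using c(2)[OF yz(1)] by simp
  then have q: "norm (f y - f z) / norm (1 - cnj (f z) * f y) = norm (y - z) / norm (1 - cnj z * y)"
    by (simp add: norm_mult norm_divide c(1))
  have "norm (1 - cnj z * y) > 0" using one_minus_cnj_mult_nonzero[of z y] yz by simp
  moreover have "norm (1 - cnj (f z) * f y) > 0"
    using one_minus_cnj_mult_nonzero[of "f z" "f y"] moebius_preserving_in_disk[OF f] yz by simp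
  ultimately show ?thesis using q by (simp add: field_simps)
qed

lemma moebius_union_dist:
  assumes \<sigma>: "\<sigma> \<in> moebius_preserving \<union> moebius_reversing" and yz: "y \<in> disk" "z \<in> disk"
  shows "norm (\<sigma> y - \<sigma> z) * norm (1 - cnj z * y) = norm (y - z) * norm (1 - cnj (\<sigma> z) * \<sigma> y)"
proof (cases "\<sigma> \<in> moebius_preserving")
  case True
  then show ?thesis by (rule moebius_preserving_dist[OF _ yz])
next
  case False
  then obtain g where g: "g \<in> moebius_preserving" "\<sigma> = (\<lambda>z\<in>disk. g (cnj z))"
    using \<sigma> moebius_reversing_iff by blast
  have c: "cnj y \<in> disk" "cnj z \<in> disk" using yz by auto
  have e: "\<sigma> y = g (cnj y)" "\<sigma> z = g (cnj z)" using yz by (auto simp: g(2))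
  have "norm (1 - cnj (cnj z) * cnj y) = norm (1 - cnj z * y)"
  proof -
    have "1 - cnj (cnj z) * cnj y = cnj (1 - cnj z * y)" by simp
    then show ?thesis by (simp only: complex_mod_cnj)
  qed
  moreover have "norm (cnj y - cnj z) = norm (y - z)" by (simp only: complex_cnj_diff[symmetric] complex_mod_cnj)
  ultimately show ?thesis using moebius_preserving_dist[OF g(1) c] unfolding e by simp
qed

context vortex_surface
begin

text \<open>The definition of a symmetry yields one inclusion: the orbit of \<sigma> w lies in the
  image of the orbit of \<open>w\<close>. Applying it twice and using that \<sigma> is an involution
  on the surface sandwiches the image of the orbit of \<sigma> w, and every point of the disk has
  the form \<sigma> w.\<close>

lemma symmetry_orbit_map:
  assumes sym: "symmetry F \<sigma>" and invol: "involutive F \<sigma>"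
  shows "orbit_map \<sigma>"
proof -
  have u: "\<sigma> \<in> moebius_preserving \<union> moebius_reversing" using sym by (simp add: symmetry_def)
  note props = moebius_union_props[OF u]
  have "\<sigma> \<in> extensional disk"
    using u unfolding moebius_preserving_def moebius_reversing_def by auto
  then have B: "\<sigma> \<in> Bij disk" using props(2,4) by (simp add: Bij_def bij_betw_def)
  have iB: "inv\<^bsub>BijGroup disk\<^esub> \<sigma> \<in> Bij disk"
  proof -
    have "carrier (BijGroup disk) = Bij disk" by (simp add: BijGroup_def)
    then show ?thesis using group.inv_closed[OF group_BijGroup, of \<sigma> disk] B by (simp only:)
  qed
  have sub: "proj F (\<sigma> w) \<subseteq> \<sigma> ` proj F w" if w: "w \<in> disk" for w
  proof
    fix x assume "x \<in> proj F (\<sigma> w)"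
    then obtain \<gamma> where \<gamma>: "\<gamma> \<in> F" "x = \<gamma> (\<sigma> w)" unfolding proj_def by blast
    let ?\<delta> = "inv\<^bsub>BijGroup disk\<^esub> \<sigma> \<otimes>\<^bsub>BijGroup disk\<^esub> \<gamma> \<otimes>\<^bsub>BijGroup disk\<^esub> \<sigma>"
    have \<delta>: "?\<delta> \<in> F" using sym \<gamma>(1) by (simp add: symmetry_def)
    have "?\<delta> = compose disk (compose disk (inv\<^bsub>BijGroup disk\<^esub> \<sigma>) \<gamma>) \<sigma>"
    proof -
      have m: "f \<otimes>\<^bsub>BijGroup disk\<^esub> g = compose disk f g" if "f \<in> Bij disk" "g \<in> Bij disk" for f g
        using that by (simp add: BijGroup_def)
      show ?thesis unfolding m[OF iB F_Bij[OF \<gamma>(1)]] by (rule m[OF compose_Bij[OF iB F_Bij[OF \<gamma>(1)]] B])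
    qed
    moreover have sw: "\<sigma> w \<in> disk" by (rule props(1)[OF w])
    ultimately have "?\<delta> w = (inv\<^bsub>BijGroup disk\<^esub> \<sigma>) x" using w \<gamma>(2) by (simp add: compose_def)
    moreover have xd: "x \<in> disk" using F_in_disk[OF \<gamma>(1) sw] \<gamma>(2) by simp
    ultimately have "?\<delta> w = inv_into disk \<sigma> x" using inv_BijGroup[OF B] by simp
    then have "\<sigma> (?\<delta> w) = x" using f_inv_into_f[of x \<sigma> disk] xd props(4) by simp
    moreover have "?\<delta> w \<in> proj F w" using \<delta> unfolding proj_def by blast
    ultimately show "x \<in> \<sigma> ` proj F w" by blast
  qed
  have twice: "\<sigma> ` proj F (\<sigma> w) = proj F w \<and> proj F (\<sigma> (\<sigma> w)) = proj F w" if w: "w \<in> disk" for w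
  proof -
    have sw: "\<sigma> w \<in> disk" "\<sigma> (\<sigma> w) \<in> disk" using props(1) w by blast+
    have "\<sigma> ` (\<sigma> ` proj F w) = proj F w" using invol proj_in_surface[OF w] by (simp add: involutive_def)
    then have 1: "\<sigma> ` proj F (\<sigma> w) \<subseteq> proj F w" using image_mono[OF sub[OF w], of \<sigma>] by simp
    have 2: "proj F (\<sigma> (\<sigma> w)) \<subseteq> \<sigma> ` proj F (\<sigma> w)" by (rule sub[OF sw(1)])
    have "\<sigma> (\<sigma> w) \<in> proj F w" using self_in_proj[OF sw(2)] 1 2 by blast
    then have "proj F (\<sigma> (\<sigma> w)) = proj F w" using in_proj_iff[OF w] by blast
    then show ?thesis using 1 2 by simp
  qed
  have "\<sigma> ` proj F y = proj F (\<sigma> y)" if y: "y \<in> disk" for y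
  proof -
    obtain x where x: "x \<in> disk" "y = \<sigma> x" using y props(4) by blast
    show ?thesis using twice[OF x(1)] unfolding x(2) by simp
  qed
  then show ?thesis using u by (simp add: orbit_map_def)
qed

lemma orbit_map_involutive:
  assumes \<sigma>: "orbit_map \<sigma>" and invol: "involutive F \<sigma>" and w: "w \<in> disk"
  shows "proj F (\<sigma> (\<sigma> w)) = proj F w"
proof -
  have sw: "\<sigma> w \<in> disk" using moebius_union_props(1) \<sigma> w by (simp add: orbit_map_def)
  have img: "\<forall>w\<in>disk. \<sigma> ` proj F w = proj F (\<sigma> w)" using \<sigma> by (simp add: orbit_map_def)
  have "\<sigma> ` (\<sigma> ` proj F w) = proj F w" using invol proj_in_surface[OF w] by (simp add: involutive_def)
  then show ?thesis unfolding bspec[OF img w] bspec[OF img sw] .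
qed

text \<open>Compare the expansions of \<open>G\<close> at \<open>z\<close> and at \<sigma> z. The
  quotient |\<sigma> y - \<sigma> z| / |y - z| tends to (1 - |\<sigma> z|^2) / (1 - |z|^2), and the
  logarithm of this limit accounts exactly for the difference of the conformal terms.\<close>

lemma robin_invariant:
  assumes \<sigma>: "orbit_map \<sigma>" and invol: "involutive F \<sigma>" and z: "z \<in> disk"
  shows "robin_function F G (proj F (\<sigma> z)) = robin_function F G (proj F z)"
proof -
  have u: "\<sigma> \<in> moebius_preserving \<union> moebius_reversing" using \<sigma> by (simp add: orbit_map_def)
  note props = moebius_union_props[OF u]
  have sz: "\<sigma> z \<in> disk" by (rule props(1)[OF z])
  let ?R = "\<lambda>z. robin_function F G (proj F z)"
  let ?L = "\<lambda>z. ln (2 / (1 - (norm z)\<^sup>2)) / (2 * pi)"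
  obtain r where r: "r > 0" "cball z r \<subseteq> disk"
    "\<And>x y. x \<in> cball z r \<Longrightarrow> y \<in> cball z r \<Longrightarrow> proj F x = proj F y \<Longrightarrow> x = y"
    by (rule nice_ball_proj[OF z], rule that)
  have near: "\<forall>\<^sub>F y in at z. y \<in> ball z r - {z}" by (rule eventually_at_in_open) (use r(1) in auto)
  have scont: "(\<sigma> \<longlongrightarrow> \<sigma> z) (at z)"
    using props(3) z continuous_on_eq_continuous_at[OF open_ball] isCont_def by blast
  have inj: "\<forall>\<^sub>F y in at z. \<sigma> y \<noteq> \<sigma> z"
    using near
  proof eventually_elim
    case (elim y)
    then have "y \<in> cball z r" "y \<noteq> z" by auto
    then have "y \<in> disk" "y \<noteq> z" using r(2) by blast+
    then show ?case using inj_onD[OF props(2)] z by blast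
  qed
  have sat: "filterlim \<sigma> (at (\<sigma> z)) (at z)" using scont inj by (simp add: filterlim_at)
  have l1: "((\<lambda>y. G (proj F (\<sigma> y)) (proj F (\<sigma> z)) + ln (norm (\<sigma> y - \<sigma> z)) / (2 * pi)) \<longlongrightarrow> ?R (\<sigma> z) - ?L (\<sigma> z)) (at z)"
    by (rule filterlim_compose[OF robin_local(2)[OF sz] sat])
  have l2: "((\<lambda>y. G (proj F y) (proj F z) + ln (norm (y - z)) / (2 * pi)) \<longlongrightarrow> ?R z - ?L z) (at z)"
    by (rule robin_local(2)[OF z])
  have nz: "1 - (norm z)\<^sup>2 > 0" "1 - (norm (\<sigma> z))\<^sup>2 > 0" using z sz by (auto simp: abs_square_less_1)
  have n: "norm (1 - cnj x * x) = 1 - (norm x)\<^sup>2" if "1 - (norm x)\<^sup>2 > 0" for x :: complex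
  proof -
    have "1 - cnj x * x = of_real (1 - (norm x)\<^sup>2)"
      unfolding of_real_diff complex_norm_square by (simp add: mult.commute)
    then show ?thesis using that by (simp only: norm_of_real)
  qed
  note n1 = n[OF nz(1)] and n2 = n[OF nz(2)]
  have "((\<lambda>y. ln (norm (1 - cnj z * y))) \<longlongrightarrow> ln (norm (1 - cnj z * z))) (at z)"
    using nz(1) n1 by (intro tendsto_intros) auto
  moreover have "((\<lambda>y. ln (norm (1 - cnj (\<sigma> z) * \<sigma> y))) \<longlongrightarrow> ln (norm (1 - cnj (\<sigma> z) * \<sigma> z))) (at z)"
    using nz(2) n2 scont by (intro tendsto_intros) auto
  ultimately have l3: "((\<lambda>y. (ln (norm (1 - cnj (\<sigma> z) * \<sigma> y)) - ln (norm (1 - cnj z * y))) / (2 * pi)) \<longlongrightarrow>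
      (ln (1 - (norm (\<sigma> z))\<^sup>2) - ln (1 - (norm z)\<^sup>2)) / (2 * pi)) (at z)"
    unfolding n1 n2 by (intro tendsto_divide tendsto_diff tendsto_const) auto
  have eq: "\<forall>\<^sub>F y in at z. (G (proj F y) (proj F z) + ln (norm (y - z)) / (2 * pi)) +
      (ln (norm (1 - cnj (\<sigma> z) * \<sigma> y)) - ln (norm (1 - cnj z * y))) / (2 * pi) =
      G (proj F (\<sigma> y)) (proj F (\<sigma> z)) + ln (norm (\<sigma> y - \<sigma> z)) / (2 * pi)"
    using near inj
  proof eventually_elim
    case (elim y)
    then have y': "y \<noteq> z" "y \<in> cball z r" by auto
    then have y: "y \<in> disk" "y \<noteq> z" "y \<in> cball z r" using r(2) by blast+
    have "proj F y \<noteq> proj F z" using r(3)[OF y(3)] y(2) r(1) by auto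
    then have g: "G (proj F (\<sigma> y)) (proj F (\<sigma> z)) = G (proj F y) (proj F z)"
      by (rule G_invariant[OF \<sigma> invol y(1) z])
    have p: "norm (1 - cnj z * y) > 0" "norm (1 - cnj (\<sigma> z) * \<sigma> y) > 0" "norm (y - z) > 0" "norm (\<sigma> y - \<sigma> z) > 0"
      using one_minus_cnj_mult_nonzero[of z y] one_minus_cnj_mult_nonzero[of "\<sigma> z" "\<sigma> y"] y z sz props(1)[OF y(1)] elim by auto
    have "ln (norm (\<sigma> y - \<sigma> z) * norm (1 - cnj z * y)) = ln (norm (y - z) * norm (1 - cnj (\<sigma> z) * \<sigma> y))"
      using moebius_union_dist[OF u y(1) z] by simp
    then have "ln (norm (\<sigma> y - \<sigma> z)) = ln (norm (y - z)) + (ln (norm (1 - cnj (\<sigma> z) * \<sigma> y)) - ln (norm (1 - cnj z * y)))"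
      using p by (simp add: ln_mult_pos)
    then show ?case unfolding g by (simp add: add_divide_distrib)
  qed
  have "((\<lambda>y. G (proj F (\<sigma> y)) (proj F (\<sigma> z)) + ln (norm (\<sigma> y - \<sigma> z)) / (2 * pi)) \<longlongrightarrow>
      (?R z - ?L z) + (ln (1 - (norm (\<sigma> z))\<^sup>2) - ln (1 - (norm z)\<^sup>2)) / (2 * pi)) (at z)"
    by (rule Lim_transform_eventually[OF tendsto_add[OF l2 l3] eq])
  from tendsto_unique[OF _ l1 this]
  have "?R (\<sigma> z) - ?L (\<sigma> z) = (?R z - ?L z) + (ln (1 - (norm (\<sigma> z))\<^sup>2) - ln (1 - (norm z)\<^sup>2)) / (2 * pi)" by simp
  moreover have "?L z = ln 2 / (2 * pi) - ln (1 - (norm z)\<^sup>2) / (2 * pi)"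
    "?L (\<sigma> z) = ln 2 / (2 * pi) - ln (1 - (norm (\<sigma> z))\<^sup>2) / (2 * pi)"
    using nz by (simp_all add: ln_div diff_divide_distrib)
  ultimately show ?thesis by (simp add: diff_divide_distrib)
qed

section \<open>Lifts of a symmetry at its fixed points\<close>

lemma proj_lift:
  assumes \<sigma>: "orbit_map \<sigma>" and z: "z \<in> disk" and fixed: "\<sigma> ` proj F z = proj F z"
  obtains \<gamma> where "\<gamma> \<in> F" "\<gamma> (\<sigma> z) = z"
proof -
  have sz: "\<sigma> z \<in> disk" using moebius_union_props(1) \<sigma> z by (simp add: orbit_map_def)
  have "proj F (\<sigma> z) = proj F z" using \<sigma> z fixed by (simp add: orbit_map_def)
  then obtain \<gamma> where "\<gamma> \<in> F" "z = \<gamma> (\<sigma> z)" using proj_eq_iff[OF sz z] by blast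
  then show ?thesis using that[of \<gamma>] by simp
qed

text \<open>The pseudo-hyperbolic coordinate \<open>(y - z) / (1 - cnj z * y)\<close> linearizes the Moebius
  transformations fixing \<open>z\<close>.\<close>

definition centre :: "complex \<Rightarrow> complex \<Rightarrow> complex" where
  "centre z y = (y - z) / (1 - cnj z * y)"

lemma centre_inj:
  assumes z: "z \<in> disk" and "x \<in> disk" "y \<in> disk" "centre z x = centre z y"
  shows "x = y"
proof -
  have "1 - cnj z * x \<noteq> 0" "1 - cnj z * y \<noteq> 0" using one_minus_cnj_mult_nonzero assms by auto
  then have "(x - z) * (1 - cnj z * y) = (y - z) * (1 - cnj z * x)"
    using assms(4) by (simp add: centre_def frac_eq_eq)
  then have "(x - y) * (1 - cnj z * z) = 0" by (simp add: algebra_simps)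
  moreover have "1 - cnj z * z \<noteq> 0" using one_minus_cnj_mult_nonzero[of z z] z by auto
  ultimately show ?thesis by simp
qed

text \<open>A point fixed on the surface need not be fixed in the disk; composing with a suitable
  element of \<open>F\<close> gives a lift that fixes \<open>z\<close>. Its derivative at
  \<open>z\<close> and its multiplier in the coordinate \<open>centre z\<close> are the same number,
  which links local and global behaviour.\<close>

lemma lift_preserving:
  assumes \<sigma>: "orbit_map \<sigma>" "\<sigma> \<in> moebius_preserving" and z: "z \<in> disk" and fixed: "\<sigma> ` proj F z = proj F z"
  obtains \<tau> c where "\<tau> z = z" "\<And>w. w \<in> disk \<Longrightarrow> \<tau> w \<in> disk" "\<And>w. w \<in> disk \<Longrightarrow> proj F (\<tau> w) = proj F (\<sigma> w)"
    "\<And>w. w \<in> disk \<Longrightarrow> centre z (\<tau> w) = c * centre z w" "(\<tau> has_derivative (\<lambda>h. c * h)) (at z)"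
proof -
  obtain \<gamma> where \<gamma>: "\<gamma> \<in> F" "\<gamma> (\<sigma> z) = z" by (rule proj_lift[OF \<sigma>(1) z fixed], rule that)
  obtain \<tau> where \<tau>: "\<tau> \<in> moebius_preserving" "\<And>w. w \<in> disk \<Longrightarrow> \<tau> w = \<gamma> (\<sigma> w)"
    using moebius_preserving_compose[OF F_moebius[OF \<gamma>(1)] \<sigma>(2)] by blast
  have tz: "\<tau> z = z" using \<tau>(2)[OF z] \<gamma>(2) by simp
  obtain c where c: "\<forall>x\<in>disk. (\<tau> x - \<tau> z) / (1 - cnj (\<tau> z) * \<tau> x) = c * ((x - z) / (1 - cnj z * x))"
    using moebius_preserving_diff_quotient[OF \<tau>(1) z] by blast
  have nz: "1 - (norm z)\<^sup>2 \<noteq> 0" using z by (simp add: abs_square_eq_1)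
  have d: "(\<tau> has_derivative (\<lambda>h. c * h)) (at z)"
    using moebius_preserving_deriv[OF \<tau>(1) z c] nz by (simp add: tz has_field_derivative_def)
  have p: "proj F (\<tau> w) = proj F (\<sigma> w)" if "w \<in> disk" for w
    using \<tau>(2)[OF that] proj_F[OF \<gamma>(1) moebius_preserving_in_disk[OF \<sigma>(2) that]] by simp
  have m: "centre z (\<tau> w) = c * centre z w" if "w \<in> disk" for w
    using bspec[OF c that] unfolding tz centre_def .
  show ?thesis by (rule that[OF tz moebius_preserving_in_disk[OF \<tau>(1)] p m d])
qed

text \<open>The orientation preserving factor \<open>h\<close> carries \<open>cnj z\<close> to
  \<open>z\<close>, so the difference quotient identity is used between these two points; the
  conjugation makes the result antilinear.\<close>

lemma lift_reversing:
  assumes \<sigma>: "orbit_map \<sigma>" "\<sigma> \<in> moebius_reversing" and z: "z \<in> disk" and fixed: "\<sigma> ` proj F z = proj F z"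
  obtains \<tau> c where "\<tau> z = z" "\<And>w. w \<in> disk \<Longrightarrow> \<tau> w \<in> disk" "\<And>w. w \<in> disk \<Longrightarrow> proj F (\<tau> w) = proj F (\<sigma> w)"
    "\<And>w. w \<in> disk \<Longrightarrow> centre z (\<tau> w) = c * cnj (centre z w)" "(\<tau> has_derivative (\<lambda>h. c * cnj h)) (at z)"
proof -
  obtain \<gamma> where \<gamma>: "\<gamma> \<in> F" "\<gamma> (\<sigma> z) = z" by (rule proj_lift[OF \<sigma>(1) z fixed], rule that)
  obtain g where g: "g \<in> moebius_preserving" "\<sigma> = (\<lambda>z\<in>disk. g (cnj z))"
    using \<sigma>(2) moebius_reversing_iff by blast
  obtain h where h: "h \<in> moebius_preserving" "\<And>w. w \<in> disk \<Longrightarrow> h w = \<gamma> (g w)"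
    using moebius_preserving_compose[OF F_moebius[OF \<gamma>(1)] g(1)] by blast
  have cd: "cnj w \<in> disk" if "w \<in> disk" for w using that by simp
  define \<tau> where "\<tau> w = h (cnj w)" for w
  have \<tau>: "\<tau> w = \<gamma> (\<sigma> w)" if "w \<in> disk" for w using h(2)[OF cd[OF that]] that by (simp add: \<tau>_def g(2))
  have tz: "\<tau> z = z" "h (cnj z) = z" using \<tau>[OF z] \<gamma>(2) by (simp_all add: \<tau>_def)
  obtain c where c: "\<forall>x\<in>disk. (h x - h (cnj z)) / (1 - cnj (h (cnj z)) * h x) = c * ((x - cnj z) / (1 - cnj (cnj z) * x))"
    using moebius_preserving_diff_quotient[OF h(1) cd[OF z]] by blast
  have nz: "1 - (norm z)\<^sup>2 \<noteq> 0" using z by (simp add: abs_square_eq_1)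
  have "(h has_derivative (\<lambda>k. c * k)) (at (cnj z))"
    using moebius_preserving_deriv[OF h(1) cd[OF z] c] nz by (simp add: tz has_field_derivative_def)
  from has_derivative_compose[OF bounded_linear_imp_has_derivative[OF bounded_linear_cnj] this]
  have d: "(\<tau> has_derivative (\<lambda>k. c * cnj k)) (at z)" by (simp add: \<tau>_def[abs_def])
  have td: "\<tau> w \<in> disk" if "w \<in> disk" for w
    unfolding \<tau>_def by (rule moebius_preserving_in_disk[OF h(1) cd[OF that]])
  have p: "proj F (\<tau> w) = proj F (\<sigma> w)" if w: "w \<in> disk" for w
  proof -
    have "\<sigma> w \<in> disk" using moebius_union_props(1) \<sigma>(2) w by blast
    then show ?thesis using \<tau>[OF w] proj_F[OF \<gamma>(1)] by simp
  qed
  have m: "centre z (\<tau> w) = c * cnj (centre z w)" if "w \<in> disk" for w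
    using bspec[OF c cd[OF that]] unfolding tz(2) centre_def \<tau>_def by simp
  show ?thesis by (rule that[OF tz(1) td p m d])
qed

text \<open>The lifts \<tau> and \<tau>' of one symmetry, fixing \<open>z\<close> and
  \<open>z'\<close> respectively, may be different maps. Since \<open>G\<close> depends on orbits
  only, they can be used simultaneously, one in each argument.\<close>

lemma derivatives_invariant:
  fixes D :: "complex \<Rightarrow> real"
  assumes \<sigma>: "orbit_map \<sigma>" and invol: "involutive F \<sigma>"
    and z: "z \<in> disk" "z' \<in> disk" "proj F z \<noteq> proj F z'"
    and \<tau>: "\<tau> z = z" "\<And>w. w \<in> disk \<Longrightarrow> proj F (\<tau> w) = proj F (\<sigma> w)" "(\<tau> has_derivative A) (at z)"
    and \<tau>': "\<tau>' z' = z'" "\<And>w. w \<in> disk \<Longrightarrow> proj F (\<tau>' w) = proj F (\<sigma> w)" "(\<tau>' has_derivative A') (at z')"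
    and D: "((\<lambda>x. robin_function F G (proj F x)) has_derivative D) (at z)"
  shows "D (A h) = D h" and "blinfun_apply (dG (z, z')) (A h, A' k) = blinfun_apply (dG (z, z')) (h, k)"
proof -
  have "((\<lambda>x. robin_function F G (proj F (\<tau> x))) has_derivative (\<lambda>h. D (A h))) (at z)"
    by (rule has_derivative_compose[OF \<tau>(3), where g = "\<lambda>x. robin_function F G (proj F x)", unfolded \<tau>(1), OF D])
  then have "((\<lambda>x. robin_function F G (proj F x)) has_derivative (\<lambda>h. D (A h))) (at z)"
    by (rule has_derivative_transform_within_open[OF _ open_ball z(1)]) (simp only: \<tau>(2) robin_invariant[OF \<sigma> invol])
  then have "(\<lambda>h. D (A h)) = D" by (rule has_derivative_unique[OF _ D])
  then show "D (A h) = D h" by (rule fun_cong)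
  have q: "(z, z') \<in> off_diag" using z by simp
  have dq: "(Gp has_derivative blinfun_apply (dG (z, z'))) (at (z, z'))" by (rule dG_derivative[OF q])
  have "((\<lambda>q. (\<tau> (fst q), \<tau>' (snd q))) has_derivative (\<lambda>hk. (A (fst hk), A' (snd hk)))) (at (z, z'))"
    by (intro has_derivative_Pair has_derivative_compose[OF has_derivative_fst[OF has_derivative_ident]]
        has_derivative_compose[OF has_derivative_snd[OF has_derivative_ident]]) (simp_all add: \<tau>(3) \<tau>'(3))
  from has_derivative_compose[OF this, of Gp] dq \<tau>(1) \<tau>'(1)
  have "((\<lambda>q. Gp (\<tau> (fst q), \<tau>' (snd q))) has_derivative (\<lambda>hk. blinfun_apply (dG (z, z')) (A (fst hk), A' (snd hk)))) (at (z, z'))"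
    by simp
  then have "(Gp has_derivative (\<lambda>hk. blinfun_apply (dG (z, z')) (A (fst hk), A' (snd hk)))) (at (z, z'))"
  proof (rule has_derivative_transform_within_open[OF _ open_off_diagonal q])
    fix q assume "q \<in> off_diag"
    then have q: "fst q \<in> disk" "snd q \<in> disk" "proj F (fst q) \<noteq> proj F (snd q)" by auto
    show "Gp (\<tau> (fst q), \<tau>' (snd q)) = Gp q"
      unfolding Gp_def fst_conv snd_conv \<tau>(2)[OF q(1)] \<tau>'(2)[OF q(2)] by (rule G_invariant[OF \<sigma> invol q])
  qed
  then have "(\<lambda>hk. blinfun_apply (dG (z, z')) (A (fst hk), A' (snd hk))) = blinfun_apply (dG (z, z'))"
    by (rule has_derivative_unique[OF _ dq])
  from fun_cong[OF this, of "(h, k)"]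
  show "blinfun_apply (dG (z, z')) (A h, A' k) = blinfun_apply (dG (z, z')) (h, k)" by simp
qed

text \<open>The square of the lift fixes \<open>z\<close> and moves points within their orbits, so
  it fixes points near \<open>z\<close>, which gives c^2 = 1. The value c = 1 would make the lift
  the identity and the symmetry trivial on the surface.\<close>

lemma rotation_lift:
  assumes \<sigma>: "orbit_map \<sigma>" "\<sigma> \<in> moebius_preserving" and invol: "involutive F \<sigma>" and nt: "\<exists>x\<in>surface F. \<sigma> ` x \<noteq> x"
    and z: "z \<in> disk" and fixed: "\<sigma> ` proj F z = proj F z"
  obtains \<tau> where "\<tau> z = z" "\<And>w. w \<in> disk \<Longrightarrow> proj F (\<tau> w) = proj F (\<sigma> w)" "(\<tau> has_derivative (\<lambda>h. - h)) (at z)"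
proof -
  obtain \<tau> c where \<tau>: "\<tau> z = z" "\<And>w. w \<in> disk \<Longrightarrow> \<tau> w \<in> disk" "\<And>w. w \<in> disk \<Longrightarrow> proj F (\<tau> w) = proj F (\<sigma> w)"
    "\<And>w. w \<in> disk \<Longrightarrow> centre z (\<tau> w) = c * centre z w" "(\<tau> has_derivative (\<lambda>h. c * h)) (at z)"
    by (rule lift_preserving[OF \<sigma> z fixed], rule that)
  have sd: "\<sigma> w \<in> disk" if "w \<in> disk" for w by (rule moebius_preserving_in_disk[OF \<sigma>(2) that])
  have sq: "proj F (\<tau> (\<tau> w)) = proj F w" if w: "w \<in> disk" for w
  proof -
    have "proj F (\<tau> (\<tau> w)) = proj F (\<sigma> (\<tau> w))" by (rule \<tau>(3)[OF \<tau>(2)[OF w]])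
    also have "\<dots> = proj F (\<sigma> (\<sigma> w))"
      using orbit_map_proj_iff[OF \<sigma>(1) \<tau>(2)[OF w] sd[OF w]] \<tau>(3)[OF w] by simp
    finally show ?thesis using orbit_map_involutive[OF \<sigma>(1) invol w] by simp
  qed
  obtain r where r: "r > 0" "cball z r \<subseteq> disk"
    "\<And>x y. x \<in> cball z r \<Longrightarrow> y \<in> cball z r \<Longrightarrow> proj F x = proj F y \<Longrightarrow> x = y"
    by (rule nice_ball_proj[OF z], rule that)
  have tc: "isCont \<tau> z" using has_derivative_continuous[OF \<tau>(5)] .
  then have "isCont (\<lambda>w. \<tau> (\<tau> w)) z" using isCont_o2[of z \<tau> \<tau>] \<tau>(1) by simp
  then have "\<forall>\<^sub>F w in at z. \<tau> (\<tau> w) \<in> ball z r"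
    using r(1) \<tau>(1) topological_tendstoD[of "\<lambda>w. \<tau> (\<tau> w)" z "at z" "ball z r"] by (simp add: isCont_def)
  moreover have "\<forall>\<^sub>F w in at z. w \<in> ball z r - {z}" by (rule eventually_at_in_open) (use r(1) in auto)
  ultimately have "\<forall>\<^sub>F w in at z. \<tau> (\<tau> w) \<in> ball z r \<and> w \<in> ball z r - {z}" by (rule eventually_conj)
  then obtain w where w: "\<tau> (\<tau> w) \<in> ball z r" "w \<in> ball z r - {z}"
    using eventually_happens[of _ "at z"] trivial_limit_at[of z] by (metis (no_types, lifting))
  then have "w \<in> cball z r" by simp
  then have wd: "w \<in> disk" using r(2) by blast
  have "\<tau> (\<tau> w) = w" by (rule r(3)[OF _ _ sq[OF wd]]) (use w in auto)
  then have "centre z w = c * (c * centre z w)" using \<tau>(4)[OF wd] \<tau>(4)[OF \<tau>(2)[OF wd]] by simp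
  moreover have "centre z w \<noteq> 0" using centre_inj[OF z wd z] w by (auto simp: centre_def)
  ultimately have "c * c = 1" by simp
  then have "c = 1 \<or> c = -1" using square_eq_1_iff by blast
  moreover have "c \<noteq> 1"
  proof
    assume c: "c = 1"
    have "\<sigma> ` x = x" if x: "x \<in> surface F" for x
    proof -
      obtain w where w: "w \<in> disk" "x = proj F w" by (rule surface_obtain[OF x], rule that)
      have "\<tau> w = w" using \<tau>(4)[OF w(1)] c by (intro centre_inj[OF z \<tau>(2)[OF w(1)] w(1)]) simp
      moreover have "\<sigma> ` proj F w = proj F (\<sigma> w)" using \<sigma>(1) w(1) unfolding orbit_map_def by blast
      ultimately show ?thesis using \<tau>(3)[OF w(1)] w(2) by simp
    qed
    then show False using nt by blast
  qed
  ultimately have d: "(\<tau> has_derivative (\<lambda>h. - h)) (at z)" using \<tau>(5) by simp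
  show ?thesis by (rule that[OF \<tau>(1,3) d])
qed

lemma critical_pair:
  assumes pair: "rotation_pair F s s' \<or> reflection_pair F s s'"
    and z: "z \<in> disk" "z' \<in> disk" and s: "s = proj F z" "s' = proj F z'" "s \<noteq> s'"
  shows "((\<lambda>x. robin_function F G (proj F x)) has_derivative (\<lambda>_. 0)) (at z)"
    and "(Gp has_derivative (\<lambda>_. 0)) (at (z, z'))"
proof -
  have ne: "proj F z \<noteq> proj F z'" using s by simp
  have q: "(z, z') \<in> off_diag" using z ne by simp
  obtain D where D: "((\<lambda>x. robin_function F G (proj F x)) has_derivative D) (at z)"
    using robin_local(1)[OF z(1)] unfolding differentiable_def by blast
  have lD: "linear D" by (rule has_derivative_linear[OF D])
  let ?g = "blinfun_apply (dG (z, z'))"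
  have "(\<forall>h. D h = 0) \<and> (\<forall>h k. ?g (h, k) = 0)"
    using pair
  proof
    assume "rotation_pair F s s'"
    then obtain \<sigma> where \<sigma>: "symmetry F \<sigma>" "\<sigma> \<in> moebius_preserving" "involutive F \<sigma>"
      "\<exists>x\<in>surface F. \<sigma> ` x \<noteq> x" "\<sigma> ` proj F z = proj F z" "\<sigma> ` proj F z' = proj F z'"
      unfolding rotation_pair_def s by blast
    note o = symmetry_orbit_map[OF \<sigma>(1,3)]
    obtain \<tau> where \<tau>: "\<tau> z = z" "\<And>w. w \<in> disk \<Longrightarrow> proj F (\<tau> w) = proj F (\<sigma> w)" "(\<tau> has_derivative (\<lambda>h. - h)) (at z)"
      by (rule rotation_lift[OF o \<sigma>(2-4) z(1) \<sigma>(5)], rule that)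
    obtain \<tau>' where \<tau>': "\<tau>' z' = z'" "\<And>w. w \<in> disk \<Longrightarrow> proj F (\<tau>' w) = proj F (\<sigma> w)" "(\<tau>' has_derivative (\<lambda>h. - h)) (at z')"
      by (rule rotation_lift[OF o \<sigma>(2-4) z(2) \<sigma>(6)], rule that)
    note inv = derivatives_invariant[OF o \<sigma>(3) z ne \<tau> \<tau>' D]
    have "D h = 0" for h using inv(1)[of h] linear_neg[OF lD, of h] by simp
    moreover have "?g (h, k) = 0" for h k using inv(2)[of h k] blinfun.minus_right[of "dG (z, z')" "(h, k)"] by simp
    ultimately show ?thesis by blast
  next
    assume "reflection_pair F s s'"
    then obtain \<sigma> \<rho> where \<sigma>0: "symmetry F \<sigma>" "\<sigma> \<in> moebius_reversing" "involutive F \<sigma>"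
      and \<rho>0: "symmetry F \<rho>" "\<rho> \<in> moebius_reversing" "involutive F \<rho>"
      and dif: "\<exists>x\<in>surface F. \<sigma> ` x \<noteq> \<rho> ` x"
      and \<sigma>1: "\<sigma> ` proj F z = proj F z" "\<sigma> ` proj F z' = proj F z'"
      and \<rho>1: "\<rho> ` proj F z = proj F z" "\<rho> ` proj F z' = proj F z'"
      unfolding reflection_pair_def s by (elim exE conjE) (rule that)
    note \<sigma> = \<sigma>0 \<sigma>1 and \<rho> = \<rho>0 \<rho>1
    note o = symmetry_orbit_map[OF \<sigma>(1,3)] and p = symmetry_orbit_map[OF \<rho>(1,3)]
    have key: "\<exists>\<tau> \<tau>' a b. \<tau> y = y \<and> \<tau>' y = y \<and> (\<forall>w\<in>disk. proj F (\<tau> w) = proj F (\<sigma> w)) \<and>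
        (\<forall>w\<in>disk. proj F (\<tau>' w) = proj F (\<rho> w)) \<and> (\<tau> has_derivative (\<lambda>h. a * cnj h)) (at y) \<and>
        (\<tau>' has_derivative (\<lambda>h. b * cnj h)) (at y) \<and> a \<noteq> b"
      if y: "y \<in> disk" "\<sigma> ` proj F y = proj F y" "\<rho> ` proj F y = proj F y" for y
    proof -
      obtain \<tau> a where \<tau>: "\<tau> y = y" "\<And>w. w \<in> disk \<Longrightarrow> \<tau> w \<in> disk" "\<And>w. w \<in> disk \<Longrightarrow> proj F (\<tau> w) = proj F (\<sigma> w)"
        "\<And>w. w \<in> disk \<Longrightarrow> centre y (\<tau> w) = a * cnj (centre y w)" "(\<tau> has_derivative (\<lambda>h. a * cnj h)) (at y)"
        by (rule lift_reversing[OF o \<sigma>(2) y(1,2)], rule that)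
      obtain \<tau>' b where \<tau>': "\<tau>' y = y" "\<And>w. w \<in> disk \<Longrightarrow> \<tau>' w \<in> disk" "\<And>w. w \<in> disk \<Longrightarrow> proj F (\<tau>' w) = proj F (\<rho> w)"
        "\<And>w. w \<in> disk \<Longrightarrow> centre y (\<tau>' w) = b * cnj (centre y w)" "(\<tau>' has_derivative (\<lambda>h. b * cnj h)) (at y)"
        by (rule lift_reversing[OF p \<rho>(2) y(1,3)], rule that)
      \<comment> \<open>Equal factors would make the two lifts agree in the coordinate
        \<open>centre y\<close>, hence on the disk, and the two reflections would coincide on the
        surface.\<close>
      have "a \<noteq> b"
      proof
        assume ab: "a = b"
        have "\<sigma> ` x = \<rho> ` x" if x: "x \<in> surface F" for x
        proof -
          obtain w where w: "w \<in> disk" "x = proj F w" using x unfolding surface_def by blast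
          have "\<tau> w = \<tau>' w"
            using \<tau>(4)[OF w(1)] \<tau>'(4)[OF w(1)] ab by (intro centre_inj[OF y(1) \<tau>(2)[OF w(1)] \<tau>'(2)[OF w(1)]]) simp
          moreover have "\<sigma> ` proj F w = proj F (\<sigma> w)" "\<rho> ` proj F w = proj F (\<rho> w)"
            using o p w(1) unfolding orbit_map_def by blast+
          ultimately show ?thesis using \<tau>(3)[OF w(1)] \<tau>'(3)[OF w(1)] w(2) by simp
        qed
        then show False using dif by blast
      qed
      then show ?thesis using \<tau>(1,3,5) \<tau>'(1,3,5) by (intro exI[of _ \<tau>] exI[of _ \<tau>'] exI[of _ a] exI[of _ b]) simp
    qed
    obtain \<tau>1 \<tau>2 a b where 1: "\<tau>1 z = z" "\<tau>2 z = z" "\<forall>w\<in>disk. proj F (\<tau>1 w) = proj F (\<sigma> w)"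
        "\<forall>w\<in>disk. proj F (\<tau>2 w) = proj F (\<rho> w)" "(\<tau>1 has_derivative (\<lambda>h. a * cnj h)) (at z)"
        "(\<tau>2 has_derivative (\<lambda>h. b * cnj h)) (at z)" "a \<noteq> b"
      using key[OF z(1) \<sigma>(4) \<rho>(4)] by (elim exE conjE) (rule that)
    obtain \<tau>1' \<tau>2' a' b' where 2: "\<tau>1' z' = z'" "\<tau>2' z' = z'" "\<forall>w\<in>disk. proj F (\<tau>1' w) = proj F (\<sigma> w)"
        "\<forall>w\<in>disk. proj F (\<tau>2' w) = proj F (\<rho> w)" "(\<tau>1' has_derivative (\<lambda>h. a' * cnj h)) (at z')"
        "(\<tau>2' has_derivative (\<lambda>h. b' * cnj h)) (at z')" "a' \<noteq> b'"
      using key[OF z(2) \<sigma>(5) \<rho>(5)] by (elim exE conjE) (rule that)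
    note i1 = derivatives_invariant[OF o \<sigma>(3) z ne 1(1) bspec[OF 1(3)] 1(5) 2(1) bspec[OF 2(3)] 2(5) D]
    note i2 = derivatives_invariant[OF p \<rho>(3) z ne 1(2) bspec[OF 1(4)] 1(6) 2(2) bspec[OF 2(4)] 2(6) D]
    have "D h = 0" for h
    proof -
      \<comment> \<open>Chosen so that \<open>h\<close> is the difference of the images of
        \<open>x\<close> under the two tangent maps, on both of which \<open>D\<close> takes the
        value at \<open>x\<close>.\<close>
      define x where "x = cnj (h / (a - b))"
      have "(a - b) * cnj x = h" using 1(7) by (simp add: x_def)
      then have "D h = D (a * cnj x - b * cnj x)" by (simp add: left_diff_distrib)
      also have "\<dots> = 0" using i1(1)[of x] i2(1)[of x] by (simp add: linear_diff[OF lD])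
      finally show ?thesis .
    qed
    moreover have "?g (h, k) = 0" for h k
    proof -
      \<comment> \<open>The factors at the two points may differ, so \<open>x\<close> and
        \<open>y\<close> are solved for separately; each pair of lifts still acts on both arguments
        at once.\<close>
      define x where "x = cnj (h / (a - b))"
      define y where "y = cnj (k / (a' - b'))"
      have "(a - b) * cnj x = h" "(a' - b') * cnj y = k" using 1(7) 2(7) by (simp_all add: x_def y_def)
      then have "?g (h, k) = ?g ((a * cnj x, a' * cnj y) - (b * cnj x, b' * cnj y))" by (simp add: left_diff_distrib)
      also have "\<dots> = ?g (a * cnj x, a' * cnj y) - ?g (b * cnj x, b' * cnj y)" by (rule blinfun.diff_right)
      also have "\<dots> = 0" using i1(2)[where h = x and k = y] i2(2)[where h = x and k = y] by simp
      finally show ?thesis .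
    qed
    ultimately show ?thesis by blast
  qed
  then have "D = (\<lambda>_. 0)" "?g = (\<lambda>_. 0)" by (auto simp: fun_eq_iff)
  then show "((\<lambda>x. robin_function F G (proj F x)) has_derivative (\<lambda>_. 0)) (at z)"
    "(Gp has_derivative (\<lambda>_. 0)) (at (z, z'))"
    using D dG_derivative[OF q] by simp_all
qed

text \<open>A maximum over the closed subdisk that meets every orbit is a maximum over the open
  disk, hence an interior one at each lift of the point.\<close>

lemma robin_maximum:
  obtains s where "s \<in> surface F"
    "\<And>z. z \<in> s \<Longrightarrow> ((\<lambda>x. robin_function F G (proj F x)) has_derivative (\<lambda>_. 0)) (at z)"
proof -
  let ?R = "\<lambda>x. robin_function F G (proj F x)"
  obtain r where r: "0 < r" "r < 1" "\<And>z. z \<in> disk \<Longrightarrow> \<exists>\<gamma>\<in>F. \<gamma> z \<in> cball 0 r"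
    by (rule exhausting_ball, rule that)
  have sub: "cball 0 r \<subseteq> disk" using r(2) by auto
  have "continuous_on (cball 0 r) ?R"
    using robin_local(1) sub differentiable_imp_continuous_within by (blast intro: continuous_at_imp_continuous_on)
  then obtain m where m: "m \<in> cball 0 r" "\<And>x. x \<in> cball 0 r \<Longrightarrow> ?R x \<le> ?R m"
    using continuous_attains_sup[of "cball 0 r" ?R] r(1) by auto
  have md: "m \<in> disk" using m(1) sub by blast
  have glob: "?R x \<le> ?R m" if x: "x \<in> disk" for x
  proof -
    obtain \<gamma> where \<gamma>: "\<gamma> \<in> F" "\<gamma> x \<in> cball 0 r" using r(3)[OF x] by blast
    show ?thesis using m(2)[OF \<gamma>(2)] proj_F[OF \<gamma>(1) x] by simp
  qed
  show ?thesis
  proof (rule that[of "proj F m"])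
    show "proj F m \<in> surface F" by (rule proj_in_surface[OF md])
    fix z assume "z \<in> proj F m"
    then have z: "z \<in> disk" "proj F z = proj F m" using in_proj_iff[OF md] by blast+
    obtain D where D: "(?R has_derivative D) (at z)"
      using robin_local(1)[OF z(1)] unfolding differentiable_def by blast
    have "D = (\<lambda>_. 0)"
      by (rule differential_zero_maxmin[OF z(1) open_ball D]) (use glob z(2) in simp)
    then show "(?R has_derivative (\<lambda>_. 0)) (at z)" using D by simp
  qed
qed

text \<open>Each term of the Hamiltonian involves one or two of the points, so criticality in all
  variables follows from that of the Robin function at single points and of \<open>Gp\<close> at
  pairs.\<close>

lemma equilibrium_if_critical:
  fixes \<Gamma> :: "'m::finite \<Rightarrow> real"
  assumes s: "range s \<subseteq> surface F" "inj s"
    and R: "\<And>j z. z \<in> s j \<Longrightarrow> ((\<lambda>x. robin_function F G (proj F x)) has_derivative (\<lambda>_. 0)) (at z)"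
    and H: "\<And>j k z z'. j \<noteq> k \<Longrightarrow> z \<in> s j \<Longrightarrow> z' \<in> s k \<Longrightarrow> (Gp has_derivative (\<lambda>_. 0)) (at (z, z'))"
  shows "equilibrium F G \<Gamma> s"
  unfolding equilibrium_def
proof (intro conjI allI impI s)
  fix z :: "complex ^ 'm" assume z: "\<forall>j. z $ j \<in> s j"
  have n: "((\<lambda>w. w $ j) has_derivative (\<lambda>h. h $ j)) (at z)" for j
    by (rule bounded_linear_imp_has_derivative[OF bounded_linear_vec_nth])
  have 1: "((\<lambda>w. robin_function F G (proj F (w $ j))) has_derivative (\<lambda>_. 0)) (at z)" for j
    using has_derivative_compose[OF n R] z by blast
  have 2: "((\<lambda>w. Gp (w $ j, w $ k)) has_derivative (\<lambda>_. 0)) (at z)" if "j \<noteq> k" for j k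
    using has_derivative_compose[OF has_derivative_Pair[OF n n] H[OF that]] z by blast
  have "((\<lambda>w. (\<Sum>j\<in>UNIV. (\<Gamma> j)\<^sup>2 / 2 * robin_function F G (proj F (w $ j))) +
      (\<Sum>j\<in>UNIV. \<Sum>k\<in>UNIV - {j}. \<Gamma> j * \<Gamma> k / 2 * Gp (w $ j, w $ k))) has_derivative
      (\<lambda>_. (\<Sum>j\<in>(UNIV :: 'm set). (\<Gamma> j)\<^sup>2 / 2 * 0) + (\<Sum>j\<in>UNIV. \<Sum>k\<in>UNIV - {j}. \<Gamma> j * \<Gamma> k / 2 * 0))) (at z)"
    by (intro has_derivative_add has_derivative_sum has_derivative_mult_right 1 2) auto
  then show "((\<lambda>w. vortex_hamiltonian F G \<Gamma> (\<lambda>j. proj F (w $ j))) has_derivative (\<lambda>_. 0)) (at z)"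
    by (simp add: vortex_hamiltonian_def Gp_def)
qed

end

section \<open>Counting the placements of the vortices, and the theorem\<close>

lemma card_injections:
  assumes P: "finite P" "CARD('m::finite) \<le> card P"
  shows "finite {s :: 'm \<Rightarrow> 'a. inj s \<and> range s \<subseteq> P}"
    and "card {s :: 'm \<Rightarrow> 'a. inj s \<and> range s \<subseteq> P} = fact (card P) div fact (card P - CARD('m))"
proof -
  have e: "{s :: 'm \<Rightarrow> 'a. inj s \<and> range s \<subseteq> P} = {s \<in> UNIV \<rightarrow>\<^sub>E P. inj_on s UNIV}" by auto
  show "finite {s :: 'm \<Rightarrow> 'a. inj s \<and> range s \<subseteq> P}"
    unfolding e by (rule finite_subset[OF _ finite_PiE[of UNIV "\<lambda>_. P"]]) (use P in auto)
  have f: "fact n = prod ((-) n) {0..<k} * fact (n - k)" if "k \<le> n" for n k :: nat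
    using that
  proof (induction k)
    case (Suc k)
    have "fact (n - k) = (n - k) * fact (n - Suc k)" using Suc.prems by (simp add: fact_reduce)
    then show ?case using Suc by simp
  qed simp
  have "card {s \<in> (UNIV :: 'm set) \<rightarrow>\<^sub>E P. inj_on s UNIV} = prod ((-) (card P)) {0..<CARD('m)}"
    using card_inj_on_subset_funcset[of "UNIV :: 'm set" P UNIV] P by simp
  also have "\<dots> = fact (card P) div fact (card P - CARD('m))"
    using f[OF P(2)] by simp
  finally show "card {s :: 'm \<Rightarrow> 'a. inj s \<and> range s \<subseteq> P} = fact (card P) div fact (card P - CARD('m))"
    unfolding e .
qed

theorem theorem10:
  fixes F :: "(complex \<Rightarrow> complex) set"
    and G :: "complex set \<Rightarrow> complex set \<Rightarrow> real"
    and g N :: nat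
    and P :: "complex set set"
    and \<Gamma> :: "'m::finite \<Rightarrow> real"
  assumes "fuchsian_group F" and "acts_freely F" and "compact_space (surface_topology F)"
    and "has_genus F g" and "g \<ge> 2"
    and "green_function F G"
    and "P \<subseteq> surface F" and "finite P" and "card P = N"
    and "\<And>s s'. s \<in> P \<Longrightarrow> s' \<in> P \<Longrightarrow> s \<noteq> s' \<Longrightarrow> rotation_pair F s s' \<or> reflection_pair F s s'"
    and "CARD('m) \<le> N"
    and "\<And>j. \<Gamma> j \<noteq> 0"
  shows "\<exists>C \<subseteq> {s. equilibrium F G \<Gamma> s}. finite C \<and> card C = fact N div fact (N - CARD('m))"
proof -
  interpret vortex_surface F G
    using assms(1-3,6) by unfold_locales
  let ?crit = "\<lambda>z. ((\<lambda>x. robin_function F G (proj F x)) has_derivative (\<lambda>_. 0)) (at z)"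
  have lift: "z \<in> disk \<and> s = proj F z" if s: "s \<in> surface F" "z \<in> s" for s z
  proof -
    obtain w where w: "w \<in> disk" "s = proj F w" by (rule surface_obtain[OF s(1)], rule that)
    then show ?thesis using in_proj_iff[OF w(1)] s(2) by auto
  qed
  have "\<exists>Q \<subseteq> surface F. finite Q \<and> card Q = N \<and> (\<forall>s\<in>Q. \<forall>z\<in>s. ?crit z) \<and>
      (\<forall>s\<in>Q. \<forall>s'\<in>Q. s \<noteq> s' \<longrightarrow> (\<forall>z\<in>s. \<forall>z'\<in>s'. (Gp has_derivative (\<lambda>_. 0)) (at (z, z'))))"
  \<comment> \<open>For a single point the assumption on pairs is vacuous and the given point need
    not be critical, so the set of positions is replaced.\<close>
  proof (cases "N = 1")
    case True
    obtain s where s: "s \<in> surface F" "\<And>z. z \<in> s \<Longrightarrow> ?crit z" by (rule robin_maximum, rule that)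
    show ?thesis using s True by (intro exI[of _ "{s}"]) simp
  next
    case False
    \<comment> \<open>At least one vortex forces N \<ge> 1, so in this case N \<ge> 2 and every
      point of \<open>P\<close> has a partner.\<close>
    have pos: "CARD('m) > 0" by (simp add: card_gt_0_iff)
    have crit: "?crit z" if s: "s \<in> P" "z \<in> s" for s z
    proof -
      have "\<not> P \<subseteq> {s}"
      proof
        assume "P \<subseteq> {s}"
        then have "card P \<le> 1" using card_mono[of "{s}" P] by simp
        then show False using False pos assms(9,11) by linarith
      qed
      then obtain s' where s': "s' \<in> P" "s \<noteq> s'" by blast
      have sf: "s \<in> surface F" "s' \<in> surface F" using s s' assms(7) by blast+
      obtain z' where z': "z' \<in> disk" "s' = proj F z'" by (rule surface_obtain[OF sf(2)], rule that)
      show ?thesis using critical_pair(1)[OF assms(10)[OF s(1) s'] _ z'(1) _ z'(2) s'(2)] lift[OF sf(1) s(2)] by blast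
    qed
    have pair: "(Gp has_derivative (\<lambda>_. 0)) (at (z, z'))" if s: "s \<in> P" "s' \<in> P" "s \<noteq> s'" "z \<in> s" "z' \<in> s'" for s s' z z'
    proof -
      have sf: "s \<in> surface F" "s' \<in> surface F" using s assms(7) by blast+
      show ?thesis
        using critical_pair(2)[OF assms(10)[OF s(1-3)] _ _ _ _ s(3)] lift[OF sf(1) s(4)] lift[OF sf(2) s(5)] by blast
    qed
    show ?thesis using assms(7-9) crit pair by (intro exI[of _ P]) simp
  qed
  then obtain Q where Q: "Q \<subseteq> surface F" "finite Q" "card Q = N" "\<forall>s\<in>Q. \<forall>z\<in>s. ?crit z"
    "\<forall>s\<in>Q. \<forall>s'\<in>Q. s \<noteq> s' \<longrightarrow> (\<forall>z\<in>s. \<forall>z'\<in>s'. (Gp has_derivative (\<lambda>_. 0)) (at (z, z')))"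
    by (elim exE conjE) (rule that)
  have "equilibrium F G \<Gamma> s" if s: "inj s" "range s \<subseteq> Q" for s
  proof (rule equilibrium_if_critical)
    have sQ: "s j \<in> Q" for j using s(2) by blast
    show "range s \<subseteq> surface F" "inj s" using s Q(1) by blast+
    show "?crit z" if "z \<in> s j" for j z using Q(4) sQ[of j] that by blast
    show "(Gp has_derivative (\<lambda>_. 0)) (at (z, z'))" if "j \<noteq> k" "z \<in> s j" "z' \<in> s k" for j k z z'
    proof -
      have "s j \<noteq> s k" using s(1) that(1) by (auto dest: injD)
      then show ?thesis using Q(5) sQ that(2,3) by blast
    qed
  qed
  then show ?thesis
    using card_injections[of Q, where 'm = 'm] Q(2,3) assms(11)
    by (intro exI[of _ "{s. inj s \<and> range s \<subseteq> Q}"]) auto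
qed

end
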